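(* Let $M$ be an immersed surface of $\mathbb{R}^3$, and let $N$ be an oriented complete surface properly immersed in $\mathbb{R}^3$ with bounded curvature. Then, unless $M$ and $N$ are parallel flat minimal surfaces, the surface $N$ cannot be well-oriented with respect to $M$ provided that either (a) $M$ is recurrent and its mean curvature satisfies $\sup_M |H_M|\le \inf_N H_N$; or (b) $M$ is stochastically complete and $\sup_M |H_M|<\inf_N H_N$.
   Context: Surfaces are smooth, connected, without boundary; $M$ carries the induced metric and is not assumed geodesically complete. The mean curvature is the trace of the second fundamental form (the sum of the principal curvatures). "Bounded curvature" for $N$ means that the principal curvatures of $N$ are bounded. "Parallel flat minimal surfaces" means that $N$ is a plane and $M$ is contained in a plane parallel to it. For a complete oriented properly immersed surface $N$ of $\mathbb{R}^3$, $\xi$ denotes the unit normal vector field along $N$ for which the mean curvature vector is $\overrightarrow{H}_N=H_N\,\xi$ with $H_N\ge 0$. Let $W$ be a connected component of $\mathbb{R}^3\setminus N$. The mean curvature vector field of $N$ at $z_0\in N\cap\partial W$ is said to point into $W$ if, for any sequence $y_n\in W$ with $y_n\to z_0$, we have $y_n=\exp_z(t\,\xi(z))=z+t\,\xi(z)$ for some $0<t<\varepsilon$ and some $z$ in a neighborhood $V\subset N$ of $z_0$. Well-oriented: let $M$ be a surface immersed in $\mathbb{R}^3$. A properly immersed surface $N$ of $\mathbb{R}^3$, disjoint from $M$, is well-oriented with respect to $M$ if $M$ lies in a connected component $W$ of $\mathbb{R}^3\setminus N$ into which the mean curvature vector field of $N$ points (at the points of $N\cap\partial W$). By convention, every complete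 oriented properly immersed minimal surface $N$ is regarded as well-oriented with respect to any surface immersed in $\mathbb{R}^3\setminus N$. A Riemannian manifold $M$ is recurrent (parabolic) if standard Brownian motion on $M$ visits any open set at arbitrarily large times with probability $1$; equivalently, every bounded weak solution of $\Delta u\ge 0$ on $M$ is constant. $M$ is stochastically complete if its heat kernel $p$ satisfies $\int_M p(t,x,y)\,d\mu(y)=1$ for some (equivalently every) $x\in M$ and all $t>0$; equivalently, for every $\lambda>0$, any bounded non-negative weak solution of $\Delta u\ge\lambda u$ on $M$ is identically zero. *)

theory Defs
  imports "HOL-Analysis.Analysis"
begin

section \<open>Smooth maps between Euclidean spaces\<close>

fun Ck_on :: "nat \<Rightarrow> 'a::euclidean_space set \<Rightarrow> ('a \<Rightarrow> 'b::euclidean_space) \<Rightarrow> bool" where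
  "Ck_on 0 U F \<longleftrightarrow> continuous_on U F"
| "Ck_on (Suc k) U F \<longleftrightarrow> (\<forall>x\<in>U. F differentiable (at x)) \<and>
     (\<forall>v. Ck_on k U (\<lambda>x. frechet_derivative F (at x) v))"

text \<open>Used for open \<open>U\<close> only, so that derivatives do not depend on values outside \<open>U\<close>.\<close>

definition smooth_on :: "'a::euclidean_space set \<Rightarrow> ('a \<Rightarrow> 'b::euclidean_space) \<Rightarrow> bool" where
  "smooth_on U F \<longleftrightarrow> (\<forall>k. Ck_on k U F)"

definition pderiv_at :: "(real^2 \<Rightarrow> 'b::euclidean_space) \<Rightarrow> 2 \<Rightarrow> real^2 \<Rightarrow> 'b" where
  "pderiv_at F i x = frechet_derivative F (at x) (axis i 1)"


section \<open>Immersed surfaces of three-space\<close>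

text \<open>
  An immersed surface consists of an abstract surface, given by a topology and an atlas of local
  parametrizations \<open>(U, \<phi>)\<close> with \<open>\<phi>\<close> defined on the open set \<open>U\<close> of the plane, together with the
  position map into three-space. The position map need not be injective.
\<close>

record 'a surface3 =
  topo :: "'a topology"
  params :: "((real^2) set \<times> (real^2 \<Rightarrow> 'a)) set"
  pos :: "'a \<Rightarrow> real^3"

abbreviation pts :: "'a surface3 \<Rightarrow> 'a set" where
  "pts S \<equiv> topspace (topo S)"

abbreviation image_of :: "'a surface3 \<Rightarrow> (real^3) set" where
  "image_of S \<equiv> pos S ` pts S"

definition smooth_surface :: "'a surface3 \<Rightarrow> bool" where
  "smooth_surface S \<longleftrightarrow>
     pts S \<noteq> {} \<and> connected_space (topo S) \<and> Hausdorff_space (topo S) \<and> second_countable (topo S) \<and>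
     (\<forall>(U,\<phi>)\<in>params S. open U \<and> openin (topo S) (\<phi> ` U) \<and>
        homeomorphic_map (top_of_set U) (subtopology (topo S) (\<phi> ` U)) \<phi>) \<and>
     (\<Union>(U,\<phi>)\<in>params S. \<phi> ` U) = pts S \<and>
     (\<forall>(U,\<phi>)\<in>params S. \<forall>(V,\<psi>)\<in>params S.
        smooth_on (U \<inter> \<phi> -` (\<psi> ` V)) (inv_into V \<psi> \<circ> \<phi>))"

definition immersed_surface :: "'a surface3 \<Rightarrow> bool" where
  "immersed_surface S \<longleftrightarrow> smooth_surface S \<and>
     (\<forall>(U,\<phi>)\<in>params S. smooth_on U (pos S \<circ> \<phi>) \<and>
        (\<forall>x\<in>U. inj (frechet_derivative (pos S \<circ> \<phi>) (at x))))"

definition properly_immersed :: "'a surface3 \<Rightarrow> bool" where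
  "properly_immersed S \<longleftrightarrow> immersed_surface S \<and> proper_map (topo S) euclidean (pos S)"

text \<open>
  Pointwise geometric quantities are computed in an arbitrary but fixed parametrization around
  the point; they do not depend on it (the Gauss normal only up to sign).
\<close>

definition param_at :: "'a surface3 \<Rightarrow> 'a \<Rightarrow> (real^2) set \<times> (real^2 \<Rightarrow> 'a)" where
  "param_at S p = (SOME c. c \<in> params S \<and> p \<in> snd c ` fst c)"

definition coord_at :: "'a surface3 \<Rightarrow> 'a \<Rightarrow> real^2" where
  "coord_at S p = inv_into (fst (param_at S p)) (snd (param_at S p)) p"

definition local_pos :: "'a surface3 \<Rightarrow> 'a \<Rightarrow> real^2 \<Rightarrow> real^3" where
  "local_pos S p = pos S \<circ> snd (param_at S p)"

definition tangent_plane :: "'a surface3 \<Rightarrow> 'a \<Rightarrow> (real^3) set" where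
  "tangent_plane S p = range (frechet_derivative (local_pos S p) (at (coord_at S p)))"


section \<open>Curvature\<close>

definition first_ff :: "(real^2 \<Rightarrow> real^3) \<Rightarrow> real^2 \<Rightarrow> real^2^2" where
  "first_ff F x = (\<chi> i j. pderiv_at F i x \<bullet> pderiv_at F j x)"

text \<open>The second fundamental form with respect to the unit normal vector \<open>n\<close> at \<open>F x\<close>.\<close>

definition second_ff :: "(real^2 \<Rightarrow> real^3) \<Rightarrow> real^3 \<Rightarrow> real^2 \<Rightarrow> real^2^2" where
  "second_ff F n x = (\<chi> i j. pderiv_at (pderiv_at F j) i x \<bullet> n)"

definition shape_matrix :: "'a surface3 \<Rightarrow> real^3 \<Rightarrow> 'a \<Rightarrow> real^2^2" where
  "shape_matrix S n p =
     matrix_inv (first_ff (local_pos S p) (coord_at S p)) ** second_ff (local_pos S p) n (coord_at S p)"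

definition gauss_normal :: "'a surface3 \<Rightarrow> 'a \<Rightarrow> real^3" where
  "gauss_normal S p = sgn (cross3 (pderiv_at (local_pos S p) 1 (coord_at S p))
                                  (pderiv_at (local_pos S p) 2 (coord_at S p)))"

definition principal_curvature :: "'a surface3 \<Rightarrow> 'a \<Rightarrow> real \<Rightarrow> bool" where
  "principal_curvature S p k \<longleftrightarrow> (\<exists>v. v \<noteq> 0 \<and> shape_matrix S (gauss_normal S p) p *v v = k *s v)"

definition bounded_curvature :: "'a surface3 \<Rightarrow> bool" where
  "bounded_curvature S \<longleftrightarrow> (\<exists>K. \<forall>p\<in>pts S. \<forall>k. principal_curvature S p k \<longrightarrow> \<bar>k\<bar> \<le> K)"

definition mean_curvature :: "'a surface3 \<Rightarrow> real^3 \<Rightarrow> 'a \<Rightarrow> real" where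
  "mean_curvature S n p = trace (shape_matrix S n p)"

definition mean_curvature_vector :: "'a surface3 \<Rightarrow> 'a \<Rightarrow> real^3" where
  "mean_curvature_vector S p = mean_curvature S (gauss_normal S p) p *\<^sub>R gauss_normal S p"

definition minimal :: "'a surface3 \<Rightarrow> bool" where
  "minimal S \<longleftrightarrow> (\<forall>p\<in>pts S. mean_curvature_vector S p = 0)"


section \<open>Orientation and completeness\<close>

text \<open>A continuous unit normal field of an immersed surface is automatically smooth.\<close>

definition unit_normal_field :: "'a surface3 \<Rightarrow> ('a \<Rightarrow> real^3) \<Rightarrow> bool" where
  "unit_normal_field S \<xi> \<longleftrightarrow> continuous_map (topo S) euclidean \<xi> \<and>
     (\<forall>p\<in>pts S. norm (\<xi> p) = 1 \<and> (\<forall>v\<in>tangent_plane S p. v \<bullet> \<xi> p = 0))"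

definition mean_curvature_normal :: "'a surface3 \<Rightarrow> ('a \<Rightarrow> real^3) \<Rightarrow> bool" where
  "mean_curvature_normal S \<xi> \<longleftrightarrow> unit_normal_field S \<xi> \<and>
     (\<forall>p\<in>pts S. 0 \<le> mean_curvature S (\<xi> p) p \<and>
        mean_curvature_vector S p = mean_curvature S (\<xi> p) p *\<^sub>R \<xi> p)"

text \<open>
  A geodesic of the induced metric is a smooth curve whose acceleration in three-space is normal
  to the surface, the covariant derivative being the tangential part of the ordinary one. Since
  \<open>pos S\<close> is an immersion, a continuous curve in \<open>S\<close> is smooth iff its image curve is.
\<close>

definition geodesic_line :: "'a surface3 \<Rightarrow> (real \<Rightarrow> 'a) \<Rightarrow> bool" where
  "geodesic_line S \<gamma> \<longleftrightarrow> continuous_map euclidean (topo S) \<gamma> \<and> smooth_on UNIV (pos S \<circ> \<gamma>) \<and>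
     (\<forall>t. \<forall>w\<in>tangent_plane S (\<gamma> t).
        vector_derivative (\<lambda>s. vector_derivative (pos S \<circ> \<gamma>) (at s)) (at t) \<bullet> w = 0)"

definition geodesically_complete :: "'a surface3 \<Rightarrow> bool" where
  "geodesically_complete S \<longleftrightarrow> (\<forall>p\<in>pts S. \<forall>v\<in>tangent_plane S p.
     \<exists>\<gamma>. geodesic_line S \<gamma> \<and> \<gamma> 0 = p \<and> vector_derivative (pos S \<circ> \<gamma>) (at 0) = v)"


section \<open>Well-oriented surfaces\<close>

text \<open>
  The condition is local at \<open>q\<close>: for every bound \<open>e\<close> on \<open>t\<close> and every neighbourhood \<open>V\<close> of \<open>q\<close> in
  the abstract surface (so of the sheet through \<open>q\<close>), all but finitely many points of the sequence
  have the stated form.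
\<close>

definition points_into :: "'a surface3 \<Rightarrow> ('a \<Rightarrow> real^3) \<Rightarrow> (real^3) set \<Rightarrow> 'a \<Rightarrow> bool" where
  "points_into N \<xi> W q \<longleftrightarrow>
     (\<forall>y. (\<forall>n. y n \<in> W) \<and> y \<longlonglongrightarrow> pos N q \<longrightarrow>
        (\<forall>e>0. \<forall>V. openin (topo N) V \<and> q \<in> V \<longrightarrow>
           (\<forall>\<^sub>F n in sequentially. \<exists>t z. 0 < t \<and> t < e \<and> z \<in> V \<and> y n = pos N z + t *\<^sub>R \<xi> z)))"

definition well_oriented :: "'a surface3 \<Rightarrow> ('a \<Rightarrow> real^3) \<Rightarrow> 'b surface3 \<Rightarrow> bool" where
  "well_oriented N \<xi> M \<longleftrightarrow>
     properly_immersed N \<and> geodesically_complete N \<and> mean_curvature_normal N \<xi> \<and>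
     image_of M \<inter> image_of N = {} \<and>
     (minimal N \<or>
      (\<exists>W \<in> components (- image_of N). image_of M \<subseteq> W \<and>
         (\<forall>q\<in>pts N. pos N q \<in> frontier W \<longrightarrow> points_into N \<xi> W q)))"

definition parallel_flat :: "'a surface3 \<Rightarrow> 'b surface3 \<Rightarrow> bool" where
  "parallel_flat M N \<longleftrightarrow> (\<exists>a b c. a \<noteq> 0 \<and>
     image_of N = {x. a \<bullet> x = b} \<and> image_of M \<subseteq> {x. a \<bullet> x = c})"


section \<open>Laplacian, recurrence and stochastic completeness\<close>

definition area_measure :: "'a surface3 \<Rightarrow> 'a measure" where
  "area_measure S = (THE \<mu>. space \<mu> = pts S \<and> sets \<mu> = sigma_sets (pts S) {G. openin (topo S) G} \<and>
     (\<forall>(U,\<phi>)\<in>params S. \<forall>B\<in>sets \<mu>. B \<subseteq> \<phi> ` U \<longrightarrow>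
        emeasure \<mu> B = (\<integral>\<^sup>+x\<in>U \<inter> \<phi> -` B. ennreal (sqrt (det (first_ff (pos S \<circ> \<phi>) x))) \<partial>lborel)))"

text \<open>The Laplace-Beltrami operator of the metric induced by \<open>F\<close>, acting on functions of the parameter.\<close>

definition local_laplacian :: "(real^2 \<Rightarrow> real^3) \<Rightarrow> (real^2 \<Rightarrow> real) \<Rightarrow> real^2 \<Rightarrow> real" where
  "local_laplacian F w x =
     (\<Sum>i\<in>UNIV. pderiv_at (\<lambda>z. sqrt (det (first_ff F z)) *
        (\<Sum>j\<in>UNIV. matrix_inv (first_ff F z) $ i $ j * pderiv_at w j z)) i x)
     / sqrt (det (first_ff F x))"

definition laplacian :: "'a surface3 \<Rightarrow> ('a \<Rightarrow> real) \<Rightarrow> 'a \<Rightarrow> real" where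
  "laplacian S u p = local_laplacian (local_pos S p) (u \<circ> snd (param_at S p)) (coord_at S p)"

definition test_function :: "'a surface3 \<Rightarrow> ('a \<Rightarrow> real) \<Rightarrow> bool" where
  "test_function S \<eta> \<longleftrightarrow> (\<forall>(U,\<phi>)\<in>params S. smooth_on U (\<eta> \<circ> \<phi>)) \<and>
     (\<exists>K. compactin (topo S) K \<and> (\<forall>p\<in>pts S - K. \<eta> p = 0))"

text \<open>
  Bounded weak solutions of \<open>\<Delta> u \<ge> \<lambda> u\<close>, the inequality being tested against non-negative
  smooth functions of compact support; such solutions are determined only up to null sets.
\<close>

definition bounded_weak_solution :: "'a surface3 \<Rightarrow> real \<Rightarrow> ('a \<Rightarrow> real) \<Rightarrow> bool" where
  "bounded_weak_solution S l u \<longleftrightarrow>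
     u \<in> borel_measurable (area_measure S) \<and> (\<exists>C. \<forall>p\<in>pts S. \<bar>u p\<bar> \<le> C) \<and>
     (\<forall>\<eta>. test_function S \<eta> \<and> (\<forall>p\<in>pts S. 0 \<le> \<eta> p) \<longrightarrow>
        (\<integral>p. u p * laplacian S \<eta> p \<partial>area_measure S) \<ge> l * (\<integral>p. u p * \<eta> p \<partial>area_measure S))"

text \<open>
  Both notions are taken in their analytic form (bounded weak solutions) rather than in terms of
  Brownian motion and of the total mass of the heat kernel; the two forms are equivalent.
\<close>

definition recurrent :: "'a surface3 \<Rightarrow> bool" where
  "recurrent S \<longleftrightarrow>
     (\<forall>u. bounded_weak_solution S 0 u \<longrightarrow> (\<exists>c. AE p in area_measure S. u p = c))"

definition stochastically_complete :: "'a surface3 \<Rightarrow> bool" where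
  "stochastically_complete S \<longleftrightarrow>
     (\<forall>l>0. \<forall>u. bounded_weak_solution S l u \<and> (\<forall>p\<in>pts S. 0 \<le> u p) \<longrightarrow>
        (AE p in area_measure S. u p = 0))"

end

theory Submission
  imports Defs
begin

text \<open>
  Let \<open>d\<close> be the distance to the image of \<open>N\<close>, \<open>\<kappa>\<close> a bound for the principal curvatures of \<open>N\<close>, and
  \<open>u = exp (- \<kappa> d)\<close> on \<open>M\<close>. If \<open>q\<close> is a point of \<open>N\<close> nearest to \<open>p\<close>, then moving the two points by
  tangent vectors that coincide in the common tangent plane gives a \<open>C\<^sup>2\<close> function that touches \<open>u\<close> from
  below at \<open>p\<close>; its Laplacian there is at least \<open>\<kappa> u (H\<^sub>N(q) - \<bar>H\<^sub>M(p)\<bar>)\<close>, because \<open>\<xi>(q)\<close> points to \<open>p\<close>. As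
  \<open>u\<close> is locally semiconvex, this pointwise information makes it a weak subsolution: symmetric difference
  quotients of \<open>u\<close> along four fixed directions are bounded below, so dominated convergence applies to their
  minimum with the lower bound to be proved.
  Strict inequality of the curvatures thus contradicts stochastic completeness. If \<open>M\<close> is recurrent,
  \<open>d\<close> is constant; the second variation of the distance, degenerate on the diagonal vectors, then
  forces \<open>M\<close> into a plane \<open>P\<close>, and recurrence again, applied to the distance from a point of \<open>P\<close>, shows
  that \<open>M\<close> is dense in \<open>P\<close>. Hence \<open>N\<close> stays at distance \<open>d\<close> from \<open>P\<close>, and the strong minimum principle
  identifies it with a parallel plane.
\<close>

section \<open>Calculus of \<open>C\<^sup>k\<close> maps\<close>

text \<open>Nearest points of \<open>N\<close> need not be unique and the distance need not be
  differentiable, so neither parallel surfaces nor a tubular neighbourhood are available. But any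
  pairing of points of \<open>M\<close> with points of \<open>N\<close> bounds the distance from
  above, with equality at the start; a decreasing function of it is then touched from below, the
  right side for a subsolution. The exponential rate equals the curvature bound because the two
  tangent planes are tilted against each other. The trace over the tangent plane of \<open>M\<close>
  misses part of the trace over that of \<open>N\<close>, and the missing curvature is at most
  \<kappa> times the squared tangential part of the unit vector joining the two points. The second
  derivative of the exponential produces exactly this amount with the favourable sign, at every
  distance from \<open>N\<close>; hence nothing has to be truncated. Weak solutions are tested
  against an area measure given by a definite description, and Laplacian and curvatures are computed
  in charts selected by a choice operator. Existence and uniqueness of that measure and invariance
  under change of chart therefore come before the geometry.\<close>

abbreviation dd :: "'a::euclidean_space \<Rightarrow> ('a \<Rightarrow> 'b::euclidean_space) \<Rightarrow> 'a \<Rightarrow> 'b" where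
  "dd v F \<equiv> (\<lambda>x. frechet_derivative F (at x) v)"

lemma dd_eqI: "(F has_derivative F') (at x) \<Longrightarrow> dd v F x = F' v"
  by (simp add: frechet_derivative_at[symmetric])

text \<open>Differentiability is not assumed: near \<open>x\<close> both functions have the same
  derivatives in the sense of \<open>has_derivative\<close>, so the choice inside
  \<open>frechet_derivative\<close> returns the same value.\<close>

lemma dd_cong:
  assumes "open U" "x \<in> U" "\<And>y. y \<in> U \<Longrightarrow> F y = G y"
  shows "dd v F x = dd v G x"
proof -
  have "(F has_derivative F') (at x) \<longleftrightarrow> (G has_derivative F') (at x)" for F'
  proof
    show "(G has_derivative F') (at x)" if "(F has_derivative F') (at x)"
      by (rule has_derivative_transform_within_open[OF that assms(1,2)]) (rule assms(3))
    show "(F has_derivative F') (at x)" if "(G has_derivative F') (at x)"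
      by (rule has_derivative_transform_within_open[OF that assms(1,2)]) (rule assms(3)[symmetric])
  qed
  then show ?thesis by (simp add: frechet_derivative_def)
qed

lemma Ck_on_cong:
  assumes "open U" "\<And>y. y \<in> U \<Longrightarrow> F y = G y" "Ck_on k U F"
  shows "Ck_on k U G"
  using assms(2,3)
proof (induction k arbitrary: F G)
  case 0
  then show ?case using continuous_on_cong[of U U F G] by simp
next
  case (Suc k)
  have "G differentiable (at x)" if x: "x \<in> U" for x
  proof -
    obtain F' where "(F has_derivative F') (at x)"
      using Suc.prems(2) x by (auto simp: differentiable_def)
    from has_derivative_transform_within_open[OF this assms(1) x Suc.prems(1)]
    show ?thesis by (auto simp: differentiable_def)
  qed
  moreover have "Ck_on k U (dd v G)" for v
  proof (rule Suc.IH)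
    show "dd v F y = dd v G y" if "y \<in> U" for y
      by (rule dd_cong[OF assms(1) that Suc.prems(1)])
    show "Ck_on k U (dd v F)" using Suc.prems(2) by simp
  qed
  ultimately show ?case by simp
qed

lemma Ck_on_SucD: "Ck_on (Suc k) U F \<Longrightarrow> Ck_on k U F"
proof (induction k arbitrary: F)
  case 0
  then show ?case
    by (intro Ck_on.simps(1)[THEN iffD2] continuous_at_imp_continuous_on ballI
        differentiable_imp_continuous_within) simp
next
  case (Suc k)
  have "Ck_on (Suc k) U (dd v F)" for v using Suc.prems by simp
  then have "Ck_on k U (dd v F)" for v using Suc.IH by blast
  then show ?case using Suc.prems by simp
qed

lemma Ck_on_le: "Ck_on k U F \<Longrightarrow> l \<le> k \<Longrightarrow> Ck_on l U F"
  by (induction k) (auto simp: le_Suc_eq dest: Ck_on_SucD simp del: Ck_on.simps(2))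

lemma Ck_on_subset: "Ck_on k U F \<Longrightarrow> V \<subseteq> U \<Longrightarrow> Ck_on k V F"
  by (induction k arbitrary: F) (auto intro: continuous_on_subset)

lemma smooth_on_Ck: "smooth_on U F \<Longrightarrow> Ck_on k U F"
  by (simp add: smooth_on_def)

text \<open>Used to glue a function that is regular inside a chart with its extension by
  zero.\<close>

lemma Ck_on_local:
  assumes "\<And>x. x \<in> U \<Longrightarrow> \<exists>V. open V \<and> x \<in> V \<and> Ck_on k V F"
  shows "Ck_on k U F"
  using assms
proof (induction k arbitrary: F)
  case 0
  have "isCont F x" if "x \<in> U" for x
    using 0[OF that] continuous_on_eq_continuous_at by auto
  then show ?case by (simp add: continuous_at_imp_continuous_on)
next
  case (Suc k)
  have "F differentiable (at x)" if "x \<in> U" for x using Suc.prems[OF that] by auto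
  moreover have "Ck_on k U (dd v F)" for v
  proof (rule Suc.IH)
    fix x assume "x \<in> U"
    then obtain V where "open V" "x \<in> V" "Ck_on (Suc k) V F" using Suc.prems by blast
    then show "\<exists>V. open V \<and> x \<in> V \<and> Ck_on k V (dd v F)" by (intro exI[of _ V]) auto
  qed
  ultimately show ?case by simp
qed

lemma Ck_on_has_derivative:
  "Ck_on k U F \<Longrightarrow> 0 < k \<Longrightarrow> x \<in> U \<Longrightarrow> (F has_derivative (\<lambda>v. dd v F x)) (at x)"
  by (cases k) (auto simp: frechet_derivative_works[symmetric])

lemma Ck_on_dd: "Ck_on (Suc k) U F \<Longrightarrow> Ck_on k U (dd v F)"
  by simp

lemma Ck_on_cont: "Ck_on k U F \<Longrightarrow> continuous_on U F"
  using Ck_on_le[of k U F 0] by simp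

text \<open>Turns an explicit derivative formula into one more order of regularity; the closure
  rules below rest on it, by induction on \<open>k\<close>.\<close>

lemma Ck_on_SucI:
  assumes U: "open U" and F: "\<And>x. x \<in> U \<Longrightarrow> (F has_derivative F' x) (at x)"
    and k: "\<And>v. Ck_on k U (\<lambda>x. F' x v)"
  shows "Ck_on (Suc k) U F"
proof -
  have "Ck_on k U (dd v F)" for v
    by (rule Ck_on_cong[OF U _ k[of v]]) (rule dd_eqI[OF F, symmetric])
  then show ?thesis using F unfolding Ck_on.simps differentiable_def by blast
qed

lemma Ck_on_const: "open U \<Longrightarrow> Ck_on k U (\<lambda>x. c)"
proof (induction k arbitrary: c)
  case (Suc k)
  have "Ck_on k U (\<lambda>x. 0 :: 'b)" using Suc by blast
  then show ?case
    by (intro Ck_on_SucI[where F' = "\<lambda>_ _. 0"] Suc.prems) auto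
qed simp

lemma Ck_on_compose_linear:
  assumes U: "open U" and L: "bounded_linear L"
  shows "Ck_on k U F \<Longrightarrow> Ck_on k U (\<lambda>x. L (F x))"
proof (induction k arbitrary: F)
  case 0
  then show ?case using bounded_linear.continuous_on[OF L] by simp
next
  case (Suc k)
  show ?case
  proof (rule Ck_on_SucI[OF U])
    show "((\<lambda>x. L (F x)) has_derivative (\<lambda>v. L (dd v F x))) (at x)" if "x \<in> U" for x
      using bounded_linear.has_derivative[OF L Ck_on_has_derivative[OF Suc.prems _ that]] by simp
    show "Ck_on k U (\<lambda>x. L (dd v F x))" for v using Suc by simp
  qed
qed

lemma Ck_on_add:
  assumes U: "open U"
  shows "Ck_on k U F \<Longrightarrow> Ck_on k U G \<Longrightarrow> Ck_on k U (\<lambda>x. F x + G x)"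
proof (induction k arbitrary: F G)
  case 0
  then show ?case by (auto intro: continuous_on_add)
next
  case (Suc k)
  show ?case
  proof (rule Ck_on_SucI[OF U])
    show "((\<lambda>x. F x + G x) has_derivative (\<lambda>v. dd v F x + dd v G x)) (at x)" if "x \<in> U" for x
      using Suc.prems that by (intro has_derivative_add Ck_on_has_derivative) auto
    show "Ck_on k U (\<lambda>x. dd v F x + dd v G x)" for v using Suc by simp
  qed
qed

lemma Ck_on_bilinear:
  assumes U: "open U" and B: "bounded_bilinear B"
  shows "Ck_on k U F \<Longrightarrow> Ck_on k U G \<Longrightarrow> Ck_on k U (\<lambda>x. B (F x) (G x))"
proof (induction k arbitrary: F G)
  case 0
  then show ?case using bounded_bilinear.continuous_on[OF B] by simp
next
  case (Suc k)
  show ?case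
  proof (rule Ck_on_SucI[OF U])
    show "((\<lambda>x. B (F x) (G x)) has_derivative (\<lambda>v. B (F x) (dd v G x) + B (dd v F x) (G x))) (at x)"
      if "x \<in> U" for x
      using Suc.prems that by (intro bounded_bilinear.FDERIV[OF B] Ck_on_has_derivative) auto
    show "Ck_on k U (\<lambda>x. B (F x) (dd v G x) + B (dd v F x) (G x))" for v
      using Suc.prems Ck_on_SucD[OF Suc.prems(1)] Ck_on_SucD[OF Suc.prems(2)]
      by (intro Ck_on_add[OF U] Suc.IH) (auto simp del: Ck_on.simps simp: Ck_on_dd)
  qed
qed

lemma Ck_on_minus: "open U \<Longrightarrow> Ck_on k U F \<Longrightarrow> Ck_on k U (\<lambda>x. - F x)"
  by (rule Ck_on_compose_linear[OF _ bounded_linear_minus[OF bounded_linear_ident]])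

lemma Ck_on_diff: "open U \<Longrightarrow> Ck_on k U F \<Longrightarrow> Ck_on k U G \<Longrightarrow> Ck_on k U (\<lambda>x. F x - G x)"
  using Ck_on_add[of U k F "\<lambda>x. - G x"] Ck_on_minus[of U k G] by simp

lemmas Ck_on_scaleR = Ck_on_bilinear[OF _ bounded_bilinear_scaleR]
lemmas Ck_on_inner = Ck_on_bilinear[OF _ bounded_bilinear_inner]

lemma Ck_on_mult: "open U \<Longrightarrow> Ck_on k U F \<Longrightarrow> Ck_on k U G \<Longrightarrow> Ck_on k U (\<lambda>x. F x * G x :: real)"
  by (rule Ck_on_bilinear[OF _ bounded_bilinear_mult])

lemma Ck_on_sum: "open U \<Longrightarrow> (\<And>i. i \<in> I \<Longrightarrow> Ck_on k U (F i)) \<Longrightarrow> Ck_on k U (\<lambda>x. \<Sum>i\<in>I. F i x)"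
  by (induction I rule: infinite_finite_induct) (auto intro: Ck_on_const Ck_on_add)

lemma Ck_on_ident: "open U \<Longrightarrow> Ck_on k U (\<lambda>x. x)"
proof (cases k)
  case (Suc j)
  assume "open U"
  then show ?thesis unfolding Suc
    by (intro Ck_on_SucI[where F' = "\<lambda>_ v. v"] Ck_on_const has_derivative_ident)
qed simp

lemma dd_compose:
  assumes F: "F differentiable (at (G x))" and G: "G differentiable (at x)"
  shows "dd v (\<lambda>y. F (G y)) x = dd (dd v G x) F (G x)"
  using dd_eqI[OF has_derivative_compose[OF G[unfolded frechet_derivative_works]
    F[unfolded frechet_derivative_works]]] .

lemma dd_linear: "F differentiable (at x) \<Longrightarrow> linear (\<lambda>v. dd v F x)"
  by (simp add: linear_frechet_derivative)

lemma Ck_on_compose: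
  fixes G :: "'a::euclidean_space \<Rightarrow> 'b::euclidean_space" and F :: "'b \<Rightarrow> 'c::euclidean_space"
  assumes U: "open U" and GU: "\<And>x. x \<in> U \<Longrightarrow> G x \<in> V"
  shows "Ck_on k V F \<Longrightarrow> Ck_on k U G \<Longrightarrow> Ck_on k U (\<lambda>x. F (G x))"
proof (induction k arbitrary: F)
  case 0
  then show ?case using GU by (auto intro: continuous_on_compose2)
next
  case (Suc k)
  show ?case
  proof (rule Ck_on_SucI[OF U])
    fix x assume x: "x \<in> U"
    have F: "(F has_derivative (\<lambda>w. dd w F (G x))) (at (G x))"
      using Ck_on_has_derivative[OF Suc.prems(1) _ GU[OF x]] by simp
    have lin: "linear (\<lambda>w. dd w F (G x))" using F has_derivative_linear by blast
    \<comment> \<open>The direction \<open>dd v G x\<close> moves with \<open>x\<close>, but the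
      induction hypothesis concerns \<open>dd b F\<close> for a fixed direction; expanding in
      \<open>Basis\<close> moves the dependence on \<open>x\<close> into scalar
      coefficients.\<close>
    have eq: "dd (dd v G x) F (G x) = (\<Sum>b\<in>Basis. (dd v G x \<bullet> b) *\<^sub>R dd b F (G x))" for v
      using linear_sum[OF lin, of "\<lambda>b. (dd v G x \<bullet> b) *\<^sub>R b" Basis]
      by (simp add: euclidean_representation linear_cmul[OF lin])
    show "((\<lambda>x. F (G x)) has_derivative (\<lambda>v. \<Sum>b\<in>Basis. (dd v G x \<bullet> b) *\<^sub>R dd b F (G x))) (at x)"
      unfolding eq[symmetric]
      using has_derivative_compose[OF Ck_on_has_derivative[OF Suc.prems(2) _ x] F] by simp
  next
    fix v
    have "Ck_on k U (\<lambda>x. dd b F (G x))" for b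
      using Suc.prems Suc.IH[of "dd b F"] Ck_on_SucD by (metis Ck_on_dd)
    then show "Ck_on k U (\<lambda>x. \<Sum>b\<in>Basis. (dd v G x \<bullet> b) *\<^sub>R dd b F (G x))"
      using Suc.prems(2) by (intro Ck_on_sum[OF U] Ck_on_scaleR[OF U] Ck_on_inner[OF U] Ck_on_const[OF U]) auto
  qed
qed

lemma Ck_on_powr: "Ck_on k {0::real<..} (\<lambda>t. t powr a)"
proof (induction k arbitrary: a)
  case 0
  then show ?case by (auto intro!: continuous_intros)
next
  case (Suc k)
  show ?case
  proof (rule Ck_on_SucI)
    show "((\<lambda>t. t powr a) has_derivative (\<lambda>v. a * x powr (a - 1) * v)) (at x)" if "x \<in> {0<..}" for x :: real
      using that by (auto intro!: derivative_eq_intros simp: powr_diff field_simps)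
    show "Ck_on k {0<..} (\<lambda>x. a * x powr (a - 1) * v)" for v
      by (intro Ck_on_mult Ck_on_const Suc) auto
  qed simp
qed

lemma Ck_on_exp: "Ck_on k (UNIV::real set) exp"
proof (induction k)
  case (Suc k)
  show ?case
    by (rule Ck_on_SucI[where F' = "\<lambda>x v. exp x * v"])
      (auto intro!: derivative_eq_intros Ck_on_mult Ck_on_const Suc)
qed (auto intro!: continuous_intros)

lemma Ck_on_powr_compose:
  "open U \<Longrightarrow> Ck_on k U F \<Longrightarrow> (\<And>x. x \<in> U \<Longrightarrow> 0 < F x) \<Longrightarrow> Ck_on k U (\<lambda>x. F x powr a :: real)"
  using Ck_on_compose[OF _ _ Ck_on_powr, of U F k a] by auto

lemma Ck_on_exp_compose: "open U \<Longrightarrow> Ck_on k U F \<Longrightarrow> Ck_on k U (\<lambda>x. exp (F x) :: real)"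
  using Ck_on_compose[OF _ _ Ck_on_exp, of U F k] by auto

lemma Ck_on_divide:
  fixes F G :: "'a::euclidean_space \<Rightarrow> real"
  assumes U: "open U" and F: "Ck_on k U F" and G: "Ck_on k U G" and pos: "\<And>x. x \<in> U \<Longrightarrow> 0 < G x"
  shows "Ck_on k U (\<lambda>x. F x / G x)"
  by (rule Ck_on_cong[OF U _ Ck_on_mult[OF U F Ck_on_powr_compose[OF U G pos, of "-1"]]])
    (use pos in \<open>auto simp: powr_minus field_simps less_imp_le\<close>)

lemma Ck_on_sqrt:
  fixes F :: "'a::euclidean_space \<Rightarrow> real"
  assumes U: "open U" and F: "Ck_on k U F" and pos: "\<And>x. x \<in> U \<Longrightarrow> 0 < F x"
  shows "Ck_on k U (\<lambda>x. sqrt (F x))"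
  by (rule Ck_on_cong[OF U _ Ck_on_powr_compose[OF U F pos, of "1/2"]])
    (use pos in \<open>auto simp: powr_half_sqrt less_imp_le\<close>)

lemma Ck_on_norm:
  assumes U: "open U" and F: "Ck_on k U F" and nz: "\<And>x. x \<in> U \<Longrightarrow> F x \<noteq> 0"
  shows "Ck_on k U (\<lambda>x. norm (F x))"
  unfolding norm_eq_sqrt_inner
  by (intro Ck_on_sqrt[OF U] Ck_on_inner[OF U] F) (use nz in auto)

text \<open>Source of the compactly supported functions of the partition of unity. The cube is the
  lowest integer power of the positive part with two continuous derivatives, which is all that the
  Laplacian needs.\<close>

lemma C2_on_pos_part_cube: "Ck_on 2 (UNIV::real set) (\<lambda>t. max 0 t ^ 3)"
proof -
  have dpos: "((\<lambda>t. max 0 t ^ (Suc (Suc n))) has_derivative (\<lambda>v. (real n + 2) * max 0 x ^ Suc n * v)) (at x)"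
    for x :: real and n
  proof -
    consider "x < 0" | "x > 0" | "x = 0" by linarith
    then show ?thesis
    proof cases
      case 1
      have "((\<lambda>t. max 0 t ^ (Suc (Suc n))) has_derivative (\<lambda>v. 0)) (at x)"
        by (rule has_derivative_transform_within_open[OF has_derivative_const, of "{..<0}"])
          (use 1 in \<open>auto simp: max_absorb1\<close>)
      then show ?thesis using 1 by (simp add: max_absorb1)
    next
      case 2
      have "((\<lambda>t. t ^ Suc (Suc n)) has_derivative (\<lambda>v. (real n + 2) * x ^ Suc n * v)) (at x)"
        using DERIV_pow[of "Suc (Suc n)" x UNIV] by (simp add: has_field_derivative_def add.commute)
      then have "((\<lambda>t. max 0 t ^ (Suc (Suc n))) has_derivative (\<lambda>v. (real n + 2) * x ^ Suc n * v)) (at x)"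
        by (rule has_derivative_transform_within_open[of _ _ _ _ "{0<..}"])
          (use 2 in \<open>auto simp: max_absorb2\<close>)
      then show ?thesis using 2 by (simp add: max_absorb2)
    next
      case 3
      have "((\<lambda>h. max 0 h ^ Suc (Suc n) / h) \<longlongrightarrow> 0) (at (0::real))"
      proof (rule Lim_null_comparison)
        show "\<forall>\<^sub>F h in at (0::real). norm (max 0 h ^ Suc (Suc n) / h) \<le> \<bar>h\<bar> ^ Suc n"
        proof (intro always_eventually allI)
          show "norm (max 0 h ^ Suc (Suc n) / h) \<le> \<bar>h\<bar> ^ Suc n" for h :: real
            by (cases "h > 0") (auto simp: max_absorb1 max_absorb2 intro: mult_nonpos_nonneg)
        qed
        show "((\<lambda>h. \<bar>h\<bar> ^ Suc n) \<longlongrightarrow> 0) (at (0::real))"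
          by (auto intro!: tendsto_eq_intros)
      qed
      then have "((\<lambda>t. max 0 t ^ (Suc (Suc n))) has_field_derivative 0) (at (0::real))"
        by (simp add: DERIV_def)
      then show ?thesis using 3 by (simp add: has_field_derivative_def mult_zero_class.mult_zero_left[abs_def])
    qed
  qed
  have "Ck_on (Suc (Suc 0)) (UNIV::real set) (\<lambda>t. max 0 t ^ 3)"
  proof (rule Ck_on_SucI[OF open_UNIV])
    show "((\<lambda>t. max 0 t ^ 3) has_derivative (\<lambda>v. 3 * max 0 x ^ 2 * v)) (at x)" for x :: real
      using dpos[of 1 x] by (simp add: numeral_eq_Suc)
    fix v :: real
    have "Ck_on (Suc 0) UNIV (\<lambda>t::real. max 0 t ^ 2)"
    proof (rule Ck_on_SucI[OF open_UNIV])
      show "((\<lambda>t. max 0 t ^ 2) has_derivative (\<lambda>v. 2 * max 0 x * v)) (at x)" for x :: real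
        using dpos[of 0 x] by (simp add: numeral_eq_Suc)
    qed (auto intro!: continuous_intros)
    then show "Ck_on (Suc 0) UNIV (\<lambda>x. 3 * max 0 x ^ 2 * v)"
      by (intro Ck_on_mult Ck_on_const) auto
  qed
  then show ?thesis by (simp add: numeral_2_eq_2)
qed

section \<open>Second derivatives: symmetry, chain rule, Taylor expansion\<close>

lemma line_DERIV:
  fixes F :: "'a::euclidean_space \<Rightarrow> real"
  assumes "Ck_on (Suc k) U F" "x + t *\<^sub>R v \<in> U"
  shows "((\<lambda>s. F (x + s *\<^sub>R v)) has_real_derivative dd v F (x + t *\<^sub>R v)) (at t within S)"
proof -
  have F: "(F has_derivative (\<lambda>v. dd v F (x + t *\<^sub>R v'))) (at (x + t *\<^sub>R v'))" if "v' = v" for v'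
    using Ck_on_has_derivative[OF assms(1)] assms(2) that by simp
  have g: "((\<lambda>s. x + s *\<^sub>R v) has_derivative (\<lambda>s. s *\<^sub>R v)) (at t)"
    by (auto intro!: derivative_eq_intros)
  have "((\<lambda>s. F (x + s *\<^sub>R v)) has_derivative (\<lambda>s. dd (s *\<^sub>R v) F (x + t *\<^sub>R v))) (at t)"
    using has_derivative_compose[OF g F[OF refl]] .
  moreover have "dd (s *\<^sub>R v) F (x + t *\<^sub>R v) = dd v F (x + t *\<^sub>R v) * s" for s
    using linear_cmul[OF has_derivative_linear[OF F[OF refl]], of s v] by simp
  ultimately show ?thesis
    by (auto simp: has_field_derivative_def intro: has_derivative_at_withinI)
qed

lemma dd_scaleR: "F differentiable (at x) \<Longrightarrow> dd (c *\<^sub>R v) F x = c *\<^sub>R dd v F x"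
  using linear_cmul[OF dd_linear] by blast

lemma dd_add: "F differentiable (at x) \<Longrightarrow> dd (v + w) F x = dd v F x + dd w F x"
  using linear_add[OF dd_linear] by blast

lemma dd_inner:
  assumes "F differentiable (at x)"
  shows "dd v (\<lambda>y. F y \<bullet> n) x = dd v F x \<bullet> n"
  using dd_eqI[OF has_derivative_inner_left[OF assms[unfolded frechet_derivative_works]]] by simp

lemma C2_dd: "Ck_on 2 U F \<Longrightarrow> Ck_on 1 U (dd v F)"
  by (simp add: numeral_2_eq_2)

lemma C2_C1: "Ck_on 2 U F \<Longrightarrow> Ck_on 1 U F"
  by (rule Ck_on_le) auto

lemma C1_diff: "Ck_on 1 U F \<Longrightarrow> x \<in> U \<Longrightarrow> F differentiable (at x)"
  by simp

lemma C1_cont_dd: "Ck_on 1 U F \<Longrightarrow> continuous_on U (dd v F)"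
  by simp

lemma C2_diff: "Ck_on 2 U F \<Longrightarrow> x \<in> U \<Longrightarrow> F differentiable (at x)"
  using C2_C1 C1_diff by blast

lemma C2_cont_dd2: "Ck_on 2 U F \<Longrightarrow> continuous_on U (dd v (dd w F))"
  using C2_dd C1_cont_dd by blast

lemma dd_inner_const:
  assumes "open U" "Ck_on 2 U F" "x \<in> U"
  shows "dd v (dd w (\<lambda>y. F y \<bullet> n)) x = dd v (dd w F) x \<bullet> n"
proof -
  have "dd v (dd w (\<lambda>y. F y \<bullet> n)) x = dd v (\<lambda>y. dd w F y \<bullet> n) x"
    by (rule dd_cong[OF assms(1,3)]) (rule dd_inner[OF C2_diff[OF assms(2)]])
  also have "\<dots> = dd v (dd w F) x \<bullet> n"
    by (rule dd_inner[OF C1_diff[OF C2_dd[OF assms(2)] assms(3)]])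
  finally show ?thesis .
qed

text \<open>The mixed second difference over a small parallelogram is symmetric in \<open>v\<close>
  and \<open>w\<close>. The mean value theorem, applied twice in either order, writes it as
  \<open>h * h\<close> times either mixed derivative at a nearby point; continuity does the
  rest.\<close>

lemma dd_commute_real:
  fixes F :: "'a::euclidean_space \<Rightarrow> real"
  assumes U: "open U" and x: "x \<in> U" and F: "Ck_on 2 U F"
  shows "dd v (dd w F) x = dd w (dd v F) x"
proof (rule ccontr)
  have mixed: "\<exists>s t. 0 \<le> s \<and> s \<le> h \<and> 0 \<le> t \<and> t \<le> h \<and>
      F (x + h *\<^sub>R v + h *\<^sub>R w) - F (x + h *\<^sub>R v) - F (x + h *\<^sub>R w) + F x
       = h * h * dd w (dd v F) (x + s *\<^sub>R v + t *\<^sub>R w)"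
    if h: "0 < h" and sub: "\<And>s t. \<lbrakk>0 \<le> s; s \<le> h; 0 \<le> t; t \<le> h\<rbrakk> \<Longrightarrow> x + s *\<^sub>R v + t *\<^sub>R w \<in> U" for h v w
  proof -
    have D: "((\<lambda>s. F (x + s *\<^sub>R v + h *\<^sub>R w) - F (x + s *\<^sub>R v)) has_real_derivative
        dd v F (x + s *\<^sub>R v + h *\<^sub>R w) - dd v F (x + s *\<^sub>R v)) (at s)" if s: "0 \<le> s" "s \<le> h" for s
    proof -
      have "((\<lambda>s. F ((x + h *\<^sub>R w) + s *\<^sub>R v)) has_real_derivative dd v F ((x + h *\<^sub>R w) + s *\<^sub>R v)) (at s)"
        using sub[of s h] s h by (intro line_DERIV[OF C2_C1[OF F, unfolded One_nat_def]]) (simp add: ac_simps)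
      moreover have "((\<lambda>s. F (x + s *\<^sub>R v)) has_real_derivative dd v F (x + s *\<^sub>R v)) (at s)"
        using sub[of s 0] s h by (intro line_DERIV[OF C2_C1[OF F, unfolded One_nat_def]]) simp
      ultimately show ?thesis by (auto intro!: derivative_eq_intros simp: ac_simps)
    qed
    obtain s where s: "0 < s" "s < h" and
      e1: "(F (x + h *\<^sub>R v + h *\<^sub>R w) - F (x + h *\<^sub>R v)) - (F (x + 0 *\<^sub>R v + h *\<^sub>R w) - F (x + 0 *\<^sub>R v))
        = (h - 0) * (dd v F (x + s *\<^sub>R v + h *\<^sub>R w) - dd v F (x + s *\<^sub>R v))"
      using MVT2[OF h D] by blast
    have D2: "((\<lambda>t. dd v F ((x + s *\<^sub>R v) + t *\<^sub>R w)) has_real_derivative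
        dd w (dd v F) ((x + s *\<^sub>R v) + t *\<^sub>R w)) (at t)" if t: "0 \<le> t" "t \<le> h" for t
      using sub[of s t] s t by (intro line_DERIV[OF C2_dd[OF F, unfolded One_nat_def]]) simp
    obtain t where t: "0 < t" "t < h" and
      e2: "dd v F ((x + s *\<^sub>R v) + h *\<^sub>R w) - dd v F ((x + s *\<^sub>R v) + 0 *\<^sub>R w)
        = (h - 0) * dd w (dd v F) ((x + s *\<^sub>R v) + t *\<^sub>R w)"
      using MVT2[OF h D2] by blast
    have "F (x + h *\<^sub>R v + h *\<^sub>R w) - F (x + h *\<^sub>R v) - F (x + h *\<^sub>R w) + F x
       = h * (dd v F (x + s *\<^sub>R v + h *\<^sub>R w) - dd v F (x + s *\<^sub>R v))"
      using e1 by simp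
    also have "\<dots> = h * h * dd w (dd v F) (x + s *\<^sub>R v + t *\<^sub>R w)"
      using e2 by (simp only: scaleR_zero_left add_0_right diff_0_right mult.assoc)
    finally show ?thesis using s t less_imp_le by blast
  qed
  assume ne: "dd v (dd w F) x \<noteq> dd w (dd v F) x"
  define e where "e = \<bar>dd v (dd w F) x - dd w (dd v F) x\<bar> / 2"
  have e: "e > 0" using ne by (simp add: e_def)
  have "\<exists>d>0. \<forall>y. dist y x < d \<longrightarrow> y \<in> U \<and> \<bar>dd a (dd b F) y - dd a (dd b F) x\<bar> < e" for a b
  proof -
    obtain d1 where d1: "d1 > 0" "ball x d1 \<subseteq> U" using U x open_contains_ball by blast
    have "isCont (dd a (dd b F)) x"
      using C2_cont_dd2[OF F] U x continuous_on_eq_continuous_at by blast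
    then obtain d2 where d2: "d2 > 0" "\<And>y. dist y x < d2 \<Longrightarrow> dist (dd a (dd b F) y) (dd a (dd b F) x) < e"
      using e unfolding continuous_at_eps_delta by blast
    show ?thesis
      by (rule exI[of _ "min d1 d2"]) (use d1 d2 in \<open>auto simp: dist_commute dist_real_def subset_eq\<close>)
  qed note near = this
  obtain d1 where d1: "d1 > 0" "\<And>y. dist y x < d1 \<Longrightarrow> y \<in> U \<and> \<bar>dd v (dd w F) y - dd v (dd w F) x\<bar> < e"
    using near by blast
  obtain d2 where d2: "d2 > 0" "\<And>y. dist y x < d2 \<Longrightarrow> y \<in> U \<and> \<bar>dd w (dd v F) y - dd w (dd v F) x\<bar> < e"
    using near by blast
  \<comment> \<open>Side length that keeps the whole parallelogram within both radii; the summand 1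
    keeps the denominator positive when \<open>v\<close> and \<open>w\<close> vanish.\<close>
  define h where "h = min d1 d2 / (2 * (norm v + norm w + 1))"
  have h: "h > 0" using d1(1) d2(1) by (simp add: h_def add_nonneg_pos)
  have close: "dist (x + s *\<^sub>R v + t *\<^sub>R w) x < min d1 d2" if "0 \<le> s" "s \<le> h" "0 \<le> t" "t \<le> h" for s t
  proof -
    have "dist (x + s *\<^sub>R v + t *\<^sub>R w) x \<le> s * norm v + t * norm w"
      using that norm_triangle_ineq[of "s *\<^sub>R v" "t *\<^sub>R w"] by (simp add: dist_norm add.assoc)
    also have "\<dots> \<le> h * norm v + h * norm w" using that by (intro add_mono mult_right_mono) auto
    also have "\<dots> < h * (2 * (norm v + norm w + 1))"
      using h by (simp add: algebra_simps add_nonneg_pos add_pos_nonneg)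
    also have "\<dots> = min d1 d2"
    proof -
      have "norm v + norm w + 1 > 0" using norm_ge_zero[of v] norm_ge_zero[of w] by linarith
      then show ?thesis by (simp add: h_def)
    qed
    finally show ?thesis .
  qed
  have sub1: "x + s *\<^sub>R v + t *\<^sub>R w \<in> U" if "0 \<le> s" "s \<le> h" "0 \<le> t" "t \<le> h" for s t
    using close[OF that] d1(2) by (simp add: min_less_iff_conj)
  have sub2: "x + s *\<^sub>R w + t *\<^sub>R v \<in> U" if "0 \<le> s" "s \<le> h" "0 \<le> t" "t \<le> h" for s t
    using sub1[OF that(3,4,1,2)] by (simp add: ac_simps)
  obtain s t where st: "0 \<le> s" "s \<le> h" "0 \<le> t" "t \<le> h" and
    1: "F (x + h *\<^sub>R v + h *\<^sub>R w) - F (x + h *\<^sub>R v) - F (x + h *\<^sub>R w) + F x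
       = h * h * dd w (dd v F) (x + s *\<^sub>R v + t *\<^sub>R w)"
    using mixed[OF h sub1] by blast
  obtain s' t' where st': "0 \<le> s'" "s' \<le> h" "0 \<le> t'" "t' \<le> h" and
    2: "F (x + h *\<^sub>R w + h *\<^sub>R v) - F (x + h *\<^sub>R w) - F (x + h *\<^sub>R v) + F x
       = h * h * dd v (dd w F) (x + s' *\<^sub>R w + t' *\<^sub>R v)"
    using mixed[OF h sub2] by blast
  have comm: "x + s' *\<^sub>R w + t' *\<^sub>R v = x + t' *\<^sub>R v + s' *\<^sub>R w" "x + h *\<^sub>R w + h *\<^sub>R v = x + h *\<^sub>R v + h *\<^sub>R w"
    by (simp_all add: ac_simps)
  have "h * h * dd w (dd v F) (x + s *\<^sub>R v + t *\<^sub>R w)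
      = h * h * dd v (dd w F) (x + t' *\<^sub>R v + s' *\<^sub>R w)"
    using 1 2[unfolded comm] by linarith
  with h have eq: "dd w (dd v F) (x + s *\<^sub>R v + t *\<^sub>R w) = dd v (dd w F) (x + t' *\<^sub>R v + s' *\<^sub>R w)"
    by simp
  have "\<bar>dd w (dd v F) (x + s *\<^sub>R v + t *\<^sub>R w) - dd w (dd v F) x\<bar> < e"
    using d2(2) close[OF st] by simp
  moreover have "\<bar>dd v (dd w F) (x + t' *\<^sub>R v + s' *\<^sub>R w) - dd v (dd w F) x\<bar> < e"
    using d1(2) close[OF st'(3,4,1,2)] by simp
  moreover have "\<bar>a - b\<bar> / 2 \<le> \<bar>c - a\<bar> \<or> \<bar>a - b\<bar> / 2 \<le> \<bar>c - b\<bar>" for a b c :: real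
    by (auto simp: abs_if)
  ultimately show False unfolding e_def eq by (meson not_less)
qed

lemma dd_commute:
  assumes "open U" "x \<in> U" "Ck_on 2 U F"
  shows "dd v (dd w F) x = dd w (dd v F) x"
proof (rule euclidean_eqI)
  fix b :: 'b
  have "Ck_on 2 U (\<lambda>y. F y \<bullet> b)" by (intro Ck_on_inner Ck_on_const assms)
  from dd_commute_real[OF assms(1,2) this, of v w]
  show "dd v (dd w F) x \<bullet> b = dd w (dd v F) x \<bullet> b"
    unfolding dd_inner_const[OF assms(1,3,2)] by (rule sym)
qed

lemma dd2_linear:
  assumes "open U" "x \<in> U" "Ck_on 2 U F"
  shows "linear (\<lambda>v. dd w (dd v F) x)" "linear (\<lambda>v. dd v (dd w F) x)"
proof -
  show 2: "linear (\<lambda>v. dd v (dd w F) x)" for w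
    using dd_linear[OF C1_diff[OF C2_dd[OF assms(3)] assms(2)]] .
  have "(\<lambda>v. dd w (dd v F) x) = (\<lambda>v. dd v (dd w F) x)"
    by (rule ext) (rule dd_commute[OF assms])
  then show "linear (\<lambda>v. dd w (dd v F) x)" using 2[of w] by (simp only:)
qed

lemma dd2_bilinear:
  assumes "open U" "x \<in> U" "Ck_on 2 U F"
  shows "bilinear (\<lambda>v w. dd v (dd w F) x)"
  using dd2_linear[OF assms] by (simp add: bilinear_def)

lemma dd_basis:
  assumes "F differentiable (at x)"
  shows "dd v F x = (\<Sum>b\<in>Basis. (v \<bullet> b) *\<^sub>R dd b F x)"
proof -
  have "dd v F x = dd (\<Sum>b\<in>Basis. (v \<bullet> b) *\<^sub>R b) F x" by (simp add: euclidean_representation)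
  also have "\<dots> = (\<Sum>b\<in>Basis. dd ((v \<bullet> b) *\<^sub>R b) F x)" by (rule linear_sum[OF dd_linear[OF assms]])
  finally show ?thesis by (simp add: dd_scaleR[OF assms])
qed

text \<open>The inner direction \<open>dd b G y\<close> varies with \<open>y\<close>, and
  differentiating it produces the additional first-order term. The expansion in \<open>Basis\<close>
  reduces the computation to the product rule with fixed directions.\<close>

lemma dd2_compose:
  assumes U: "open U" and V: "open V" and F: "Ck_on 2 V F" and G: "Ck_on 2 U G"
    and GU: "\<And>y. y \<in> U \<Longrightarrow> G y \<in> V" and x: "x \<in> U"
  shows "dd a (dd b (\<lambda>y. F (G y))) x
    = dd (dd a G x) (dd (dd b G x) F) (G x) + dd (dd a (dd b G) x) F (G x)"
proof -
  have "dd b (\<lambda>y. F (G y)) y = (\<Sum>i\<in>Basis. (dd b G y \<bullet> i) *\<^sub>R dd i F (G y))" if "y \<in> U" for y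
    using dd_compose[OF C2_diff[OF F GU[OF that]] C2_diff[OF G that], of b]
      dd_basis[OF C2_diff[OF F GU[OF that]], of "dd b G y"] by (rule trans)
  then have "dd a (dd b (\<lambda>y. F (G y))) x = dd a (\<lambda>y. \<Sum>i\<in>Basis. (dd b G y \<bullet> i) *\<^sub>R dd i F (G y)) x"
    by (rule dd_cong[OF U x])
  also have "\<dots> = (\<Sum>i\<in>Basis. (dd b G x \<bullet> i) *\<^sub>R dd (dd a G x) (dd i F) (G x)
      + (dd a (dd b G) x \<bullet> i) *\<^sub>R dd i F (G x))"
  proof (rule dd_eqI)
    have Fi: "((\<lambda>y. dd i F (G y)) has_derivative (\<lambda>a. dd (dd a G x) (dd i F) (G x))) (at x)" for i
      by (rule has_derivative_compose[OF Ck_on_has_derivative[OF G _ x]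
            Ck_on_has_derivative[OF C2_dd[OF F] _ GU[OF x]]]) auto
    have Gi: "((\<lambda>y. dd b G y \<bullet> i) has_derivative (\<lambda>a. dd a (dd b G) x \<bullet> i)) (at x)" for i
      by (rule has_derivative_inner_left[OF Ck_on_has_derivative[OF C2_dd[OF G] _ x]]) simp
    show "((\<lambda>y. \<Sum>i\<in>Basis. (dd b G y \<bullet> i) *\<^sub>R dd i F (G y)) has_derivative (\<lambda>a.
        \<Sum>i\<in>Basis. (dd b G x \<bullet> i) *\<^sub>R dd (dd a G x) (dd i F) (G x)
      + (dd a (dd b G) x \<bullet> i) *\<^sub>R dd i F (G x))) (at x)"
      by (intro has_derivative_sum has_derivative_scaleR Fi Gi)
  qed
  also have "\<dots> = (\<Sum>i\<in>Basis. (dd b G x \<bullet> i) *\<^sub>R dd (dd a G x) (dd i F) (G x))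
      + dd (dd a (dd b G) x) F (G x)"
    using dd_basis[OF C2_diff[OF F GU[OF x]], of "dd a (dd b G) x"] by (simp add: sum.distrib)
  also have "(\<Sum>i\<in>Basis. (dd b G x \<bullet> i) *\<^sub>R dd (dd a G x) (dd i F) (G x))
      = dd (dd a G x) (dd (dd b G x) F) (G x)"
  proof -
    note lin = dd2_linear(1)[OF V GU[OF x] F, of "dd a G x"]
    have "dd (dd a G x) (dd (\<Sum>i\<in>Basis. (dd b G x \<bullet> i) *\<^sub>R i) F) (G x)
        = (\<Sum>i\<in>Basis. (dd b G x \<bullet> i) *\<^sub>R dd (dd a G x) (dd i F) (G x))"
      by (subst linear_sum[OF lin]) (simp add: linear_cmul[OF lin])
    then show ?thesis by (simp add: euclidean_representation)
  qed
  finally show ?thesis .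
qed

lemma taylor2_line:
  fixes F :: "'a::euclidean_space \<Rightarrow> real"
  assumes F: "Ck_on 2 U F" and sub: "\<And>t. \<bar>t\<bar> \<le> \<bar>h\<bar> \<Longrightarrow> x + t *\<^sub>R v \<in> U"
  shows "\<exists>t. \<bar>t\<bar> \<le> \<bar>h\<bar> \<and> F (x + h *\<^sub>R v) = F x + h * dd v F x + h\<^sup>2 / 2 * dd v (dd v F) (x + t *\<^sub>R v)"
proof -
  define diff where "diff = (\<lambda>n. if n = 0 then (\<lambda>t. F (x + t *\<^sub>R v))
      else if n = Suc 0 then (\<lambda>t. dd v F (x + t *\<^sub>R v)) else (\<lambda>t. dd v (dd v F) (x + t *\<^sub>R v)))"
  have "\<forall>m t. m < 2 \<and> \<bar>t\<bar> \<le> \<bar>h\<bar> \<longrightarrow> DERIV (diff m) t :> diff (Suc m) t"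
    using line_DERIV[OF C2_C1[OF F, unfolded One_nat_def]] line_DERIV[OF C2_dd[OF F, unfolded One_nat_def]] sub
    by (auto simp: diff_def less_2_cases_iff)
  from Maclaurin_bi_le[OF refl this] obtain t where t: "\<bar>t\<bar> \<le> \<bar>h\<bar>"
    "diff 0 h = (\<Sum>m<2. diff m 0 / fact m * h ^ m) + diff 2 t / fact 2 * h ^ 2" by blast
  have "(\<Sum>m<2. diff m 0 / fact m * h ^ m) = diff 0 0 + diff 1 0 * h"
    by (simp add: numeral_2_eq_2 lessThan_Suc)
  with t show ?thesis by (intro exI[of _ t]) (simp add: diff_def fact_2 mult.commute)
qed

section \<open>The Laplacian of an immersion\<close>

definition immersion_on :: "(real^2) set \<Rightarrow> (real^2 \<Rightarrow> real^3) \<Rightarrow> bool" where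
  "immersion_on U F \<longleftrightarrow> open U \<and> Ck_on 2 U F \<and> (\<forall>x\<in>U. inj (frechet_derivative F (at x)))"

lemma immersion_onD:
  assumes "immersion_on U F"
  shows "open U" "Ck_on 2 U F" "\<And>x. x \<in> U \<Longrightarrow> inj (frechet_derivative F (at x))"
  using assms by (auto simp: immersion_on_def)

lemma immersion_on_subset: "immersion_on U F \<Longrightarrow> open V \<Longrightarrow> V \<subseteq> U \<Longrightarrow> immersion_on V F"
  using Ck_on_subset by (auto simp: immersion_on_def)

lemma pderiv_at_eq: "pderiv_at F i = dd (axis i 1) F"
  by (rule ext) (simp add: pderiv_at_def)

lemma axis2_expand: "(v::real^2) = v $ 1 *\<^sub>R axis 1 1 + v $ 2 *\<^sub>R axis 2 1"
  by (simp add: vec_eq_iff forall_2 axis_def)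

lemma dd_axis_expand:
  fixes v :: "real^2"
  assumes "F differentiable (at x)"
  shows "dd v F x = v $ 1 *\<^sub>R dd (axis 1 1) F x + v $ 2 *\<^sub>R dd (axis 2 1) F x"
  by (subst axis2_expand) (simp add: dd_add[OF assms] dd_scaleR[OF assms] del: scaleR_conv_of_real)

lemma dd_mult:
  fixes f g :: "'a::euclidean_space \<Rightarrow> real"
  assumes "f differentiable (at x)" "g differentiable (at x)"
  shows "dd v (\<lambda>z. f z * g z) x = dd v f x * g x + f x * dd v g x"
  using dd_eqI[OF has_derivative_mult[OF assms[unfolded frechet_derivative_works]]] by simp

lemma dd_inner2:
  assumes "f differentiable (at x)" "g differentiable (at x)"
  shows "dd v (\<lambda>z. f z \<bullet> g z) x = dd v f x \<bullet> g x + f x \<bullet> dd v g x"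
  using dd_eqI[OF has_derivative_inner[OF assms[unfolded frechet_derivative_works]]] by (simp add: add.commute)

lemma dd_sum2:
  fixes f :: "2 \<Rightarrow> 'a::euclidean_space \<Rightarrow> real"
  assumes "\<And>i. f i differentiable (at x)"
  shows "dd v (\<lambda>z. \<Sum>i\<in>UNIV. f i z) x = (\<Sum>i\<in>UNIV. dd v (f i) x)"
  using dd_eqI[OF has_derivative_sum[of UNIV f, OF assms[unfolded frechet_derivative_works]]] by simp

lemma matrix_inv_2:
  fixes A :: "real^2^2"
  assumes "det A \<noteq> 0"
  shows "matrix_inv A $ 1 $ 1 = A $ 2 $ 2 / det A" "matrix_inv A $ 1 $ 2 = - A $ 1 $ 2 / det A"
    "matrix_inv A $ 2 $ 1 = - A $ 2 $ 1 / det A" "matrix_inv A $ 2 $ 2 = A $ 1 $ 1 / det A"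
    "A ** matrix_inv A = mat 1" "matrix_inv A ** A = mat 1"
proof -
  define B :: "real^2^2" where "B = (\<chi> i j. (if i = 1 then (if j = 1 then A $ 2 $ 2 else - A $ 1 $ 2)
      else (if j = 1 then - A $ 2 $ 1 else A $ 1 $ 1)) / det A)"
  have AB: "A ** B = mat 1"
    using assms by (simp add: vec_eq_iff forall_2 matrix_matrix_mult_def sum_2 B_def mat_def det_2 divide_simps)
  then have BA: "B ** A = mat 1" by (simp add: matrix_left_right_inverse)
  have "A ** matrix_inv A = mat 1 \<and> matrix_inv A ** A = mat 1"
    unfolding matrix_inv_def by (rule someI[of _ B]) (use AB BA in simp)
  then show 1: "A ** matrix_inv A = mat 1" "matrix_inv A ** A = mat 1" by auto
  have "matrix_inv A = (B ** A) ** matrix_inv A" by (simp add: BA matrix_mul_lid)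
  also have "\<dots> = B" by (simp add: matrix_mul_assoc[symmetric] 1 matrix_mul_rid)
  finally have eq: "matrix_inv A = B" .
  show "matrix_inv A $ 1 $ 1 = A $ 2 $ 2 / det A" "matrix_inv A $ 1 $ 2 = - A $ 1 $ 2 / det A"
    "matrix_inv A $ 2 $ 1 = - A $ 2 $ 1 / det A" "matrix_inv A $ 2 $ 2 = A $ 1 $ 1 / det A"
    by (simp_all add: eq B_def)
qed

lemma first_ff_nth: "first_ff F x $ i $ j = dd (axis i 1) F x \<bullet> dd (axis j 1) F x"
  by (simp add: first_ff_def pderiv_at_def)

lemma inner_2: "(v::real^2) \<bullet> w = v $ 1 * w $ 1 + v $ 2 * w $ 2"
  by (simp add: inner_vec_def sum_2)

lemma first_ff_quadratic:
  assumes "F differentiable (at x)"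
  shows "dd v F x \<bullet> dd w F x = v \<bullet> (first_ff F x *v w)"
  unfolding dd_axis_expand[OF assms, of v] dd_axis_expand[OF assms, of w]
  by (simp add: inner_2 sum_2 matrix_vector_mult_def first_ff_nth inner_add_left inner_add_right inner_commute algebra_simps)

lemma det_first_ff_pos:
  assumes "immersion_on U F" "x \<in> U"
  shows "0 < det (first_ff F x)"
proof -
  have dF: "F differentiable (at x)" using C2_diff immersion_onD(2)[OF assms(1)] assms(2) .
  have inj0: "dd v F x = 0 \<Longrightarrow> v = 0" for v
    using immersion_onD(3)[OF assms] linear_injective_0[OF linear_frechet_derivative[OF dF]] by blast
  let ?a = "dd (axis 1 1) F x" and ?b = "dd (axis 2 1) F x"
  have b: "?b \<noteq> 0" using inj0[of "axis 2 1"] by (auto simp: axis_eq_0_iff)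
  \<comment> \<open>The image of this vector is orthogonal to the second coordinate vector
    \<open>?b\<close>, and its squared length is \<open>(?b \<bullet> ?b)\<close> times the
    determinant.\<close>
  define v :: "real^2" where "v = (?b \<bullet> ?b) *\<^sub>R axis 1 1 - (?a \<bullet> ?b) *\<^sub>R axis 2 1"
  have v1: "v $ 1 = ?b \<bullet> ?b" "v $ 2 = - (?a \<bullet> ?b)" by (simp_all add: v_def axis_def)
  then have "v \<noteq> 0" using b by (metis inner_eq_zero_iff zero_index)
  then have "dd v F x \<noteq> 0" using inj0 by blast
  then have "0 < dd v F x \<bullet> dd v F x" by simp
  also have "dd v F x \<bullet> dd v F x = (?b \<bullet> ?b) * det (first_ff F x)"
    unfolding first_ff_quadratic[OF dF, of v v]
    by (simp add: inner_2 sum_2 matrix_vector_mult_def first_ff_nth v1 det_2 algebra_simps inner_commute[of ?b ?a])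
  finally show ?thesis using b by (metis inner_gt_zero_iff zero_less_mult_pos)
qed

text \<open>The coefficients of the divergence form \<open>\<surd>g \<Delta> w = \<Sum> \<partial>\<^sub>i (A\<^sub>i\<^sub>j \<partial>\<^sub>j w)\<close>.\<close>

definition lapA :: "(real^2 \<Rightarrow> real^3) \<Rightarrow> 2 \<Rightarrow> 2 \<Rightarrow> real^2 \<Rightarrow> real" where
  "lapA F i j z = sqrt (det (first_ff F z)) * matrix_inv (first_ff F z) $ i $ j"

lemma Ck_on_det_first_ff:
  assumes "immersion_on U F"
  shows "Ck_on 1 U (\<lambda>z. first_ff F z $ i $ j)" "Ck_on 1 U (\<lambda>z. det (first_ff F z))"
    "Ck_on 1 U (\<lambda>z. sqrt (det (first_ff F z)))"
proof -
  show 1: "Ck_on 1 U (\<lambda>z. first_ff F z $ i $ j)" for i j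
    unfolding first_ff_nth
    by (intro Ck_on_inner immersion_onD(1)[OF assms] C2_dd immersion_onD(2)[OF assms])
  show 2: "Ck_on 1 U (\<lambda>z. det (first_ff F z))"
    unfolding det_2 by (intro Ck_on_diff Ck_on_mult 1 immersion_onD(1)[OF assms])
  show "Ck_on 1 U (\<lambda>z. sqrt (det (first_ff F z)))"
    by (intro Ck_on_sqrt immersion_onD(1)[OF assms] 2 det_first_ff_pos[OF assms])
qed

lemma Ck_on_matrix_inv:
  assumes "immersion_on U F"
  shows "Ck_on 1 U (\<lambda>z. matrix_inv (first_ff F z) $ i $ j)"
proof -
  note U = immersion_onD(1)[OF assms]
  note pos = det_first_ff_pos[OF assms]
  have ne: "z \<in> U \<Longrightarrow> det (first_ff F z) \<noteq> 0" for z using pos[of z] by simp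
  note C = Ck_on_det_first_ff[OF assms]
  have "Ck_on 1 U (\<lambda>z. first_ff F z $ k $ l / det (first_ff F z))"
    "Ck_on 1 U (\<lambda>z. - first_ff F z $ k $ l / det (first_ff F z))" for k l
    by (rule Ck_on_divide[OF U C(1) C(2) pos] Ck_on_divide[OF U Ck_on_minus[OF U C(1)] C(2) pos], assumption)+
  note D = this
  have "Ck_on 1 U (\<lambda>z. matrix_inv (first_ff F z) $ 1 $ 1)" "Ck_on 1 U (\<lambda>z. matrix_inv (first_ff F z) $ 1 $ 2)"
    "Ck_on 1 U (\<lambda>z. matrix_inv (first_ff F z) $ 2 $ 1)" "Ck_on 1 U (\<lambda>z. matrix_inv (first_ff F z) $ 2 $ 2)"
    by (rule Ck_on_cong[OF U _ D(1)[of 2 2]], simp add: matrix_inv_2[OF ne],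
        rule Ck_on_cong[OF U _ D(2)[of 1 2]], simp add: matrix_inv_2[OF ne],
        rule Ck_on_cong[OF U _ D(2)[of 2 1]], simp add: matrix_inv_2[OF ne],
        rule Ck_on_cong[OF U _ D(1)[of 1 1]], simp add: matrix_inv_2[OF ne])
  then show ?thesis using exhaust_2[of i] exhaust_2[of j] by auto
qed

lemma Ck_on_lapA:
  assumes "immersion_on U F"
  shows "Ck_on 1 U (lapA F i j)"
proof -
  have "lapA F i j = (\<lambda>z. sqrt (det (first_ff F z)) * matrix_inv (first_ff F z) $ i $ j)"
    by (rule ext) (simp add: lapA_def)
  then show ?thesis
    by (simp only:) (intro Ck_on_mult immersion_onD(1)[OF assms] Ck_on_det_first_ff[OF assms] Ck_on_matrix_inv[OF assms])
qed

lemma local_laplacian_lapA: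
  assumes F: "immersion_on U F" and x: "x \<in> U" and w: "Ck_on 2 U w"
  shows "local_laplacian F w x = (\<Sum>i\<in>UNIV. \<Sum>j\<in>UNIV. dd (axis i 1) (lapA F i j) x * dd (axis j 1) w x
      + lapA F i j x * dd (axis i 1) (dd (axis j 1) w) x) / sqrt (det (first_ff F x))"
proof -
  have "dd (axis i 1) (\<lambda>z. sqrt (det (first_ff F z)) *
        (\<Sum>j\<in>UNIV. matrix_inv (first_ff F z) $ i $ j * dd (axis j 1) w z)) x
    = (\<Sum>j\<in>UNIV. dd (axis i 1) (lapA F i j) x * dd (axis j 1) w x
      + lapA F i j x * dd (axis i 1) (dd (axis j 1) w) x)" for i
  proof -
    have "(\<lambda>z. sqrt (det (first_ff F z)) * (\<Sum>j\<in>UNIV. matrix_inv (first_ff F z) $ i $ j * dd (axis j 1) w z))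
      = (\<lambda>z. \<Sum>j\<in>UNIV. lapA F i j z * dd (axis j 1) w z)"
      by (rule ext) (simp add: lapA_def sum_distrib_left mult.assoc)
    moreover have "dd (axis i 1) (\<lambda>z. \<Sum>j\<in>UNIV. lapA F i j z * dd (axis j 1) w z) x
      = (\<Sum>j\<in>UNIV. dd (axis i 1) (\<lambda>z. lapA F i j z * dd (axis j 1) w z) x)"
      using C1_diff[OF Ck_on_lapA[OF F] x] C1_diff[OF C2_dd[OF w] x]
      by (intro dd_sum2 differentiable_mult)
    moreover have "dd (axis i 1) (\<lambda>z. lapA F i j z * dd (axis j 1) w z) x = dd (axis i 1) (lapA F i j) x * dd (axis j 1) w x
      + lapA F i j x * dd (axis i 1) (dd (axis j 1) w) x" for j
      by (rule dd_mult[OF C1_diff[OF Ck_on_lapA[OF F] x] C1_diff[OF C2_dd[OF w] x]])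
    ultimately show ?thesis by (simp only:)
  qed
  then show ?thesis unfolding local_laplacian_def pderiv_at_eq by (simp only:)
qed

lemma continuous_on_local_laplacian:
  assumes F: "immersion_on U F" and w: "Ck_on 2 U w"
  shows "continuous_on U (local_laplacian F w)"
proof -
  have "continuous_on U (\<lambda>x. (\<Sum>i\<in>UNIV. \<Sum>j\<in>UNIV. dd (axis i 1) (lapA F i j) x * dd (axis j 1) w x
      + lapA F i j x * dd (axis i 1) (dd (axis j 1) w) x) / sqrt (det (first_ff F x)))"
    by (intro continuous_on_divide continuous_on_sum continuous_on_add continuous_on_mult ballI
        C1_cont_dd[OF Ck_on_lapA[OF F]] C1_cont_dd[OF C2_C1[OF w]] C2_cont_dd2[OF w]
        Ck_on_cont[OF Ck_on_lapA[OF F]] Ck_on_cont[OF Ck_on_det_first_ff(3)[OF F]])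
      (use det_first_ff_pos[OF F] in force)
  then show ?thesis
    by (subst continuous_on_cong[OF refl local_laplacian_lapA[OF F _ w]])
qed

text \<open>Coordinates of an orthonormal tangent basis, with a vector \<open>c\<close> that removes
  the tangential part of the second derivatives of \<open>F\<close>. Then second derivatives along
  \<open>a\<close> and \<open>b\<close> plus a first derivative along \<open>c\<close> give the
  Laplacian at \<open>x\<close>, without Christoffel symbols; on \<open>F\<close> itself they give
  the mean curvature vector.\<close>

definition lap_frame :: "(real^2 \<Rightarrow> real^3) \<Rightarrow> real^2 \<Rightarrow> real^2 \<Rightarrow> real^2 \<Rightarrow> real^2 \<Rightarrow> bool" where
  "lap_frame F x a b c \<longleftrightarrow> norm (dd a F x) = 1 \<and> norm (dd b F x) = 1 \<and> dd a F x \<bullet> dd b F x = 0 \<and>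
     (\<forall>v. (dd a (dd a F) x + dd b (dd b F) x + dd c F x) \<bullet> dd v F x = 0)"

text \<open>For the matrix \<open>P\<close> with columns \<open>a\<close> and \<open>b\<close>,
  orthonormality says that \<open>P\<close> transforms the metric matrix into the identity; hence
  its inverse is \<open>P ** transpose P\<close>.\<close>

lemma frame_inverse:
  assumes F: "F differentiable (at x)" and d: "det (first_ff F x) \<noteq> 0"
    and on: "norm (dd a F x) = 1" "norm (dd b F x) = 1" "dd a F x \<bullet> dd b F x = 0"
  shows "matrix_inv (first_ff F x) $ i $ j = a $ i * a $ j + b $ i * b $ j"
proof -
  define g where "g = first_ff F x"
  define P :: "real^2^2" where "P = (\<chi> i j. if j = 1 then a $ i else b $ i)"
  have q: "a \<bullet> (g *v a) = 1" "b \<bullet> (g *v b) = 1" "a \<bullet> (g *v b) = 0" "b \<bullet> (g *v a) = 0"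
    using on first_ff_quadratic[OF F] unfolding g_def norm_eq_1 by (metis inner_commute)+
  have "transpose P ** (g ** P) = mat 1"
    using q by (simp add: vec_eq_iff forall_2 matrix_matrix_mult_def sum_2 P_def mat_def transpose_def
        inner_vec_def matrix_vector_mult_def algebra_simps)
  then have "(g ** P) ** transpose P = mat 1" by (simp add: matrix_left_right_inverse)
  then have 1: "g ** (P ** transpose P) = mat 1" by (simp add: matrix_mul_assoc)
  have "matrix_inv g = matrix_inv g ** (g ** (P ** transpose P))" by (simp add: 1 matrix_mul_rid)
  also have "\<dots> = P ** transpose P"
    using matrix_inv_2(6)[of g] d by (simp add: matrix_mul_assoc g_def matrix_mul_lid)
  finally show ?thesis
    by (simp add: g_def P_def matrix_matrix_mult_def sum_2 transpose_def)
qed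

lemma bilinear_axis_expand:
  fixes T :: "real^2 \<Rightarrow> real^2 \<Rightarrow> 'c::real_vector"
  assumes "bilinear T"
  shows "T v w = (\<Sum>i\<in>UNIV. \<Sum>j\<in>UNIV. (v $ i * w $ j) *\<^sub>R T (axis i 1) (axis j 1))"
proof -
  have "T v w = T (v $ 1 *\<^sub>R axis 1 1 + v $ 2 *\<^sub>R axis 2 1) (w $ 1 *\<^sub>R axis 1 1 + w $ 2 *\<^sub>R axis 2 1)"
    using axis2_expand[of v] axis2_expand[of w] by simp
  also have "\<dots> = (\<Sum>i\<in>UNIV. \<Sum>j\<in>UNIV. (v $ i * w $ j) *\<^sub>R T (axis i 1) (axis j 1))"
    by (simp add: bilinear_ladd[OF assms] bilinear_radd[OF assms] bilinear_lmul[OF assms] bilinear_rmul[OF assms] sum_2 algebra_simps)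
  finally show ?thesis .
qed

lemma frame_trace:
  fixes T :: "real^2 \<Rightarrow> real^2 \<Rightarrow> 'c::real_vector"
  assumes F: "F differentiable (at x)" and d: "det (first_ff F x) \<noteq> 0"
    and on: "norm (dd a F x) = 1" "norm (dd b F x) = 1" "dd a F x \<bullet> dd b F x = 0"
    and T: "bilinear T"
  shows "(\<Sum>i\<in>UNIV. \<Sum>j\<in>UNIV. matrix_inv (first_ff F x) $ i $ j *\<^sub>R T (axis i 1) (axis j 1)) = T a a + T b b"
  unfolding frame_inverse[OF F d on] bilinear_axis_expand[OF T, of a a] bilinear_axis_expand[OF T, of b b]
  by (simp add: sum_2 algebra_simps)

text \<open>Differentiating the inverse relation between \<open>lapA\<close> and the metric, and the
  formula for the determinant, leaves terms that cancel by the symmetry of second derivatives. The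
  meaning is that the Laplacian of the position vector is normal, which pins down the first-order
  part of the operator.\<close>

lemma lapA_normal:
  assumes F: "immersion_on U F" and x: "x \<in> U"
  shows "(\<Sum>i\<in>UNIV. \<Sum>j\<in>UNIV. lapA F i j x *\<^sub>R dd (axis i 1) (dd (axis j 1) F) x
      + dd (axis i 1) (lapA F i j) x *\<^sub>R dd (axis j 1) F x) \<bullet> dd (axis k 1) F x = 0"
proof -
  note U = immersion_onD(1)[OF F] and C2 = immersion_onD(2)[OF F]
  define D where "D = (\<lambda>z. sqrt (det (first_ff F z)))"
  define g where "g = (\<lambda>i j z. first_ff F z $ i $ j)"
  define h where "h = (\<lambda>l i j. dd (axis l 1) (dd (axis i 1) F) x \<bullet> dd (axis j 1) F x)"
  have D1: "Ck_on 1 U D" unfolding D_def by (rule Ck_on_det_first_ff(3)[OF F])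
  have g1: "Ck_on 1 U (g i j)" for i j unfolding g_def by (rule Ck_on_det_first_ff(1)[OF F])
  have Dpos: "D z > 0" if "z \<in> U" for z using det_first_ff_pos[OF F that] by (simp add: D_def)
  have dg: "dd (axis l 1) (g i j) x = h l i j + h l j i" for l i j
    unfolding g_def first_ff_nth h_def
    using dd_inner2[OF C1_diff[OF C2_dd[OF C2] x] C1_diff[OF C2_dd[OF C2] x]] by (simp add: inner_commute)
  have sym: "h l i j = h i l j" for l i j
    unfolding h_def using dd_commute[OF U x C2, of "axis l 1" "axis i 1"] by simp
  have Adiff: "lapA F i j differentiable (at x)" for i j by (rule C1_diff[OF Ck_on_lapA[OF F] x])
  have gdiff: "g i j differentiable (at x)" for i j by (rule C1_diff[OF g1 x])
  have Ddiff: "D differentiable (at x)" by (rule C1_diff[OF D1 x])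
  have inv: "(\<Sum>j\<in>UNIV. lapA F i j z * g j k z) = (if i = k then D z else 0)" if "z \<in> U" for z i k
  proof -
    have "(matrix_inv (first_ff F z) ** first_ff F z) $ i $ k = (mat 1 :: real^2^2) $ i $ k"
      using matrix_inv_2(6)[of "first_ff F z"] det_first_ff_pos[OF F that] by simp
    then have "(\<Sum>j\<in>UNIV. matrix_inv (first_ff F z) $ i $ j * first_ff F z $ j $ k) = (if i = k then 1 else 0)"
      by (simp add: matrix_matrix_mult_def mat_def)
    moreover have "(\<Sum>j\<in>UNIV. lapA F i j z * g j k z)
        = D z * (\<Sum>j\<in>UNIV. matrix_inv (first_ff F z) $ i $ j * first_ff F z $ j $ k)"
      by (simp add: lapA_def g_def D_def sum_distrib_left mult.assoc)
    ultimately show ?thesis by simp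
  qed
  have dinv: "(\<Sum>j\<in>UNIV. dd (axis i 1) (lapA F i j) x * g j k x + lapA F i j x * (h i j k + h i k j))
      = (if i = k then dd (axis i 1) D x else 0)" for i
  proof -
    have "dd (axis i 1) (\<lambda>z. \<Sum>j\<in>UNIV. lapA F i j z * g j k z) x = (\<Sum>j\<in>UNIV. dd (axis i 1) (\<lambda>z. lapA F i j z * g j k z) x)"
      by (rule dd_sum2) (rule differentiable_mult[OF Adiff gdiff])
    also have "\<dots> = (\<Sum>j\<in>UNIV. dd (axis i 1) (lapA F i j) x * g j k x + lapA F i j x * (h i j k + h i k j))"
      by (simp only: dd_mult[OF Adiff gdiff] dg)
    finally have "(\<Sum>j\<in>UNIV. dd (axis i 1) (lapA F i j) x * g j k x + lapA F i j x * (h i j k + h i k j))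
       = dd (axis i 1) (\<lambda>z. \<Sum>j\<in>UNIV. lapA F i j z * g j k z) x" by simp
    also have "\<dots> = dd (axis i 1) (\<lambda>z. if i = k then D z else 0) x"
      by (rule dd_cong[OF U x inv])
    also have "\<dots> = (if i = k then dd (axis i 1) D x else 0)"
      using dd_eqI[OF has_derivative_const] by auto
    finally show ?thesis .
  qed
  \<comment> \<open>Jacobi's formula for the derivative of the area density, obtained from its
    square so that no root is differentiated; the factor \<open>2 * D x\<close> is cancelled
    afterwards.\<close>
  have dD: "2 * D x * dd (axis k 1) D x = 2 * D x * (\<Sum>i\<in>UNIV. \<Sum>j\<in>UNIV. lapA F i j x * h k i j)"
  proof -
    have "dd (axis k 1) (\<lambda>z. D z * D z) x = 2 * D x * dd (axis k 1) D x"
      using dd_mult[OF Ddiff Ddiff] by simp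
    moreover have "dd (axis k 1) (\<lambda>z. D z * D z) x = dd (axis k 1) (\<lambda>z. g 1 1 z * g 2 2 z - g 1 2 z * g 1 2 z) x"
      by (rule dd_cong[OF U x]) (use det_first_ff_pos[OF F] in \<open>auto simp: D_def g_def det_2 first_ff_nth inner_commute less_imp_le\<close>)
    moreover have "dd (axis k 1) (\<lambda>z. g 1 1 z * g 2 2 z - g 1 2 z * g 1 2 z) x
       = (dd (axis k 1) (g 1 1) x * g 2 2 x + g 1 1 x * dd (axis k 1) (g 2 2) x)
          - (dd (axis k 1) (g 1 2) x * g 1 2 x + g 1 2 x * dd (axis k 1) (g 1 2) x)"
      by (rule dd_eqI[THEN trans, OF has_derivative_diff[OF
            has_derivative_mult[OF gdiff[unfolded frechet_derivative_works] gdiff[unfolded frechet_derivative_works]]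
            has_derivative_mult[OF gdiff[unfolded frechet_derivative_works] gdiff[unfolded frechet_derivative_works]]]]) simp
    ultimately have 1: "2 * D x * dd (axis k 1) D x
       = 2 * (h k 1 1 * g 2 2 x + g 1 1 x * h k 2 2 - g 1 2 x * (h k 1 2 + h k 2 1))"
      unfolding dg by (simp add: algebra_simps)
    have ne: "det (first_ff F x) \<noteq> 0" using det_first_ff_pos[OF F x] by simp
    have DD: "D x * D x = det (first_ff F x)" using det_first_ff_pos[OF F x] by (simp add: D_def)
    have "D x * lapA F i j x = det (first_ff F x) * matrix_inv (first_ff F x) $ i $ j" for i j
    proof -
      have "lapA F i j x = D x * matrix_inv (first_ff F x) $ i $ j" by (simp add: lapA_def D_def)
      then show ?thesis using DD by (metis mult.assoc)
    qed
    then have "D x * lapA F 1 1 x = g 2 2 x" "D x * lapA F 1 2 x = - g 1 2 x"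
       "D x * lapA F 2 1 x = - g 1 2 x" "D x * lapA F 2 2 x = g 1 1 x"
      using ne by (simp_all add: matrix_inv_2[OF ne] g_def first_ff_nth inner_commute)
    then have 2: "D x * (\<Sum>i\<in>UNIV. \<Sum>j\<in>UNIV. lapA F i j x * h k i j)
       = g 2 2 x * h k 1 1 + (- g 1 2 x) * h k 1 2 + (- g 1 2 x) * h k 2 1 + g 1 1 x * h k 2 2"
      by (simp add: sum_2 distrib_left mult.assoc[symmetric])
    show ?thesis unfolding 1 mult.assoc[of 2 "D x" "sum _ _"] 2 by (simp add: algebra_simps)
  qed
  then have dD': "dd (axis k 1) D x = (\<Sum>i\<in>UNIV. \<Sum>j\<in>UNIV. lapA F i j x * h k i j)" using Dpos[OF x] by simp
  have "(\<Sum>i\<in>UNIV. \<Sum>j\<in>UNIV. dd (axis i 1) (lapA F i j) x * g j k x + lapA F i j x * (h i j k + h i k j))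
      = dd (axis k 1) D x"
    unfolding dinv by (simp add: sum.delta)
  moreover have "h i k j = h k i j" for i j by (rule sym)
  moreover have "(\<Sum>i\<in>UNIV. \<Sum>j\<in>UNIV. lapA F i j x *\<^sub>R dd (axis i 1) (dd (axis j 1) F) x
      + dd (axis i 1) (lapA F i j) x *\<^sub>R dd (axis j 1) F x) \<bullet> dd (axis k 1) F x
     = (\<Sum>i\<in>UNIV. \<Sum>j\<in>UNIV. lapA F i j x * h i j k + dd (axis i 1) (lapA F i j) x * g j k x)"
    by (simp add: inner_sum_left inner_add_left h_def g_def first_ff_nth)
  ultimately show ?thesis
    using dD' by (simp add: sum_2 algebra_simps)
qed

text \<open>Divergence form and frame formula have the same second-order part, by
  \<open>frame_trace\<close>. Applied to \<open>F\<close>, both give a normal vector, so their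
  first-order coefficients have the same image under the injective differential of \<open>F\<close>
  and coincide.\<close>

lemma local_laplacian_frame:
  assumes F: "immersion_on U F" and x: "x \<in> U" and w: "Ck_on 2 U w" and fr: "lap_frame F x a b c"
  shows "local_laplacian F w x = dd a (dd a w) x + dd b (dd b w) x + dd c w x"
proof -
  note U = immersion_onD(1)[OF F] and C2 = immersion_onD(2)[OF F]
  have dF: "F differentiable (at x)" by (rule C2_diff[OF C2 x])
  have dw: "w differentiable (at x)" by (rule C2_diff[OF w x])
  have ne: "det (first_ff F x) \<noteq> 0" using det_first_ff_pos[OF F x] by simp
  have on: "norm (dd a F x) = 1" "norm (dd b F x) = 1" "dd a F x \<bullet> dd b F x = 0"
    and nrm: "\<And>v. (dd a (dd a F) x + dd b (dd b F) x + dd c F x) \<bullet> dd v F x = 0"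
    using fr by (auto simp: lap_frame_def)
  define D where "D = sqrt (det (first_ff F x))"
  have D: "D > 0" using det_first_ff_pos[OF F x] by (simp add: D_def)
  \<comment> \<open>First-order coefficient of the divergence form after division by the area
    density.\<close>
  define \<beta> :: "real^2" where "\<beta> = (\<chi> j. (\<Sum>i\<in>UNIV. dd (axis i 1) (lapA F i j) x) / D)"
  have gen: "(\<Sum>i\<in>UNIV. \<Sum>j\<in>UNIV. lapA F i j x *\<^sub>R dd (axis i 1) (dd (axis j 1) W) x
      + dd (axis i 1) (lapA F i j) x *\<^sub>R dd (axis j 1) W x) = D *\<^sub>R (dd a (dd a W) x + dd b (dd b W) x + dd \<beta> W x)"
    if W: "Ck_on 2 U W" for W :: "real^2 \<Rightarrow> 'c::euclidean_space"
  proof -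
    have "(\<Sum>i\<in>UNIV. \<Sum>j\<in>UNIV. lapA F i j x *\<^sub>R dd (axis i 1) (dd (axis j 1) W) x)
      = D *\<^sub>R (\<Sum>i\<in>UNIV. \<Sum>j\<in>UNIV. matrix_inv (first_ff F x) $ i $ j *\<^sub>R dd (axis i 1) (dd (axis j 1) W) x)"
      by (simp add: lapA_def D_def scaleR_sum_right)
    also have "(\<Sum>i\<in>UNIV. \<Sum>j\<in>UNIV. matrix_inv (first_ff F x) $ i $ j *\<^sub>R dd (axis i 1) (dd (axis j 1) W) x)
      = dd a (dd a W) x + dd b (dd b W) x"
      by (rule frame_trace[OF dF ne on dd2_bilinear[OF U x W]])
    finally have 1: "(\<Sum>i\<in>UNIV. \<Sum>j\<in>UNIV. lapA F i j x *\<^sub>R dd (axis i 1) (dd (axis j 1) W) x)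
      = D *\<^sub>R (dd a (dd a W) x + dd b (dd b W) x)" .
    have \<beta>: "D * \<beta> $ j = (\<Sum>i\<in>UNIV. dd (axis i 1) (lapA F i j) x)" for j using D by (simp add: \<beta>_def)
    have "D *\<^sub>R dd \<beta> W x = (D * \<beta> $ 1) *\<^sub>R dd (axis 1 1) W x + (D * \<beta> $ 2) *\<^sub>R dd (axis 2 1) W x"
      by (subst dd_axis_expand[OF C2_diff[OF W x]]) (simp add: scaleR_add_right)
    then have 2: "(\<Sum>i\<in>UNIV. \<Sum>j\<in>UNIV. dd (axis i 1) (lapA F i j) x *\<^sub>R dd (axis j 1) W x) = D *\<^sub>R dd \<beta> W x"
      unfolding \<beta> by (simp add: sum_2 algebra_simps)
    show ?thesis using 1 2 by (simp only: sum.distrib scaleR_add_right)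
  qed
  have "(dd a (dd a F) x + dd b (dd b F) x + dd \<beta> F x) \<bullet> dd (axis k 1) F x = 0" for k
    using lapA_normal[OF F x, of k] D unfolding gen[OF C2] by simp
  then have "(dd a (dd a F) x + dd b (dd b F) x + dd \<beta> F x) \<bullet> dd v F x = 0" for v
    unfolding dd_axis_expand[OF dF, of v] by (simp add: inner_add_right)
  with nrm have "(dd \<beta> F x - dd c F x) \<bullet> dd v F x = 0" for v
    by (simp add: inner_diff_left inner_add_left algebra_simps) (metis add.left_cancel add_diff_cancel_left' diff_add_cancel)
  moreover have "dd \<beta> F x - dd c F x = dd (\<beta> - c) F x"
    using linear_diff[OF dd_linear[OF dF]] by metis
  ultimately have "dd \<beta> F x - dd c F x = 0" by (metis inner_eq_zero_iff)
  then have "\<beta> = c" using immersion_onD(3)[OF F x] by (simp add: inj_def)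
  moreover have "D * local_laplacian F w x = D * (dd a (dd a w) x + dd b (dd b w) x + dd \<beta> w x)"
    using gen[OF w] D unfolding local_laplacian_lapA[OF F x w] D_def[symmetric]
    by (simp add: add.commute)
  ultimately show ?thesis using D by simp
qed

text \<open>Gram-Schmidt on the two coordinate vectors gives \<open>a\<close> and \<open>b\<close>;
  then \<open>c\<close> subtracts the two tangential components of the second derivatives.\<close>

lemma lap_frame_exists:
  assumes F: "immersion_on U F" and x: "x \<in> U"
  shows "\<exists>a b c. lap_frame F x a b c"
proof -
  note U = immersion_onD(1)[OF F] and C2 = immersion_onD(2)[OF F]
  have dF: "F differentiable (at x)" by (rule C2_diff[OF C2 x])
  have lin: "linear (\<lambda>v. dd v F x)" by (rule dd_linear[OF dF])
  have inj0: "dd v F x = 0 \<Longrightarrow> v = 0" for v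
    using immersion_onD(3)[OF F x] linear_injective_0[OF linear_frechet_derivative[OF dF]] by blast
  let ?a = "dd (axis 1 1) F x" and ?b = "dd (axis 2 1) F x"
  have na: "?a \<noteq> 0" using inj0[of "axis 1 1"] by (auto simp: axis_eq_0_iff)
  define a :: "real^2" where "a = (1 / norm ?a) *\<^sub>R axis 1 1"
  have Fa: "dd a F x = (1 / norm ?a) *\<^sub>R ?a" by (simp add: a_def dd_scaleR[OF dF])
  define b0 :: "real^2" where "b0 = axis 2 1 - (?b \<bullet> dd a F x) *\<^sub>R a"
  have Fb0: "dd b0 F x = ?b - (?b \<bullet> dd a F x) *\<^sub>R dd a F x"
    unfolding b0_def using linear_diff[OF lin] linear_cmul[OF lin] by simp
  have "b0 $ 2 = 1" by (simp add: b0_def a_def axis_def)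
  then have "b0 \<noteq> 0" by auto
  then have nb: "dd b0 F x \<noteq> 0" using inj0 by blast
  define b where "b = (1 / norm (dd b0 F x)) *\<^sub>R b0"
  have Fb: "dd b F x = (1 / norm (dd b0 F x)) *\<^sub>R dd b0 F x" by (simp add: b_def dd_scaleR[OF dF])
  have n1: "norm (dd a F x) = 1" using na by (simp add: Fa)
  have n2: "norm (dd b F x) = 1" using nb by (simp add: Fb)
  have "dd a F x \<bullet> dd b0 F x = 0"
    using n1 unfolding Fb0 by (simp add: inner_diff_right norm_eq_1 inner_commute)
  then have o: "dd a F x \<bullet> dd b F x = 0" by (simp add: Fb)
  define S where "S = dd a (dd a F) x + dd b (dd b F) x"
  define c where "c = (- (S \<bullet> dd a F x)) *\<^sub>R a + (- (S \<bullet> dd b F x)) *\<^sub>R b"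
  have Fc: "dd c F x = (- (S \<bullet> dd a F x)) *\<^sub>R dd a F x + (- (S \<bullet> dd b F x)) *\<^sub>R dd b F x"
    unfolding c_def dd_add[OF dF] dd_scaleR[OF dF] ..
  have o': "dd b F x \<bullet> dd a F x = 0" using o by (simp add: inner_commute)
  have 1: "(S + dd c F x) \<bullet> dd a F x = 0" "(S + dd c F x) \<bullet> dd b F x = 0"
    using n1 n2 unfolding Fc inner_add_left inner_scaleR_left o o' by (simp_all add: norm_eq_1)
  have span: "\<exists>p q. v = p *\<^sub>R a + q *\<^sub>R b" for v :: "real^2"
  proof -
    have ab: "a $ 2 = 0" "a $ 1 \<noteq> 0" "b $ 2 \<noteq> 0" using na nb \<open>b0 $ 2 = 1\<close> by (simp_all add: a_def b_def axis_def)
    have "v = ((v $ 1 - v $ 2 / b $ 2 * b $ 1) / a $ 1) *\<^sub>R a + (v $ 2 / b $ 2) *\<^sub>R b"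
      using ab by (simp add: vec_eq_iff forall_2 field_simps)
    then show ?thesis by blast
  qed
  have "(S + dd c F x) \<bullet> dd v F x = 0" for v
  proof -
    obtain p q where v: "v = p *\<^sub>R a + q *\<^sub>R b" using span by blast
    have "dd v F x = p *\<^sub>R dd a F x + q *\<^sub>R dd b F x"
      unfolding v using linear_add[OF lin] linear_cmul[OF lin] by simp
    then show ?thesis using 1 by (simp add: inner_add_right)
  qed
  then have "lap_frame F x a b c" using n1 n2 o by (auto simp: lap_frame_def S_def)
  then show ?thesis by blast
qed

lemma lap_frame_span:
  assumes F: "F differentiable (at x)" and fr: "lap_frame F x a b c"
  shows "\<exists>p q. v = p *\<^sub>R a + q *\<^sub>R b"
proof -
  have lin: "linear (\<lambda>v. dd v F x)" by (rule dd_linear[OF F])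
  define d where "d = a $ 1 * b $ 2 - a $ 2 * b $ 1"
  have on: "norm (dd a F x) = 1" "norm (dd b F x) = 1" "dd a F x \<bullet> dd b F x = 0"
    using fr by (auto simp: lap_frame_def)
  have d: "d \<noteq> 0"
  proof
    assume d0: "d = 0"
    have "b $ i *\<^sub>R a - a $ i *\<^sub>R b = 0" for i
      using d0 exhaust_2[of i] by (auto simp: vec_eq_iff forall_2 d_def algebra_simps)
    then have "dd (b $ i *\<^sub>R a - a $ i *\<^sub>R b) F x = 0" for i using linear_0[OF lin] by simp
    then have "b $ i *\<^sub>R dd a F x = a $ i *\<^sub>R dd b F x" for i
      using linear_diff[OF lin] linear_cmul[OF lin] by simp
    then have "(b $ i *\<^sub>R dd a F x) \<bullet> dd a F x = (a $ i *\<^sub>R dd b F x) \<bullet> dd a F x" for i by simp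
    moreover have "dd a F x \<noteq> 0" using on(1) by auto
    ultimately have "b $ i = 0" for i using on by (auto simp: norm_eq_1 inner_commute)
    then have "b = 0" by (simp add: vec_eq_iff)
    then show False using on(2) linear_0[OF lin] by simp
  qed
  have "v = ((v $ 1 * b $ 2 - v $ 2 * b $ 1) / d) *\<^sub>R a + ((a $ 1 * v $ 2 - a $ 2 * v $ 1) / d) *\<^sub>R b"
    using d by (simp add: vec_eq_iff forall_2 divide_simps) (simp add: d_def algebra_simps)
  then show ?thesis by blast
qed

text \<open>A frame is pushed forward by the differential of \<theta>, and the second derivatives of
  \<theta> enter the first-order vector just as they enter \<open>dd2_compose\<close>. The
  differential is injective because the composition is an immersion, hence onto, so normality can be
  tested on its image.\<close>

lemma lap_frame_compose:
  assumes V: "immersion_on V (\<lambda>y. F (\<theta> y))" and F: "immersion_on U F" and \<theta>: "Ck_on 2 V \<theta>"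
    and VU: "\<And>y. y \<in> V \<Longrightarrow> \<theta> y \<in> U" and y: "y \<in> V" and fr: "lap_frame (\<lambda>y. F (\<theta> y)) y a b c"
  shows "lap_frame F (\<theta> y) (dd a \<theta> y) (dd b \<theta> y) (dd c \<theta> y + dd a (dd a \<theta>) y + dd b (dd b \<theta>) y)"
proof -
  note oV = immersion_onD(1)[OF V] and oU = immersion_onD(1)[OF F] and C2 = immersion_onD(2)[OF F]
  have dF: "F differentiable (at (\<theta> y))" by (rule C2_diff[OF C2 VU[OF y]])
  have d\<theta>: "\<theta> differentiable (at y)" by (rule C2_diff[OF \<theta> y])
  have 1: "dd v (\<lambda>y. F (\<theta> y)) y = dd (dd v \<theta> y) F (\<theta> y)" for v by (rule dd_compose[OF dF d\<theta>])
  have 2: "dd v (dd v (\<lambda>y. F (\<theta> y))) y = dd (dd v \<theta> y) (dd (dd v \<theta> y) F) (\<theta> y) + dd (dd v (dd v \<theta>) y) F (\<theta> y)" for v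
    by (rule dd2_compose[OF oV oU C2 \<theta> VU y])
  have surj: "\<exists>v. u = dd v \<theta> y" for u
  proof -
    have "inj (\<lambda>v. dd v \<theta> y)"
    proof (rule injI)
      fix v w assume eq: "dd v \<theta> y = dd w \<theta> y"
      have "dd v (\<lambda>y. F (\<theta> y)) y = dd w (\<lambda>y. F (\<theta> y)) y" unfolding 1 eq ..
      then show "v = w" using immersion_onD(3)[OF V y] by (simp add: inj_def)
    qed
    then have "surj (\<lambda>v. dd v \<theta> y)" using linear_injective_imp_surjective[OF dd_linear[OF d\<theta>]] by blast
    then show ?thesis by (metis surjD)
  qed
  have "(dd (dd a \<theta> y) (dd (dd a \<theta> y) F) (\<theta> y) + dd (dd b \<theta> y) (dd (dd b \<theta> y) F) (\<theta> y) +
       dd (dd c \<theta> y + dd a (dd a \<theta>) y + dd b (dd b \<theta>) y) F (\<theta> y)) \<bullet> dd u F (\<theta> y) = 0" for u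
  proof -
    obtain v where u: "u = dd v \<theta> y" using surj by blast
    have "(dd a (dd a (\<lambda>y. F (\<theta> y))) y + dd b (dd b (\<lambda>y. F (\<theta> y))) y + dd c (\<lambda>y. F (\<theta> y)) y) \<bullet> dd v (\<lambda>y. F (\<theta> y)) y = 0"
      using fr unfolding lap_frame_def by blast
    then show ?thesis unfolding 2 1 u dd_add[OF dF] by (simp add: algebra_simps)
  qed
  then show ?thesis using fr unfolding lap_frame_def 1 by blast
qed

text \<open>Both sides are frame formulas, one for a frame and one for its push-forward, and they
  agree term by term.\<close>

lemma local_laplacian_compose:
  assumes V: "immersion_on V (\<lambda>y. F (\<theta> y))" and F: "immersion_on U F" and \<theta>: "Ck_on 2 V \<theta>"
    and VU: "\<And>y. y \<in> V \<Longrightarrow> \<theta> y \<in> U" and y: "y \<in> V" and w: "Ck_on 2 U w"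
  shows "local_laplacian (\<lambda>y. F (\<theta> y)) (\<lambda>y. w (\<theta> y)) y = local_laplacian F w (\<theta> y)"
proof -
  note oV = immersion_onD(1)[OF V] and oU = immersion_onD(1)[OF F] and C2 = immersion_onD(2)[OF F]
  obtain a b c where fr: "lap_frame (\<lambda>y. F (\<theta> y)) y a b c" using lap_frame_exists[OF V y] by blast
  have dw: "w differentiable (at (\<theta> y))" by (rule C2_diff[OF w VU[OF y]])
  have d\<theta>: "\<theta> differentiable (at y)" by (rule C2_diff[OF \<theta> y])
  have w2: "Ck_on 2 V (\<lambda>y. w (\<theta> y))" by (rule Ck_on_compose[OF oV VU w \<theta>])
  have 1: "dd v (\<lambda>y. w (\<theta> y)) y = dd (dd v \<theta> y) w (\<theta> y)" for v by (rule dd_compose[OF dw d\<theta>])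
  have 2: "dd v (dd v (\<lambda>y. w (\<theta> y))) y = dd (dd v \<theta> y) (dd (dd v \<theta> y) w) (\<theta> y) + dd (dd v (dd v \<theta>) y) w (\<theta> y)" for v
    by (rule dd2_compose[OF oV oU w \<theta> VU y])
  have "local_laplacian F w (\<theta> y) = dd (dd a \<theta> y) (dd (dd a \<theta> y) w) (\<theta> y) + dd (dd b \<theta> y) (dd (dd b \<theta> y) w) (\<theta> y)
      + dd (dd c \<theta> y + dd a (dd a \<theta>) y + dd b (dd b \<theta>) y) w (\<theta> y)"
    by (rule local_laplacian_frame[OF F VU[OF y] w lap_frame_compose[OF V F \<theta> VU y fr]])
  then show ?thesis
    unfolding local_laplacian_frame[OF V y w2 fr] 2 1 dd_add[OF dw] by simp
qed

lemma trace_shape_frame: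
  assumes F: "immersion_on U F" and x: "x \<in> U" and fr: "lap_frame F x a b c"
  shows "trace (matrix_inv (first_ff F x) ** second_ff F n x) = (dd a (dd a F) x + dd b (dd b F) x) \<bullet> n"
proof -
  note U = immersion_onD(1)[OF F] and C2 = immersion_onD(2)[OF F]
  have dF: "F differentiable (at x)" by (rule C2_diff[OF C2 x])
  have ne: "det (first_ff F x) \<noteq> 0" using det_first_ff_pos[OF F x] by simp
  have on: "norm (dd a F x) = 1" "norm (dd b F x) = 1" "dd a F x \<bullet> dd b F x = 0"
    using fr by (auto simp: lap_frame_def)
  have "trace (matrix_inv (first_ff F x) ** second_ff F n x)
     = (\<Sum>i\<in>UNIV. \<Sum>j\<in>UNIV. matrix_inv (first_ff F x) $ i $ j *\<^sub>R dd (axis i 1) (dd (axis j 1) F) x) \<bullet> n"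
    using dd_commute[OF U x C2, of "axis 1 1" "axis 2 1"]
    by (simp add: trace_def matrix_matrix_mult_def second_ff_def pderiv_at_eq sum_2 inner_add_left)
  then show ?thesis unfolding frame_trace[OF dF ne on dd2_bilinear[OF U x C2]] .
qed

section \<open>Charts of an immersed surface\<close>

lemma immersion_on_cong:
  assumes "immersion_on U F" "\<And>x. x \<in> U \<Longrightarrow> F x = G x"
  shows "immersion_on U G"
proof -
  note U = immersion_onD(1)[OF assms(1)]
  have "frechet_derivative F (at x) = frechet_derivative G (at x)" if "x \<in> U" for x
    by (rule ext) (rule dd_cong[OF U that assms(2)])
  moreover have "Ck_on 2 U G" by (rule Ck_on_cong[OF U assms(2) immersion_onD(2)[OF assms(1)]])
  ultimately show ?thesis using assms(1) by (auto simp: immersion_on_def)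
qed

locale immersed =
  fixes S :: "'a surface3"
  assumes immersed: "immersed_surface S"
begin

lemma smooth_surface: "smooth_surface S"
  using immersed by (simp add: immersed_surface_def)

lemma chartD:
  assumes "(U, \<phi>) \<in> params S"
  shows "open U" "openin (topo S) (\<phi> ` U)"
    "homeomorphic_map (top_of_set U) (subtopology (topo S) (\<phi> ` U)) \<phi>"
    "smooth_on U (pos S \<circ> \<phi>)" "\<And>x. x \<in> U \<Longrightarrow> inj (frechet_derivative (pos S \<circ> \<phi>) (at x))"
  using smooth_surface immersed assms unfolding smooth_surface_def immersed_surface_def by blast+

lemma chart_subset: "(U, \<phi>) \<in> params S \<Longrightarrow> \<phi> ` U \<subseteq> pts S"
  by (rule openin_subset[OF chartD(2)])

lemma chart_in_pts: "(U, \<phi>) \<in> params S \<Longrightarrow> x \<in> U \<Longrightarrow> \<phi> x \<in> pts S"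
  using chart_subset by blast

lemma chart_inj: "(U, \<phi>) \<in> params S \<Longrightarrow> inj_on \<phi> U"
  using chartD(3) by (fastforce simp: homeomorphic_map_def)

lemma chart_continuous:
  assumes "(U, \<phi>) \<in> params S" shows "continuous_map (top_of_set U) (topo S) \<phi>"
  using homeomorphic_imp_continuous_map[OF chartD(3)[OF assms]] continuous_map_in_subtopology by blast

lemma chart_cover: "p \<in> pts S \<Longrightarrow> \<exists>U \<phi>. (U, \<phi>) \<in> params S \<and> p \<in> \<phi> ` U"
  using smooth_surface unfolding smooth_surface_def by blast

lemma chart_open_preimage:
  assumes c: "(U, \<phi>) \<in> params S" and G: "openin (topo S) G"
  shows "open (U \<inter> \<phi> -` G)"
proof -
  have "openin (top_of_set U) {x \<in> topspace (top_of_set U). \<phi> x \<in> G}"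
    by (rule openin_continuous_map_preimage[OF chart_continuous[OF c] G])
  moreover have "{x \<in> topspace (top_of_set U). \<phi> x \<in> G} = U \<inter> \<phi> -` G" by auto
  ultimately show ?thesis using chartD(1)[OF c] by (metis openin_open_trans)
qed

lemma chart_open_image:
  assumes c: "(U, \<phi>) \<in> params S" and W: "open W" "W \<subseteq> U"
  shows "openin (topo S) (\<phi> ` W)"
proof -
  have "openin (top_of_set U) W" using W by (simp add: openin_open_eq chartD(1)[OF c])
  then have "openin (subtopology (topo S) (\<phi> ` U)) (\<phi> ` W)"
    using homeomorphic_imp_open_map[OF chartD(3)[OF c]] by (auto simp: open_map_def)
  then show ?thesis using chartD(2)[OF c] by (simp add: openin_open_subtopology)
qed

lemma chart_immersion:
  assumes "(U, \<phi>) \<in> params S" shows "immersion_on U (pos S \<circ> \<phi>)"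
  using chartD[OF assms] smooth_on_Ck unfolding immersion_on_def by blast

lemma transition:
  assumes c: "(U, \<phi>) \<in> params S" and d: "(V, \<psi>) \<in> params S"
  defines "\<theta> \<equiv> inv_into V \<psi> \<circ> \<phi>" and "W \<equiv> U \<inter> \<phi> -` (\<psi> ` V)"
  shows "open W" "smooth_on W \<theta>" "\<And>x. x \<in> W \<Longrightarrow> \<theta> x \<in> V" "\<And>x. x \<in> W \<Longrightarrow> \<psi> (\<theta> x) = \<phi> x"
proof -
  show "open W" unfolding W_def by (rule chart_open_preimage[OF c chartD(2)[OF d]])
  show "smooth_on W \<theta>" using smooth_surface c d unfolding smooth_surface_def W_def \<theta>_def by fast
  show "\<theta> x \<in> V" "\<psi> (\<theta> x) = \<phi> x" if "x \<in> W" for x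
    using that by (auto simp: W_def \<theta>_def inv_into_into f_inv_into_f)
qed

lemma param_at:
  assumes "p \<in> pts S"
  shows "param_at S p \<in> params S" "coord_at S p \<in> fst (param_at S p)" "snd (param_at S p) (coord_at S p) = p"
proof -
  have "\<exists>c. c \<in> params S \<and> p \<in> snd c ` fst c" using chart_cover[OF assms] by force
  then have 1: "param_at S p \<in> params S \<and> p \<in> snd (param_at S p) ` fst (param_at S p)"
    unfolding param_at_def by (rule someI_ex)
  then show "param_at S p \<in> params S" "coord_at S p \<in> fst (param_at S p)"
    "snd (param_at S p) (coord_at S p) = p"
    by (auto simp: coord_at_def inv_into_into f_inv_into_f)
qed

text \<open>Frees the Laplacian from the chart selected by \<open>param_at\<close>, by passing
  through the transition map and \<open>local_laplacian_compose\<close>.\<close>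

lemma laplacian_chart:
  assumes c: "(U, \<phi>) \<in> params S" and W: "open W" "W \<subseteq> U" "x \<in> W" and u: "Ck_on 2 W (u \<circ> \<phi>)"
  shows "laplacian S u (\<phi> x) = local_laplacian (pos S \<circ> \<phi>) (u \<circ> \<phi>) x"
proof -
  define p where "p = \<phi> x"
  have p: "p \<in> pts S" using chart_in_pts[OF c] W by (auto simp: p_def)
  obtain V \<psi> where d: "param_at S p = (V, \<psi>)" by fastforce
  have dp: "(V, \<psi>) \<in> params S" using param_at(1)[OF p] d by simp
  define y where "y = coord_at S p"
  have y: "y \<in> V" "\<psi> y = p" using param_at(2,3)[OF p] by (auto simp: d y_def)
  define \<theta> where "\<theta> = inv_into U \<phi> \<circ> \<psi>"
  define D where "D = V \<inter> \<psi> -` (\<phi> ` U)"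
  note tr = transition[OF dp c, folded \<theta>_def D_def]
  define D' where "D' = V \<inter> \<psi> -` (\<phi> ` W)"
  have D': "open D'" unfolding D'_def by (rule chart_open_preimage[OF dp chart_open_image[OF c W(1,2)]])
  have D'D: "D' \<subseteq> D" using W(2) by (auto simp: D'_def D_def)
  have \<theta>W: "\<theta> z \<in> W" if z: "z \<in> D'" for z
  proof -
    obtain w where w: "w \<in> W" "\<psi> z = \<phi> w" using z by (auto simp: D'_def)
    then have "\<theta> z = w" using inv_into_f_f[OF chart_inj[OF c]] W(2) by (auto simp: \<theta>_def)
    then show ?thesis using w by simp
  qed
  have yD': "y \<in> D'" using y W(3) by (auto simp: D'_def p_def)
  have \<theta>y: "\<theta> y = x" using y inv_into_f_f[OF chart_inj[OF c]] W by (auto simp: \<theta>_def p_def)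
  have eq: "\<phi> (\<theta> z) = \<psi> z" if "z \<in> D'" for z using tr(4) D'D that by blast
  have F: "immersion_on W (pos S \<circ> \<phi>)" by (rule immersion_on_subset[OF chart_immersion[OF c] W(1,2)])
  have "immersion_on D' (pos S \<circ> \<psi>)"
    using D' D'D by (intro immersion_on_subset[OF chart_immersion[OF dp]]) (auto simp: D_def)
  moreover have eqF: "(pos S \<circ> \<psi>) z = (pos S \<circ> \<phi>) (\<theta> z)" if "z \<in> D'" for z using eq[OF that] by simp
  ultimately have I: "immersion_on D' (\<lambda>z. (pos S \<circ> \<phi>) (\<theta> z))"
    by (rule immersion_on_cong)
  have \<theta>2: "Ck_on 2 D' \<theta>" by (rule Ck_on_subset[OF smooth_on_Ck[OF tr(2)] D'D])
  have "local_laplacian (\<lambda>z. (pos S \<circ> \<phi>) (\<theta> z)) (\<lambda>z. (u \<circ> \<phi>) (\<theta> z)) y = local_laplacian (pos S \<circ> \<phi>) (u \<circ> \<phi>) x"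
    using local_laplacian_compose[OF I F \<theta>2 \<theta>W yD' u] \<theta>y by simp
  \<comment> \<open>Composition with \<theta> agrees with the chart \<psi> only on
    \<open>D'\<close>. The conditions of a frame involve derivatives at \<open>y\<close> alone, so
    the same frame serves both Laplacians.\<close>
  moreover have "local_laplacian (\<lambda>z. (pos S \<circ> \<phi>) (\<theta> z)) (\<lambda>z. (u \<circ> \<phi>) (\<theta> z)) y = local_laplacian (pos S \<circ> \<psi>) (u \<circ> \<psi>) y"
  proof -
    obtain a b k where fr: "lap_frame (pos S \<circ> \<psi>) y a b k"
      using lap_frame_exists[OF chart_immersion[OF dp] y(1)] by blast
    have dF: "dd v (\<lambda>z. (pos S \<circ> \<phi>) (\<theta> z)) z = dd v (pos S \<circ> \<psi>) z" if "z \<in> D'" for v z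
      by (rule dd_cong[OF D' that eqF[symmetric]])
    have ddF: "dd v (dd w (\<lambda>z. (pos S \<circ> \<phi>) (\<theta> z))) y = dd v (dd w (pos S \<circ> \<psi>)) y" for v w
      by (rule dd_cong[OF D' yD' dF])
    have fr': "lap_frame (\<lambda>z. (pos S \<circ> \<phi>) (\<theta> z)) y a b k"
      using fr unfolding lap_frame_def ddF dF[OF yD'] .
    have equ: "(u \<circ> \<phi>) (\<theta> z) = (u \<circ> \<psi>) z" if "z \<in> D'" for z using eq[OF that] by simp
    have du: "dd v (\<lambda>z. (u \<circ> \<phi>) (\<theta> z)) z = dd v (u \<circ> \<psi>) z" if "z \<in> D'" for v z
      by (rule dd_cong[OF D' that equ])
    have ddu: "dd v (dd w (\<lambda>z. (u \<circ> \<phi>) (\<theta> z))) y = dd v (dd w (u \<circ> \<psi>)) y" for v w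
      by (rule dd_cong[OF D' yD' du])
    have u1: "Ck_on 2 D' (\<lambda>z. (u \<circ> \<phi>) (\<theta> z))" by (rule Ck_on_compose[OF D' \<theta>W u \<theta>2])
    have u2: "Ck_on 2 D' (u \<circ> \<psi>)" by (rule Ck_on_cong[OF D' equ u1])
    have I2: "immersion_on D' (pos S \<circ> \<psi>)"
      using D' D'D by (intro immersion_on_subset[OF chart_immersion[OF dp]]) (auto simp: D_def)
    show ?thesis
      unfolding local_laplacian_frame[OF I yD' u1 fr'] local_laplacian_frame[OF I2 yD' u2 fr] ddu du[OF yD'] ..
  qed
  ultimately show ?thesis unfolding laplacian_def local_pos_def p_def[symmetric] d by (simp add: y_def)
qed

lemma tangent_plane_chart:
  assumes c: "(U, \<phi>) \<in> params S" and x: "x \<in> U"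
  shows "tangent_plane S (\<phi> x) = range (\<lambda>v. dd v (pos S \<circ> \<phi>) x)"
proof -
  \<comment> \<open>Stated for two arbitrary charts, so that exchanging them gives the opposite
    inclusion.\<close>
  have sub: "range (\<lambda>v. dd v (pos S \<circ> \<psi>) y) \<subseteq> range (\<lambda>v. dd v (pos S \<circ> \<phi>) x)"
    if c: "(U, \<phi>) \<in> params S" and x: "x \<in> U" and d: "(V, \<psi>) \<in> params S" and y: "y \<in> V" and eq: "\<psi> y = \<phi> x"
    for U V \<phi> \<psi> x y
  proof -
    define \<theta> where "\<theta> = inv_into U \<phi> \<circ> \<psi>"
    define D where "D = V \<inter> \<psi> -` (\<phi> ` U)"
    note tr = transition[OF d c, folded \<theta>_def D_def]
    have yD: "y \<in> D" using y x eq by (auto simp: D_def)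
    have \<theta>y: "\<theta> y = x" using eq x inv_into_f_f[OF chart_inj[OF c]] by (auto simp: \<theta>_def)
    have "dd v (pos S \<circ> \<psi>) y = dd (dd v \<theta> y) (pos S \<circ> \<phi>) x" for v
    proof -
      have "dd v (pos S \<circ> \<psi>) y = dd v (\<lambda>z. (pos S \<circ> \<phi>) (\<theta> z)) y"
        by (rule dd_cong[OF tr(1) yD]) (simp add: tr(4))
      also have "\<dots> = dd (dd v \<theta> y) (pos S \<circ> \<phi>) (\<theta> y)"
        by (rule dd_compose[OF C2_diff[OF immersion_onD(2)[OF chart_immersion[OF c]] tr(3)[OF yD]]
              C2_diff[OF smooth_on_Ck[OF tr(2)] yD]])
      finally show ?thesis by (simp only: \<theta>y)
    qed
    then show ?thesis by auto
  qed
  have p: "\<phi> x \<in> pts S" by (rule chart_in_pts[OF c x])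
  obtain V \<psi> where d: "param_at S (\<phi> x) = (V, \<psi>)" by fastforce
  have dp: "(V, \<psi>) \<in> params S" "coord_at S (\<phi> x) \<in> V" "\<psi> (coord_at S (\<phi> x)) = \<phi> x"
    using param_at[OF p] d by auto
  show ?thesis
    using sub[OF c x dp] sub[OF dp(1,2) c x dp(3)[symmetric]]
    unfolding tangent_plane_def local_pos_def d by (auto simp: comp_def)
qed

end

text \<open>With \<open>g\<close> the normalized cross product, orthogonality to \<open>a\<close>
  and \<open>b\<close> makes the cross product of \<open>g\<close> and \<open>v\<close> vanish; the
  double product formula then leaves only the component of \<open>v\<close> along
  \<open>g\<close>.\<close>

lemma cross3_normal:
  fixes a b v :: "real^3"
  assumes "v \<bullet> a = 0" "v \<bullet> b = 0" "cross3 a b \<noteq> 0"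
  shows "v = (v \<bullet> sgn (cross3 a b)) *\<^sub>R sgn (cross3 a b)"
proof -
  define g where "g = sgn (cross3 a b)"
  have "cross3 (cross3 a b) v = 0"
    using assms(1,2) by (simp add: cross3_simps forall_3 inner_vec_def sum_3 vec_eq_iff algebra_simps) algebra
  then have "cross3 g v = 0" by (simp add: g_def sgn_div_norm cross_mult_left)
  then have "cross3 g (cross3 g v) = 0" by simp
  moreover have "cross3 g (cross3 g v) = (g \<bullet> v) *\<^sub>R g - (g \<bullet> g) *\<^sub>R v"
    by (simp add: cross3_simps forall_3 inner_vec_def sum_3 vec_eq_iff algebra_simps)
  moreover have "g \<bullet> g = 1" using assms(3) by (simp add: g_def norm_eq_1[symmetric] norm_sgn)
  ultimately show ?thesis by (simp add: g_def inner_commute)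
qed

lemma cross3_immersion:
  assumes "immersion_on U F" "x \<in> U"
  shows "cross3 (dd (axis 1 1) F x) (dd (axis 2 1) F x) \<noteq> 0"
proof
  assume 0: "cross3 (dd (axis 1 1) F x) (dd (axis 2 1) F x) = 0"
  have "0 < det (first_ff F x)" by (rule det_first_ff_pos[OF assms])
  also have "det (first_ff F x) = norm (cross3 (dd (axis 1 1) F x) (dd (axis 2 1) F x)) ^ 2"
    using norm_cross_dot[of "dd (axis 1 1) F x" "dd (axis 2 1) F x"]
    by (simp add: det_2 first_ff_nth dot_square_norm inner_commute[of "dd (axis 2 1) F x"] power2_eq_square algebra_simps)
  finally show False by (simp add: 0)
qed

context immersed begin

text \<open>The mean curvature vector is defined in the chart of \<open>param_at\<close>, through
  the Gauss normal there. The Laplacian of each function \<open>pos S q \<bullet> n\<close> is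
  independent of the chart, so the frame sum may be evaluated in that chart, where it is normal and
  its component is the trace of the shape matrix.\<close>

lemma lap_frame_mcv:
  assumes c: "(U, \<phi>) \<in> params S" and x: "x \<in> U" and fr: "lap_frame (pos S \<circ> \<phi>) x a b k"
  shows "dd a (dd a (pos S \<circ> \<phi>)) x + dd b (dd b (pos S \<circ> \<phi>)) x + dd k (pos S \<circ> \<phi>) x = mean_curvature_vector S (\<phi> x)"
proof -
  have p: "\<phi> x \<in> pts S" by (rule chart_in_pts[OF c x])
  have lap: "laplacian S (\<lambda>q. pos S q \<bullet> n) (\<phi> x)
      = (dd a (dd a (pos S \<circ> \<phi>)) x + dd b (dd b (pos S \<circ> \<phi>)) x + dd k (pos S \<circ> \<phi>) x) \<bullet> n"
    if c: "(U, \<phi>) \<in> params S" and x: "x \<in> U" and fr: "lap_frame (pos S \<circ> \<phi>) x a b k" for U \<phi> x a b k n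
  proof -
    note I = chart_immersion[OF c]
    have C: "Ck_on 2 U (\<lambda>y. (pos S \<circ> \<phi>) y \<bullet> n)"
      by (intro Ck_on_inner Ck_on_const immersion_onD[OF I])
    then have C': "Ck_on 2 U ((\<lambda>q. pos S q \<bullet> n) \<circ> \<phi>)" by (simp add: comp_def)
    have "laplacian S (\<lambda>q. pos S q \<bullet> n) (\<phi> x) = local_laplacian (pos S \<circ> \<phi>) ((\<lambda>q. pos S q \<bullet> n) \<circ> \<phi>) x"
      by (rule laplacian_chart[OF c chartD(1)[OF c] order_refl x C'])
    also have "((\<lambda>q. pos S q \<bullet> n) \<circ> \<phi>) = (\<lambda>y. (pos S \<circ> \<phi>) y \<bullet> n)" by auto
    also have "local_laplacian (pos S \<circ> \<phi>) (\<lambda>y. (pos S \<circ> \<phi>) y \<bullet> n) x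
      = (dd a (dd a (pos S \<circ> \<phi>)) x + dd b (dd b (pos S \<circ> \<phi>)) x + dd k (pos S \<circ> \<phi>) x) \<bullet> n"
      unfolding local_laplacian_frame[OF I x C fr] dd_inner_const[OF immersion_onD(1,2)[OF I] x]
        dd_inner[OF C2_diff[OF immersion_onD(2)[OF I] x]] inner_add_left ..
    finally show ?thesis .
  qed
  obtain V \<psi> where d: "param_at S (\<phi> x) = (V, \<psi>)" by fastforce
  define y where "y = coord_at S (\<phi> x)"
  have dp: "(V, \<psi>) \<in> params S" "y \<in> V" "\<psi> y = \<phi> x"
    using param_at[OF p] d by (auto simp: y_def)
  note I = chart_immersion[OF dp(1)]
  obtain a' b' k' where fr': "lap_frame (pos S \<circ> \<psi>) y a' b' k'"
    using lap_frame_exists[OF I dp(2)] by blast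
  define H where "H = dd a' (dd a' (pos S \<circ> \<psi>)) y + dd b' (dd b' (pos S \<circ> \<psi>)) y + dd k' (pos S \<circ> \<psi>) y"
  have Hn: "H \<bullet> dd v (pos S \<circ> \<psi>) y = 0" for v using fr' by (simp add: lap_frame_def H_def)
  define g where "g = gauss_normal S (\<phi> x)"
  have g: "g = sgn (cross3 (dd (axis 1 1) (pos S \<circ> \<psi>) y) (dd (axis 2 1) (pos S \<circ> \<psi>) y))"
    by (simp add: g_def gauss_normal_def local_pos_def d y_def pderiv_at_eq)
  have gn: "g \<bullet> dd v (pos S \<circ> \<psi>) y = 0" for v
    unfolding dd_axis_expand[OF C2_diff[OF immersion_onD(2)[OF I] dp(2)], of v]
    by (simp add: g sgn_div_norm inner_add_right dot_cross_self)
  have "H = (H \<bullet> g) *\<^sub>R g"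
    unfolding g by (rule cross3_normal[OF Hn Hn cross3_immersion[OF I dp(2)]])
  moreover have "H \<bullet> g = mean_curvature S g (\<phi> x)"
  proof -
    have "mean_curvature S g (\<phi> x) = (dd a' (dd a' (pos S \<circ> \<psi>)) y + dd b' (dd b' (pos S \<circ> \<psi>)) y) \<bullet> g"
      unfolding mean_curvature_def shape_matrix_def local_pos_def d snd_conv y_def[symmetric]
      by (rule trace_shape_frame[OF I dp(2) fr'])
    then show ?thesis using gn[of k'] by (simp add: H_def inner_add_left inner_add_right inner_commute)
  qed
  ultimately have H: "mean_curvature_vector S (\<phi> x) = H" unfolding mean_curvature_vector_def g_def[symmetric] by simp
  have "(dd a (dd a (pos S \<circ> \<phi>)) x + dd b (dd b (pos S \<circ> \<phi>)) x + dd k (pos S \<circ> \<phi>) x) \<bullet> n = H \<bullet> n" for n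
    using lap[OF c x fr, of n] lap[OF dp(1,2) fr', of n] unfolding dp(3) H_def by simp
  then show ?thesis unfolding H by (metis vector_eq_ldot inner_commute)
qed

end

section \<open>The area measure\<close>

text \<open>Bridge from Lebesgue integrals of nonnegative functions to \<open>has_integral\<close>,
  the form of the change of variables theorem \<open>cov_invertible_nonneg_eq\<close>.\<close>

lemma has_integral_set_nn_integral:
  fixes k :: "'a::euclidean_space \<Rightarrow> real"
  assumes k0: "\<And>x. x \<in> R \<Longrightarrow> 0 \<le> k x" and m: "(\<lambda>x. indicator R x *\<^sub>R k x) \<in> borel_measurable borel"
    and fin: "(\<integral>\<^sup>+x\<in>R. ennreal (k x) \<partial>lborel) = ennreal r" "0 \<le> r"
  shows "(k has_integral r) R"
proof -
  have "(\<integral>\<^sup>+x. ennreal (indicator R x * k x) \<partial>lborel) = (\<integral>\<^sup>+x\<in>R. ennreal (k x) \<partial>lborel)"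
    by (intro nn_integral_cong) (auto simp: indicator_def)
  then have "(\<integral>\<^sup>+x. ennreal (indicator R x * k x) \<partial>lborel) = ennreal r" using fin by simp
  moreover have "0 \<le> indicator R x * k x" for x using k0[of x] by (auto simp: indicator_def)
  moreover have "(\<lambda>x. indicator R x * k x) \<in> borel_measurable borel" using m by simp
  ultimately have "((\<lambda>x. indicator R x * k x) has_integral r) UNIV"
    using fin(2) by (intro nn_integral_has_integral)
  moreover have "(\<lambda>x. indicator R x * k x) = (\<lambda>x. if x \<in> R then k x else 0)"
    by (auto simp: indicator_def)
  ultimately show ?thesis using has_integral_restrict_UNIV[of R k r] by simp
qed

text \<open>If one of the two integrals is finite, the theorem for \<open>has_integral\<close> gives
  the other the same value; otherwise both are infinite.\<close>

lemma nn_integral_change_of_variables: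
  fixes f :: "real^'n::{finite,wellorder} \<Rightarrow> real" and g :: "real^'n::_ \<Rightarrow> real^'n::_"
  assumes "\<And>x. x \<in> S \<Longrightarrow> (g has_derivative g' x) (at x within S)"
      and "\<And>y. y \<in> T \<Longrightarrow> (h has_derivative h' y) (at y within T)"
      and f0: "\<And>y. y \<in> T \<Longrightarrow> 0 \<le> f y"
      and gT: "\<And>x. x \<in> S \<Longrightarrow> g x \<in> T \<and> h(g x) = x"
      and "\<And>y. y \<in> T \<Longrightarrow> h y \<in> S \<and> g(h y) = y"
      and "\<And>y. y \<in> T \<Longrightarrow> h' y \<circ> g'(h y) = id"
      and mT: "(\<lambda>y. indicator T y *\<^sub>R f y) \<in> borel_measurable borel"
      and mS: "(\<lambda>x. indicator S x *\<^sub>R (\<bar>det (matrix (g' x))\<bar> * f(g x))) \<in> borel_measurable borel"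
  shows "(\<integral>\<^sup>+x\<in>S. ennreal (\<bar>det (matrix (g' x))\<bar> * f(g x)) \<partial>lborel) = (\<integral>\<^sup>+y\<in>T. ennreal (f y) \<partial>lborel)"
proof -
  define F where "F = (\<lambda>x. \<bar>det (matrix (g' x))\<bar> * f(g x))"
  have iff: "(F has_integral b) S \<longleftrightarrow> (f has_integral b) T" for b
    unfolding F_def by (rule cov_invertible_nonneg_eq[of S g g' T h h']) (use assms in auto)
  have F0: "0 \<le> F x" if "x \<in> S" for x using f0 gT[OF that] by (simp add: F_def)
  have mF: "(\<lambda>x. indicator S x *\<^sub>R F x) \<in> borel_measurable borel" using mS by (simp add: F_def)
  note key = has_integral_set_nn_integral
  have "(\<integral>\<^sup>+x\<in>S. ennreal (F x) \<partial>lborel) = (\<integral>\<^sup>+y\<in>T. ennreal (f y) \<partial>lborel)"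
  proof (cases "(\<integral>\<^sup>+x\<in>S. ennreal (F x) \<partial>lborel)")
    case (real r)
    have "(F has_integral r) S" by (rule key[OF F0 mF real(2,1)])
    then have "(f has_integral r) T" using iff by simp
    then show ?thesis using nn_integral_has_integral_lebesgue'[of T f r] f0 real by simp
  next
    case top
    show ?thesis
    proof (cases "(\<integral>\<^sup>+y\<in>T. ennreal (f y) \<partial>lborel)")
      case (real r)
      have "(f has_integral r) T" by (rule key[OF f0 mT real(2,1)])
      then have "(F has_integral r) S" using iff by simp
      then show ?thesis using nn_integral_has_integral_lebesgue'[of S F r] F0 real by simp
    qed (use top in simp)
  qed
  then show ?thesis by (simp add: F_def)
qed

text \<open>The Gram matrix changes by congruence with the Jacobian. The root of its determinant
  therefore scales by the absolute Jacobian determinant, as a density must.\<close>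

lemma first_ff_compose:
  assumes F: "F differentiable (at (\<theta> x))" and \<theta>: "\<theta> differentiable (at x)"
  shows "det (first_ff (\<lambda>y. F (\<theta> y)) x) = (det (matrix (\<lambda>v. dd v \<theta> x)))\<^sup>2 * det (first_ff F (\<theta> x))"
proof -
  define J where "J = matrix (\<lambda>v. dd v \<theta> x)"
  have "first_ff (\<lambda>y. F (\<theta> y)) x = transpose J ** first_ff F (\<theta> x) ** J"
    by (simp add: vec_eq_iff first_ff_nth dd_compose[OF F \<theta>] first_ff_quadratic[OF F])
      (simp add: inner_2 matrix_matrix_mult_def sum_2 transpose_def J_def matrix_def matrix_vector_mult_def
        first_ff_nth algebra_simps)
  then show ?thesis by (simp add: det_mul J_def[symmetric] power2_eq_square)
qed

section \<open>Existence and uniqueness of the area, integration in charts\<close>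

context immersed begin

text \<open>The Borel structure of the surface as an object of its own, so that measurability can be
  discussed before \<open>area_measure\<close> is known to exist.\<close>

definition borelS :: "'a measure" where
  "borelS = sigma (pts S) {G. openin (topo S) G}"

abbreviation vol :: "(real^2 \<Rightarrow> 'a) \<Rightarrow> real^2 \<Rightarrow> real" where
  "vol \<phi> x \<equiv> sqrt (det (first_ff (pos S \<circ> \<phi>) x))"

lemma opens_Pow: "{G. openin (topo S) G} \<subseteq> Pow (pts S)"
  using openin_subset by auto

lemma space_borelS [simp]: "space borelS = pts S"
  by (simp add: borelS_def space_measure_of[OF opens_Pow])

lemma sets_borelS: "sets borelS = sigma_sets (pts S) {G. openin (topo S) G}"
  by (simp add: borelS_def sets_measure_of[OF opens_Pow])

lemma open_borelS: "openin (topo S) G \<Longrightarrow> G \<in> sets borelS"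
  by (auto simp: sets_borelS)

lemma vol_continuous: "(U, \<phi>) \<in> params S \<Longrightarrow> continuous_on U (vol \<phi>)"
  by (rule Ck_on_cont[OF Ck_on_det_first_ff(3)[OF chart_immersion]])

lemma vol_pos: "(U, \<phi>) \<in> params S \<Longrightarrow> x \<in> U \<Longrightarrow> 0 < vol \<phi> x"
  using det_first_ff_pos[OF chart_immersion] by simp

lemma chart_measurable:
  assumes c: "(U, \<phi>) \<in> params S"
  shows "\<phi> \<in> measurable (restrict_space borel U) borelS"
  unfolding borelS_def
proof (rule measurable_measure_of[OF opens_Pow])
  show "\<phi> \<in> space (restrict_space borel U) \<rightarrow> pts S" using chart_in_pts[OF c] by (auto simp: space_restrict_space)
  fix G assume "G \<in> {G. openin (topo S) G}"
  then have "open (U \<inter> \<phi> -` G)" using chart_open_preimage[OF c] by simp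
  then show "\<phi> -` G \<inter> space (restrict_space borel U) \<in> sets (restrict_space borel U)"
    using chartD(1)[OF c] by (auto simp: space_restrict_space sets_restrict_space_iff Int_commute)
qed

lemma chart_vimage_borel:
  assumes c: "(U, \<phi>) \<in> params S" and B: "B \<in> sets borelS"
  shows "U \<inter> \<phi> -` B \<in> sets borel"
  using measurable_sets[OF chart_measurable[OF c] B] chartD(1)[OF c]
  by (auto simp: space_restrict_space sets_restrict_space_iff Int_commute)

lemma vol_indicator_measurable:
  assumes c: "(U, \<phi>) \<in> params S" and A: "A \<in> sets borel" "A \<subseteq> U"
  shows "(\<lambda>x. indicator A x *\<^sub>R vol \<phi> x) \<in> borel_measurable borel"
  by (rule borel_measurable_continuous_on_indicator[OF A(1) continuous_on_subset[OF vol_continuous[OF c] A(2)]])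

text \<open>Change of variables along the transition map, whose absolute Jacobian is the quotient of
  the two area densities. It makes the local prescriptions for the area consistent.\<close>

lemma vol_transition:
  assumes c: "(U, \<phi>) \<in> params S" and d: "(V, \<psi>) \<in> params S"
    and B: "B \<in> sets borelS" "B \<subseteq> \<phi> ` U" "B \<subseteq> \<psi> ` V"
  shows "(\<integral>\<^sup>+x\<in>U \<inter> \<phi> -` B. ennreal (vol \<phi> x) \<partial>lborel) = (\<integral>\<^sup>+x\<in>V \<inter> \<psi> -` B. ennreal (vol \<psi> x) \<partial>lborel)"
proof -
  define g where "g = inv_into V \<psi> \<circ> \<phi>"
  define h where "h = inv_into U \<phi> \<circ> \<psi>"
  define A where "A = U \<inter> \<phi> -` B"
  define T where "T = V \<inter> \<psi> -` B"
  note tr = transition[OF c d, folded g_def] and tr' = transition[OF d c, folded h_def]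
  have AW: "A \<subseteq> U \<inter> \<phi> -` (\<psi> ` V)" and TW: "T \<subseteq> V \<inter> \<psi> -` (\<phi> ` U)" using B by (auto simp: A_def T_def)
  have gA: "g x \<in> T \<and> h (g x) = x" if x: "x \<in> A" for x
  proof -
    have 1: "g x \<in> V" "\<psi> (g x) = \<phi> x" using tr(3,4) AW x by blast+
    then have "h (g x) = x" using inv_into_f_f[OF chart_inj[OF c]] x by (auto simp: h_def A_def)
    then show ?thesis using 1 x by (auto simp: T_def A_def)
  qed
  have hT: "h y \<in> A \<and> g (h y) = y" if y: "y \<in> T" for y
  proof -
    have 1: "h y \<in> U" "\<phi> (h y) = \<psi> y" using tr'(3,4) TW y by blast+
    then have "g (h y) = y" using inv_into_f_f[OF chart_inj[OF d]] y by (auto simp: g_def T_def)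
    then show ?thesis using 1 y by (auto simp: T_def A_def)
  qed
  have dg: "(g has_derivative (\<lambda>v. dd v g x)) (at x)" if "x \<in> A" for x
    by (rule Ck_on_has_derivative[OF smooth_on_Ck[OF tr(2), of 1]]) (use AW that in auto)
  have dh: "(h has_derivative (\<lambda>v. dd v h y)) (at y)" if "y \<in> T" for y
    by (rule Ck_on_has_derivative[OF smooth_on_Ck[OF tr'(2), of 1]]) (use TW that in auto)
  have id: "(\<lambda>v. dd v h y) \<circ> (\<lambda>v. dd v g (h y)) = id" if y: "y \<in> T" for y
  proof -
    have hy: "h y \<in> A" "g (h y) = y" using hT[OF y] by auto
    have "((\<lambda>x. h (g x)) has_derivative (\<lambda>v. dd (dd v g (h y)) h y)) (at (h y))"
      using has_derivative_compose[OF dg[OF hy(1)], of h] dh[OF y] hy by simp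
    moreover have "((\<lambda>x. h (g x)) has_derivative (\<lambda>v. v)) (at (h y))"
    proof (rule has_derivative_transform_within_open[OF has_derivative_ident tr(1)])
      show "h y \<in> U \<inter> \<phi> -` (\<psi> ` V)" using AW hy by auto
      show "x = h (g x)" if x: "x \<in> U \<inter> \<phi> -` (\<psi> ` V)" for x
      proof -
        have "\<psi> (g x) = \<phi> x" using tr(4) x by blast
        then show ?thesis using inv_into_f_f[OF chart_inj[OF c]] x by (auto simp: h_def)
      qed
    qed
    ultimately have "(\<lambda>v. dd (dd v g (h y)) h y) = (\<lambda>v. v)" by (rule has_derivative_unique)
    then show ?thesis by (simp add: comp_def id_def)
  qed
  have eq: "vol \<phi> x = \<bar>det (matrix (\<lambda>v. dd v g x))\<bar> * vol \<psi> (g x)" if x: "x \<in> A" for x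
  proof -
    have gx: "g x \<in> V" using gA[OF x] by (auto simp: T_def)
    have "first_ff (pos S \<circ> \<phi>) x = first_ff (\<lambda>z. (pos S \<circ> \<psi>) (g z)) x"
    proof -
      have "dd v (pos S \<circ> \<phi>) x = dd v (\<lambda>z. (pos S \<circ> \<psi>) (g z)) x" for v
        by (rule dd_cong[OF tr(1)]) (use AW x tr(4) in auto)
      then show ?thesis by (simp add: first_ff_def pderiv_at_def)
    qed
    also have "det \<dots> = (det (matrix (\<lambda>v. dd v g x)))\<^sup>2 * det (first_ff (pos S \<circ> \<psi>) (g x))"
    proof (rule first_ff_compose)
      show "pos S \<circ> \<psi> differentiable (at (g x))" by (rule C2_diff[OF immersion_onD(2)[OF chart_immersion[OF d]] gx])
      show "g differentiable (at x)" using dg[OF x] unfolding differentiable_def by blast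
    qed
    finally show ?thesis by (simp only: real_sqrt_mult real_sqrt_abs)
  qed
  have Ab: "A \<in> sets borel" "A \<subseteq> U" using chart_vimage_borel[OF c B(1)] by (auto simp: A_def)
  have Tb: "T \<in> sets borel" "T \<subseteq> V" using chart_vimage_borel[OF d B(1)] by (auto simp: T_def)
  have mS: "(\<lambda>x. indicator A x *\<^sub>R (\<bar>det (matrix (\<lambda>v. dd v g x))\<bar> * vol \<psi> (g x))) \<in> borel_measurable borel"
  proof -
    have "(\<lambda>x. indicator A x *\<^sub>R (\<bar>det (matrix (\<lambda>v. dd v g x))\<bar> * vol \<psi> (g x))) = (\<lambda>x. indicator A x *\<^sub>R vol \<phi> x)"
      by (rule ext) (auto simp: indicator_def eq)
    then show ?thesis using vol_indicator_measurable[OF c Ab] by simp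
  qed
  have "(\<integral>\<^sup>+x\<in>A. ennreal (\<bar>det (matrix (\<lambda>v. dd v g x))\<bar> * vol \<psi> (g x)) \<partial>lborel) = (\<integral>\<^sup>+y\<in>T. ennreal (vol \<psi> y) \<partial>lborel)"
  proof (rule nn_integral_change_of_variables[OF _ _ _ gA hT id vol_indicator_measurable[OF d Tb] mS])
    show "(g has_derivative (\<lambda>v. dd v g x)) (at x within A)" if "x \<in> A" for x
      by (rule has_derivative_at_withinI[OF dg[OF that]])
    show "(h has_derivative (\<lambda>v. dd v h y)) (at y within T)" if "y \<in> T" for y
      by (rule has_derivative_at_withinI[OF dh[OF that]])
    show "0 \<le> vol \<psi> y" if "y \<in> T" for y using vol_pos[OF d, of y] Tb that by auto
  qed
  moreover have "(\<integral>\<^sup>+x\<in>A. ennreal (\<bar>det (matrix (\<lambda>v. dd v g x))\<bar> * vol \<psi> (g x)) \<partial>lborel) = (\<integral>\<^sup>+x\<in>A. ennreal (vol \<phi> x) \<partial>lborel)"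
    by (intro nn_integral_cong) (auto simp: indicator_def eq)
  ultimately show ?thesis by (simp add: A_def T_def)
qed

text \<open>Second countability gives the Lindelof property, hence countably many charts that cover.
  The enumeration by \<open>from_nat_into\<close> may repeat charts, which is harmless.\<close>

lemma countable_atlas:
  obtains U \<phi> where "\<And>n::nat. (U n, \<phi> n) \<in> params S" "(\<Union>n. \<phi> n ` U n) = pts S"
proof -
  have "Lindelof_space (topo S)"
    using smooth_surface second_countable_imp_Lindelof_space by (auto simp: smooth_surface_def)
  moreover have "\<forall>G\<in>(\<lambda>(U, \<phi>). \<phi> ` U) ` params S. openin (topo S) G" using chartD(2) by auto
  moreover have cov: "\<Union>((\<lambda>(U, \<phi>). \<phi> ` U) ` params S) = pts S"
    using smooth_surface by (auto simp: smooth_surface_def)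
  ultimately obtain \<V> where V: "countable \<V>" "\<V> \<subseteq> (\<lambda>(U, \<phi>). \<phi> ` U) ` params S" "\<Union>\<V> = pts S"
    unfolding Lindelof_space_def by meson
  have "pts S \<noteq> {}" using smooth_surface unfolding smooth_surface_def by blast
  then have ne: "\<V> \<noteq> {}" using V(3) by blast
  have "\<exists>c. c \<in> params S \<and> from_nat_into \<V> n = snd c ` fst c" for n
  proof -
    have "from_nat_into \<V> n \<in> (\<lambda>(U, \<phi>). \<phi> ` U) ` params S" using from_nat_into[OF ne] V(2) by blast
    then show ?thesis by force
  qed
  then obtain C where C: "\<And>n. C n \<in> params S" "\<And>n. from_nat_into \<V> n = snd (C n) ` fst (C n)" by metis
  show thesis
  proof (rule that[of "\<lambda>n. fst (C n)" "\<lambda>n. snd (C n)"])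
    show "(fst (C n), snd (C n)) \<in> params S" for n using C(1) by simp
    have "(\<Union>n. snd (C n) ` fst (C n)) = \<Union>(range (from_nat_into \<V>))" using C(2) by simp
    then show "(\<Union>n. snd (C n) ` fst (C n)) = pts S" using range_from_nat_into[OF ne V(1)] V(3) by simp
  qed
qed

text \<open>The predicate inside the definite description of \<open>area_measure\<close>, named so
  that existence and uniqueness can be stated.\<close>

definition is_area :: "'a measure \<Rightarrow> bool" where
  "is_area \<mu> \<longleftrightarrow> space \<mu> = pts S \<and> sets \<mu> = sigma_sets (pts S) {G. openin (topo S) G} \<and>
     (\<forall>(U,\<phi>)\<in>params S. \<forall>B\<in>sets \<mu>. B \<subseteq> \<phi> ` U \<longrightarrow>
        emeasure \<mu> B = (\<integral>\<^sup>+x\<in>U \<inter> \<phi> -` B. ennreal (vol \<phi> x) \<partial>lborel))"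

text \<open>A countable atlas cuts the surface into disjoint Borel pieces, each inside one chart,
  and on subsets of charts the value is prescribed.\<close>

lemma is_area_unique:
  assumes "is_area \<mu>" "is_area \<nu>"
  shows "\<mu> = \<nu>"
proof (rule measure_eqI)
  show sets: "sets \<mu> = sets \<nu>" using assms by (simp add: is_area_def)
  obtain U \<phi> where at: "\<And>n::nat. (U n, \<phi> n) \<in> params S" "(\<Union>n. \<phi> n ` U n) = pts S" by (rule countable_atlas) blast
  define A where "A = disjointed (\<lambda>n. \<phi> n ` U n)"
  fix B assume B: "B \<in> sets \<mu>"
  have m\<mu>: "sets \<mu> = sets borelS" "sets \<nu> = sets borelS" using assms by (auto simp: is_area_def sets_borelS)
  have "range (\<lambda>n. \<phi> n ` U n) \<subseteq> sets borelS" using open_borelS[OF chartD(2)[OF at(1)]] by auto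
  from sets.range_disjointed_sets[OF this] have A: "A n \<in> sets borelS" "A n \<subseteq> \<phi> n ` U n" for n
    using disjointed_subset[of "\<lambda>n. \<phi> n ` U n" n] by (auto simp: A_def)
  have BA: "B = (\<Union>n. B \<inter> A n)"
  proof -
    have "B \<subseteq> pts S" using sets.sets_into_space[OF B] assms by (simp add: is_area_def)
    then show ?thesis using UN_disjointed_eq[of "\<lambda>n. \<phi> n ` U n"] at(2) by (auto simp: A_def)
  qed
  have disj: "disjoint_family (\<lambda>n. B \<inter> A n)"
    using disjoint_family_disjointed[of "\<lambda>n. \<phi> n ` U n"] unfolding A_def disjoint_family_on_def by blast
  have "emeasure \<mu> (B \<inter> A n) = emeasure \<nu> (B \<inter> A n)" for n
  proof -
    have "B \<inter> A n \<in> sets \<mu>" "B \<inter> A n \<in> sets \<nu>" using B A sets m\<mu> by auto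
    moreover have "B \<inter> A n \<subseteq> \<phi> n ` U n" using A by auto
    ultimately show ?thesis using assms at(1)[of n] unfolding is_area_def by fastforce
  qed
  moreover have "emeasure \<rho> B = (\<Sum>n. emeasure \<rho> (B \<inter> A n))" if "sets \<rho> = sets borelS" for \<rho>
  proof -
    have r: "range (\<lambda>n. B \<inter> A n) \<subseteq> sets \<rho>" using B A m\<mu> that by auto
    have "emeasure \<rho> B = emeasure \<rho> (\<Union>n. B \<inter> A n)" by (rule arg_cong[OF BA])
    also have "\<dots> = (\<Sum>n. emeasure \<rho> (B \<inter> A n))" by (rule suminf_emeasure[OF r disj, symmetric])
    finally show ?thesis .
  qed
  ultimately show "emeasure \<mu> B = emeasure \<nu> B" using m\<mu> by simp
qed

lemma is_area_exists: "\<exists>\<mu>. is_area \<mu>"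
proof -
  obtain U \<phi> where at: "\<And>n::nat. (U n, \<phi> n) \<in> params S" "(\<Union>n. \<phi> n ` U n) = pts S" by (rule countable_atlas) blast
  define A where "A = disjointed (\<lambda>n. \<phi> n ` U n)"
  have "range (\<lambda>n. \<phi> n ` U n) \<subseteq> sets borelS" using open_borelS[OF chartD(2)[OF at(1)]] by auto
  from sets.range_disjointed_sets[OF this] have A: "A n \<in> sets borelS" "A n \<subseteq> \<phi> n ` U n" for n
    using disjointed_subset[of "\<lambda>n. \<phi> n ` U n" n] by (auto simp: A_def)
  have cov: "(\<Union>n. A n) = pts S" unfolding A_def UN_disjointed_eq by (rule at(2))
  have disjA: "disjoint_family A" unfolding A_def by (rule disjoint_family_disjointed)
  \<comment> \<open>Area of the part of \<open>B\<close> in the n-th disjoint piece, computed in the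
    n-th chart. The measure is the sum over \<open>n\<close>, and \<open>vol_transition\<close>
    shows that any other chart would give the same.\<close>
  define m where "m = (\<lambda>n B. \<integral>\<^sup>+x\<in>U n \<inter> \<phi> n -` (B \<inter> A n). ennreal (vol (\<phi> n) x) \<partial>lborel)"
  have msum: "(\<Sum>i. m n (B i)) = m n (\<Union>i. B i)"
    if B: "range B \<subseteq> sets borelS" "disjoint_family B" for B n
  proof -
    have meas: "(\<lambda>x. ennreal (vol (\<phi> n) x) * indicator (U n \<inter> \<phi> n -` (B i \<inter> A n)) x) \<in> borel_measurable lborel" for i
    proof -
      have b: "U n \<inter> \<phi> n -` (B i \<inter> A n) \<in> sets borel" by (rule chart_vimage_borel[OF at(1)]) (use B A in auto)
      have "(\<lambda>x. ennreal (vol (\<phi> n) x) * indicator (U n \<inter> \<phi> n -` (B i \<inter> A n)) x)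
        = (\<lambda>x. ennreal (indicator (U n \<inter> \<phi> n -` (B i \<inter> A n)) x *\<^sub>R vol (\<phi> n) x))"
        by (auto simp: indicator_def)
      then show ?thesis using vol_indicator_measurable[OF at(1) b] by simp
    qed
    have "(\<Sum>i. m n (B i)) = (\<integral>\<^sup>+x. (\<Sum>i. ennreal (vol (\<phi> n) x) * indicator (U n \<inter> \<phi> n -` (B i \<inter> A n)) x) \<partial>lborel)"
      unfolding m_def by (rule nn_integral_suminf[symmetric]) (rule meas)
    also have "\<dots> = m n (\<Union>i. B i)"
    proof -
      have "disjoint_family (\<lambda>i. U n \<inter> \<phi> n -` (B i \<inter> A n))"
        using B(2) unfolding disjoint_family_on_def by blast
      then have "(\<Sum>i. indicator (U n \<inter> \<phi> n -` (B i \<inter> A n)) x :: ennreal) = indicator (\<Union>i. U n \<inter> \<phi> n -` (B i \<inter> A n)) x" for x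
        by (rule suminf_indicator)
      moreover have "(\<Union>i. U n \<inter> \<phi> n -` (B i \<inter> A n)) = U n \<inter> \<phi> n -` ((\<Union>i. B i) \<inter> A n)" by auto
      ultimately show ?thesis unfolding m_def by (simp add: ennreal_suminf_cmult)
    qed
    finally show ?thesis .
  qed
  define \<mu> where "\<mu> = measure_of (pts S) (sets borelS) (\<lambda>B. \<Sum>n. m n B)"
  have pow: "sets borelS \<subseteq> Pow (pts S)" using sets.space_closed[of borelS] by simp
  have sets\<mu>: "sets \<mu> = sets borelS" and space\<mu>: "space \<mu> = pts S"
    using sets.sigma_sets_eq[of borelS] by (simp_all add: \<mu>_def sets_measure_of[OF pow] space_measure_of[OF pow])
  have em: "emeasure \<mu> B = (\<Sum>n. m n B)" if "B \<in> sets borelS" for B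
  proof (rule emeasure_measure_of[OF \<mu>_def pow])
    show "B \<in> sets \<mu>" using that sets\<mu> by simp
    show "positive (sets \<mu>) (\<lambda>B. \<Sum>n. m n B)" by (simp add: positive_def m_def)
    show "countably_additive (sets \<mu>) (\<lambda>B. \<Sum>n. m n B)"
      unfolding countably_additive_def sets\<mu>
    proof (intro allI impI)
      fix B :: "nat \<Rightarrow> 'a set" assume B: "range B \<subseteq> sets borelS" "disjoint_family B"
      \<comment> \<open>The two summations are exchanged by reading one of them as an integral for
        the counting measure.\<close>
      have "(\<Sum>i. \<Sum>n. m n (B i)) = (\<integral>\<^sup>+i. (\<Sum>n. m n (B i)) \<partial>count_space UNIV)"
        by (rule nn_integral_count_space_nat[symmetric])
      also have "\<dots> = (\<Sum>n. \<integral>\<^sup>+i. m n (B i) \<partial>count_space UNIV)"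
        by (rule nn_integral_suminf) simp
      also have "\<dots> = (\<Sum>n. \<Sum>i. m n (B i))" by (simp add: nn_integral_count_space_nat)
      also have "\<dots> = (\<Sum>n. m n (\<Union>i. B i))" by (simp add: msum[OF B])
      finally show "(\<Sum>i. \<Sum>n. m n (B i)) = (\<Sum>n. m n (\<Union>i. B i))" .
    qed
  qed
  have "emeasure \<mu> B = (\<integral>\<^sup>+x\<in>V \<inter> \<psi> -` B. ennreal (vol \<psi> x) \<partial>lborel)"
    if d: "(V, \<psi>) \<in> params S" and B: "B \<in> sets \<mu>" "B \<subseteq> \<psi> ` V" for V \<psi> B
  proof -
    have Bb: "B \<in> sets borelS" using B sets\<mu> by simp
    have "m n B = (\<integral>\<^sup>+x\<in>V \<inter> \<psi> -` (B \<inter> A n). ennreal (vol \<psi> x) \<partial>lborel)" for n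
      unfolding m_def by (rule vol_transition[OF at(1) d]) (use A Bb B in auto)
    then have "emeasure \<mu> B = (\<Sum>n. \<integral>\<^sup>+x\<in>V \<inter> \<psi> -` (B \<inter> A n). ennreal (vol \<psi> x) \<partial>lborel)"
      using em[OF Bb] by simp
    also have "\<dots> = (\<integral>\<^sup>+x. (\<Sum>n. ennreal (vol \<psi> x) * indicator (V \<inter> \<psi> -` (B \<inter> A n)) x) \<partial>lborel)"
    proof (rule nn_integral_suminf[symmetric])
      fix n
      have b: "V \<inter> \<psi> -` (B \<inter> A n) \<in> sets borel" by (rule chart_vimage_borel[OF d]) (use Bb A in auto)
      have "(\<lambda>x. ennreal (vol \<psi> x) * indicator (V \<inter> \<psi> -` (B \<inter> A n)) x)
        = (\<lambda>x. ennreal (indicator (V \<inter> \<psi> -` (B \<inter> A n)) x *\<^sub>R vol \<psi> x))"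
        by (auto simp: indicator_def)
      then show "(\<lambda>x. ennreal (vol \<psi> x) * indicator (V \<inter> \<psi> -` (B \<inter> A n)) x) \<in> borel_measurable lborel"
        using vol_indicator_measurable[OF d b] by simp
    qed
    also have "\<dots> = (\<integral>\<^sup>+x\<in>V \<inter> \<psi> -` B. ennreal (vol \<psi> x) \<partial>lborel)"
    proof -
      have "disjoint_family (\<lambda>n. V \<inter> \<psi> -` (B \<inter> A n))"
        using disjA unfolding disjoint_family_on_def by blast
      then have "(\<Sum>n. indicator (V \<inter> \<psi> -` (B \<inter> A n)) x :: ennreal) = indicator (\<Union>n. V \<inter> \<psi> -` (B \<inter> A n)) x" for x
        by (rule suminf_indicator)
      moreover have "(\<Union>n. V \<inter> \<psi> -` (B \<inter> A n)) = V \<inter> \<psi> -` B"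
      proof -
        have "B \<inter> (\<Union>n. A n) = B" unfolding cov using chart_subset[OF d] B(2) by blast
        then show ?thesis by blast
      qed
      ultimately show ?thesis by (simp add: ennreal_suminf_cmult)
    qed
    finally show ?thesis .
  qed
  then have "is_area \<mu>" using sets\<mu> space\<mu> by (auto simp: is_area_def sets_borelS)
  then show ?thesis by blast
qed

lemma is_area_area_measure: "is_area (area_measure S)"
proof -
  have "\<exists>!\<mu>. is_area \<mu>" using is_area_exists is_area_unique by blast
  moreover have "area_measure S = (THE \<mu>. is_area \<mu>)" unfolding area_measure_def is_area_def ..
  ultimately show ?thesis using theI'[of is_area] by simp
qed

lemma sets_area [measurable_cong]: "sets (area_measure S) = sets borelS"
  using is_area_area_measure by (simp add: is_area_def sets_borelS)

lemma space_area [simp]: "space (area_measure S) = pts S"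
  using is_area_area_measure by (simp add: is_area_def)

lemma emeasure_area:
  "(U, \<phi>) \<in> params S \<Longrightarrow> B \<in> sets borelS \<Longrightarrow> B \<subseteq> \<phi> ` U \<Longrightarrow>
    emeasure (area_measure S) B = (\<integral>\<^sup>+x\<in>U \<inter> \<phi> -` B. ennreal (vol \<phi> x) \<partial>lborel)"
  using is_area_area_measure sets_area by (auto simp: is_area_def)

lemma emeasure_area_open_pos:
  assumes G: "openin (topo S) G" "G \<noteq> {}"
  shows "0 < emeasure (area_measure S) G"
proof -
  obtain p where p: "p \<in> G" "p \<in> pts S" using G openin_subset by blast
  obtain U \<phi> where c: "(U, \<phi>) \<in> params S" "p \<in> \<phi> ` U" using chart_cover[OF p(2)] by blast
  define H where "H = G \<inter> \<phi> ` U"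
  have H: "openin (topo S) H" unfolding H_def using G chartD(2)[OF c(1)] by blast
  have o: "open (U \<inter> \<phi> -` H)" by (rule chart_open_preimage[OF c(1) H])
  have ne: "U \<inter> \<phi> -` H \<noteq> {}" using c p by (auto simp: H_def)
  have "emeasure (area_measure S) H = (\<integral>\<^sup>+x\<in>U \<inter> \<phi> -` H. ennreal (vol \<phi> x) \<partial>lborel)"
    by (rule emeasure_area[OF c(1) open_borelS[OF H]]) (auto simp: H_def)
  moreover have "(\<integral>\<^sup>+x\<in>U \<inter> \<phi> -` H. ennreal (vol \<phi> x) \<partial>lborel) \<noteq> 0"
  proof
    assume 0: "(\<integral>\<^sup>+x\<in>U \<inter> \<phi> -` H. ennreal (vol \<phi> x) \<partial>lborel) = 0"
    have eq: "(\<lambda>x. ennreal (vol \<phi> x) * indicator (U \<inter> \<phi> -` H) x)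
        = (\<lambda>x. ennreal (indicator (U \<inter> \<phi> -` H) x *\<^sub>R vol \<phi> x))"
      by (auto simp: indicator_def)
    have "(\<lambda>x. ennreal (vol \<phi> x) * indicator (U \<inter> \<phi> -` H) x) \<in> borel_measurable lborel"
      unfolding eq using vol_indicator_measurable[OF c(1), of "U \<inter> \<phi> -` H"] o by simp
    then have "AE x in lborel. ennreal (vol \<phi> x) * indicator (U \<inter> \<phi> -` H) x = 0"
      using 0 by (simp add: nn_integral_0_iff_AE)
    then have "AE x in lborel. x \<notin> U \<inter> \<phi> -` H"
    proof (rule AE_mp, intro AE_I2 impI)
      fix x assume "ennreal (vol \<phi> x) * indicator (U \<inter> \<phi> -` H) x = 0"
      then show "x \<notin> U \<inter> \<phi> -` H" using vol_pos[OF c(1), of x] by (auto simp: indicator_def)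
    qed
    then have "U \<inter> \<phi> -` H \<in> null_sets lborel" using o by (subst AE_iff_null_sets) auto
    then show False using emeasure_lborel_ball_finite open_not_negligible[OF o ne] negligible_iff_null_sets null_sets_completionI by blast
  qed
  moreover have "emeasure (area_measure S) H \<le> emeasure (area_measure S) G"
    by (rule emeasure_mono) (use G open_borelS in \<open>auto simp: H_def sets_area\<close>)
  ultimately show ?thesis by (metis le_zero_eq not_gr_zero)
qed

text \<open>The set where \<open>f\<close> differs from \<open>c\<close> is open, and nonempty open
  sets have positive area. This makes the almost everywhere conclusions of recurrence and stochastic
  completeness pointwise.\<close>

lemma AE_area_continuous:
  fixes f :: "'a \<Rightarrow> real"
  assumes f: "continuous_map (topo S) euclidean f" and ae: "AE p in area_measure S. f p = c" and p: "p \<in> pts S"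
  shows "f p = c"
proof (rule ccontr)
  assume ne: "f p \<noteq> c"
  define G where "G = {q \<in> pts S. f q \<in> - {c}}"
  have G: "openin (topo S) G"
    unfolding G_def by (rule openin_continuous_map_preimage[OF f]) auto
  have "G \<noteq> {}" using ne p by (auto simp: G_def)
  moreover have "AE q in area_measure S. q \<notin> G" using ae by eventually_elim (auto simp: G_def)
  then have "G \<in> null_sets (area_measure S)"
    by (subst AE_iff_null_sets) (use open_borelS[OF G] in \<open>auto simp: sets_area\<close>)
  ultimately show False using emeasure_area_open_pos[OF G] by (auto simp: null_sets_def)
qed

text \<open>On the image of the chart the area measure is the image of the measure with density
  \<open>vol \<phi>\<close> on \<open>U\<close>, and \<open>f\<close> vanishes on the rest of the
  surface.\<close>

lemma integral_area_chart:
  fixes f :: "'a \<Rightarrow> real"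
  assumes c: "(U, \<phi>) \<in> params S" and f: "f \<in> borel_measurable borelS"
    and 0: "\<And>p. p \<in> pts S \<Longrightarrow> p \<notin> \<phi> ` U \<Longrightarrow> f p = 0"
  shows "(\<integral>p. f p \<partial>area_measure S) = (\<integral>x. indicator U x * (vol \<phi> x * f (\<phi> x)) \<partial>lborel)"
    "integrable (area_measure S) f \<longleftrightarrow> integrable lborel (\<lambda>x. indicator U x * (vol \<phi> x * f (\<phi> x)))"
proof -
  define R where "R = restrict_space lborel U"
  have Ub: "U \<in> sets borel" using chartD(1)[OF c] by simp
  have \<phi>U: "\<phi> ` U \<in> sets borelS" by (rule open_borelS[OF chartD(2)[OF c]])
  have mphi: "\<phi> \<in> measurable R borelS"
    using chart_measurable[OF c] measurable_cong_sets[of R "restrict_space borel U" borelS borelS]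
    by (simp add: R_def sets_restrict_space)
  have mvol: "vol \<phi> \<in> borel_measurable R"
    unfolding R_def using borel_measurable_continuous_on_restrict[OF vol_continuous[OF c]]
    by (simp add: measurable_cong_sets sets_restrict_space cong: measurable_cong_sets)
  have mvol': "(\<lambda>x. ennreal (vol \<phi> x)) \<in> borel_measurable R" using mvol by simp
  define \<nu> where "\<nu> = distr (density R (\<lambda>x. ennreal (vol \<phi> x))) borelS \<phi>"
  have eqm: "density (area_measure S) (indicator (\<phi> ` U)) = \<nu>"
  proof (rule measure_eqI)
    show "sets (density (area_measure S) (indicator (\<phi> ` U))) = sets \<nu>" by (simp add: \<nu>_def sets_area)
    fix B assume "B \<in> sets (density (area_measure S) (indicator (\<phi> ` U)))"
    then have B: "B \<in> sets borelS" by (simp add: sets_area)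
    have "emeasure (density (area_measure S) (indicator (\<phi> ` U))) B
      = (\<integral>\<^sup>+p. indicator (\<phi> ` U) p * indicator B p \<partial>area_measure S)"
      using B \<phi>U by (subst emeasure_density) (auto simp: sets_area)
    also have "\<dots> = (\<integral>\<^sup>+p. indicator (\<phi> ` U \<inter> B) p \<partial>area_measure S)"
      by (intro nn_integral_cong) (auto simp: indicator_def)
    also have "\<dots> = emeasure (area_measure S) (\<phi> ` U \<inter> B)"
      using B \<phi>U by (subst nn_integral_indicator) (auto simp: sets_area)
    also have "\<dots> = (\<integral>\<^sup>+x\<in>U \<inter> \<phi> -` (\<phi> ` U \<inter> B). ennreal (vol \<phi> x) \<partial>lborel)"
      by (rule emeasure_area[OF c]) (use B \<phi>U in auto)
    also have "\<dots> = (\<integral>\<^sup>+x. (ennreal (vol \<phi> x) * indicator (\<phi> -` B \<inter> space R) x) * indicator U x \<partial>lborel)"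
      by (intro nn_integral_cong) (auto simp: indicator_def R_def space_restrict_space)
    also have "\<dots> = (\<integral>\<^sup>+x. ennreal (vol \<phi> x) * indicator (\<phi> -` B \<inter> space R) x \<partial>R)"
      unfolding R_def using Ub by (subst nn_integral_restrict_space) auto
    also have "\<dots> = emeasure \<nu> B"
      unfolding \<nu>_def using mphi mvol' B measurable_sets[OF mphi B]
      by (subst emeasure_distr) (auto simp: emeasure_density space_density)
    finally show "emeasure (density (area_measure S) (indicator (\<phi> ` U))) B = emeasure \<nu> B" .
  qed
  have fa: "f \<in> borel_measurable (area_measure S)" using f measurable_cong_sets[OF sets_area refl] by blast
  have fphi: "(\<lambda>x. f (\<phi> x)) \<in> borel_measurable R" using measurable_compose[OF mphi f] .
  have ind: "indicator (\<phi> ` U) = (\<lambda>p. ennreal (indicator (\<phi> ` U) p))" by (auto simp: indicator_def)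
  have eqf: "indicator (\<phi> ` U) p *\<^sub>R f p = f p" if "p \<in> space (area_measure S)" for p
    using 0 that by (auto simp: indicator_def)
  have vnn: "AE x in R. 0 \<le> vol \<phi> x" by (rule AE_I2) (use vol_pos[OF c] in \<open>auto simp: R_def space_restrict_space intro: less_imp_le\<close>)
  have "(\<integral>p. f p \<partial>area_measure S) = (\<integral>p. indicator (\<phi> ` U) p *\<^sub>R f p \<partial>area_measure S)"
    using eqf by (intro Bochner_Integration.integral_cong) auto
  also have "\<dots> = (\<integral>p. f p \<partial>\<nu>)"
    unfolding eqm[symmetric] ind using fa \<phi>U by (subst integral_density) (auto simp: sets_area)
  also have "\<dots> = (\<integral>x. f (\<phi> x) \<partial>density R (\<lambda>x. ennreal (vol \<phi> x)))"
    unfolding \<nu>_def using mphi f by (subst integral_distr) auto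
  also have "\<dots> = (\<integral>x. vol \<phi> x *\<^sub>R f (\<phi> x) \<partial>R)"
    by (rule integral_density[OF fphi mvol vnn])
  also have "\<dots> = (\<integral>x. indicator U x *\<^sub>R (vol \<phi> x *\<^sub>R f (\<phi> x)) \<partial>lborel)"
    unfolding R_def using Ub by (subst integral_restrict_space) auto
  finally show "(\<integral>p. f p \<partial>area_measure S) = (\<integral>x. indicator U x * (vol \<phi> x * f (\<phi> x)) \<partial>lborel)" by simp
  have "integrable (area_measure S) f \<longleftrightarrow> integrable (area_measure S) (\<lambda>p. indicator (\<phi> ` U) p *\<^sub>R f p)"
    using eqf by (intro Bochner_Integration.integrable_cong) auto
  also have "\<dots> \<longleftrightarrow> integrable \<nu> f"
    unfolding eqm[symmetric] ind using fa \<phi>U by (subst integrable_density) (auto simp: sets_area)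
  also have "\<dots> \<longleftrightarrow> integrable (density R (\<lambda>x. ennreal (vol \<phi> x))) (\<lambda>x. f (\<phi> x))"
    unfolding \<nu>_def using mphi f by (subst integrable_distr_eq) auto
  also have "\<dots> \<longleftrightarrow> integrable R (\<lambda>x. vol \<phi> x *\<^sub>R f (\<phi> x))"
    by (rule integrable_density[OF fphi mvol vnn])
  also have "\<dots> \<longleftrightarrow> integrable lborel (\<lambda>x. indicator U x *\<^sub>R (vol \<phi> x *\<^sub>R f (\<phi> x)))"
    unfolding R_def using Ub by (subst integrable_restrict_space) auto
  finally show "integrable (area_measure S) f \<longleftrightarrow> integrable lborel (\<lambda>x. indicator U x * (vol \<phi> x * f (\<phi> x)))" by simp
qed

end

section \<open>Symmetric difference quotients\<close>

lemma integrable_bounded_support: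
  fixes f :: "'a::euclidean_space \<Rightarrow> real"
  assumes f: "f \<in> borel_measurable borel" and C: "\<And>x. \<bar>f x\<bar> \<le> C" and 0: "\<And>x. x \<notin> cball a R \<Longrightarrow> f x = 0"
  shows "integrable lborel f"
proof (rule Bochner_Integration.integrable_bound)
  show "integrable lborel (\<lambda>x. C * indicator (cball a R) x :: real)"
    by (rule integrable_mult_right, rule integrable_real_indicator) (simp, rule emeasure_lborel_cball_finite)
  show "AE x in lborel. norm (f x) \<le> norm (C * indicator (cball a R) x :: real)"
  proof (rule AE_I2)
    fix x
    show "norm (f x) \<le> norm (C * indicator (cball a R) x :: real)"
      using C[of x] 0[of x] by (cases "x \<in> cball a R") (auto simp: indicator_def)
  qed
qed (use f in simp)

lemma integral_translate:
  fixes f :: "'a::euclidean_space \<Rightarrow> real"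
  assumes "f \<in> borel_measurable borel"
  shows "(\<integral>x. f (x + c) \<partial>lborel) = (\<integral>x. f x \<partial>lborel)"
proof -
  have "(\<integral>x. f x \<partial>lborel) = (\<integral>x. f x \<partial>distr lborel borel ((+) c))" by (simp add: lborel_distr_plus)
  also have "\<dots> = (\<integral>x. f (c + x) \<partial>lborel)" using assms by (subst integral_distr) auto
  finally show ?thesis by (simp add: add.commute)
qed

text \<open>A symmetric discretization of the operator \<open>\<partial>\<^sub>v (a \<partial>\<^sub>v u)\<close>; it is monotone in the
  values of \<open>u\<close> away from \<open>x\<close>, so that touching from below survives.\<close>

definition sdiff :: "('a::euclidean_space \<Rightarrow> real) \<Rightarrow> 'a \<Rightarrow> real \<Rightarrow> ('a \<Rightarrow> real) \<Rightarrow> 'a \<Rightarrow> real" where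
  "sdiff a v h u x = (a (x + (h/2) *\<^sub>R v) * (u (x + h *\<^sub>R v) - u x) + a (x - (h/2) *\<^sub>R v) * (u (x - h *\<^sub>R v) - u x)) / h\<^sup>2"

text \<open>Discrete integration by parts: since the coefficients are taken at half steps,
  translation by a full step exchanges the forward and the backward term.\<close>

lemma sdiff_symmetric:
  fixes u a \<eta> :: "'a::euclidean_space \<Rightarrow> real"
  assumes m: "u \<in> borel_measurable borel" "a \<in> borel_measurable borel" "\<eta> \<in> borel_measurable borel"
    and b: "\<And>x. \<bar>u x\<bar> \<le> C" "\<And>x. \<bar>a x\<bar> \<le> C" "\<And>x. \<bar>\<eta> x\<bar> \<le> C" and 0: "\<And>x. x \<notin> cball x0 R \<Longrightarrow> \<eta> x = 0"
  shows "(\<integral>x. u x * sdiff a v h \<eta> x \<partial>lborel) = (\<integral>x. \<eta> x * sdiff a v h u x \<partial>lborel)"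
proof -
  note [measurable] = m
  have C: "0 \<le> C" using b(1)[of 0] by linarith
  have int: "integrable lborel (\<lambda>x. u (x + p) * a (x + q) * \<eta> (x + s))" for p q s
  proof (rule integrable_bounded_support)
    show "(\<lambda>x. u (x + p) * a (x + q) * \<eta> (x + s)) \<in> borel_measurable borel" by measurable
    show "\<bar>u (x + p) * a (x + q) * \<eta> (x + s)\<bar> \<le> C * C * C" for x
      unfolding abs_mult using b C by (intro mult_mono) auto
    show "u (x + p) * a (x + q) * \<eta> (x + s) = 0" if "x \<notin> cball (x0 - s) R" for x
      using 0[of "x + s"] that by (simp add: dist_norm algebra_simps)
  qed
  let ?p = "h *\<^sub>R v" and ?q = "(h/2) *\<^sub>R v"
  have half: "?q + ?q = ?p" by (simp add: scaleR_add_left[symmetric])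
  have e1: "x + ?p - ?q = x + ?q" and e2: "x + ?q - ?p = x - ?q" and e3: "x - ?p + ?q = x - ?q" for x
    unfolding half[symmetric] by simp_all
  have t1: "(\<integral>x. u x * a (x + ?q) * \<eta> (x + ?p) \<partial>lborel) = (\<integral>x. u (x - ?p) * a (x - ?q) * \<eta> x \<partial>lborel)"
  proof -
    have "(\<lambda>x. u (x - ?p) * a (x - ?q) * \<eta> x) \<in> borel_measurable borel" by measurable
    from integral_translate[OF this, of ?p] show ?thesis
      by (simp add: e1 e2 e3)
  qed
  have t2: "(\<integral>x. u x * a (x - ?q) * \<eta> (x - ?p) \<partial>lborel) = (\<integral>x. u (x + ?p) * a (x + ?q) * \<eta> x \<partial>lborel)"
  proof -
    have "(\<lambda>x. u (x + ?p) * a (x + ?q) * \<eta> x) \<in> borel_measurable borel" by measurable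
    from integral_translate[OF this, of "- ?p"] show ?thesis
      by (simp add: e1 e2 e3)
  qed
  have "(\<integral>x. u x * sdiff a v h \<eta> x \<partial>lborel)
     = (\<integral>x. (u x * a (x + ?q) * \<eta> (x + ?p) - u x * a (x + ?q) * \<eta> x + (u x * a (x - ?q) * \<eta> (x - ?p) - u x * a (x - ?q) * \<eta> x)) / h\<^sup>2 \<partial>lborel)"
    by (intro Bochner_Integration.integral_cong) (auto simp: sdiff_def algebra_simps diff_divide_distrib add_divide_distrib)
  also have "\<dots> = ((\<integral>x. u x * a (x + ?q) * \<eta> (x + ?p) \<partial>lborel) - (\<integral>x. u x * a (x + ?q) * \<eta> x \<partial>lborel)
      + ((\<integral>x. u x * a (x - ?q) * \<eta> (x - ?p) \<partial>lborel) - (\<integral>x. u x * a (x - ?q) * \<eta> x \<partial>lborel))) / h\<^sup>2"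
    using int[of 0 ?q ?p] int[of 0 ?q 0] int[of 0 "- ?q" "- ?p"] int[of 0 "- ?q" 0]
    by simp
  also have "\<dots> = ((\<integral>x. u (x + ?p) * a (x + ?q) * \<eta> x \<partial>lborel) - (\<integral>x. u x * a (x + ?q) * \<eta> x \<partial>lborel)
      + ((\<integral>x. u (x - ?p) * a (x - ?q) * \<eta> x \<partial>lborel) - (\<integral>x. u x * a (x - ?q) * \<eta> x \<partial>lborel))) / h\<^sup>2"
    unfolding t1 t2 by simp
  also have "\<dots> = (\<integral>x. (u (x + ?p) * a (x + ?q) * \<eta> x - u x * a (x + ?q) * \<eta> x + (u (x - ?p) * a (x - ?q) * \<eta> x - u x * a (x - ?q) * \<eta> x)) / h\<^sup>2 \<partial>lborel)"
    using int[of ?p ?q 0] int[of 0 ?q 0] int[of "- ?p" "- ?q" 0] int[of 0 "- ?q" 0]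
    by simp
  also have "\<dots> = (\<integral>x. \<eta> x * sdiff a v h u x \<partial>lborel)"
    by (intro Bochner_Integration.integral_cong) (auto simp: sdiff_def algebra_simps diff_divide_distrib add_divide_distrib)
  finally show ?thesis .
qed

lemma tendsto_line:
  fixes x v :: "'a::euclidean_space"
  shows "((\<lambda>h. x + (c * h) *\<^sub>R v) \<longlongrightarrow> x) (at 0)"
  by (rule tendsto_eq_intros refl | simp)+

lemma peano_line:
  fixes F :: "'a::euclidean_space \<Rightarrow> real"
  assumes U: "open U" "x \<in> U" and F: "Ck_on 2 U F"
  shows "((\<lambda>h. (F (x + h *\<^sub>R v) - F x - h * dd v F x) / h\<^sup>2) \<longlongrightarrow> dd v (dd v F) x / 2) (at 0)"
proof (rule tendstoI)
  fix e :: real assume e: "0 < e"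
  have "continuous (at x) (dd v (dd v F))"
    using C2_cont_dd2[OF F] U continuous_on_eq_continuous_at by blast
  then obtain d1 where d1: "d1 > 0" "\<And>y. dist y x < d1 \<Longrightarrow> dist (dd v (dd v F) y) (dd v (dd v F) x) < e"
    using e unfolding continuous_at_eps_delta by blast
  obtain d2 where d2: "d2 > 0" "ball x d2 \<subseteq> U" using U open_contains_ball by blast
  define d where "d = min d1 d2 / (norm v + 1)"
  have nv: "norm v + 1 > 0" using norm_ge_zero[of v] by linarith
  have d: "d > 0" using d1 d2 nv by (simp add: d_def)
  have near: "dist (x + t *\<^sub>R v) x < min d1 d2" if "\<bar>t\<bar> < d" for t
  proof -
    have "dist (x + t *\<^sub>R v) x = \<bar>t\<bar> * norm v" by (simp add: dist_norm)
    also have "\<dots> \<le> \<bar>t\<bar> * (norm v + 1)" by (intro mult_left_mono) auto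
    also have "\<dots> < d * (norm v + 1)" using that nv by (intro mult_strict_right_mono) auto
    also have "\<dots> = min d1 d2" using nv by (simp add: d_def)
    finally show ?thesis .
  qed
  show "\<forall>\<^sub>F h in at 0. dist ((F (x + h *\<^sub>R v) - F x - h * dd v F x) / h\<^sup>2) (dd v (dd v F) x / 2) < e"
    unfolding eventually_at
  proof (intro exI[of _ d] conjI ballI impI d)
    fix h :: real assume h: "h \<noteq> 0 \<and> dist h 0 < d"
    have "x + t *\<^sub>R v \<in> U" if "\<bar>t\<bar> \<le> \<bar>h\<bar>" for t
      using near[of t] that h d2 by (auto simp: dist_commute subset_eq)
    from taylor2_line[OF F this] obtain t where t: "\<bar>t\<bar> \<le> \<bar>h\<bar>"
      "F (x + h *\<^sub>R v) = F x + h * dd v F x + h\<^sup>2 / 2 * dd v (dd v F) (x + t *\<^sub>R v)" by blast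
    then have eq: "(F (x + h *\<^sub>R v) - F x - h * dd v F x) / h\<^sup>2 = dd v (dd v F) (x + t *\<^sub>R v) / 2"
      using h by simp
    have "dist (dd v (dd v F) (x + t *\<^sub>R v)) (dd v (dd v F) x) < e"
      using d1(2)[of "x + t *\<^sub>R v"] near[of t] t h by auto
    then show "dist ((F (x + h *\<^sub>R v) - F x - h * dd v F x) / h\<^sup>2) (dd v (dd v F) x / 2) < e"
      unfolding eq using e by (simp add: dist_real_def abs_if split: if_splits)
  qed
qed

text \<open>The first-order terms of \<open>F\<close> at the two ends combine into the symmetric
  slope of \<open>a\<close>; the remainders \<open>q h\<close> and \<open>q (- h)\<close> each
  contribute half of the second derivative.\<close>

lemma sdiff_tendsto:
  fixes F a :: "'a::euclidean_space \<Rightarrow> real"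
  assumes U: "open U" "x \<in> U" and F: "Ck_on 2 U F" and a: "Ck_on 1 U a"
  shows "((\<lambda>h. sdiff a v h F x) \<longlongrightarrow> dd v a x * dd v F x + a x * dd v (dd v F) x) (at 0)"
proof -
  define q where "q = (\<lambda>h. (F (x + h *\<^sub>R v) - F x - h * dd v F x) / h\<^sup>2)"
  have q: "(q \<longlongrightarrow> dd v (dd v F) x / 2) (at 0)" unfolding q_def by (rule peano_line[OF U F])
  have neg: "filterlim uminus (at (0::real)) (at 0)"
    by (rule filterlim_atI) (auto intro!: tendsto_eq_intros simp: eventually_at_filter)
  have q': "((\<lambda>h. q (- h)) \<longlongrightarrow> dd v (dd v F) x / 2) (at 0)" by (rule filterlim_compose[OF q neg])
  have ca: "isCont a x" using Ck_on_cont[OF a] U continuous_on_eq_continuous_at by blast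
  have a1: "((\<lambda>h. a (x + (h/2) *\<^sub>R v)) \<longlongrightarrow> a x) (at 0)"
    using isCont_tendsto_compose[OF ca tendsto_line[of x "1/2" v]] by simp
  have a2: "((\<lambda>h. a (x - (h/2) *\<^sub>R v)) \<longlongrightarrow> a x) (at 0)"
    using isCont_tendsto_compose[OF ca tendsto_line[of x "-1/2" v]] by simp
  have D: "((\<lambda>s. a (x + s *\<^sub>R v)) has_real_derivative dd v a x) (at 0)"
    using line_DERIV[OF a[unfolded One_nat_def], of x 0 v UNIV] U by simp
  have D1: "((\<lambda>h. a (x + (h/2) *\<^sub>R v)) has_real_derivative dd v a x * (1/2)) (at 0)"
    by (rule DERIV_chain2[of "\<lambda>s. a (x + s *\<^sub>R v)"]) (use D in \<open>auto intro!: derivative_eq_intros\<close>)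
  have D2: "((\<lambda>h. a (x + (- h/2) *\<^sub>R v)) has_real_derivative dd v a x * (-1/2)) (at 0)"
    by (rule DERIV_chain2[of "\<lambda>s. a (x + s *\<^sub>R v)"]) (use D in \<open>auto intro!: derivative_eq_intros\<close>)
  have "((\<lambda>h. a (x + (h/2) *\<^sub>R v) - a (x + (- h/2) *\<^sub>R v)) has_real_derivative dd v a x) (at 0)"
    using DERIV_diff[OF D1 D2] by simp
  then have sl: "((\<lambda>h. (a (x + (h/2) *\<^sub>R v) - a (x - (h/2) *\<^sub>R v)) / h) \<longlongrightarrow> dd v a x) (at 0)"
    by (simp add: DERIV_def)
  have "((\<lambda>h. (a (x + (h/2) *\<^sub>R v) - a (x - (h/2) *\<^sub>R v)) / h * dd v F x
       + (a (x + (h/2) *\<^sub>R v) * q h + a (x - (h/2) *\<^sub>R v) * q (- h)))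
     \<longlongrightarrow> dd v a x * dd v F x + (a x * (dd v (dd v F) x / 2) + a x * (dd v (dd v F) x / 2))) (at 0)"
    by (intro tendsto_intros sl a1 a2 q q')
  moreover have "dd v a x * dd v F x + (a x * (dd v (dd v F) x / 2) + a x * (dd v (dd v F) x / 2))
      = dd v a x * dd v F x + a x * dd v (dd v F) x" by simp
  moreover have "\<forall>\<^sub>F h in at 0. (a (x + (h/2) *\<^sub>R v) - a (x - (h/2) *\<^sub>R v)) / h * dd v F x
       + (a (x + (h/2) *\<^sub>R v) * q h + a (x - (h/2) *\<^sub>R v) * q (- h)) = sdiff a v h F x"
    unfolding eventually_at_filter
  proof (intro always_eventually allI impI)
    fix h :: real assume h: "h \<noteq> 0"
    have 1: "F (x + h *\<^sub>R v) = F x + h * dd v F x + h\<^sup>2 * q h"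
      "F (x - h *\<^sub>R v) = F x - h * dd v F x + h\<^sup>2 * q (- h)" using h by (simp_all add: q_def)
    show "(a (x + (h/2) *\<^sub>R v) - a (x - (h/2) *\<^sub>R v)) / h * dd v F x
       + (a (x + (h/2) *\<^sub>R v) * q h + a (x - (h/2) *\<^sub>R v) * q (- h)) = sdiff a v h F x"
      unfolding sdiff_def 1 using h by (simp add: field_simps power2_eq_square)
  qed
  ultimately show ?thesis using Lim_transform_eventually by fastforce
qed

text \<open>The linear parts \<open>h * m\<close> and \<open>- h * m\<close> cancel up to the
  variation of the coefficient across the step, which is itself of order \<open>h\<close>. So the
  bound does not depend on \<open>h\<close>, as dominated convergence will require.\<close>

lemma sdiff_lower:
  fixes u a :: "'a::euclidean_space \<Rightarrow> real"
  assumes h: "h > 0" and ap: "0 \<le> a (x + (h/2) *\<^sub>R v)" "a (x + (h/2) *\<^sub>R v) \<le> M"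
    and am: "0 \<le> a (x - (h/2) *\<^sub>R v)" "a (x - (h/2) *\<^sub>R v) \<le> M"
    and lip: "\<bar>a (x + (h/2) *\<^sub>R v) - a (x - (h/2) *\<^sub>R v)\<bar> \<le> L * h"
    and up: "u (x + h *\<^sub>R v) \<ge> u x + h * m - C * h\<^sup>2" and um: "u (x - h *\<^sub>R v) \<ge> u x - h * m - C * h\<^sup>2"
    and C: "C \<ge> 0" and m: "\<bar>m\<bar> \<le> C"
  shows "sdiff a v h u x \<ge> - (L * C + 2 * M * C)"
proof -
  let ?p = "a (x + (h/2) *\<^sub>R v)" and ?m = "a (x - (h/2) *\<^sub>R v)"
  have "?p * (u (x + h *\<^sub>R v) - u x) \<ge> ?p * (h * m - C * h\<^sup>2)" using ap up by (intro mult_left_mono) auto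
  moreover have "?m * (u (x - h *\<^sub>R v) - u x) \<ge> ?m * (- h * m - C * h\<^sup>2)" using am um by (intro mult_left_mono) auto
  moreover have "?p * (h * m - C * h\<^sup>2) + ?m * (- h * m - C * h\<^sup>2) = (?p - ?m) * (h * m) - (?p + ?m) * (C * h\<^sup>2)"
    by (simp add: algebra_simps)
  moreover have "(?p - ?m) * (h * m) \<ge> - ((L * h) * (h * C))"
  proof -
    have "\<bar>(?p - ?m) * (h * m)\<bar> = \<bar>?p - ?m\<bar> * (h * \<bar>m\<bar>)" using h by (simp add: abs_mult)
    also have "\<dots> \<le> (L * h) * (h * C)" using lip m h by (intro mult_mono) auto
    finally show ?thesis by linarith
  qed
  moreover have "(?p + ?m) * (C * h\<^sup>2) \<le> (2 * M) * (C * h\<^sup>2)" using ap am C by (intro mult_right_mono) auto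
  ultimately have 1: "- ((L * h) * (h * C)) - (2 * M) * (C * h\<^sup>2) \<le> ?p * (u (x + h *\<^sub>R v) - u x) + ?m * (u (x - h *\<^sub>R v) - u x)"
    by linarith
  have "- ((L * h) * (h * C)) - (2 * M) * (C * h\<^sup>2) = - (L * C + 2 * M * C) * h\<^sup>2"
    by (simp add: algebra_simps power2_eq_square)
  with 1 have "- (L * C + 2 * M * C) * h\<^sup>2 \<le> ?p * (u (x + h *\<^sub>R v) - u x) + ?m * (u (x - h *\<^sub>R v) - u x)"
    by (simp only:)
  then show ?thesis unfolding sdiff_def using h mult_imp_le_div_pos zero_less_power by blast
qed

text \<open>Compactness bounds the derivatives along the finitely many basis directions; linearity
  extends the bounds to all directions with one constant.\<close>

lemma dd_bounds:
  fixes F :: "'a::euclidean_space \<Rightarrow> 'b::euclidean_space"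
  assumes U: "open U" and F: "Ck_on 2 U F" and K: "compact K" "K \<subseteq> U"
  obtains C where "C \<ge> 0" "\<And>y k. y \<in> K \<Longrightarrow> norm (dd k F y) \<le> C * norm k"
    "\<And>y k. y \<in> K \<Longrightarrow> norm (dd k (dd k F) y) \<le> C * (norm k)\<^sup>2"
proof -
  have bd: "\<exists>c. \<forall>y\<in>K. norm (f y) \<le> c" if "continuous_on U f" for f :: "'a \<Rightarrow> 'b"
  proof -
    have "bounded (f ` K)" by (intro compact_imp_bounded compact_continuous_image continuous_on_subset[OF that] K)
    then show ?thesis by (auto simp: bounded_iff)
  qed
  define c1 where "c1 i = (SOME c. \<forall>y\<in>K. norm (dd i F y) \<le> c)" for i
  have c1: "norm (dd i F y) \<le> c1 i" if "y \<in> K" for i y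
    using someI_ex[OF bd[OF C1_cont_dd[OF C2_C1[OF F], of i]]] that unfolding c1_def by blast
  define c2 where "c2 i j = (SOME c. \<forall>y\<in>K. norm (dd i (dd j F) y) \<le> c)" for i j
  have c2: "norm (dd i (dd j F) y) \<le> c2 i j" if "y \<in> K" for i j y
    using someI_ex[OF bd[OF C2_cont_dd2[OF F, of j i]]] that unfolding c2_def by blast
  define C1 where "C1 = (\<Sum>i\<in>Basis. \<bar>c1 i\<bar>)"
  define C2 where "C2 = (\<Sum>i\<in>Basis. \<Sum>j\<in>Basis. \<bar>c2 i j\<bar>)"
  have pos: "C1 \<ge> 0" "C2 \<ge> 0" by (auto simp: C1_def C2_def intro!: sum_nonneg)
  have 1: "norm (dd k F y) \<le> C1 * norm k" if y: "y \<in> K" for y k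
  proof -
    have dF: "F differentiable (at y)" using C2_diff[OF F] K y by blast
    have "norm (dd k F y) \<le> (\<Sum>b\<in>Basis. norm ((k \<bullet> b) *\<^sub>R dd b F y))"
      by (subst dd_basis[OF dF]) (rule norm_sum)
    also have "\<dots> \<le> (\<Sum>b\<in>Basis. norm k * \<bar>c1 b\<bar>)"
    proof (rule sum_mono)
      fix b :: 'a assume b: "b \<in> Basis"
      have "norm (dd b F y) \<le> \<bar>c1 b\<bar>" by (rule order_trans[OF c1[OF y] abs_ge_self])
      then show "norm ((k \<bullet> b) *\<^sub>R dd b F y) \<le> norm k * \<bar>c1 b\<bar>"
        using Basis_le_norm[OF b, of k] by (simp add: mult_mono)
    qed
    finally show ?thesis by (simp add: C1_def sum_distrib_left mult.commute)
  qed
  have 2: "norm (dd k (dd k F) y) \<le> C2 * (norm k)\<^sup>2" if y: "y \<in> K" for y k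
  proof -
    have yU: "y \<in> U" using K y by blast
    have "dd k (dd k F) y = (\<Sum>i\<in>Basis. (k \<bullet> i) *\<^sub>R dd i (dd k F) y)"
      by (rule dd_basis[OF C1_diff[OF C2_dd[OF F] yU]])
    also have "\<dots> = (\<Sum>i\<in>Basis. (k \<bullet> i) *\<^sub>R (\<Sum>j\<in>Basis. (k \<bullet> j) *\<^sub>R dd j (dd i F) y))"
    proof (rule sum.cong[OF refl])
      fix i :: 'a assume "i \<in> Basis"
      have "dd i (dd k F) y = dd k (dd i F) y" by (rule dd_commute[OF U yU F])
      also have "\<dots> = (\<Sum>j\<in>Basis. (k \<bullet> j) *\<^sub>R dd j (dd i F) y)"
        by (rule dd_basis[OF C1_diff[OF C2_dd[OF F] yU]])
      finally show "(k \<bullet> i) *\<^sub>R dd i (dd k F) y = (k \<bullet> i) *\<^sub>R (\<Sum>j\<in>Basis. (k \<bullet> j) *\<^sub>R dd j (dd i F) y)" by simp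
    qed
    finally have eq: "dd k (dd k F) y = (\<Sum>i\<in>Basis. (k \<bullet> i) *\<^sub>R (\<Sum>j\<in>Basis. (k \<bullet> j) *\<^sub>R dd j (dd i F) y))" .
    have "norm (dd k (dd k F) y) \<le> (\<Sum>i\<in>Basis. \<Sum>j\<in>Basis. norm k * (norm k * \<bar>c2 j i\<bar>))"
      unfolding eq
    proof (intro sum_norm_le)
      fix i :: 'a assume i: "i \<in> Basis"
      have "norm (\<Sum>j\<in>Basis. (k \<bullet> j) *\<^sub>R dd j (dd i F) y) \<le> (\<Sum>j\<in>Basis. norm k * \<bar>c2 j i\<bar>)"
      proof (rule sum_norm_le)
        fix j :: 'a assume j: "j \<in> Basis"
        have "norm (dd j (dd i F) y) \<le> \<bar>c2 j i\<bar>" by (rule order_trans[OF c2[OF y] abs_ge_self])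
        then show "norm ((k \<bullet> j) *\<^sub>R dd j (dd i F) y) \<le> norm k * \<bar>c2 j i\<bar>"
          using Basis_le_norm[OF j, of k] by (simp add: mult_mono)
      qed
      then show "norm ((k \<bullet> i) *\<^sub>R (\<Sum>j\<in>Basis. (k \<bullet> j) *\<^sub>R dd j (dd i F) y)) \<le> (\<Sum>j\<in>Basis. norm k * (norm k * \<bar>c2 j i\<bar>))"
        using Basis_le_norm[OF i, of k] by (simp add: mult_mono sum_distrib_left[symmetric])
    qed
    also have "\<dots> = C2 * (norm k)\<^sup>2"
      unfolding C2_def by (subst sum.swap) (simp add: sum_distrib_left sum_distrib_right power2_eq_square mult_ac)
    finally show ?thesis .
  qed
  show thesis
  proof (rule that[of "C1 + C2"])
    show "norm (dd k F y) \<le> (C1 + C2) * norm k" if "y \<in> K" for y k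
      using 1[OF that, of k] pos mult_nonneg_nonneg[OF pos(2) norm_ge_zero[of k]] unfolding distrib_right by linarith
    show "norm (dd k (dd k F) y) \<le> (C1 + C2) * (norm k)\<^sup>2" if "y \<in> K" for y k
      using 2[OF that, of k] pos mult_nonneg_nonneg[OF pos(1) zero_le_power2[of "norm k"]] unfolding distrib_right by linarith
  qed (use pos in simp)
qed

text \<open>The radii form a ladder: test functions live in radius \<open>r/2\<close> and steps have
  length at most \<open>r/8\<close>, so difference quotients of test functions live in radius
  \<open>5*r/8\<close>, and one more step stays within \<open>3*r/4\<close>, compactly inside the
  ball.\<close>

lemma coef_bounds:
  fixes a :: "'a::euclidean_space \<Rightarrow> real"
  assumes r: "r > 0" and a: "Ck_on 1 (ball x0 r) a"
  obtains M L where "M \<ge> 0" "L \<ge> 0"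
    "\<And>x h. x \<in> cball x0 (5*r/8) \<Longrightarrow> 0 < h \<Longrightarrow> h * norm v \<le> r/8 \<Longrightarrow>
      a (x + (h/2) *\<^sub>R v) \<le> M \<and> a (x - (h/2) *\<^sub>R v) \<le> M \<and> \<bar>a (x + (h/2) *\<^sub>R v) - a (x - (h/2) *\<^sub>R v)\<bar> \<le> L * h"
proof -
  let ?K = "cball x0 (3*r/4)"
  have K: "compact ?K" "?K \<subseteq> ball x0 r" using r by auto
  have bd: "\<exists>c\<ge>0. \<forall>y\<in>?K. \<bar>f y\<bar> \<le> c" if "continuous_on (ball x0 r) f" for f :: "'a \<Rightarrow> real"
  proof -
    have "bounded (f ` ?K)" by (intro compact_imp_bounded compact_continuous_image continuous_on_subset[OF that] K)
    then obtain c where "\<forall>y\<in>?K. \<bar>f y\<bar> \<le> c" by (auto simp: bounded_iff)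
    then show ?thesis by (intro exI[of _ "max c 0"]) (auto simp: le_max_iff_disj)
  qed
  obtain M where M: "M \<ge> 0" "\<And>y. y \<in> ?K \<Longrightarrow> \<bar>a y\<bar> \<le> M" using bd[OF Ck_on_cont[OF a]] by blast
  obtain L where L: "L \<ge> 0" "\<And>y. y \<in> ?K \<Longrightarrow> \<bar>dd v a y\<bar> \<le> L" using bd[OF C1_cont_dd[OF a]] by blast
  have in_K: "x + s *\<^sub>R v \<in> ?K" if "x \<in> cball x0 (5*r/8)" "\<bar>s\<bar> \<le> h/2" "h * norm v \<le> r/8" for x s h
  proof -
    have "norm (s *\<^sub>R v) \<le> (h/2) * norm v" unfolding norm_scaleR using that(2) by (rule mult_right_mono) simp
    also have "\<dots> \<le> r/16" using that(3) by simp
    finally have "norm (s *\<^sub>R v) \<le> r/16" .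
    moreover have "dist x0 (x + s *\<^sub>R v) \<le> dist x0 x + norm (s *\<^sub>R v)"
      using norm_triangle_ineq4[of "x0 - x" "s *\<^sub>R v"] by (simp add: dist_norm diff_diff_eq)
    ultimately show ?thesis using that(1) r by simp
  qed
  show thesis
  proof (rule that[OF M(1) L(1)])
    fix x h assume x: "x \<in> cball x0 (5*r/8)" and h: "0 < (h::real)" "h * norm v \<le> r/8"
    have p: "x + (h/2) *\<^sub>R v \<in> ?K" using in_K[OF x _ h(2), of "h/2"] h by simp
    have m: "x - (h/2) *\<^sub>R v \<in> ?K" using in_K[OF x _ h(2), of "-h/2"] h by simp
    have D: "((\<lambda>s. a (x + s *\<^sub>R v)) has_real_derivative dd v a (x + s *\<^sub>R v)) (at s)"
      if s: "- (h/2) \<le> s" "s \<le> h/2" for s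
    proof (rule line_DERIV[OF a[unfolded One_nat_def]])
      have "\<bar>s\<bar> \<le> h/2" using s by linarith
      then show "x + s *\<^sub>R v \<in> ball x0 r" using in_K[OF x _ h(2)] K(2) by blast
    qed
    have "- (h/2) < h/2" using h by simp
    from MVT2[OF this D] obtain s where s: "- (h/2) < s" "s < h/2"
      "a (x + (h/2) *\<^sub>R v) - a (x + (- (h/2)) *\<^sub>R v) = (h/2 - (- (h/2))) * dd v a (x + s *\<^sub>R v)" by blast
    have "x + s *\<^sub>R v \<in> ?K" using in_K[OF x _ h(2), of s] s by auto
    then have "\<bar>h * dd v a (x + s *\<^sub>R v)\<bar> \<le> L * h" using L(2) h by (simp add: abs_mult mult.commute)
    moreover have "a (x + (h/2) *\<^sub>R v) - a (x - (h/2) *\<^sub>R v) = h * dd v a (x + s *\<^sub>R v)" using s(3) by simp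
    ultimately show "a (x + (h/2) *\<^sub>R v) \<le> M \<and> a (x - (h/2) *\<^sub>R v) \<le> M \<and> \<bar>a (x + (h/2) *\<^sub>R v) - a (x - (h/2) *\<^sub>R v)\<bar> \<le> L * h"
      using M(2)[OF p] M(2)[OF m] by (simp add: abs_le_iff)
  qed
qed

text \<open>Extension by zero off a compact set yields globally bounded Borel functions, as
  \<open>sdiff_symmetric\<close> demands.\<close>

lemma measurable_bounded_truncation:
  fixes u :: "'a::euclidean_space \<Rightarrow> real"
  assumes "continuous_on U u" "compact K" "K \<subseteq> U"
  shows "(\<lambda>x. indicator K x * u x) \<in> borel_measurable borel" "\<exists>C\<ge>0. \<forall>x. \<bar>indicator K x * u x\<bar> \<le> C"
proof -
  have c: "continuous_on K u" by (rule continuous_on_subset[OF assms(1,3)])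
  show "(\<lambda>x. indicator K x * u x) \<in> borel_measurable borel"
    using borel_measurable_continuous_on_indicator[OF _ c] assms(2) by (simp add: borel_compact)
  have "bounded (u ` K)" by (intro compact_imp_bounded compact_continuous_image c assms)
  then obtain C where "\<forall>y\<in>K. \<bar>u y\<bar> \<le> C" by (auto simp: bounded_iff)
  then show "\<exists>C\<ge>0. \<forall>x. \<bar>indicator K x * u x\<bar> \<le> C"
    by (intro exI[of _ "max C 0"]) (auto simp: indicator_def le_max_iff_disj)
qed

lemma sdiff_minus: "sdiff a v h (\<lambda>x. - u x) x = - sdiff a v h u x"
  by (simp add: sdiff_def algebra_simps minus_divide_left)

lemma shift_cball:
  fixes x v :: "'a::euclidean_space"
  assumes "x \<in> cball x0 R" "\<bar>s\<bar> * norm v \<le> d" shows "x + s *\<^sub>R v \<in> cball x0 (R + d)" "x - s *\<^sub>R v \<in> cball x0 (R + d)"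
proof -
  have "dist x0 (x + t *\<^sub>R v) \<le> dist x0 x + \<bar>t\<bar> * norm v" for t
    using norm_triangle_ineq4[of "x0 - x" "t *\<^sub>R v"] by (simp add: dist_norm diff_diff_eq)
  from this[of s] this[of "- s"] show "x + s *\<^sub>R v \<in> cball x0 (R + d)" "x - s *\<^sub>R v \<in> cball x0 (R + d)"
    using assms by auto
qed

lemma shift_cball4:
  fixes x v :: "'a::euclidean_space"
  assumes "x \<in> cball x0 R" "0 < h" "h * norm v \<le> d" "R + d \<le> R'"
  shows "x + h *\<^sub>R v \<in> cball x0 R'" "x - h *\<^sub>R v \<in> cball x0 R'"
    "x + (h/2) *\<^sub>R v \<in> cball x0 R'" "x - (h/2) *\<^sub>R v \<in> cball x0 R'"
proof -
  have "0 \<le> h * norm v" using assms(2) by simp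
  moreover have "\<bar>h\<bar> * norm v = h * norm v" "\<bar>h/2\<bar> * norm v = h * norm v / 2" using assms(2) by simp_all
  ultimately have "\<bar>h\<bar> * norm v \<le> d" "\<bar>h/2\<bar> * norm v \<le> d" using assms(3) by linarith+
  from shift_cball[OF assms(1) this(1)] shift_cball[OF assms(1) this(2)]
  show "x + h *\<^sub>R v \<in> cball x0 R'" "x - h *\<^sub>R v \<in> cball x0 R'"
    "x + (h/2) *\<^sub>R v \<in> cball x0 R'" "x - (h/2) *\<^sub>R v \<in> cball x0 R'"
    using assms(4) by auto
qed

text \<open>Symmetry moves the difference operator to \<eta>, where Taylor's formula bounds it
  uniformly, while \<open>u\<close> is only continuous. The truncation at radius
  \<open>3*r/4\<close> leaves no trace in the limit, since the quotients of \<eta> vanish beyond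
  \<open>5*r/8\<close>.\<close>

lemma sdiff_integral_limit:
  fixes u a \<eta> :: "'a::euclidean_space \<Rightarrow> real"
  assumes r: "r > 0" and a: "Ck_on 1 (ball x0 r) a" and a0: "\<And>x. x \<in> ball x0 r \<Longrightarrow> 0 \<le> a x"
    and u: "continuous_on (ball x0 r) u"
    and \<eta>: "Ck_on 2 UNIV \<eta>" and \<eta>0: "\<And>x. x \<notin> cball x0 (r/2) \<Longrightarrow> \<eta> x = 0"
    and h: "\<And>n::nat. h n > 0" "\<And>n. h n * norm v \<le> r/8" "h \<longlonglongrightarrow> 0"
  defines "uc \<equiv> \<lambda>x. indicator (cball x0 (3*r/4)) x * u x" and "ac \<equiv> \<lambda>x. indicator (cball x0 (3*r/4)) x * a x"
  shows "(\<lambda>n. \<integral>x. \<eta> x * sdiff ac v (h n) uc x \<partial>lborel)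
    \<longlonglongrightarrow> (\<integral>x. indicator (cball x0 (r/2)) x * (u x * (dd v a x * dd v \<eta> x + a x * dd v (dd v \<eta>) x)) \<partial>lborel)"
    and "\<And>n. integrable lborel (\<lambda>x. \<eta> x * sdiff ac v (h n) uc x)"
    and "integrable lborel (\<lambda>x. indicator (cball x0 (r/2)) x * (u x * (dd v a x * dd v \<eta> x + a x * dd v (dd v \<eta>) x)))"
proof -
  let ?K = "cball x0 (r/2)" and ?K2 = "cball x0 (3*r/4)"
  have K2: "compact ?K2" "?K2 \<subseteq> ball x0 r" using r by auto
  have K: "compact ?K" "?K \<subseteq> ball x0 r" using r by auto
  note muc = measurable_bounded_truncation(1)[OF u K2, folded uc_def]
  note mac = measurable_bounded_truncation(1)[OF Ck_on_cont[OF a] K2, folded ac_def]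
  have meta: "\<eta> \<in> borel_measurable borel"
    using Ck_on_cont[OF \<eta>] borel_measurable_continuous_onI by blast
  note [measurable] = muc mac meta
  have "\<exists>C\<ge>0. \<forall>x. \<bar>uc x\<bar> \<le> C" unfolding uc_def by (rule measurable_bounded_truncation(2)[OF u K2])
  then obtain C1 where C1: "C1 \<ge> 0" "\<And>x. \<bar>uc x\<bar> \<le> C1" by blast
  have "\<exists>C\<ge>0. \<forall>x. \<bar>ac x\<bar> \<le> C" unfolding ac_def by (rule measurable_bounded_truncation(2)[OF Ck_on_cont[OF a] K2])
  then obtain C2 where C2: "C2 \<ge> 0" "\<And>x. \<bar>ac x\<bar> \<le> C2" by blast
  obtain C3 where C3: "C3 \<ge> 0" "\<And>x. \<bar>indicator ?K x * \<eta> x\<bar> \<le> C3" using measurable_bounded_truncation(2)[OF Ck_on_cont[OF \<eta>] K(1)] by auto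
  have C3': "\<bar>\<eta> x\<bar> \<le> C3" for x using C3(2)[of x] C3(1) \<eta>0[of x] by (cases "x \<in> ?K") auto
  define C where "C = max C1 (max C2 C3)"
  have CC: "\<bar>uc x\<bar> \<le> C" "\<bar>ac x\<bar> \<le> C" "\<bar>\<eta> x\<bar> \<le> C" for x
    using C1(2)[of x] C2(2)[of x] C3'[of x] by (auto simp: C_def)
  have C0: "C \<ge> 0" using C1(1) by (simp add: C_def)
  have sym: "(\<integral>x. uc x * sdiff ac v (h n) \<eta> x \<partial>lborel) = (\<integral>x. \<eta> x * sdiff ac v (h n) uc x \<partial>lborel)" for n
    by (rule sdiff_symmetric[OF muc mac meta CC \<eta>0])
  have msd: "(\<lambda>x. sdiff ac v (h n) f x) \<in> borel_measurable borel" if [measurable]: "f \<in> borel_measurable borel" for f n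
    unfolding sdiff_def by measurable
  have sdb: "\<bar>sdiff ac v (h n) uc x\<bar> \<le> (C * (2*C) + C * (2*C)) / (h n)\<^sup>2" for n x
  proof -
    have b: "\<bar>ac y * (uc z - uc w)\<bar> \<le> C * (2*C)" for y z w
      unfolding abs_mult using CC(1)[of z] CC(1)[of w] CC(2)[of y] C0 by (intro mult_mono) auto
    have "\<bar>sdiff ac v (h n) uc x\<bar> = \<bar>ac (x + (h n/2) *\<^sub>R v) * (uc (x + h n *\<^sub>R v) - uc x) + ac (x - (h n/2) *\<^sub>R v) * (uc (x - h n *\<^sub>R v) - uc x)\<bar> / (h n)\<^sup>2"
      unfolding sdiff_def by simp
    also have "\<dots> \<le> (C * (2*C) + C * (2*C)) / (h n)\<^sup>2"
      by (rule divide_right_mono[OF order_trans[OF abs_triangle_ineq add_mono[OF b b]]]) simp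
    finally show ?thesis .
  qed
  show "integrable lborel (\<lambda>x. \<eta> x * sdiff ac v (h n) uc x)" for n
  proof (rule integrable_bounded_support)
    show "(\<lambda>x. \<eta> x * sdiff ac v (h n) uc x) \<in> borel_measurable borel"
      by (rule borel_measurable_times[OF meta msd[OF muc]])
    show "\<bar>\<eta> x * sdiff ac v (h n) uc x\<bar> \<le> C * ((C * (2*C) + C * (2*C)) / (h n)\<^sup>2)" for x
      unfolding abs_mult using CC C0 sdb by (intro mult_mono) auto
    show "\<eta> x * sdiff ac v (h n) uc x = 0" if "x \<notin> ?K" for x using \<eta>0[OF that] by simp
  qed
  let ?lim = "\<lambda>x. indicator ?K x * (u x * (dd v a x * dd v \<eta> x + a x * dd v (dd v \<eta>) x))"
  have zero_out: "dd v \<eta> x = 0" "dd v (dd v \<eta>) x = 0" if "x \<notin> ?K" for x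
  proof -
    have o: "open (- ?K)" by auto
    have z: "dd v \<eta> y = 0" if "y \<notin> ?K" for y
    proof -
      have "dd v \<eta> y = dd v (\<lambda>_. 0) y" by (rule dd_cong[OF o]) (use that \<eta>0 in auto)
      then show ?thesis using dd_eqI[OF has_derivative_const] by simp
    qed
    show "dd v \<eta> x = 0" by (rule z[OF that])
    have "dd v (dd v \<eta>) x = dd v (\<lambda>_. 0) x" by (rule dd_cong[OF o]) (use that z in auto)
    then show "dd v (dd v \<eta>) x = 0" using dd_eqI[OF has_derivative_const] by simp
  qed
  have far: "sdiff ac v (h n) \<eta> x = 0" if "x \<notin> cball x0 (5*r/8)" for x n
  proof -
    have "y \<notin> ?K" if y: "y = x \<or> y = x + h n *\<^sub>R v \<or> y = x - h n *\<^sub>R v" for y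
    proof
      assume yK: "y \<in> ?K"
      have "x \<in> cball x0 (r/2 + r/8)"
        using y shift_cball4[OF yK h(1)[of n] h(2)[of n] order_refl] yK r by auto
      then show False using \<open>x \<notin> cball x0 (5*r/8)\<close> by simp
    qed
    then have "\<eta> x = 0" "\<eta> (x + h n *\<^sub>R v) = 0" "\<eta> (x - h n *\<^sub>R v) = 0" using \<eta>0 by blast+
    then show ?thesis by (simp add: sdiff_def)
  qed
  have pw: "(\<lambda>n. uc x * sdiff ac v (h n) \<eta> x) \<longlonglongrightarrow> ?lim x" for x
  proof (cases "x \<in> ball x0 (3*r/4)")
    case True
    let ?O = "ball x0 (3*r/4)"
    have OO: "?O \<subseteq> ball x0 r" using r by auto
    have eq: "a y = ac y" if "y \<in> ?O" for y using that by (auto simp: ac_def)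
    have ac1: "Ck_on 1 ?O ac" by (rule Ck_on_cong[OF open_ball eq Ck_on_subset[OF a OO]])
    have "((\<lambda>h. sdiff ac v h \<eta> x) \<longlongrightarrow> dd v ac x * dd v \<eta> x + ac x * dd v (dd v \<eta>) x) (at 0)"
      by (rule sdiff_tendsto[OF open_ball True Ck_on_subset[OF \<eta>] ac1]) simp
    moreover have "filterlim h (at 0) sequentially"
      by (rule filterlim_atI[OF h(3)]) (use h(1) in \<open>auto intro!: always_eventually simp: less_imp_neq[symmetric]\<close>)
    ultimately have "(\<lambda>n. sdiff ac v (h n) \<eta> x) \<longlonglongrightarrow> dd v ac x * dd v \<eta> x + ac x * dd v (dd v \<eta>) x"
      by (rule filterlim_compose)
    moreover have "dd v ac x = dd v a x" by (rule dd_cong[OF open_ball True eq[symmetric]])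
    moreover have "ac x = a x" "uc x = u x" using True by (auto simp: ac_def uc_def)
    ultimately have "(\<lambda>n. uc x * sdiff ac v (h n) \<eta> x) \<longlonglongrightarrow> u x * (dd v a x * dd v \<eta> x + a x * dd v (dd v \<eta>) x)"
      by (auto intro: tendsto_mult)
    then show ?thesis using zero_out[of x] by (cases "x \<in> ?K") auto
  next
    case False
    then have "x \<notin> cball x0 (5*r/8)" "x \<notin> ?K" using r by auto
    then show ?thesis using far by simp
  qed
  obtain M L where bML: "M \<ge> 0" "L \<ge> 0" "\<And>x h. x \<in> cball x0 (5*r/8) \<Longrightarrow> 0 < h \<Longrightarrow> h * norm v \<le> r/8 \<Longrightarrow>
      a (x + (h/2) *\<^sub>R v) \<le> M \<and> a (x - (h/2) *\<^sub>R v) \<le> M \<and> \<bar>a (x + (h/2) *\<^sub>R v) - a (x - (h/2) *\<^sub>R v)\<bar> \<le> L * h"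
    using coef_bounds[OF r a] by metis
  obtain C4 where C4: "C4 \<ge> 0" "\<And>y k. y \<in> ?K \<Longrightarrow> norm (dd k \<eta> y) \<le> C4 * norm k"
    "\<And>y k. y \<in> ?K \<Longrightarrow> norm (dd k (dd k \<eta>) y) \<le> C4 * (norm k)\<^sup>2"
    using dd_bounds[OF open_UNIV \<eta> K(1)] by (metis subset_UNIV)
  define D where "D = C4 * norm v + C4 * (norm v)\<^sup>2"
  have D0: "D \<ge> 0" using C4(1) by (simp add: D_def)
  have D1: "\<bar>dd v \<eta> y\<bar> \<le> D" "\<bar>dd v (dd v \<eta>) y\<bar> \<le> D" for y
  proof -
    have p: "C4 * norm v \<ge> 0" "C4 * (norm v)\<^sup>2 \<ge> 0" using C4(1) by auto
    show "\<bar>dd v \<eta> y\<bar> \<le> D" "\<bar>dd v (dd v \<eta>) y\<bar> \<le> D"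
      using C4(2)[of y v] C4(3)[of y v] zero_out[of y] p D0 by (cases "y \<in> ?K"; auto simp: D_def)+
  qed
  have T: "\<bar>\<eta> (x + s *\<^sub>R v) - \<eta> x - s * dd v \<eta> x\<bar> \<le> D * s\<^sup>2" for x s
  proof -
    obtain t where "\<eta> (x + s *\<^sub>R v) = \<eta> x + s * dd v \<eta> x + s\<^sup>2 / 2 * dd v (dd v \<eta>) (x + t *\<^sub>R v)"
      using taylor2_line[OF \<eta>, of s x v] by auto
    then have "\<bar>\<eta> (x + s *\<^sub>R v) - \<eta> x - s * dd v \<eta> x\<bar> = s\<^sup>2 / 2 * \<bar>dd v (dd v \<eta>) (x + t *\<^sub>R v)\<bar>"
      by (simp add: abs_mult)
    also have "\<dots> \<le> s\<^sup>2 * D" using D1(2)[of "x + t *\<^sub>R v"] by (intro mult_mono) auto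
    finally show ?thesis by (simp add: mult.commute)
  qed
  \<comment> \<open>A two-sided bound from the one-sided \<open>sdiff_lower\<close>, applied to
    \<eta> and to its negative.\<close>
  have sb: "\<bar>sdiff ac v (h n) \<eta> x\<bar> \<le> L * D + 2 * M * D" for n x
  proof (cases "x \<in> cball x0 (5*r/8)")
    case True
    have in2: "x + (h n/2) *\<^sub>R v \<in> ?K2" "x - (h n/2) *\<^sub>R v \<in> ?K2"
      using shift_cball4[OF True h(1)[of n] h(2)[of n], of "3*r/4"] r by auto
    have eqa: "ac (x + (h n/2) *\<^sub>R v) = a (x + (h n/2) *\<^sub>R v)" "ac (x - (h n/2) *\<^sub>R v) = a (x - (h n/2) *\<^sub>R v)"
      using in2 by (auto simp: ac_def)
    have nn: "0 \<le> a (x + (h n/2) *\<^sub>R v)" "0 \<le> a (x - (h n/2) *\<^sub>R v)" using in2 K2(2) a0 by blast+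
    note b = bML(3)[OF True h(1,2)]
    have up: "\<eta> (x + h n *\<^sub>R v) \<ge> \<eta> x + h n * dd v \<eta> x - D * (h n)\<^sup>2" "- \<eta> (x + h n *\<^sub>R v) \<ge> - \<eta> x + h n * (- dd v \<eta> x) - D * (h n)\<^sup>2"
      using T[of x "h n"] by (auto simp: abs_le_iff)
    have dn: "\<eta> (x - h n *\<^sub>R v) \<ge> \<eta> x - h n * dd v \<eta> x - D * (h n)\<^sup>2" "- \<eta> (x - h n *\<^sub>R v) \<ge> - \<eta> x - h n * (- dd v \<eta> x) - D * (h n)\<^sup>2"
      using T[of x "- h n"] by (auto simp: abs_le_iff)
    have "sdiff ac v (h n) \<eta> x \<ge> - (L * D + 2 * M * D)"
      by (rule sdiff_lower[OF h(1), where m = "dd v \<eta> x"]) (use eqa nn b up(1) dn(1) D0 D1(1) in auto)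
    moreover have "sdiff ac v (h n) (\<lambda>x. - \<eta> x) x \<ge> - (L * D + 2 * M * D)"
      by (rule sdiff_lower[OF h(1), where m = "- dd v \<eta> x"]) (use eqa nn b up(2) dn(2) D0 D1(1) in auto)
    ultimately show ?thesis by (simp add: sdiff_minus abs_le_iff)
  next
    case False
    then show ?thesis using far[OF False] bML D0 by simp
  qed
  have dom: "integrable lborel ?lim" "(\<lambda>n. \<integral>x. uc x * sdiff ac v (h n) \<eta> x \<partial>lborel) \<longlonglongrightarrow> (\<integral>x. ?lim x \<partial>lborel)"
  proof -
    let ?w = "\<lambda>x. C * (L * D + 2 * M * D) * indicator (cball x0 (5*r/8)) x :: real"
    have w: "integrable lborel ?w"
      by (rule integrable_mult_right, rule integrable_real_indicator) (simp, rule emeasure_lborel_cball_finite)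
    have m: "(\<lambda>x. uc x * sdiff ac v (h n) \<eta> x) \<in> borel_measurable lborel" for n
      using borel_measurable_times[OF muc msd[OF meta]] by simp
    have ml: "?lim \<in> borel_measurable lborel"
      by (rule borel_measurable_LIMSEQ_real[OF pw m])
    have bd: "norm (uc x * sdiff ac v (h n) \<eta> x) \<le> ?w x" for n x
    proof (cases "x \<in> cball x0 (5*r/8)")
      case True
      then show ?thesis using CC C0 sb by (auto simp: abs_mult intro!: mult_mono)
    qed (use far in simp)
    show "integrable lborel ?lim"
      by (rule integrable_dominated_convergence[where s = "\<lambda>n x. uc x * sdiff ac v (h n) \<eta> x", OF ml m w])
        (use pw bd in auto)
    show "(\<lambda>n. \<integral>x. uc x * sdiff ac v (h n) \<eta> x \<partial>lborel) \<longlonglongrightarrow> (\<integral>x. ?lim x \<partial>lborel)"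
      by (rule integral_dominated_convergence[OF ml m w]) (use pw bd in auto)
  qed
  then show "(\<lambda>n. \<integral>x. \<eta> x * sdiff ac v (h n) uc x \<partial>lborel) \<longlonglongrightarrow> (\<integral>x. ?lim x \<partial>lborel)" "integrable lborel ?lim"
    by (simp_all add: sym)
qed

text \<open>By symmetry, the integral of the discrete operator \<open>Lu n\<close> against \<eta>
  converges to the right side. Pointwise, \<open>Lu n x\<close> is eventually at least the
  corresponding quotient of the support function, whose limit is at least \<open>\<tau> x\<close>.
  Semiconvexity bounds \<open>Lu n\<close> only from below, which is why its minimum with \<tau> is
  integrated.\<close>

lemma weak_inequality_planar:
  fixes u \<eta> \<tau> :: "'a::euclidean_space \<Rightarrow> real" and a :: "'i \<Rightarrow> 'a \<Rightarrow> real" and v :: "'i \<Rightarrow> 'a"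
  assumes r: "r > 0" and I: "finite I" and a: "\<And>k. k \<in> I \<Longrightarrow> Ck_on 1 (ball x0 r) (a k)"
    and a0: "\<And>k x. k \<in> I \<Longrightarrow> x \<in> ball x0 r \<Longrightarrow> 0 \<le> a k x"
    and u: "continuous_on (ball x0 r) u"
    and semi: "\<And>x. x \<in> cball x0 (r/2) \<Longrightarrow> \<exists>l. linear l \<and> (\<forall>k. \<bar>l k\<bar> \<le> C * norm k) \<and>
      (\<forall>k. x + k \<in> ball x0 r \<longrightarrow> u x + l k - C * (norm k)\<^sup>2 \<le> u (x + k))" and C: "C \<ge> 0"
    and \<eta>: "Ck_on 2 UNIV \<eta>" and \<eta>0: "\<And>x. x \<notin> cball x0 (r/2) \<Longrightarrow> \<eta> x = 0" and \<eta>p: "\<And>x. 0 \<le> \<eta> x"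
    and \<tau>: "continuous_on (cball x0 (r/2)) \<tau>"
    and supp: "\<And>x. x \<in> cball x0 (r/2) \<Longrightarrow> \<exists>w W. open W \<and> x \<in> W \<and> W \<subseteq> ball x0 r \<and> Ck_on 2 W w \<and>
      (\<forall>y\<in>W. w y \<le> u y) \<and> w x = u x \<and>
      \<tau> x \<le> (\<Sum>k\<in>I. dd (v k) (a k) x * dd (v k) w x + a k x * dd (v k) (dd (v k) w) x)"
  shows "(\<integral>x. indicator (cball x0 (r/2)) x * (\<tau> x * \<eta> x) \<partial>lborel)
    \<le> (\<integral>x. indicator (cball x0 (r/2)) x * (u x * (\<Sum>k\<in>I. dd (v k) (a k) x * dd (v k) \<eta> x + a k x * dd (v k) (dd (v k) \<eta>) x)) \<partial>lborel)"
proof -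
  let ?K = "cball x0 (r/2)" and ?K2 = "cball x0 (3*r/4)"
  have K: "compact ?K" "?K \<subseteq> ball x0 r" using r by auto
  have K2: "compact ?K2" "?K2 \<subseteq> ball x0 r" using r by auto
  define V where "V = 1 + (\<Sum>k\<in>I. norm (v k))"
  have V: "V > 0" "\<And>k. k \<in> I \<Longrightarrow> norm (v k) \<le> V"
  proof -
    show "V > 0" unfolding V_def using sum_nonneg[of I "\<lambda>k. norm (v k)"] by (simp add: add_pos_nonneg)
    show "norm (v k) \<le> V" if "k \<in> I" for k
      unfolding V_def using member_le_sum[OF that, of "\<lambda>k. norm (v k)"] I by (simp add: add_increasing)
  qed
  \<comment> \<open>Steps tending to 0 that have length at most \<open>r/8\<close> along every
    direction; \<open>V\<close> dominates all directions and is positive owing to its summand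
    1.\<close>
  define h where "h = (\<lambda>n::nat. (r / 8 / V) * inverse (real (Suc n)))"
  have h0: "h n > 0" for n using r V by (simp add: h_def)
  have h1: "h n * norm (v k) \<le> r/8" if k: "k \<in> I" for n k
  proof -
    have "inverse (real (Suc n)) \<le> 1" by (simp add: field_simps)
    then have "h n \<le> r / 8 / V" unfolding h_def using r V by (intro mult_left_le) auto
    then have "h n * norm (v k) \<le> (r / 8 / V) * V" using V(2)[OF k] h0[of n] by (intro mult_mono) auto
    then show ?thesis using V(1) by simp
  qed
  have h2: "h \<longlonglongrightarrow> 0"
    unfolding h_def using tendsto_mult_right_zero[OF LIMSEQ_inverse_real_of_nat] by blast
  define uc where "uc = (\<lambda>x. indicator ?K2 x * u x)"
  define ac where "ac = (\<lambda>k x. indicator ?K2 x * a k x)"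
  define Lu where "Lu = (\<lambda>n x. \<Sum>k\<in>I. sdiff (ac k) (v k) (h n) uc x)"
  define \<tau>c where "\<tau>c = (\<lambda>x. indicator ?K x * \<tau> x)"
  have eqs: "sdiff (ac k) (v k) (h n) uc x = sdiff (a k) (v k) (h n) u x" if k: "k \<in> I" and x: "x \<in> ?K" for k n x
  proof -
    have "x + h n *\<^sub>R v k \<in> ?K2" "x - h n *\<^sub>R v k \<in> ?K2" "x + (h n/2) *\<^sub>R v k \<in> ?K2" "x - (h n/2) *\<^sub>R v k \<in> ?K2" "x \<in> ?K2"
      using shift_cball4[OF x h0[of n] h1[OF k, of n], of "3*r/4"] r x by auto
    then show ?thesis by (simp add: sdiff_def uc_def ac_def)
  qed
  have lim: "(\<lambda>n. \<integral>x. \<eta> x * sdiff (ac k) (v k) (h n) uc x \<partial>lborel)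
    \<longlonglongrightarrow> (\<integral>x. indicator ?K x * (u x * (dd (v k) (a k) x * dd (v k) \<eta> x + a k x * dd (v k) (dd (v k) \<eta>) x)) \<partial>lborel)"
    "integrable lborel (\<lambda>x. \<eta> x * sdiff (ac k) (v k) (h n) uc x)"
    "integrable lborel (\<lambda>x. indicator ?K x * (u x * (dd (v k) (a k) x * dd (v k) \<eta> x + a k x * dd (v k) (dd (v k) \<eta>) x)))"
    if k: "k \<in> I" for k n
    unfolding uc_def ac_def by (rule sdiff_integral_limit[OF r a[OF k] a0[OF k] u \<eta> \<eta>0 h0 h1[OF k] h2]; assumption)+
  have int1: "integrable lborel (\<lambda>x. \<eta> x * sdiff (ac k) (v k) (h n) uc x)" if "k \<in> I" for k n
    by (rule lim(2)[OF that])
  have intL: "integrable lborel (\<lambda>x. \<eta> x * Lu n x)" for n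
    unfolding Lu_def sum_distrib_left by (rule Bochner_Integration.integrable_sum) (rule int1)
  have limL: "(\<lambda>n. \<integral>x. \<eta> x * Lu n x \<partial>lborel) \<longlonglongrightarrow>
     (\<integral>x. indicator ?K x * (u x * (\<Sum>k\<in>I. dd (v k) (a k) x * dd (v k) \<eta> x + a k x * dd (v k) (dd (v k) \<eta>) x)) \<partial>lborel)"
  proof -
    have "(\<integral>x. \<eta> x * Lu n x \<partial>lborel) = (\<Sum>k\<in>I. \<integral>x. \<eta> x * sdiff (ac k) (v k) (h n) uc x \<partial>lborel)" for n
      unfolding Lu_def sum_distrib_left by (rule Bochner_Integration.integral_sum) (rule int1)
    moreover have "(\<integral>x. indicator ?K x * (u x * (\<Sum>k\<in>I. dd (v k) (a k) x * dd (v k) \<eta> x + a k x * dd (v k) (dd (v k) \<eta>) x)) \<partial>lborel)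
      = (\<Sum>k\<in>I. \<integral>x. indicator ?K x * (u x * (dd (v k) (a k) x * dd (v k) \<eta> x + a k x * dd (v k) (dd (v k) \<eta>) x)) \<partial>lborel)"
      unfolding sum_distrib_left by (rule Bochner_Integration.integral_sum) (rule lim(3))
    moreover have "(\<lambda>n. \<Sum>k\<in>I. \<integral>x. \<eta> x * sdiff (ac k) (v k) (h n) uc x \<partial>lborel) \<longlonglongrightarrow>
      (\<Sum>k\<in>I. \<integral>x. indicator ?K x * (u x * (dd (v k) (a k) x * dd (v k) \<eta> x + a k x * dd (v k) (dd (v k) \<eta>) x)) \<partial>lborel)"
      by (rule tendsto_sum) (rule lim(1))
    ultimately show ?thesis by simp
  qed
  \<comment> \<open>The slope from \<open>semi\<close> is linear and thus serves both signs of the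
    step. \<open>C'\<close> dominates the slope along \<open>v k\<close> as well as the quadratic
    error.\<close>
  have low: "\<exists>D. \<forall>x n. x \<in> ?K \<longrightarrow> sdiff (ac k) (v k) (h n) uc x \<ge> - D" if k: "k \<in> I" for k
  proof -
    obtain M L where bML: "M \<ge> 0" "L \<ge> 0" "\<And>x h. x \<in> cball x0 (5*r/8) \<Longrightarrow> 0 < h \<Longrightarrow> h * norm (v k) \<le> r/8 \<Longrightarrow>
      a k (x + (h/2) *\<^sub>R v k) \<le> M \<and> a k (x - (h/2) *\<^sub>R v k) \<le> M \<and> \<bar>a k (x + (h/2) *\<^sub>R v k) - a k (x - (h/2) *\<^sub>R v k)\<bar> \<le> L * h"
      using coef_bounds[OF r a[OF k]] by metis
    define C' where "C' = C * norm (v k) + C * (norm (v k))\<^sup>2"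
    have p: "C * norm (v k) \<ge> 0" "C * (norm (v k))\<^sup>2 \<ge> 0" using C by auto
    have "sdiff (a k) (v k) (h n) u x \<ge> - (L * C' + 2 * M * C')" if x: "x \<in> ?K" for x n
    proof -
      obtain l where l: "linear l" "\<And>k. \<bar>l k\<bar> \<le> C * norm k"
        "\<And>k. x + k \<in> ball x0 r \<Longrightarrow> u x + l k - C * (norm k)\<^sup>2 \<le> u (x + k)" using semi[OF x] by blast
      have in2: "x + h n *\<^sub>R v k \<in> ?K2" "x - h n *\<^sub>R v k \<in> ?K2" "x + (h n/2) *\<^sub>R v k \<in> ?K2" "x - (h n/2) *\<^sub>R v k \<in> ?K2"
        using shift_cball4[OF x h0[of n] h1[OF k, of n], of "3*r/4"] r by auto
      have nn: "0 \<le> a k (x + (h n/2) *\<^sub>R v k)" "0 \<le> a k (x - (h n/2) *\<^sub>R v k)" using in2 K2(2) a0[OF k] by blast+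
      have x5: "x \<in> cball x0 (5*r/8)" using x r by auto
      note b = bML(3)[OF x5 h0 h1[OF k]]
      have qq: "C * (norm (v k))\<^sup>2 * (h n)\<^sup>2 \<le> C' * (h n)\<^sup>2" using p by (intro mult_right_mono) (auto simp: C'_def)
      have "u x + l (h n *\<^sub>R v k) - C * (norm (h n *\<^sub>R v k))\<^sup>2 \<le> u (x + h n *\<^sub>R v k)"
        by (rule l(3)) (use in2 K2(2) in blast)
      then have up: "u (x + h n *\<^sub>R v k) \<ge> u x + h n * l (v k) - C' * (h n)\<^sup>2"
        using qq by (simp add: linear_cmul[OF l(1)] power_mult_distrib mult.commute mult.left_commute)
      have "u x + l ((- h n) *\<^sub>R v k) - C * (norm ((- h n) *\<^sub>R v k))\<^sup>2 \<le> u (x + (- h n) *\<^sub>R v k)"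
        by (rule l(3)) (use in2 K2(2) in auto)
      then have dn: "u (x - h n *\<^sub>R v k) \<ge> u x - h n * l (v k) - C' * (h n)\<^sup>2"
        unfolding linear_cmul[OF l(1)] using qq by (simp add: power_mult_distrib mult.commute mult.left_commute)
      show ?thesis
        by (rule sdiff_lower[OF h0, where m = "l (v k)"]) (use nn b up dn l(2)[of "v k"] p in \<open>auto simp: C'_def\<close>)
    qed
    then show ?thesis using eqs[OF k] by (intro exI[of _ "L * C' + 2 * M * C'"]) simp
  qed
  then obtain D where D: "\<And>k x n. k \<in> I \<Longrightarrow> x \<in> ?K \<Longrightarrow> sdiff (ac k) (v k) (h n) uc x \<ge> - D k" by metis
  define E where "E = (\<Sum>k\<in>I. \<bar>D k\<bar>)"
  have LE: "Lu n x \<ge> - E" if x: "x \<in> ?K" for n x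
  proof -
    have "(\<Sum>k\<in>I. - \<bar>D k\<bar>) \<le> Lu n x" unfolding Lu_def
    proof (rule sum_mono)
      fix k assume "k \<in> I"
      from D[OF this x, of n] show "- \<bar>D k\<bar> \<le> sdiff (ac k) (v k) (h n) uc x" by linarith
    qed
    then show ?thesis by (simp add: E_def sum_negf)
  qed
  have m\<tau>: "\<tau>c \<in> borel_measurable borel" unfolding \<tau>c_def by (rule measurable_bounded_truncation(1)[OF \<tau> K(1) order_refl])
  obtain T where T: "T \<ge> 0" "\<And>x. \<bar>\<tau>c x\<bar> \<le> T"
    using measurable_bounded_truncation(2)[OF \<tau> K(1) order_refl] unfolding \<tau>c_def by blast
  have m\<eta>: "\<eta> \<in> borel_measurable borel" using Ck_on_cont[OF \<eta>] borel_measurable_continuous_onI by blast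
  obtain H where H: "H \<ge> 0" "\<And>x. \<bar>indicator ?K x * \<eta> x\<bar> \<le> H" using measurable_bounded_truncation(2)[OF Ck_on_cont[OF \<eta>] K(1)] by auto
  have H': "\<bar>\<eta> x\<bar> \<le> H" for x using H(2)[of x] H(1) \<eta>0[of x] by (cases "x \<in> ?K") auto
  have muc: "uc \<in> borel_measurable borel" unfolding uc_def by (rule measurable_bounded_truncation(1)[OF u K2])
  have mac: "ac k \<in> borel_measurable borel" if "k \<in> I" for k
    unfolding ac_def by (rule measurable_bounded_truncation(1)[OF Ck_on_cont[OF a[OF that]] K2])
  have mL: "Lu n \<in> borel_measurable borel" for n
    unfolding Lu_def
  proof (rule borel_measurable_sum)
    fix k assume k: "k \<in> I"
    note [measurable] = muc mac[OF k]
    show "(\<lambda>x. sdiff (ac k) (v k) (h n) uc x) \<in> borel_measurable borel" unfolding sdiff_def by measurable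
  qed
  have mg: "(\<lambda>x. \<eta> x * min (Lu n x) (\<tau>c x)) \<in> borel_measurable lborel" for n
  proof -
    note [measurable] = m\<eta> mL m\<tau>
    show ?thesis by measurable
  qed
  have E0: "E \<ge> 0" by (simp add: E_def sum_nonneg)
  have gb: "norm (\<eta> x * min (Lu n x) (\<tau>c x)) \<le> H * (E + T) * indicator ?K x" for n x
  proof (cases "x \<in> ?K")
    case True
    have "\<bar>min (Lu n x) (\<tau>c x)\<bar> \<le> E + T" using LE[OF True, of n] T(2)[of x] T(1) E0 by (auto simp: abs_le_iff min_def)
    then show ?thesis using H'[of x] H(1) True by (auto simp: abs_mult intro!: mult_mono)
  next
    case False
    then show ?thesis using \<eta>0 by simp
  qed
  have wint: "integrable lborel (\<lambda>x. H * (E + T) * indicator ?K x :: real)"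
    by (rule integrable_mult_right, rule integrable_real_indicator) (simp, rule emeasure_lborel_cball_finite)
  have gpw: "(\<lambda>n. \<eta> x * min (Lu n x) (\<tau>c x)) \<longlonglongrightarrow> \<eta> x * \<tau>c x" for x
  proof (cases "x \<in> ?K")
    case True
    obtain w W where w: "open W" "x \<in> W" "W \<subseteq> ball x0 r" "Ck_on 2 W w" "\<And>y. y \<in> W \<Longrightarrow> w y \<le> u y" "w x = u x"
      "\<tau> x \<le> (\<Sum>k\<in>I. dd (v k) (a k) x * dd (v k) w x + a k x * dd (v k) (dd (v k) w) x)"
      using supp[OF True] by blast
    define S where "S = (\<Sum>k\<in>I. dd (v k) (a k) x * dd (v k) w x + a k x * dd (v k) (dd (v k) w) x)"
    have hat: "filterlim h (at 0) sequentially"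
      by (rule filterlim_atI[OF h2]) (use h0 in \<open>auto intro!: always_eventually simp: less_imp_neq[symmetric]\<close>)
    have lw: "(\<lambda>n. \<Sum>k\<in>I. sdiff (a k) (v k) (h n) w x) \<longlonglongrightarrow> S"
      unfolding S_def
      by (intro tendsto_sum filterlim_compose[OF sdiff_tendsto[OF w(1,2,4) Ck_on_subset[OF a w(3)]] hat])
    have ev1: "\<forall>\<^sub>F n in sequentially. x + (c * h n) *\<^sub>R v k \<in> W" for c k
    proof -
      have "(\<lambda>n. x + (c * h n) *\<^sub>R v k) \<longlonglongrightarrow> x" by (rule filterlim_compose[OF tendsto_line hat])
      then show ?thesis using w(1,2) by (rule topological_tendstoD)
    qed
    have "\<forall>\<^sub>F n in sequentially. sdiff (a k) (v k) (h n) w x \<le> sdiff (a k) (v k) (h n) u x" if k: "k \<in> I" for k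
      using ev1[of 1 k] ev1[of "-1" k] ev1[of "1/2" k] ev1[of "-1/2" k]
    proof eventually_elim
      case (elim n)
      have nn: "0 \<le> a k (x + (h n/2) *\<^sub>R v k)" "0 \<le> a k (x - (h n/2) *\<^sub>R v k)"
        using elim(3,4) w(3) a0[OF k] by (auto simp: subset_eq)
      have le: "w (x + h n *\<^sub>R v k) \<le> u (x + h n *\<^sub>R v k)" "w (x - h n *\<^sub>R v k) \<le> u (x - h n *\<^sub>R v k)"
        using elim(1,2) w(5) by auto
      show ?case unfolding sdiff_def w(6)
        using nn le by (intro divide_right_mono add_mono mult_left_mono) auto
    qed
    then have "\<forall>\<^sub>F n in sequentially. \<forall>k\<in>I. sdiff (a k) (v k) (h n) w x \<le> sdiff (a k) (v k) (h n) u x"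
      using I by (simp add: eventually_ball_finite_distrib)
    then have ge: "\<forall>\<^sub>F n in sequentially. (\<Sum>k\<in>I. sdiff (a k) (v k) (h n) w x) \<le> Lu n x"
    proof eventually_elim
      case (elim n)
      then show ?case unfolding Lu_def by (intro sum_mono) (use eqs[OF _ True] in simp)
    qed
    \<comment> \<open>Squeezed between the minimum formed with the support function and
      \<open>\<tau>c x\<close> itself.\<close>
    have "(\<lambda>n. min (Lu n x) (\<tau>c x)) \<longlonglongrightarrow> \<tau>c x"
    proof (rule tendsto_sandwich[OF _ _ _ tendsto_const])
      show "\<forall>\<^sub>F n in sequentially. min (\<Sum>k\<in>I. sdiff (a k) (v k) (h n) w x) (\<tau>c x) \<le> min (Lu n x) (\<tau>c x)"
        using ge by eventually_elim auto
      show "\<forall>\<^sub>F n in sequentially. min (Lu n x) (\<tau>c x) \<le> \<tau>c x" by simp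
      have "(\<lambda>n. min (\<Sum>k\<in>I. sdiff (a k) (v k) (h n) w x) (\<tau>c x)) \<longlonglongrightarrow> min S (\<tau>c x)"
        by (intro tendsto_min lw tendsto_const)
      moreover have "min S (\<tau>c x) = \<tau>c x" using w(7) True by (simp add: S_def \<tau>c_def)
      ultimately show "(\<lambda>n. min (\<Sum>k\<in>I. sdiff (a k) (v k) (h n) w x) (\<tau>c x)) \<longlonglongrightarrow> \<tau>c x" by simp
    qed
    then show ?thesis by (intro tendsto_mult tendsto_const)
  next
    case False
    then show ?thesis using \<eta>0 by simp
  qed
  have mlim: "(\<lambda>x. \<eta> x * \<tau>c x) \<in> borel_measurable lborel" using m\<eta> m\<tau> by simp
  have glim: "(\<lambda>n. \<integral>x. \<eta> x * min (Lu n x) (\<tau>c x) \<partial>lborel) \<longlonglongrightarrow> (\<integral>x. \<eta> x * \<tau>c x \<partial>lborel)"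
    by (rule integral_dominated_convergence[OF mlim mg wint]) (use gpw gb in auto)
  have gint: "integrable lborel (\<lambda>x. \<eta> x * min (Lu n x) (\<tau>c x))" for n
    by (rule Bochner_Integration.integrable_bound[OF wint mg]) (rule AE_I2, subst (2) real_norm_def, rule order_trans[OF gb abs_ge_self])
  have "(\<integral>x. \<eta> x * \<tau>c x \<partial>lborel)
    \<le> (\<integral>x. indicator ?K x * (u x * (\<Sum>k\<in>I. dd (v k) (a k) x * dd (v k) \<eta> x + a k x * dd (v k) (dd (v k) \<eta>) x)) \<partial>lborel)"
  proof (rule LIMSEQ_le[OF glim limL], intro exI allI impI)
    fix n
    show "(\<integral>x. \<eta> x * min (Lu n x) (\<tau>c x) \<partial>lborel) \<le> (\<integral>x. \<eta> x * Lu n x \<partial>lborel)"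
      by (rule integral_mono[OF gint intL]) (use \<eta>p in \<open>auto intro: mult_left_mono\<close>)
  qed
  moreover have "(\<lambda>x. \<eta> x * \<tau>c x) = (\<lambda>x. indicator ?K x * (\<tau> x * \<eta> x))" by (auto simp: \<tau>c_def)
  ultimately show ?thesis by simp
qed

section \<open>Weak subsolutions from support functions\<close>

lemma local_laplacian_cong:
  assumes "open V" "x \<in> V" "\<And>y. y \<in> V \<Longrightarrow> w y = w' y"
  shows "local_laplacian F w x = local_laplacian F w' x"
proof -
  have 1: "dd (axis j 1) w z = dd (axis j 1) w' z" if "z \<in> V" for j z
    by (rule dd_cong[OF assms(1) that assms(3)])
  have "dd (axis i 1) (\<lambda>z. sqrt (det (first_ff F z)) * (\<Sum>j\<in>UNIV. matrix_inv (first_ff F z) $ i $ j * dd (axis j 1) w z)) x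
     = dd (axis i 1) (\<lambda>z. sqrt (det (first_ff F z)) * (\<Sum>j\<in>UNIV. matrix_inv (first_ff F z) $ i $ j * dd (axis j 1) w' z)) x" for i
    by (rule dd_cong[OF assms(1,2)]) (simp add: 1)
  then show ?thesis unfolding local_laplacian_def pderiv_at_eq by (simp only:)
qed

lemma dd_const: "dd v (\<lambda>x. c) x = 0"
  using dd_eqI[OF has_derivative_const] by simp

lemma local_laplacian_zero: "local_laplacian F (\<lambda>x. 0) x = 0"
  unfolding local_laplacian_def pderiv_at_eq by (simp add: dd_const)

lemma local_laplacian_add:
  assumes F: "immersion_on U F" and x: "x \<in> U" and w: "Ck_on 2 U w" and z: "Ck_on 2 U z"
  shows "local_laplacian F (\<lambda>y. w y + z y) x = local_laplacian F w x + local_laplacian F z x"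
proof -
  note U = immersion_onD(1)[OF F]
  obtain a b c where fr: "lap_frame F x a b c" using lap_frame_exists[OF F x] by blast
  have 1: "dd v (\<lambda>y. w y + z y) y = dd v w y + dd v z y" if "y \<in> U" for v y
    using dd_eqI[OF has_derivative_add[OF Ck_on_has_derivative[OF w _ that] Ck_on_has_derivative[OF z _ that]]] by simp
  have 2: "dd v (dd v' (\<lambda>y. w y + z y)) x = dd v (dd v' w) x + dd v (dd v' z) x" for v v'
  proof -
    have "dd v (dd v' (\<lambda>y. w y + z y)) x = dd v (\<lambda>y. dd v' w y + dd v' z y) x"
      by (rule dd_cong[OF U x 1])
    also have "\<dots> = dd v (dd v' w) x + dd v (dd v' z) x"
      using dd_eqI[OF has_derivative_add[OF Ck_on_has_derivative[OF C2_dd[OF w] _ x] Ck_on_has_derivative[OF C2_dd[OF z] _ x]]] by simp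
    finally show ?thesis .
  qed
  show ?thesis
    unfolding local_laplacian_frame[OF F x Ck_on_add[OF U w z] fr] local_laplacian_frame[OF F x w fr]
      local_laplacian_frame[OF F x z fr] 2 1[OF x] by simp
qed

lemma dd2_expand:
  fixes w :: "real^2 \<Rightarrow> real"
  assumes "open W" "x \<in> W" "Ck_on 2 W w"
  shows "dd v (dd v w) x = (v $ 1)\<^sup>2 * dd (axis 1 1) (dd (axis 1 1) w) x
    + 2 * (v $ 1 * v $ 2) * dd (axis 1 1) (dd (axis 2 1) w) x + (v $ 2)\<^sup>2 * dd (axis 2 1) (dd (axis 2 1) w) x"
  using bilinear_axis_expand[OF dd2_bilinear[OF assms], of v v] dd_commute[OF assms, of "axis 1 1" "axis 2 1"]
  by (simp add: sum_2 power2_eq_square algebra_simps)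

text \<open>Near a given point the divergence form operator is a sum of four one-dimensional ones with
  nonnegative coefficients: diagonalize at the point, then split off the small mixed term by means of
  \<open>2 \<gamma> v\<^sub>0 v\<^sub>1\<close> \<open>=\<close> \<open>\<gamma> / 2\<close> times the difference of the squares of \<open>v\<^sub>0 + v\<^sub>1\<close> and \<open>v\<^sub>0 - v\<^sub>1\<close>.\<close>

lemma direction_split:
  assumes F: "immersion_on U F" and x0: "x0 \<in> U"
  obtains r a and v :: "nat \<Rightarrow> real^2" where "r > 0" "ball x0 r \<subseteq> U"
    "\<And>k. k \<in> {0,1,2,3} \<Longrightarrow> Ck_on 1 (ball x0 r) (a k)" "\<And>k x. k \<in> {0,1,2,3} \<Longrightarrow> x \<in> ball x0 r \<Longrightarrow> 0 \<le> a k x"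
    "\<And>w W x. \<lbrakk>open W; x \<in> W; W \<subseteq> ball x0 r; Ck_on 2 W w\<rbrakk> \<Longrightarrow> sqrt (det (first_ff F x)) * local_laplacian F w x
      = (\<Sum>k\<in>{0,1,2,3}. dd (v k) (a k) x * dd (v k) w x + a k x * dd (v k) (dd (v k) w) x)"
proof -
  note U = immersion_onD(1)[OF F]
  have A: "Ck_on 1 U (lapA F i j)" for i j by (rule Ck_on_lapA[OF F])
  have Asym: "lapA F 2 1 x = lapA F 1 2 x" if "x \<in> U" for x
  proof -
    have ne: "det (first_ff F x) \<noteq> 0" using det_first_ff_pos[OF F that] by simp
    show ?thesis by (simp add: lapA_def matrix_inv_2[OF ne] first_ff_nth inner_commute)
  qed
  define D where "D = sqrt (det (first_ff F x0))"
  have dpos: "0 < det (first_ff F x0)" by (rule det_first_ff_pos[OF F x0])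
  then have D: "D > 0" "D * D = det (first_ff F x0)" by (simp_all add: D_def)
  have ne: "det (first_ff F x0) \<noteq> 0" using dpos by simp
  define g11 where "g11 = first_ff F x0 $ 1 $ 1"
  define g12 where "g12 = first_ff F x0 $ 1 $ 2"
  define g22 where "g22 = first_ff F x0 $ 2 $ 2"
  have det: "D * D = g11 * g22 - g12 * g12" unfolding D(2) by (simp add: det_2 g11_def g12_def g22_def first_ff_nth inner_commute)
  have DD: "det (first_ff F x0) = D * D" using D(2) by simp
  have A0: "lapA F 1 1 x0 = g22 / D" "lapA F 1 2 x0 = - g12 / D" "lapA F 2 2 x0 = g11 / D"
    using D(1) unfolding lapA_def D_def[symmetric]
    by (simp_all add: matrix_inv_2[OF ne] DD g11_def g12_def g22_def)
  have g11: "g11 > 0"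
  proof -
    have "g11 \<ge> 0" by (simp add: g11_def first_ff_nth)
    moreover have "g11 \<noteq> 0"
    proof
      assume "g11 = 0"
      then have "D * D = - (g12 * g12)" using det by simp
      moreover have "D * D > 0" using D(1) by simp
      moreover have "g12 * g12 \<ge> 0" by simp
      ultimately show False by linarith
    qed
    ultimately show ?thesis by simp
  qed
  \<comment> \<open>The shear for which the mixed coefficient vanishes at \<open>x0\<close>; it is
    frozen there, so that the directions are constant and only the coefficients vary. In the
    directions \<open>(1, 0)\<close> and \<open>(m, 1)\<close> the second-order part has
    coefficients \<alpha>, 2\<gamma> and \<beta>.\<close>
  define m where "m = - g12 / g11"
  define \<alpha> where "\<alpha> = (\<lambda>x. lapA F 1 1 x - 2 * m * lapA F 1 2 x + m\<^sup>2 * lapA F 2 2 x)"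
  define \<beta> where "\<beta> = lapA F 2 2"
  define \<gamma> where "\<gamma> = (\<lambda>x. lapA F 1 2 x - m * lapA F 2 2 x)"
  have \<gamma>0: "\<gamma> x0 = 0" using g11 by (simp add: \<gamma>_def A0 m_def)
  have \<beta>0: "\<beta> x0 > 0" using g11 D by (simp add: \<beta>_def A0)
  have \<alpha>0: "\<alpha> x0 = D / g11"
  proof -
    have "\<alpha> x0 * (g11 * D) = g22 * g11 - g12 * g12"
      using g11 D(1) by (simp add: \<alpha>_def A0 m_def power2_eq_square field_simps)
    also have "\<dots> = D * D" using det by (simp add: mult.commute)
    finally show ?thesis using g11 D(1) by (simp add: field_simps)
  qed
  then have \<alpha>p: "\<alpha> x0 > 0" using g11 D by simp
  \<comment> \<open>The amount \<open>s\<close> is taken from the two pure terms and returned along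
    \<open>v 2\<close> and \<open>v 3\<close>, the sum and the difference of \<open>v 0\<close> and
    \<open>v 1\<close>, where it outweighs \<gamma> of either sign. Since \<gamma> is 0 at
    \<open>x0\<close>, all four coefficients are positive near \<open>x0\<close>.\<close>
  define s where "s = min (\<alpha> x0) (\<beta> x0) / 2"
  have s: "s > 0" "s < \<alpha> x0" "s < \<beta> x0" using \<alpha>p \<beta>0 by (auto simp: s_def min_def)
  define a where "a = (\<lambda>k::nat. if k = 0 then (\<lambda>x. \<alpha> x - s) else if k = 1 then (\<lambda>x. \<beta> x - s)
      else if k = 2 then (\<lambda>x. (1/2) * (s + \<gamma> x)) else (\<lambda>x. (1/2) * (s - \<gamma> x)))"
  define v where "v = (\<lambda>k::nat. if k = 0 then vector [1, 0] else if k = 1 then vector [m, 1]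
      else if k = 2 then vector [1 + m, 1] else (vector [1 - m, -1] :: real^2))"
  have C: "Ck_on 1 U \<alpha>" "Ck_on 1 U \<beta>" "Ck_on 1 U \<gamma>"
    unfolding \<alpha>_def \<beta>_def \<gamma>_def by (intro Ck_on_add Ck_on_diff Ck_on_mult Ck_on_const A U)+
 have a_eq: "a 0 = (\<lambda>x. \<alpha> x - s)" "a 1 = (\<lambda>x. \<beta> x - s)" "a 2 = (\<lambda>x. (1/2) * (s + \<gamma> x))" "a 3 = (\<lambda>x. (1/2) * (s - \<gamma> x))"
    by (simp_all add: a_def)
  have Ca: "Ck_on 1 U (a k)" if "k \<in> {0,1,2,3}" for k
  proof -
    have "Ck_on 1 U (a 0)" "Ck_on 1 U (a 1)" "Ck_on 1 U (a 2)" "Ck_on 1 U (a 3)"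
      unfolding a_eq by (intro Ck_on_add Ck_on_diff Ck_on_mult Ck_on_const C U)+
    then show ?thesis using that by auto
  qed
  have apos: "a k x0 > 0" if "k \<in> {0,1,2,3}" for k
    using that s \<gamma>0 by (auto simp: a_def)
  have "\<exists>e>0. \<forall>y\<in>ball x0 e. y \<in> U \<and> 0 < a k y" if k: "k \<in> {0,1,2,3}" for k
  proof -
    have "open (U \<inter> a k -` {0<..})"
      using continuous_open_preimage[OF Ck_on_cont[OF Ca[OF k]] U, of "{0<..}"] by simp
    moreover have "x0 \<in> U \<inter> a k -` {0<..}" using apos[OF k] x0 by simp
    ultimately obtain e where "e > 0" "ball x0 e \<subseteq> U \<inter> a k -` {0<..}" using open_contains_ball by blast
    then show ?thesis by blast
  qed
  then obtain e where e: "\<And>k. k \<in> {0,1,2,3} \<Longrightarrow> e k > 0"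
    "\<And>k y. k \<in> {0,1,2,3} \<Longrightarrow> y \<in> ball x0 (e k) \<Longrightarrow> y \<in> U \<and> 0 < a k y" by metis
  define r where "r = min (min (e 0) (e 1)) (min (e 2) (e 3))"
  have r: "r > 0" using e(1) by (simp add: r_def)
  have sub: "ball x0 r \<subseteq> ball x0 (e k)" if "k \<in> {0,1,2,3}" for k
    using that by (auto simp: r_def)
  have rU: "ball x0 r \<subseteq> U" using sub[of 0] e(2)[of 0] by blast
  show thesis
  proof (rule that[of r a v])
    show "Ck_on 1 (ball x0 r) (a k)" if "k \<in> {0,1,2,3}" for k by (rule Ck_on_subset[OF Ca[OF that] rU])
    show "0 \<le> a k x" if "k \<in> {0,1,2,3}" "x \<in> ball x0 r" for k x
      using e(2)[OF that(1)] sub[OF that(1)] that(2) by (meson less_imp_le subsetD)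
    fix w :: "real^2 \<Rightarrow> real" and W x assume W: "open W" "x \<in> W" "W \<subseteq> ball x0 r" "Ck_on 2 W w"
    have xU: "x \<in> U" using W rU by blast
    have IW: "immersion_on W F" using W rU by (intro immersion_on_subset[OF F]) auto
    have Ad: "lapA F i j differentiable (at x)" for i j by (rule C1_diff[OF A xU])
    have Adf: "(lapA F i j has_derivative (\<lambda>v. dd v (lapA F i j) x)) (at x)" for i j
      using Ad by (simp add: frechet_derivative_works[symmetric])
    define A1 where "A1 i j = dd (axis 1 1) (lapA F i j) x" for i j
    define A2 where "A2 i j = dd (axis 2 1) (lapA F i j) x" for i j
    have dA: "dd u (lapA F i j) x = u $ 1 * A1 i j + u $ 2 * A2 i j" for i j and u :: "real^2"
      unfolding A1_def A2_def using dd_axis_expand[OF Ad, where v = u] by simp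
    have d\<alpha>: "dd u \<alpha> x = dd u (lapA F 1 1) x - 2 * m * dd u (lapA F 1 2) x + m\<^sup>2 * dd u (lapA F 2 2) x" for u
      unfolding \<alpha>_def by (rule dd_eqI) (auto intro!: derivative_eq_intros Adf)
    have d\<gamma>: "dd u \<gamma> x = dd u (lapA F 1 2) x - m * dd u (lapA F 2 2) x" for u
      unfolding \<gamma>_def by (rule dd_eqI) (auto intro!: derivative_eq_intros Adf)
    have C1d: "(\<alpha> has_derivative (\<lambda>v. dd v \<alpha> x)) (at x)" "(\<beta> has_derivative (\<lambda>v. dd v \<beta> x)) (at x)" "(\<gamma> has_derivative (\<lambda>v. dd v \<gamma> x)) (at x)"
      by (rule Ck_on_has_derivative[OF _ _ xU], rule C, simp)+
    have da: "dd u (a 0) x = dd u \<alpha> x" "dd u (a 1) x = dd u \<beta> x" "dd u (a 2) x = dd u \<gamma> x / 2" "dd u (a 3) x = - dd u \<gamma> x / 2" for u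
      unfolding a_eq by (rule trans[OF dd_eqI], (rule derivative_intros C1d)+, simp)+
    have dw: "dd u w x = u $ 1 * dd (axis 1 1) w x + u $ 2 * dd (axis 2 1) w x" for u
      using dd_axis_expand[OF C2_diff[OF W(4,2)], of u] by simp
    have A21: "A1 2 1 = A1 1 2" "A2 2 1 = A2 1 2"
      unfolding A1_def A2_def by (rule dd_cong[OF U xU Asym], assumption)+
    have w21: "dd (axis 2 1) (dd (axis 1 1) w) x = dd (axis 1 1) (dd (axis 2 1) w) x"
      by (rule dd_commute[OF W(1,2,4)])
    have vk: "v 0 $ 1 = 1" "v 0 $ 2 = 0" "v 1 $ 1 = m" "v 1 $ 2 = 1" "v 2 $ 1 = 1 + m" "v 2 $ 2 = 1" "v 3 $ 1 = 1 - m" "v 3 $ 2 = -1"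
      by (simp_all add: v_def)
    have ak: "a 0 x = lapA F 1 1 x - 2 * m * lapA F 1 2 x + m\<^sup>2 * lapA F 2 2 x - s" "a 1 x = lapA F 2 2 x - s"
      "a 2 x = (s + (lapA F 1 2 x - m * lapA F 2 2 x)) / 2" "a 3 x = (s - (lapA F 1 2 x - m * lapA F 2 2 x)) / 2"
      by (simp_all add: a_def \<alpha>_def \<beta>_def \<gamma>_def)
    have "sqrt (det (first_ff F x)) * local_laplacian F w x = (\<Sum>i\<in>UNIV. \<Sum>j\<in>UNIV. dd (axis i 1) (lapA F i j) x * dd (axis j 1) w x
      + lapA F i j x * dd (axis i 1) (dd (axis j 1) w) x)"
      unfolding local_laplacian_lapA[OF IW W(2,4)] using det_first_ff_pos[OF F xU] by simp
    also have "\<dots> = A1 1 1 * dd (axis 1 1) w x + A1 1 2 * dd (axis 2 1) w x + A2 1 2 * dd (axis 1 1) w x + A2 2 2 * dd (axis 2 1) w x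
      + (lapA F 1 1 x * dd (axis 1 1) (dd (axis 1 1) w) x + 2 * lapA F 1 2 x * dd (axis 1 1) (dd (axis 2 1) w) x + lapA F 2 2 x * dd (axis 2 1) (dd (axis 2 1) w) x)"
      using A21 by (simp add: sum_2 A1_def A2_def Asym[OF xU] w21)
    also have "\<dots> = (\<Sum>k\<in>{0,1,2,3}. dd (v k) (a k) x * dd (v k) w x + a k x * dd (v k) (dd (v k) w) x)"
    proof -
      have "(\<Sum>k\<in>{0,1,2,3}. dd (v k) (a k) x * dd (v k) w x + a k x * dd (v k) (dd (v k) w) x)
        = (dd (v 0) (a 0) x * dd (v 0) w x + a 0 x * dd (v 0) (dd (v 0) w) x) + (dd (v 1) (a 1) x * dd (v 1) w x + a 1 x * dd (v 1) (dd (v 1) w) x)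
        + (dd (v 2) (a 2) x * dd (v 2) w x + a 2 x * dd (v 2) (dd (v 2) w) x) + (dd (v 3) (a 3) x * dd (v 3) w x + a 3 x * dd (v 3) (dd (v 3) w) x)"
        by simp
      also have "\<dots> = A1 1 1 * dd (axis 1 1) w x + A1 1 2 * dd (axis 2 1) w x + A2 1 2 * dd (axis 1 1) w x + A2 2 2 * dd (axis 2 1) w x
      + (lapA F 1 1 x * dd (axis 1 1) (dd (axis 1 1) w) x + 2 * lapA F 1 2 x * dd (axis 1 1) (dd (axis 2 1) w) x + lapA F 2 2 x * dd (axis 2 1) (dd (axis 2 1) w) x)"
        unfolding da d\<alpha> d\<gamma> \<beta>_def dA dw[of "v 0"] dw[of "v 1"] dw[of "v 2"] dw[of "v 3"]
          dd2_expand[OF W(1,2,4), of "v 0"] dd2_expand[OF W(1,2,4), of "v 1"] dd2_expand[OF W(1,2,4), of "v 2"] dd2_expand[OF W(1,2,4), of "v 3"] vk ak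
        by (simp add: field_simps power2_eq_square)
      finally show ?thesis by simp
    qed
    finally show "sqrt (det (first_ff F x)) * local_laplacian F w x
      = (\<Sum>k\<in>{0,1,2,3}. dd (v k) (a k) x * dd (v k) w x + a k x * dd (v k) (dd (v k) w) x)" .
  qed (use r rU in auto)
qed

section \<open>Functions of class C2 on a surface\<close>

context immersed begin

text \<open>A larger class than that of \<open>test_function\<close>, because the pieces into which
  a test function will be cut are only twice continuously differentiable.\<close>

definition C2_fun :: "('a \<Rightarrow> real) \<Rightarrow> bool" where
  "C2_fun f \<longleftrightarrow> (\<forall>(U,\<phi>)\<in>params S. Ck_on 2 U (f \<circ> \<phi>))"

lemma C2_funD: "C2_fun f \<Longrightarrow> (U, \<phi>) \<in> params S \<Longrightarrow> Ck_on 2 U (f \<circ> \<phi>)"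
  by (auto simp: C2_fun_def)

lemma continuous_map_charts:
  fixes g :: "'a \<Rightarrow> 'b::topological_space"
  assumes "\<And>U \<phi>. (U, \<phi>) \<in> params S \<Longrightarrow> continuous_on U (g \<circ> \<phi>)"
  shows "continuous_map (topo S) euclidean g"
  unfolding continuous_map_openin_preimage_eq
proof (intro conjI allI impI)
  fix G :: "'b set" assume "openin euclidean G"
  then have G: "open G" by simp
  show "openin (topo S) (pts S \<inter> g -` G)"
  proof (subst openin_subopen, intro ballI)
    fix p assume p: "p \<in> pts S \<inter> g -` G"
    then obtain U \<phi> where c: "(U, \<phi>) \<in> params S" "p \<in> \<phi> ` U" using chart_cover[of p] by blast
    have o: "open (U \<inter> (g \<circ> \<phi>) -` G)"
      by (rule continuous_open_preimage[OF assms[OF c(1)] chartD(1)[OF c(1)] G])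
    have "openin (topo S) (\<phi> ` (U \<inter> (g \<circ> \<phi>) -` G))" by (rule chart_open_image[OF c(1) o]) auto
    moreover have "p \<in> \<phi> ` (U \<inter> (g \<circ> \<phi>) -` G)" using c(2) p by auto
    moreover have "\<phi> ` (U \<inter> (g \<circ> \<phi>) -` G) \<subseteq> pts S \<inter> g -` G" using chart_subset[OF c(1)] by auto
    ultimately show "\<exists>T. openin (topo S) T \<and> p \<in> T \<and> T \<subseteq> pts S \<inter> g -` G" by blast
  qed
qed auto

lemma continuous_map_measurable:
  fixes g :: "'a \<Rightarrow> real"
  assumes "continuous_map (topo S) euclidean g"
  shows "g \<in> borel_measurable borelS"
proof (rule borel_measurableI)
  fix G :: "real set" assume "open G"
  then have "openin (topo S) {p \<in> pts S. g p \<in> G}"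
    using openin_continuous_map_preimage[OF assms, of G] by simp
  moreover have "g -` G \<inter> space borelS = {p \<in> pts S. g p \<in> G}" by auto
  ultimately show "g -` G \<inter> space borelS \<in> sets borelS" using open_borelS by simp
qed

lemma C2_fun_continuous: "C2_fun f \<Longrightarrow> continuous_map (topo S) euclidean f"
  using continuous_map_charts[of f] Ck_on_cont C2_funD by blast

lemma laplacian_chart_C2:
  "C2_fun f \<Longrightarrow> (U, \<phi>) \<in> params S \<Longrightarrow> x \<in> U \<Longrightarrow> laplacian S f (\<phi> x) = local_laplacian (pos S \<circ> \<phi>) (f \<circ> \<phi>) x"
  using laplacian_chart[OF _ chartD(1) order_refl _ C2_funD] by blast

lemma laplacian_continuous:
  assumes f: "C2_fun f"
  shows "continuous_map (topo S) euclidean (laplacian S f)"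
proof (rule continuous_map_charts)
  fix U \<phi> assume c: "(U, \<phi>) \<in> params S"
  have "continuous_on U (local_laplacian (pos S \<circ> \<phi>) (f \<circ> \<phi>))"
    by (rule continuous_on_local_laplacian[OF chart_immersion[OF c] C2_funD[OF f c]])
  then show "continuous_on U (laplacian S f \<circ> \<phi>)"
    using laplacian_chart_C2[OF f c] by (subst continuous_on_cong[OF refl]) auto
qed

lemma laplacian_zero:
  assumes f: "C2_fun f" and G: "openin (topo S) G" "p \<in> G" and 0: "\<And>q. q \<in> G \<Longrightarrow> f q = 0"
  shows "laplacian S f p = 0"
proof -
  have "p \<in> pts S" using G openin_subset by blast
  then obtain U \<phi> x where c: "(U, \<phi>) \<in> params S" "x \<in> U" "p = \<phi> x" using chart_cover by blast
  have o: "open (U \<inter> \<phi> -` G)" by (rule chart_open_preimage[OF c(1) G(1)])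
  have "local_laplacian (pos S \<circ> \<phi>) (f \<circ> \<phi>) x = local_laplacian (pos S \<circ> \<phi>) (\<lambda>x. 0) x"
    by (rule local_laplacian_cong[OF o]) (use c G 0 in auto)
  then show ?thesis using laplacian_chart_C2[OF f c(1,2)] c(3) local_laplacian_zero by simp
qed

lemma C2_fun_add: "C2_fun f \<Longrightarrow> C2_fun g \<Longrightarrow> C2_fun (\<lambda>p. f p + g p)"
  using Ck_on_add[OF chartD(1)] by (fastforce simp: C2_fun_def comp_def)

lemma C2_fun_const: "C2_fun (\<lambda>p. c)"
  using Ck_on_const[OF chartD(1)] by (fastforce simp: C2_fun_def comp_def)

lemma C2_fun_sum: "(\<And>i. i \<in> I \<Longrightarrow> C2_fun (f i)) \<Longrightarrow> C2_fun (\<lambda>p. \<Sum>i\<in>I. f i p)"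
  by (induction I rule: infinite_finite_induct) (simp_all add: C2_fun_const C2_fun_add)

lemma laplacian_add:
  assumes "C2_fun f" "C2_fun g" "p \<in> pts S"
  shows "laplacian S (\<lambda>p. f p + g p) p = laplacian S f p + laplacian S g p"
proof -
  obtain U \<phi> x where c: "(U, \<phi>) \<in> params S" "x \<in> U" "p = \<phi> x" using chart_cover[OF assms(3)] by blast
  have "(\<lambda>p. f p + g p) \<circ> \<phi> = (\<lambda>y. (f \<circ> \<phi>) y + (g \<circ> \<phi>) y)" by auto
  then show ?thesis
    using local_laplacian_add[OF chart_immersion[OF c(1)] c(2) C2_funD[OF assms(1) c(1)] C2_funD[OF assms(2) c(1)]]
    unfolding c(3) laplacian_chart_C2[OF assms(1) c(1,2)] laplacian_chart_C2[OF assms(2) c(1,2)]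
      laplacian_chart_C2[OF C2_fun_add[OF assms(1,2)] c(1,2)] by simp
qed

lemma laplacian_sum:
  assumes "finite I" "\<And>i. i \<in> I \<Longrightarrow> C2_fun (f i)" "p \<in> pts S"
  shows "laplacian S (\<lambda>p. \<Sum>i\<in>I. f i p) p = (\<Sum>i\<in>I. laplacian S (f i) p)"
  using assms(1,2)
proof (induction I rule: finite_induct)
  case empty
  show ?case using laplacian_zero[OF C2_fun_const[of 0], of "pts S" p] assms(3) by simp
next
  case (insert i I)
  then show ?case using laplacian_add[OF _ C2_fun_sum assms(3), of "f i" I f] by simp
qed

lemma chart_compact_image:
  assumes c: "(U, \<phi>) \<in> params S" and K: "compact K" "K \<subseteq> U"
  shows "compactin (topo S) (\<phi> ` K)"
proof -
  have "compactin (top_of_set U) K" using K by (simp add: compactin_subtopology)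
  then show ?thesis by (rule image_compactin[OF _ chart_continuous[OF c]])
qed

lemma compactin_open_complement: "compactin (topo S) K \<Longrightarrow> openin (topo S) (pts S - K)"
  using smooth_surface compactin_imp_closedin[of "topo S" K] unfolding smooth_surface_def by blast

definition bump :: "(real^2) set \<Rightarrow> (real^2 \<Rightarrow> 'a) \<Rightarrow> real^2 \<Rightarrow> real \<Rightarrow> 'a \<Rightarrow> real" where
  "bump U \<phi> x0 r p = (if p \<in> \<phi> ` U then max 0 (r\<^sup>2 - (inv_into U \<phi> p - x0) \<bullet> (inv_into U \<phi> p - x0)) ^ 3 else 0)"

text \<open>In another chart the function is a composition with the transition map on the overlap,
  and zero off the image of the closed ball. That image is compact, hence closed in the Hausdorff
  surface, so the two regions are open and cover the chart.\<close>

lemma bump: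
  assumes c: "(U, \<phi>) \<in> params S" and r: "r > 0" "cball x0 r \<subseteq> U"
  shows "C2_fun (bump U \<phi> x0 r)" "\<And>p. 0 \<le> bump U \<phi> x0 r p" "\<And>p. p \<notin> \<phi> ` cball x0 r \<Longrightarrow> bump U \<phi> x0 r p = 0"
    "\<And>p. p \<in> \<phi> ` ball x0 r \<Longrightarrow> 0 < bump U \<phi> x0 r p"
proof -
  have val: "bump U \<phi> x0 r (\<phi> x) = max 0 (r\<^sup>2 - (dist x x0)\<^sup>2) ^ 3" if "x \<in> U" for x
    using that inv_into_f_f[OF chart_inj[OF c] that] by (simp add: bump_def dist_norm dot_square_norm)
  show nn: "0 \<le> bump U \<phi> x0 r p" for p by (simp add: bump_def)
  show out: "bump U \<phi> x0 r p = 0" if "p \<notin> \<phi> ` cball x0 r" for p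
  proof (cases "p \<in> \<phi> ` U")
    case True
    then obtain x where x: "x \<in> U" "p = \<phi> x" by blast
    then have "r < dist x x0" using that by (force simp: dist_commute)
    then have "r\<^sup>2 \<le> (dist x x0)\<^sup>2" using r by (intro power_mono) auto
    then show ?thesis using val[OF x(1)] x(2) by (simp add: max_absorb1)
  qed (simp add: bump_def)
  show "0 < bump U \<phi> x0 r p" if p: "p \<in> \<phi> ` ball x0 r" for p
  proof -
    obtain x where x: "x \<in> ball x0 r" "p = \<phi> x" using p by blast
    have "(dist x x0)\<^sup>2 < r\<^sup>2" using x r by (intro power_strict_mono) (auto simp: dist_commute)
    moreover have "x \<in> U" using x(1) r(2) ball_subset_cball by blast
    ultimately show ?thesis using val[of x] x(2) by (simp add: max_absorb2)
  qed
  show "C2_fun (bump U \<phi> x0 r)"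
    unfolding C2_fun_def
  proof (safe)
    fix V \<psi> assume d: "(V, \<psi>) \<in> params S"
    define \<theta> where "\<theta> = inv_into U \<phi> \<circ> \<psi>"
    define W where "W = V \<inter> \<psi> -` (\<phi> ` U)"
    note tr = transition[OF d c, folded \<theta>_def W_def]
    define Q where "Q = V \<inter> \<psi> -` (pts S - \<phi> ` cball x0 r)"
    have Q: "open Q" unfolding Q_def
      by (rule chart_open_preimage[OF d compactin_open_complement[OF chart_compact_image[OF c compact_cball r(2)]]])
    have 1: "Ck_on 2 W (bump U \<phi> x0 r \<circ> \<psi>)"
    proof (rule Ck_on_cong[OF tr(1)])
      have "Ck_on 2 W (\<lambda>y. r\<^sup>2 - (\<theta> y - x0) \<bullet> (\<theta> y - x0))"
        by (intro Ck_on_diff Ck_on_inner Ck_on_const smooth_on_Ck[OF tr(2)] tr(1))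
      from Ck_on_compose[OF tr(1) _ C2_on_pos_part_cube this]
      show "Ck_on 2 W (\<lambda>y. max 0 (r\<^sup>2 - (\<theta> y - x0) \<bullet> (\<theta> y - x0)) ^ 3)" by simp
      show "max 0 (r\<^sup>2 - (\<theta> y - x0) \<bullet> (\<theta> y - x0)) ^ 3 = (bump U \<phi> x0 r \<circ> \<psi>) y" if "y \<in> W" for y
        using that by (auto simp: bump_def \<theta>_def W_def)
    qed
    have 2: "Ck_on 2 Q (bump U \<phi> x0 r \<circ> \<psi>)"
      by (rule Ck_on_cong[OF Q _ Ck_on_const[OF Q, of 2 0]]) (simp add: out Q_def)
    show "Ck_on 2 V (bump U \<phi> x0 r \<circ> \<psi>)"
    proof (rule Ck_on_local)
      fix y assume y: "y \<in> V"
      show "\<exists>V. open V \<and> y \<in> V \<and> Ck_on 2 V (bump U \<phi> x0 r \<circ> \<psi>)"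
      proof (cases "\<psi> y \<in> \<phi> ` U")
        case True
        then show ?thesis using 1 tr(1) y by (auto simp: W_def)
      next
        case False
        then have "y \<in> Q" using y r(2) chart_in_pts[OF d y] by (auto simp: Q_def)
        then show ?thesis using 2 Q by blast
      qed
    qed
  qed
qed

end

section \<open>Localization in charts and partition of unity\<close>

context immersed begin

text \<open>A form of local semiconvexity that supplies at every point a slope \<open>l\<close>
  valid for steps of both signs, with constants uniform on a ball: what \<open>sdiff_lower\<close>
  consumes.\<close>

definition semiconvex_chart :: "('a \<Rightarrow> real) \<Rightarrow> (real^2) set \<Rightarrow> (real^2 \<Rightarrow> 'a) \<Rightarrow> real^2 \<Rightarrow> bool" where
  "semiconvex_chart u U \<phi> x0 \<longleftrightarrow> (\<exists>r>0. \<exists>C\<ge>0. ball x0 r \<subseteq> U \<and> (\<forall>x\<in>ball x0 r. \<exists>l. linear l \<and>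
      (\<forall>k. \<bar>l k\<bar> \<le> C * norm k) \<and>
      (\<forall>k. x + k \<in> ball x0 r \<longrightarrow> u (\<phi> x) + l k - C * (norm k)\<^sup>2 \<le> u (\<phi> (x + k)))))"

text \<open>Subsolution in the barrier sense of Calabi, without an error term: the function touching
  from below may depend on the point, and its Laplacian is estimated only there.\<close>

definition lower_support :: "('a \<Rightarrow> real) \<Rightarrow> real \<Rightarrow> (real^2) set \<Rightarrow> (real^2 \<Rightarrow> 'a) \<Rightarrow> real^2 \<Rightarrow> bool" where
  "lower_support u l U \<phi> x \<longleftrightarrow> (\<exists>w W. open W \<and> x \<in> W \<and> W \<subseteq> U \<and> Ck_on 2 W w \<and>
      (\<forall>y\<in>W. w y \<le> u (\<phi> y)) \<and> w x = u (\<phi> x) \<and> l * u (\<phi> x) \<le> local_laplacian (pos S \<circ> \<phi>) w x)"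

text \<open>Multiplication by the area density turns the Laplacian into the divergence form split by
  \<open>direction_split\<close>, so \<open>weak_inequality_planar\<close> applies to test functions
  supported in a small ball. Integrability is recorded because the local integrals are to be added
  later.\<close>

lemma weak_inequality_chart:
  assumes c: "(U, \<phi>) \<in> params S" and x0: "x0 \<in> U" and u: "continuous_map (topo S) euclidean u"
    and semi: "semiconvex_chart u U \<phi> x0" and supp: "\<And>x. x \<in> U \<Longrightarrow> lower_support u l U \<phi> x"
  obtains \<rho> where "\<rho> > 0" "cball x0 \<rho> \<subseteq> U"
    "\<And>f. \<lbrakk>C2_fun f; \<And>p. 0 \<le> f p; \<And>p. p \<notin> \<phi> ` cball x0 \<rho> \<Longrightarrow> f p = 0\<rbrakk> \<Longrightarrow>
      integrable (area_measure S) (\<lambda>p. u p * f p) \<and> integrable (area_measure S) (\<lambda>p. u p * laplacian S f p) \<and>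
      l * (\<integral>p. u p * f p \<partial>area_measure S) \<le> (\<integral>p. u p * laplacian S f p \<partial>area_measure S)"
proof -
  note I = chart_immersion[OF c]
  obtain r1 a and v :: "nat \<Rightarrow> real^2" where split: "r1 > 0" "ball x0 r1 \<subseteq> U"
    "\<And>k. k \<in> {0,1,2,3} \<Longrightarrow> Ck_on 1 (ball x0 r1) (a k)" "\<And>k x. k \<in> {0,1,2,3} \<Longrightarrow> x \<in> ball x0 r1 \<Longrightarrow> 0 \<le> a k x"
    "\<And>w W x. \<lbrakk>open W; x \<in> W; W \<subseteq> ball x0 r1; Ck_on 2 W w\<rbrakk> \<Longrightarrow> vol \<phi> x * local_laplacian (pos S \<circ> \<phi>) w x
      = (\<Sum>k\<in>{0,1,2,3}. dd (v k) (a k) x * dd (v k) w x + a k x * dd (v k) (dd (v k) w) x)"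
    using direction_split[OF I x0] by blast
  obtain r2 C where sc: "r2 > 0" "C \<ge> 0" "ball x0 r2 \<subseteq> U"
    "\<And>x. x \<in> ball x0 r2 \<Longrightarrow> \<exists>l. linear l \<and> (\<forall>k. \<bar>l k\<bar> \<le> C * norm k) \<and>
      (\<forall>k. x + k \<in> ball x0 r2 \<longrightarrow> u (\<phi> x) + l k - C * (norm k)\<^sup>2 \<le> u (\<phi> (x + k)))"
    using semi unfolding semiconvex_chart_def by blast
  define r where "r = min r1 r2"
  have r: "r > 0" "ball x0 r \<subseteq> ball x0 r1" "ball x0 r \<subseteq> ball x0 r2" "ball x0 r \<subseteq> U"
    using split(1,2) sc(1) by (auto simp: r_def)
  let ?K = "cball x0 (r/2)" and ?I = "{0,1,2,3::nat}"
  have K: "compact ?K" "?K \<subseteq> ball x0 r" "?K \<subseteq> U" using r by auto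
  have uc: "continuous_on U (u \<circ> \<phi>)"
    using continuous_map_compose[OF chart_continuous[OF c] u] by simp
  note oU = chartD(1)[OF c]
  show thesis
  proof (rule that[of "r/2"])
    show "r/2 > 0" "?K \<subseteq> U" using r K by auto
    fix f assume f: "C2_fun f" and f0: "\<And>p. 0 \<le> f p" and fout: "\<And>p. p \<notin> \<phi> ` ?K \<Longrightarrow> f p = 0"
    \<comment> \<open>Coordinate expression of \<open>f\<close>, extended by 0 because the planar
      inequality is tested with functions on the whole plane.\<close>
    define \<eta> where "\<eta> = (\<lambda>x. if x \<in> ball x0 r then f (\<phi> x) else 0)"
    have fK: "f (\<phi> x) = 0" if "x \<in> U" "x \<notin> ?K" for x
    proof (rule fout)
      show "\<phi> x \<notin> \<phi> ` ?K" using that inj_onD[OF chart_inj[OF c]] K(3) by blast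
    qed
    have \<eta>f: "\<eta> x = f (\<phi> x)" if "x \<in> U" for x
    proof (cases "x \<in> ball x0 r")
      case False
      then have "x \<notin> ?K" using K(2) by blast
      then show ?thesis using fK[OF that] False by (simp add: \<eta>_def)
    qed (simp add: \<eta>_def)
    have \<eta>0: "\<eta> x = 0" if "x \<notin> ?K" for x using fK[of x] that r(4) by (auto simp: \<eta>_def)
    have \<eta>p: "0 \<le> \<eta> x" for x using f0 by (simp add: \<eta>_def)
    have f2: "Ck_on 2 U (f \<circ> \<phi>)" by (rule C2_funD[OF f c])
    have \<eta>2: "Ck_on 2 UNIV \<eta>"
    proof (rule Ck_on_local)
      fix x :: "real^2"
      have 1: "Ck_on 2 (ball x0 r) \<eta>"
        by (rule Ck_on_cong[OF open_ball _ Ck_on_subset[OF f2 r(4)]]) (use r(4) \<eta>f in auto)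
      have o: "open (- ?K)" by auto
      have 2: "Ck_on 2 (- ?K) \<eta>" by (rule Ck_on_cong[OF o _ Ck_on_const[OF o, of 2 0]]) (use \<eta>0 in auto)
      show "\<exists>V. open V \<and> x \<in> V \<and> Ck_on 2 V \<eta>"
        using 1 2 o K(2) by (cases "x \<in> ?K") (blast intro: open_ball)+
    qed
    have lapf: "laplacian S f (\<phi> x) = local_laplacian (pos S \<circ> \<phi>) \<eta> x" if "x \<in> U" for x
      unfolding laplacian_chart_C2[OF f c that]
      by (rule local_laplacian_cong[OF oU that]) (use \<eta>f in auto)
    have lapout: "local_laplacian (pos S \<circ> \<phi>) \<eta> x = 0" if "x \<notin> ?K" for x
    proof -
      have "local_laplacian (pos S \<circ> \<phi>) \<eta> x = local_laplacian (pos S \<circ> \<phi>) (\<lambda>x. 0) x"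
        by (rule local_laplacian_cong[of "- ?K"]) (use that \<eta>0 in auto)
      then show ?thesis using local_laplacian_zero by simp
    qed
    have lap_off: "laplacian S f p = 0" if p: "p \<in> pts S" "p \<notin> \<phi> ` U" for p
    proof (rule laplacian_zero[OF f compactin_open_complement[OF chart_compact_image[OF c K(1,3)]]])
      show "p \<in> pts S - \<phi> ` ?K" using p K(3) by blast
      show "f q = 0" if "q \<in> pts S - \<phi> ` ?K" for q using fout that by blast
    qed
    have mu: "u \<in> borel_measurable borelS" by (rule continuous_map_measurable[OF u])
    have mf: "(\<lambda>p. u p * f p) \<in> borel_measurable borelS"
      by (rule borel_measurable_times[OF mu continuous_map_measurable[OF C2_fun_continuous[OF f]]])
    have ml: "(\<lambda>p. u p * laplacian S f p) \<in> borel_measurable borelS"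
      by (rule borel_measurable_times[OF mu continuous_map_measurable[OF laplacian_continuous[OF f]]])
    have z1: "u p * f p = 0" if "p \<in> pts S" "p \<notin> \<phi> ` U" for p using fout[of p] that K(3) by auto
    have z2: "u p * laplacian S f p = 0" if "p \<in> pts S" "p \<notin> \<phi> ` U" for p using lap_off that by simp
    have e1: "(\<lambda>x. indicator U x * (vol \<phi> x * (u (\<phi> x) * f (\<phi> x)))) = (\<lambda>x. indicator ?K x * (vol \<phi> x * u (\<phi> x) * \<eta> x))"
      using fK \<eta>f K(3) by (fastforce simp: indicator_def)
    have e2: "(\<lambda>x. indicator U x * (vol \<phi> x * (u (\<phi> x) * laplacian S f (\<phi> x))))
      = (\<lambda>x. indicator ?K x * (u (\<phi> x) * (\<Sum>k\<in>?I. dd (v k) (a k) x * dd (v k) \<eta> x + a k x * dd (v k) (dd (v k) \<eta>) x)))"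
    proof (rule ext)
      fix x
      show "indicator U x * (vol \<phi> x * (u (\<phi> x) * laplacian S f (\<phi> x)))
        = indicator ?K x * (u (\<phi> x) * (\<Sum>k\<in>?I. dd (v k) (a k) x * dd (v k) \<eta> x + a k x * dd (v k) (dd (v k) \<eta>) x))"
      proof (cases "x \<in> ?K")
        case True
        then have x: "x \<in> U" "x \<in> ball x0 r1" using K(2,3) r(2) by blast+
        have "vol \<phi> x * local_laplacian (pos S \<circ> \<phi>) \<eta> x
          = (\<Sum>k\<in>?I. dd (v k) (a k) x * dd (v k) \<eta> x + a k x * dd (v k) (dd (v k) \<eta>) x)"
          by (rule split(5)[OF open_ball x(2) order_refl Ck_on_subset[OF \<eta>2 subset_UNIV]])
        then show ?thesis using True x lapf[OF x(1)] by (simp del: sum.insert)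
      next
        case False
        then show ?thesis using lapf[of x] lapout[of x] by (simp add: indicator_def)
      qed
    qed
    have cont_vu: "continuous_on U (\<lambda>x. vol \<phi> x * u (\<phi> x) * \<eta> x)"
      using uc by (intro continuous_intros vol_continuous[OF c] continuous_on_subset[OF Ck_on_cont[OF \<eta>2]]) (auto simp: comp_def)
    have cont_lap: "continuous_on U (\<lambda>x. vol \<phi> x * (u (\<phi> x) * local_laplacian (pos S \<circ> \<phi>) \<eta> x))"
      using uc by (intro continuous_intros vol_continuous[OF c] continuous_on_local_laplacian[OF I Ck_on_subset[OF \<eta>2]]) (auto simp: comp_def)
    have intg: "integrable lborel (\<lambda>x. indicator ?K x * g x)" if g: "continuous_on U g" for g :: "real^2 \<Rightarrow> real"
    proof -
      obtain B where "\<And>x. \<bar>indicator ?K x * g x\<bar> \<le> B" using measurable_bounded_truncation(2)[OF g K(1,3)] by blast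
      then show ?thesis
        by (rule integrable_bounded_support[OF measurable_bounded_truncation(1)[OF g K(1,3)], of B x0 "r/2"]) auto
    qed
    have e3: "(\<lambda>x. indicator U x * (vol \<phi> x * (u (\<phi> x) * laplacian S f (\<phi> x))))
      = (\<lambda>x. indicator ?K x * (vol \<phi> x * (u (\<phi> x) * local_laplacian (pos S \<circ> \<phi>) \<eta> x)))"
      using lapf lapout K(3) by (fastforce simp: indicator_def)
    have i1: "integrable (area_measure S) (\<lambda>p. u p * f p)"
      by (rule integral_area_chart(2)[OF c mf z1, THEN iffD2]) (assumption | simp only: e1 intg[OF cont_vu])+
    have i2: "integrable (area_measure S) (\<lambda>p. u p * laplacian S f p)"
      by (rule integral_area_chart(2)[OF c ml z2, THEN iffD2]) (assumption | simp only: e3 intg[OF cont_lap])+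
    have v1: "(\<integral>p. u p * f p \<partial>area_measure S) = (\<integral>x. indicator ?K x * (vol \<phi> x * u (\<phi> x) * \<eta> x) \<partial>lborel)"
      by (rule trans[OF integral_area_chart(1)[OF c mf z1]]) (assumption | simp only: e1)+
    have v2: "(\<integral>p. u p * laplacian S f p \<partial>area_measure S)
      = (\<integral>x. indicator ?K x * (u (\<phi> x) * (\<Sum>k\<in>?I. dd (v k) (a k) x * dd (v k) \<eta> x + a k x * dd (v k) (dd (v k) \<eta>) x)) \<partial>lborel)"
      by (rule trans[OF integral_area_chart(1)[OF c ml z2]]) (assumption | simp only: e2)+
    have m1: "(\<integral>x. indicator ?K x * ((l * (vol \<phi> x * u (\<phi> x))) * \<eta> x) \<partial>lborel)
      \<le> (\<integral>x. indicator ?K x * (u (\<phi> x) * (\<Sum>k\<in>?I. dd (v k) (a k) x * dd (v k) \<eta> x + a k x * dd (v k) (dd (v k) \<eta>) x)) \<partial>lborel)"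
    proof (rule weak_inequality_planar[OF r(1), where C = C])
      show "finite ?I" by simp
      show "Ck_on 1 (ball x0 r) (a k)" if "k \<in> ?I" for k by (rule Ck_on_subset[OF split(3)[OF that] r(2)])
      show "0 \<le> a k x" if "k \<in> ?I" "x \<in> ball x0 r" for k x by (rule split(4)[OF that(1)]) (use r(2) that(2) in blast)
      show "continuous_on (ball x0 r) (\<lambda>x. u (\<phi> x))" using continuous_on_subset[OF uc r(4)] by (simp add: comp_def)
      show "\<exists>l. linear l \<and> (\<forall>k. \<bar>l k\<bar> \<le> C * norm k) \<and> (\<forall>k. x + k \<in> ball x0 r \<longrightarrow> u (\<phi> x) + l k - C * (norm k)\<^sup>2 \<le> u (\<phi> (x + k)))"
        if x: "x \<in> ?K" for x
      proof -
        have "x \<in> ball x0 r2" using x K(2) r(3) by blast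
        from sc(4)[OF this] obtain l where l: "linear l" "\<forall>k. \<bar>l k\<bar> \<le> C * norm k"
          "\<forall>k. x + k \<in> ball x0 r2 \<longrightarrow> u (\<phi> x) + l k - C * (norm k)\<^sup>2 \<le> u (\<phi> (x + k))" by blast
        have "\<forall>k. x + k \<in> ball x0 r \<longrightarrow> u (\<phi> x) + l k - C * (norm k)\<^sup>2 \<le> u (\<phi> (x + k))" using l(3) r(3) by blast
        then show ?thesis using l by blast
      qed
      show "C \<ge> 0" by (rule sc(2))
      show "continuous_on ?K (\<lambda>x. l * (vol \<phi> x * u (\<phi> x)))"
      proof -
        have "continuous_on ?K (\<lambda>x. u (\<phi> x))" using continuous_on_subset[OF uc K(3)] by (simp add: comp_def)
        then show ?thesis
          by (intro continuous_on_mult continuous_on_const continuous_on_subset[OF vol_continuous[OF c] K(3)])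
      qed
      fix x assume x: "x \<in> ?K"
      then have xU: "x \<in> U" using K(3) by blast
      obtain w W where w: "open W" "x \<in> W" "W \<subseteq> U" "Ck_on 2 W w" "\<And>y. y \<in> W \<Longrightarrow> w y \<le> u (\<phi> y)" "w x = u (\<phi> x)"
        "l * u (\<phi> x) \<le> local_laplacian (pos S \<circ> \<phi>) w x"
        using supp[OF xU] unfolding lower_support_def by blast
      define W' where "W' = W \<inter> ball x0 r"
      have W': "open W'" "x \<in> W'" "W' \<subseteq> ball x0 r" "Ck_on 2 W' w"
        using w x K(2) Ck_on_subset[OF w(4), of W'] by (auto simp: W'_def)
      have W'1: "W' \<subseteq> ball x0 r1" using W'(3) r(2) by blast
      have "l * (vol \<phi> x * u (\<phi> x)) = vol \<phi> x * (l * u (\<phi> x))" by simp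
      also have "\<dots> \<le> vol \<phi> x * local_laplacian (pos S \<circ> \<phi>) w x"
        using w(7) vol_pos[OF c xU] by (intro mult_left_mono) auto
      also have "\<dots> = (\<Sum>k\<in>?I. dd (v k) (a k) x * dd (v k) w x + a k x * dd (v k) (dd (v k) w) x)"
        by (rule split(5)[OF W'(1,2) W'1 W'(4)])
      finally have "l * (vol \<phi> x * u (\<phi> x)) \<le> (\<Sum>k\<in>?I. dd (v k) (a k) x * dd (v k) w x + a k x * dd (v k) (dd (v k) w) x)" .
      moreover have "\<forall>y\<in>W'. w y \<le> u (\<phi> y)" using w(5) by (simp add: W'_def)
      ultimately show "\<exists>w W. open W \<and> x \<in> W \<and> W \<subseteq> ball x0 r \<and> Ck_on 2 W w \<and> (\<forall>y\<in>W. w y \<le> u (\<phi> y)) \<and> w x = u (\<phi> x) \<and>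
          l * (vol \<phi> x * u (\<phi> x)) \<le> (\<Sum>k\<in>?I. dd (v k) (a k) x * dd (v k) w x + a k x * dd (v k) (dd (v k) w) x)"
        using W' w(6) by blast
    qed (use \<eta>2 \<eta>0 \<eta>p in auto)
    have m2: "l * (\<integral>p. u p * f p \<partial>area_measure S) = (\<integral>x. indicator ?K x * ((l * (vol \<phi> x * u (\<phi> x))) * \<eta> x) \<partial>lborel)"
    proof -
      have "l * (\<integral>p. u p * f p \<partial>area_measure S) = (\<integral>x. l * (indicator ?K x * (vol \<phi> x * u (\<phi> x) * \<eta> x)) \<partial>lborel)"
        unfolding v1 by simp
      then show ?thesis by (simp add: mult_ac)
    qed
    show "integrable (area_measure S) (\<lambda>p. u p * f p) \<and> integrable (area_measure S) (\<lambda>p. u p * laplacian S f p) \<and>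
      l * (\<integral>p. u p * f p \<partial>area_measure S) \<le> (\<integral>p. u p * laplacian S f p \<partial>area_measure S)"
      by (intro conjI i1 i2) (simp only: m2 v2 m1)
  qed
qed

text \<open>The denominator may vanish off \<open>K\<close>, but there \<eta> is 0 and so is the
  quotient. The open sets where \<sigma> is positive and where \<open>K\<close> is avoided cover the
  chart.\<close>

lemma C2_fun_quotient:
  assumes \<eta>: "C2_fun \<eta>" and b: "C2_fun b" and \<sigma>: "C2_fun \<sigma>" and Kc: "compactin (topo S) K"
    and out: "\<And>p. p \<in> pts S - K \<Longrightarrow> \<eta> p = 0" and pos: "\<And>p. p \<in> K \<Longrightarrow> \<sigma> p > 0"
  shows "C2_fun (\<lambda>p. \<eta> p * b p / \<sigma> p)"
  unfolding C2_fun_def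
proof safe
  fix V \<psi> assume d: "(V, \<psi>) \<in> params S"
  define P where "P = V \<inter> (\<sigma> \<circ> \<psi>) -` {0<..}"
  define Q where "Q = V \<inter> \<psi> -` (pts S - K)"
  have P: "open P" unfolding P_def
    by (rule continuous_open_preimage[OF Ck_on_cont[OF C2_funD[OF \<sigma> d]] chartD(1)[OF d]]) simp
  have Q: "open Q" unfolding Q_def by (rule chart_open_preimage[OF d compactin_open_complement[OF Kc]])
  have PV: "P \<subseteq> V" by (auto simp: P_def)
  have "Ck_on 2 P (\<lambda>y. (\<eta> \<circ> \<psi>) y * (b \<circ> \<psi>) y / (\<sigma> \<circ> \<psi>) y)"
    by (intro Ck_on_divide Ck_on_mult P Ck_on_subset[OF C2_funD[OF _ d] PV] \<eta> b \<sigma>) (auto simp: P_def)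
  then have 1: "Ck_on 2 P ((\<lambda>p. \<eta> p * b p / \<sigma> p) \<circ> \<psi>)" by (simp add: comp_def)
  have 2: "Ck_on 2 Q ((\<lambda>p. \<eta> p * b p / \<sigma> p) \<circ> \<psi>)"
    by (rule Ck_on_cong[OF Q _ Ck_on_const[OF Q, of 2 0]]) (use out in \<open>auto simp: Q_def\<close>)
  show "Ck_on 2 V ((\<lambda>p. \<eta> p * b p / \<sigma> p) \<circ> \<psi>)"
  proof (rule Ck_on_local)
    fix y assume y: "y \<in> V"
    show "\<exists>V. open V \<and> y \<in> V \<and> Ck_on 2 V ((\<lambda>p. \<eta> p * b p / \<sigma> p) \<circ> \<psi>)"
    proof (cases "\<psi> y \<in> K")
      case True
      then have "y \<in> P" using pos y by (simp add: P_def)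
      then show ?thesis using P 1 by blast
    next
      case False
      then have "y \<in> Q" using y chart_in_pts[OF d y] by (simp add: Q_def)
      then show ?thesis using Q 2 by blast
    qed
  qed
qed

text \<open>Finitely many bumps covering the support cut a test function into the pieces
  \<open>\<eta> p * b i p / \<sigma> p\<close>. The local inequality holds for each piece, and both
  sides are additive.\<close>

theorem bounded_weak_solution_from_support:
  assumes u: "continuous_map (topo S) euclidean u" and bd: "\<And>p. p \<in> pts S \<Longrightarrow> \<bar>u p\<bar> \<le> C"
    and semi: "\<And>U \<phi> x. (U, \<phi>) \<in> params S \<Longrightarrow> x \<in> U \<Longrightarrow> semiconvex_chart u U \<phi> x"
    and supp: "\<And>U \<phi> x. (U, \<phi>) \<in> params S \<Longrightarrow> x \<in> U \<Longrightarrow> lower_support u l U \<phi> x"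
  shows "bounded_weak_solution S l u"
  unfolding bounded_weak_solution_def
proof (intro conjI allI impI)
  have mu: "u \<in> borel_measurable borelS" by (rule continuous_map_measurable[OF u])
  then show "u \<in> borel_measurable (area_measure S)" using measurable_cong_sets[OF sets_area refl] by blast
  show "\<exists>C. \<forall>p\<in>pts S. \<bar>u p\<bar> \<le> C" using bd by blast
  fix \<eta> assume t: "test_function S \<eta> \<and> (\<forall>p\<in>pts S. 0 \<le> \<eta> p)"
  have \<eta>2: "C2_fun \<eta>" using t smooth_on_Ck unfolding test_function_def C2_fun_def by blast
  obtain K where K: "compactin (topo S) K" "\<And>p. p \<in> pts S - K \<Longrightarrow> \<eta> p = 0"
    using t unfolding test_function_def by blast
  have Kpts: "K \<subseteq> pts S" by (rule compactin_subset_topspace[OF K(1)])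
  \<comment> \<open>A chart ball on which the local inequality holds for all admissible test
    functions; compactness of \<open>K\<close> will select finitely many.\<close>
  define good where "good = (\<lambda>(U, \<phi>, x0, \<rho>). (U, \<phi>) \<in> params S \<and> \<rho> > 0 \<and> cball x0 \<rho> \<subseteq> U \<and>
    (\<forall>f. C2_fun f \<longrightarrow> (\<forall>p. 0 \<le> f p) \<longrightarrow> (\<forall>p. p \<notin> \<phi> ` cball x0 \<rho> \<longrightarrow> f p = 0) \<longrightarrow>
      integrable (area_measure S) (\<lambda>p. u p * f p) \<and> integrable (area_measure S) (\<lambda>p. u p * laplacian S f p) \<and>
      l * (\<integral>p. u p * f p \<partial>area_measure S) \<le> (\<integral>p. u p * laplacian S f p \<partial>area_measure S)))"
  have ex: "\<exists>i. good i \<and> p \<in> (case i of (U, \<phi>, x0, \<rho>) \<Rightarrow> \<phi> ` ball x0 \<rho>)" if p: "p \<in> K" for p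
  proof -
    obtain U \<phi> x0 where c: "(U, \<phi>) \<in> params S" "x0 \<in> U" "p = \<phi> x0" using chart_cover[of p] p Kpts by blast
    show ?thesis
    proof (rule weak_inequality_chart[OF c(1,2) u semi[OF c(1,2)] supp[OF c(1)]])
      fix \<rho> assume "\<rho> > 0" "cball x0 \<rho> \<subseteq> U"
        "\<And>f. \<lbrakk>C2_fun f; \<And>p. 0 \<le> f p; \<And>p. p \<notin> \<phi> ` cball x0 \<rho> \<Longrightarrow> f p = 0\<rbrakk> \<Longrightarrow>
        integrable (area_measure S) (\<lambda>p. u p * f p) \<and> integrable (area_measure S) (\<lambda>p. u p * laplacian S f p) \<and>
        l * (\<integral>p. u p * f p \<partial>area_measure S) \<le> (\<integral>p. u p * laplacian S f p \<partial>area_measure S)"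
      then have "good (U, \<phi>, x0, \<rho>)" "p \<in> \<phi> ` ball x0 \<rho>" using c by (auto simp: good_def)
      then show ?thesis by (intro exI[of _ "(U, \<phi>, x0, \<rho>)"]) simp
    qed
  qed
  define J where "J = (\<lambda>(U :: (real^2) set, \<phi> :: real^2 \<Rightarrow> 'a, x0 :: real^2, \<rho> :: real). \<phi> ` ball x0 \<rho>)"
  have "\<exists>F. finite F \<and> F \<subseteq> J ` Collect good \<and> K \<subseteq> \<Union>F"
  proof (rule compactinD[OF K(1)])
    show "openin (topo S) G" if "G \<in> J ` Collect good" for G
    proof -
      obtain U \<phi> x0 \<rho> where g: "good (U, \<phi>, x0, \<rho>)" "G = \<phi> ` ball x0 \<rho>" using \<open>G \<in> J ` Collect good\<close> by (auto simp: J_def)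
      then have "(U, \<phi>) \<in> params S" "ball x0 \<rho> \<subseteq> U" using ball_subset_cball[of x0 \<rho>] by (auto simp: good_def)
      then show ?thesis using chart_open_image[of U \<phi> "ball x0 \<rho>"] g(2) by simp
    qed
    show "K \<subseteq> \<Union> (J ` Collect good)" using ex by (fastforce simp: J_def)
  qed
  then obtain T where T: "finite T" "T \<subseteq> Collect good" "K \<subseteq> \<Union> (J ` T)"
    using finite_subset_image by (metis (no_types, lifting))
  define b where "b = (\<lambda>(U, \<phi>, x0, \<rho>). bump U \<phi> x0 \<rho>)"
  have b: "C2_fun (b i)" "\<And>p. 0 \<le> b i p" "\<And>p. p \<in> J i \<Longrightarrow> 0 < b i p"
    "\<And>p. p \<notin> (case i of (U, \<phi>, x0, \<rho>) \<Rightarrow> \<phi> ` cball x0 \<rho>) \<Longrightarrow> b i p = 0" if "i \<in> T" for i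
  proof -
    obtain U \<phi> x0 \<rho> where i: "i = (U, \<phi>, x0, \<rho>)" by (cases i)
    have g: "(U, \<phi>) \<in> params S" "\<rho> > 0" "cball x0 \<rho> \<subseteq> U" using T(2) that by (auto simp: i good_def)
    show "C2_fun (b i)" "\<And>p. 0 \<le> b i p" "\<And>p. p \<in> J i \<Longrightarrow> 0 < b i p"
      "\<And>p. p \<notin> (case i of (U, \<phi>, x0, \<rho>) \<Rightarrow> \<phi> ` cball x0 \<rho>) \<Longrightarrow> b i p = 0"
      using bump[OF g] by (auto simp: b_def i J_def)
  qed
  define \<sigma> where "\<sigma> = (\<lambda>p. \<Sum>i\<in>T. b i p)"
  have \<sigma>2: "C2_fun \<sigma>" unfolding \<sigma>_def by (rule C2_fun_sum) (rule b(1))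
  have \<sigma>p: "\<sigma> p > 0" if pK: "p \<in> K" for p
  proof -
    obtain i where "i \<in> T" "p \<in> J i" using T(3) pK by blast
    then show ?thesis unfolding \<sigma>_def using b T(1) by (intro sum_pos2[of T i]) auto
  qed
  define f where "f = (\<lambda>i p. \<eta> p * b i p / \<sigma> p)"
  have f2: "C2_fun (f i)" if "i \<in> T" for i
    unfolding f_def by (rule C2_fun_quotient[OF \<eta>2 b(1)[OF that] \<sigma>2 K \<sigma>p])
  \<comment> \<open>The local inequality asks for nonnegativity on the whole type. Off the surface
    nothing is known about \<eta>, but there the bump vanishes.\<close>
  have f0: "0 \<le> f i p" if i: "i \<in> T" for i p
  proof (cases "p \<in> pts S")
    case True
    then show ?thesis using t b(2)[OF i] b(2) unfolding f_def \<sigma>_def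
      by (intro divide_nonneg_nonneg mult_nonneg_nonneg sum_nonneg) auto
  next
    case False
    obtain U \<phi> x0 \<rho> where ii: "i = (U, \<phi>, x0, \<rho>)" by (cases i)
    have "(U, \<phi>) \<in> params S" "cball x0 \<rho> \<subseteq> U" using T(2) i by (auto simp: ii good_def)
    then have "p \<notin> \<phi> ` cball x0 \<rho>" using False chart_in_pts by blast
    then show ?thesis using b(4)[OF i, of p] by (simp add: f_def ii)
  qed
  have fi: "integrable (area_measure S) (\<lambda>p. u p * f i p)" "integrable (area_measure S) (\<lambda>p. u p * laplacian S (f i) p)"
      "l * (\<integral>p. u p * f i p \<partial>area_measure S) \<le> (\<integral>p. u p * laplacian S (f i) p \<partial>area_measure S)" if i: "i \<in> T" for i
  proof -
    obtain U \<phi> x0 \<rho> where ii: "i = (U, \<phi>, x0, \<rho>)" by (cases i)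
    have g: "good (U, \<phi>, x0, \<rho>)" using T(2) i ii by blast
    have "f i p = 0" if "p \<notin> \<phi> ` cball x0 \<rho>" for p using b(4)[OF i, of p] that by (simp add: f_def ii)
    then show "integrable (area_measure S) (\<lambda>p. u p * f i p)" "integrable (area_measure S) (\<lambda>p. u p * laplacian S (f i) p)"
      "l * (\<integral>p. u p * f i p \<partial>area_measure S) \<le> (\<integral>p. u p * laplacian S (f i) p \<partial>area_measure S)"
      using g f2[OF i] f0[OF i] unfolding good_def by blast+
  qed
  have sumf: "\<eta> p = (\<Sum>i\<in>T. f i p)" if p: "p \<in> pts S" for p
  proof (cases "p \<in> K")
    case True
    have "(\<Sum>i\<in>T. f i p) = \<eta> p * \<sigma> p / \<sigma> p"
      unfolding f_def \<sigma>_def by (simp add: sum_divide_distrib[symmetric] sum_distrib_left[symmetric])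
    then show ?thesis using \<sigma>p[OF True] by simp
  next
    case False
    then show ?thesis using K(2)[of p] p by (simp add: f_def)
  qed
  have lapsum: "laplacian S \<eta> p = (\<Sum>i\<in>T. laplacian S (f i) p)" if p: "p \<in> pts S" for p
  proof -
    obtain U \<phi> x where c: "(U, \<phi>) \<in> params S" "x \<in> U" "p = \<phi> x" using chart_cover[OF p] by blast
    have "laplacian S \<eta> p = local_laplacian (pos S \<circ> \<phi>) (\<eta> \<circ> \<phi>) x"
      unfolding c(3) by (rule laplacian_chart_C2[OF \<eta>2 c(1,2)])
    also have "\<dots> = local_laplacian (pos S \<circ> \<phi>) ((\<lambda>p. \<Sum>i\<in>T. f i p) \<circ> \<phi>) x"
      by (rule local_laplacian_cong[OF chartD(1)[OF c(1)] c(2)]) (use sumf chart_in_pts[OF c(1)] in auto)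
    also have "\<dots> = laplacian S (\<lambda>p. \<Sum>i\<in>T. f i p) p"
      unfolding c(3) by (rule laplacian_chart_C2[OF C2_fun_sum[OF f2] c(1,2), symmetric])
    also have "\<dots> = (\<Sum>i\<in>T. laplacian S (f i) p)" by (rule laplacian_sum[OF T(1) f2 p])
    finally show ?thesis .
  qed
  have "l * (\<integral>p. u p * \<eta> p \<partial>area_measure S) = l * (\<integral>p. (\<Sum>i\<in>T. u p * f i p) \<partial>area_measure S)"
    by (intro arg_cong[where f = "\<lambda>z. l * z"] Bochner_Integration.integral_cong refl) (simp add: sumf sum_distrib_left)
  also have "\<dots> = (\<Sum>i\<in>T. l * (\<integral>p. u p * f i p \<partial>area_measure S))"
    by (subst Bochner_Integration.integral_sum) (use fi(1) in \<open>auto simp: sum_distrib_left\<close>)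
  also have "\<dots> \<le> (\<Sum>i\<in>T. \<integral>p. u p * laplacian S (f i) p \<partial>area_measure S)" by (rule sum_mono[OF fi(3)])
  also have "\<dots> = (\<integral>p. (\<Sum>i\<in>T. u p * laplacian S (f i) p) \<partial>area_measure S)"
    by (subst Bochner_Integration.integral_sum) (use fi(2) in auto)
  also have "\<dots> = (\<integral>p. u p * laplacian S \<eta> p \<partial>area_measure S)"
    by (intro Bochner_Integration.integral_cong refl) (simp add: lapsum sum_distrib_left)
  finally show "(\<integral>p. u p * laplacian S \<eta> p \<partial>area_measure S) \<ge> l * (\<integral>p. u p * \<eta> p \<partial>area_measure S)" .
qed

end

section \<open>The distance to a closed set along a surface\<close>

text \<open>The mean value theorem is scalar, so it is applied twice to the inner product with the
  remainder \<open>e\<close> itself. The factor 1/2 of Taylor's formula is given away.\<close>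

lemma taylor2_vector:
  fixes F :: "'a::euclidean_space \<Rightarrow> 'b::euclidean_space"
  assumes U: "open U" and F: "Ck_on 2 U F" and seg: "\<And>t. 0 \<le> t \<Longrightarrow> t \<le> 1 \<Longrightarrow> x + t *\<^sub>R k \<in> U"
    and C: "\<And>t. 0 \<le> t \<Longrightarrow> t \<le> 1 \<Longrightarrow> norm (dd k (dd k F) (x + t *\<^sub>R k)) \<le> C"
  shows "norm (F (x + k) - F x - dd k F x) \<le> C"
proof -
  define e where "e = F (x + k) - F x - dd k F x"
  have C0: "C \<ge> 0" using order_trans[OF norm_ge_zero C[of 0]] by simp
  have Fe: "Ck_on 2 U (\<lambda>y. F y \<bullet> e)" by (intro Ck_on_inner Ck_on_const U F)
  have D0: "((\<lambda>s. F (x + s *\<^sub>R k) \<bullet> e) has_real_derivative dd k (\<lambda>y. F y \<bullet> e) (x + t *\<^sub>R k)) (at t)" if "0 \<le> t" "t \<le> 1" for t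
    by (rule line_DERIV[OF C2_C1[OF Fe, unfolded One_nat_def] seg[OF that]])
  have D1: "((\<lambda>s. dd k (\<lambda>y. F y \<bullet> e) (x + s *\<^sub>R k)) has_real_derivative dd k (dd k (\<lambda>y. F y \<bullet> e)) (x + t *\<^sub>R k)) (at t)" if "0 \<le> t" "t \<le> 1" for t
    by (rule line_DERIV[OF C2_dd[OF Fe, unfolded One_nat_def] seg[OF that]])
  have "0 < (1::real)" by simp
  from MVT2[OF this D0] obtain s where s: "0 < s" "s < 1"
    "F (x + 1 *\<^sub>R k) \<bullet> e - F (x + 0 *\<^sub>R k) \<bullet> e = (1 - 0) * dd k (\<lambda>y. F y \<bullet> e) (x + s *\<^sub>R k)" by blast
  have "\<exists>y>0. y < s \<and> dd k (\<lambda>y. F y \<bullet> e) (x + s *\<^sub>R k) - dd k (\<lambda>y. F y \<bullet> e) (x + 0 *\<^sub>R k) = (s - 0) * dd k (dd k (\<lambda>y. F y \<bullet> e)) (x + y *\<^sub>R k)"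
    by (rule MVT2[OF s(1)]) (use D1 s(2) in auto)
  then obtain y where y: "0 < y" "y < s"
    "dd k (\<lambda>y. F y \<bullet> e) (x + s *\<^sub>R k) - dd k (\<lambda>y. F y \<bullet> e) x = s * dd k (dd k (\<lambda>y. F y \<bullet> e)) (x + y *\<^sub>R k)" by auto
  have y01: "0 \<le> y" "y \<le> 1" using y s by auto
  have xU: "x \<in> U" using seg[of 0] by simp
  define B where "B = dd k (dd k F) (x + y *\<^sub>R k) \<bullet> e"
  have "norm e * norm e = e \<bullet> e" by (simp add: dot_square_norm power2_eq_square)
  also have "\<dots> = (F (x + k) \<bullet> e - F x \<bullet> e) - dd k F x \<bullet> e"
    unfolding inner_diff_left[symmetric] e_def[symmetric] ..
  also have "\<dots> = s * B"
    using s(3) y(3) dd_inner[OF C2_diff[OF F xU]] dd_inner_const[OF U F seg[OF y01]] by (simp add: B_def)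
  also have "\<dots> \<le> s * (C * norm e)"
    using norm_cauchy_schwarz[of "dd k (dd k F) (x + y *\<^sub>R k)" e] mult_right_mono[OF C[OF y01] norm_ge_zero[of e]] s(1)
    by (intro mult_left_mono) (auto simp: B_def)
  also have "\<dots> \<le> C * norm e" using s(1,2) C0 by (intro mult_left_le_one_le) auto
  finally have "norm e * norm e \<le> C * norm e" .
  then show ?thesis using C0 unfolding e_def[symmetric] by (cases "e = 0") auto
qed

text \<open>The square of the left side is \<open>t\<^sup>2 + q\<close>, whose root is at most
  \<open>t + q / (2 * t)\<close> by concavity.\<close>

lemma norm_add_le_quadratic:
  fixes v \<delta> :: "'a::real_inner"
  assumes t: "norm v = t" "t > 0"
  shows "norm (v + \<delta>) \<le> t + (v \<bullet> \<delta>) / t + (norm \<delta>)\<^sup>2 / (2 * t)"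
proof (rule power2_le_imp_le)
  define q where "q = 2 * (v \<bullet> \<delta>) + (norm \<delta>)\<^sup>2"
  have eq: "(norm (v + \<delta>))\<^sup>2 = t\<^sup>2 + q"
    unfolding t(1)[symmetric] by (simp add: q_def power2_norm_eq_inner inner_add_left inner_add_right inner_commute)
  have rhs: "t + (v \<bullet> \<delta>) / t + (norm \<delta>)\<^sup>2 / (2 * t) = t + q / (2 * t)" using t(2) by (simp add: q_def field_simps)
  have "(t + q / (2 * t))\<^sup>2 = t\<^sup>2 + q + (q / (2 * t))\<^sup>2" using t(2) by (simp add: power2_eq_square field_simps)
  then show "(norm (v + \<delta>))\<^sup>2 \<le> (t + (v \<bullet> \<delta>) / t + (norm \<delta>)\<^sup>2 / (2 * t))\<^sup>2" unfolding rhs eq by simp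
  have "0 \<le> t\<^sup>2 + q" unfolding eq[symmetric] by simp
  then have "0 \<le> t + q / t" using t(2) by (simp add: field_simps power2_eq_square)
  then show "0 \<le> t + (v \<bullet> \<delta>) / t + (norm \<delta>)\<^sup>2 / (2 * t)" unfolding rhs using t(2) by simp
qed

context immersed begin

definition udist :: "real \<Rightarrow> (real^3) set \<Rightarrow> 'a \<Rightarrow> real" where
  "udist \<kappa> C p = exp (- \<kappa> * infdist (pos S p) C)"

lemma pos_continuous: "continuous_map (topo S) euclidean (pos S)"
  by (rule continuous_map_charts) (rule Ck_on_cont[OF immersion_onD(2)[OF chart_immersion]])

lemma udist_continuous: "continuous_map (topo S) euclidean (udist \<kappa> C)"
proof (rule continuous_map_charts)
  fix U \<phi> assume c: "(U, \<phi>) \<in> params S"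
  have "continuous_on U (\<lambda>x. exp (- \<kappa> * infdist ((pos S \<circ> \<phi>) x) C))"
    by (intro continuous_intros Ck_on_cont[OF immersion_onD(2)[OF chart_immersion[OF c]]])
  then show "continuous_on U (udist \<kappa> C \<circ> \<phi>)" by (simp add: comp_def udist_def)
qed

text \<open>The distance to one fixed nearest point dominates the distance to \<open>C\<close>, with
  equality at \<open>x\<close>, and has a quadratic bound from above as long as it stays away from
  0. The decreasing exponential reverses the inequality, and its convexity preserves the quadratic
  form.\<close>

lemma udist_semiconvex:
  assumes c: "(U, \<phi>) \<in> params S" and x0: "x0 \<in> U" and C: "closed C" "C \<noteq> {}" "C \<inter> image_of S = {}" and \<kappa>: "\<kappa> \<ge> 0"
  shows "semiconvex_chart (udist \<kappa> C) U \<phi> x0"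
proof -
  define X where "X = pos S \<circ> \<phi>"
  note I = immersion_onD[OF chart_immersion[OF c], folded X_def]
  obtain r where r: "r > 0" "cball x0 r \<subseteq> U" using I(1) x0 open_contains_cball by blast
  obtain D where D: "D \<ge> 0" "\<And>y k. y \<in> cball x0 r \<Longrightarrow> norm (dd k X y) \<le> D * norm k"
    "\<And>y k. y \<in> cball x0 r \<Longrightarrow> norm (dd k (dd k X) y) \<le> D * (norm k)\<^sup>2"
    using dd_bounds[OF I(1,2) compact_cball r(2)] by blast
  define d where "d = (\<lambda>x. infdist (X x) C)"
  have dpos: "d x > 0" if "x \<in> U" for x
  proof -
    have "X x \<notin> C" using C(3) chart_in_pts[OF c that] by (auto simp: X_def)
    then show ?thesis unfolding d_def using C(1,2) by (meson infdist_nonneg infdist_pos_not_in_closed)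
  qed
  have "continuous_on (cball x0 r) d"
    unfolding d_def by (intro continuous_on_infdist continuous_on_subset[OF Ck_on_cont[OF I(2)] r(2)])
  then obtain xm where xm: "xm \<in> cball x0 r" "\<And>x. x \<in> cball x0 r \<Longrightarrow> d xm \<le> d x"
    using continuous_attains_inf[OF compact_cball, of x0 r d] r(1) by (metis centre_in_cball empty_iff less_imp_le)
  \<comment> \<open>Positive lower bound for the distance on the closed ball; it controls the factor
    \<open>1 / (2 * t)\<close> uniformly.\<close>
  define m where "m = d xm"
  have m: "m > 0" using dpos[of xm] xm(1) r(2) by (auto simp: m_def)
  \<comment> \<open>The first summand is the quadratic error of \<open>X\<close>. The second is that
    of the norm, where increments of \<open>X\<close> are at most
    \<open>D * (1 + 2 * r) * norm k\<close> because \<open>norm k\<close> is at most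
    \<open>2 * r\<close>.\<close>
  define E where "E = D + (D * (1 + 2 * r))\<^sup>2 / (2 * m)"
  have E0: "E \<ge> 0" using D(1) m by (simp add: E_def)
  have main: "\<exists>l. linear l \<and> (\<forall>k. \<bar>l k\<bar> \<le> (\<kappa> * D + \<kappa> * E) * norm k) \<and>
      (\<forall>k. x + k \<in> ball x0 r \<longrightarrow> udist \<kappa> C (\<phi> x) + l k - (\<kappa> * D + \<kappa> * E) * (norm k)\<^sup>2 \<le> udist \<kappa> C (\<phi> (x + k)))"
    if x: "x \<in> ball x0 r" for x
  proof -
    have xK: "x \<in> cball x0 r" using x by simp
    obtain z where z: "z \<in> C" "infdist (X x) C = dist (X x) z" using infdist_attains_inf[OF C(1,2)] by blast
    define t where "t = d x"
    have t: "t > 0" "m \<le> t" using dpos[of x] xm(2)[OF xK] xK r(2) by (auto simp: t_def m_def)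
    define v where "v = X x - z"
    have nv: "norm v = t" using z(2) by (simp add: v_def t_def d_def dist_norm)
    define w where "w = (1/t) *\<^sub>R v"
    have nw: "norm w = 1" using nv t by (simp add: w_def)
    define l where "l = (\<lambda>k. (- \<kappa> * exp (- \<kappa> * t)) * (w \<bullet> dd k X x))"
    have lin: "linear (\<lambda>k. dd k X x)" by (rule dd_linear[OF C2_diff[OF I(2)]]) (use xK r(2) in blast)
    have "linear l"
      unfolding l_def using lin by (auto intro!: linearI simp: linear_add linear_cmul inner_add_right algebra_simps)
    moreover have "\<bar>l k\<bar> \<le> (\<kappa> * D + \<kappa> * E) * norm k" for k
    proof -
      have "\<bar>w \<bullet> dd k X x\<bar> \<le> D * norm k" using Cauchy_Schwarz_ineq2[of w "dd k X x"] D(2)[OF xK, of k] nw by simp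
      moreover have "exp (- \<kappa> * t) \<le> 1" using \<kappa> t by simp
      ultimately have "(\<kappa> * exp (- \<kappa> * t)) * \<bar>w \<bullet> dd k X x\<bar> \<le> (\<kappa> * 1) * (D * norm k)"
        using \<kappa> D(1) by (intro mult_mono) auto
      moreover have "0 \<le> \<kappa> * E * norm k" using \<kappa> E0 by simp
      ultimately show ?thesis using \<kappa> by (simp add: l_def abs_mult algebra_simps)
    qed
    moreover have "udist \<kappa> C (\<phi> x) + l k - (\<kappa> * D + \<kappa> * E) * (norm k)\<^sup>2 \<le> udist \<kappa> C (\<phi> (x + k))" if xk: "x + k \<in> ball x0 r" for k
    proof -
      have nk: "norm k \<le> 2 * r"
      proof -
        have "norm k = dist (x + k) x" by (simp add: dist_norm)
        also have "\<dots> \<le> dist (x + k) x0 + dist x0 x" by (rule dist_triangle)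
        finally show ?thesis using x xk by (simp add: dist_commute)
      qed
      have Fe: "norm (X (x + k) - X x - dd k X x) \<le> D * (norm k)\<^sup>2"
      proof -
        have seg: "x + t *\<^sub>R k \<in> cball x0 r" if "0 \<le> t" "t \<le> 1" for t
        proof -
          have "(1 - t) *\<^sub>R x + t *\<^sub>R (x + k) \<in> ball x0 r" using convexD[OF convex_ball x xk, of "1 - t" t] that by simp
          then show ?thesis by (simp add: algebra_simps)
        qed
        show ?thesis by (rule taylor2_vector[OF I(1,2)]) (use seg r(2) D(3) in blast)+
      qed
      define \<delta> where "\<delta> = X (x + k) - X x"
      have d1: "\<bar>w \<bullet> \<delta> - w \<bullet> dd k X x\<bar> \<le> D * (norm k)\<^sup>2"
        using Cauchy_Schwarz_ineq2[of w "\<delta> - dd k X x"] Fe nw by (simp add: \<delta>_def inner_diff_right)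
      have d2: "norm \<delta> \<le> D * (1 + 2 * r) * norm k"
      proof -
        have "norm \<delta> \<le> norm (\<delta> - dd k X x) + norm (dd k X x)" using norm_triangle_ineq[of "\<delta> - dd k X x" "dd k X x"] by simp
        also have "\<dots> \<le> D * (norm k)\<^sup>2 + D * norm k" using Fe D(2)[OF xK, of k] by (simp add: \<delta>_def)
        also have "\<dots> \<le> D * (2 * r * norm k) + D * norm k"
          using nk D(1) by (intro add_mono mult_left_mono) (auto simp: power2_eq_square mult_right_mono)
        finally show ?thesis by (simp add: algebra_simps)
      qed
      have "infdist (X (x + k)) C \<le> dist (X (x + k)) z" by (rule infdist_le[OF z(1)])
      also have "\<dots> = norm (v + \<delta>)" by (simp add: v_def \<delta>_def dist_norm)
      also have "\<dots> \<le> t + (v \<bullet> \<delta>) / t + (norm \<delta>)\<^sup>2 / (2 * t)" by (rule norm_add_le_quadratic[OF nv t(1)])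
      also have "(v \<bullet> \<delta>) / t = w \<bullet> \<delta>" by (simp add: w_def)
      also have "(norm \<delta>)\<^sup>2 / (2 * t) \<le> (D * (1 + 2 * r) * norm k)\<^sup>2 / (2 * m)"
        using d2 t m by (intro frac_le power_mono) auto
      finally have "infdist (X (x + k)) C \<le> t + w \<bullet> \<delta> + (D * (1 + 2 * r) * norm k)\<^sup>2 / (2 * m)" by simp
      moreover have "(D * (1 + 2 * r) * norm k)\<^sup>2 / (2 * m) = (D * (1 + 2 * r))\<^sup>2 / (2 * m) * (norm k)\<^sup>2"
        by (simp add: power_mult_distrib)
      moreover have "w \<bullet> \<delta> \<le> w \<bullet> dd k X x + D * (norm k)\<^sup>2" using d1 by linarith
      ultimately have inf: "infdist (X (x + k)) C \<le> t + w \<bullet> dd k X x + E * (norm k)\<^sup>2"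
        unfolding E_def distrib_right by linarith
      define q where "q = w \<bullet> dd k X x + E * (norm k)\<^sup>2"
      have "udist \<kappa> C (\<phi> (x + k)) = exp (- \<kappa> * infdist (X (x + k)) C)" by (simp add: udist_def X_def)
      moreover have "exp (- \<kappa> * (t + q)) \<le> exp (- \<kappa> * infdist (X (x + k)) C)"
        using inf \<kappa> by (simp add: q_def mult_left_mono add.assoc)
      moreover have "exp (- \<kappa> * (t + q)) = exp (- \<kappa> * t) * exp (- \<kappa> * q)" by (simp add: exp_add[symmetric] algebra_simps)
      \<comment> \<open>Convexity: the exponential lies above its tangent at the base point.\<close>
      moreover have "exp (- \<kappa> * t) * (1 + (- \<kappa> * q)) \<le> exp (- \<kappa> * t) * exp (- \<kappa> * q)"
        by (intro mult_left_mono exp_ge_add_one_self) simp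
      moreover have "exp (- \<kappa> * t) * (1 + (- \<kappa> * q)) = exp (- \<kappa> * t) + l k - (\<kappa> * E * exp (- \<kappa> * t)) * (norm k)\<^sup>2"
        by (simp add: l_def q_def algebra_simps)
      moreover have "(\<kappa> * E * exp (- \<kappa> * t)) * (norm k)\<^sup>2 \<le> (\<kappa> * D + \<kappa> * E) * (norm k)\<^sup>2"
      proof (rule mult_right_mono)
        have "\<kappa> * E * exp (- \<kappa> * t) \<le> \<kappa> * E * 1" using \<kappa> E0 t by (intro mult_left_mono) auto
        moreover have "0 \<le> \<kappa> * D" using \<kappa> D(1) by simp
        ultimately show "\<kappa> * E * exp (- \<kappa> * t) \<le> \<kappa> * D + \<kappa> * E" by simp
      qed simp
      moreover have "udist \<kappa> C (\<phi> x) = exp (- \<kappa> * t)" by (simp add: udist_def t_def d_def X_def)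
      ultimately show ?thesis by linarith
    qed
    ultimately show ?thesis by blast
  qed
  show ?thesis
    unfolding semiconvex_chart_def
    by (intro exI[of _ r] exI[of _ "\<kappa> * D + \<kappa> * E"] conjI) (use r \<kappa> D(1) E0 main ball_subset_cball in \<open>auto simp: subset_eq\<close>)
qed

end

section \<open>Comparison of two surfaces\<close>

definition expdist :: "real \<Rightarrow> real^3 \<Rightarrow> real" where
  "expdist \<kappa> v = exp (- \<kappa> * norm v)"

lemma expdist_C2: "Ck_on 2 (- {0}) (expdist \<kappa>)"
proof -
  have "Ck_on 2 (- {0}) (\<lambda>v::real^3. exp (- \<kappa> * norm v))"
    by (intro Ck_on_exp_compose Ck_on_mult Ck_on_const Ck_on_norm Ck_on_ident) auto
  then show ?thesis by (simp add: expdist_def[abs_def])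
qed

lemma expdist_dd:
  assumes v: "v \<noteq> 0"
  shows "dd p (expdist \<kappa>) v = - \<kappa> * expdist \<kappa> v * (v \<bullet> p) / norm v"
    "dd p (dd p (expdist \<kappa>)) v = expdist \<kappa> v * (\<kappa>\<^sup>2 * (v \<bullet> p)\<^sup>2 / (norm v)\<^sup>2 - \<kappa> * ((norm p)\<^sup>2 / norm v - (v \<bullet> p)\<^sup>2 / (norm v) ^ 3))"
proof -
  have n: "(norm has_derivative (\<lambda>p. (v \<bullet> p) / norm v)) (at v)" if "v \<noteq> 0" for v :: "real^3"
    using has_derivative_norm[OF that] by (simp add: sgn_div_norm divide_inverse mult.commute inner_commute)
  have 1: "(expdist \<kappa> has_derivative (\<lambda>p. - \<kappa> * expdist \<kappa> v * (v \<bullet> p) / norm v)) (at v)" if "v \<noteq> 0" for v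
    unfolding expdist_def[abs_def] by (auto intro!: derivative_eq_intros n[OF that])
  show "dd p (expdist \<kappa>) v = - \<kappa> * expdist \<kappa> v * (v \<bullet> p) / norm v" by (rule dd_eqI[OF 1[OF v]])
  have "dd p (dd p (expdist \<kappa>)) v = dd p (\<lambda>v. - \<kappa> * expdist \<kappa> v * (v \<bullet> p) / norm v) v"
    by (rule dd_cong[of "- {0}"]) (use v dd_eqI[OF 1] in auto)
  also have "\<dots> = expdist \<kappa> v * (\<kappa>\<^sup>2 * (v \<bullet> p)\<^sup>2 / (norm v)\<^sup>2 - \<kappa> * ((norm p)\<^sup>2 / norm v - (v \<bullet> p)\<^sup>2 / (norm v) ^ 3))"
  proof (rule dd_eqI[THEN trans])
    show "((\<lambda>v. - \<kappa> * expdist \<kappa> v * (v \<bullet> p) / norm v) has_derivative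
      (\<lambda>q. ((- \<kappa> * (- \<kappa> * expdist \<kappa> v * (v \<bullet> q) / norm v)) * (v \<bullet> p) + - \<kappa> * expdist \<kappa> v * (q \<bullet> p)) / norm v
         - (- \<kappa> * expdist \<kappa> v * (v \<bullet> p)) * ((v \<bullet> q) / norm v) / (norm v)\<^sup>2)) (at v)"
      using v by (auto intro!: derivative_eq_intros 1[OF v] n[OF v] simp: power2_eq_square field_simps)
    show "((- \<kappa> * (- \<kappa> * expdist \<kappa> v * (v \<bullet> p) / norm v)) * (v \<bullet> p) + - \<kappa> * expdist \<kappa> v * (p \<bullet> p)) / norm v
         - (- \<kappa> * expdist \<kappa> v * (v \<bullet> p)) * ((v \<bullet> p) / norm v) / (norm v)\<^sup>2
      = expdist \<kappa> v * (\<kappa>\<^sup>2 * (v \<bullet> p)\<^sup>2 / (norm v)\<^sup>2 - \<kappa> * ((norm p)\<^sup>2 / norm v - (v \<bullet> p)\<^sup>2 / (norm v) ^ 3))"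
      using v by (simp add: field_simps power2_eq_square power3_eq_cube dot_square_norm)
  qed
  finally show "dd p (dd p (expdist \<kappa>)) v = expdist \<kappa> v * (\<kappa>\<^sup>2 * (v \<bullet> p)\<^sup>2 / (norm v)\<^sup>2 - \<kappa> * ((norm p)\<^sup>2 / norm v - (v \<bullet> p)\<^sup>2 / (norm v) ^ 3))" .
qed

text \<open>In the second derivative, the square of \<open>w \<bullet> dd a Y x\<close> with factor
  \<kappa> is the gain from exponentiating the distance; the term divided by \<open>t\<close> is the
  Hessian of the norm.\<close>

lemma expdist_compose_dd:
  assumes W: "open W" "x \<in> W" and Y: "Ck_on 2 W Y" and nz: "\<And>y. y \<in> W \<Longrightarrow> Y y \<noteq> 0" and Yx: "Y x = t *\<^sub>R w" "t > 0" "norm w = 1"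
  shows "Ck_on 2 W (\<lambda>y. expdist \<kappa> (Y y))"
    "dd a (\<lambda>y. expdist \<kappa> (Y y)) x = - \<kappa> * exp (- \<kappa> * t) * (w \<bullet> dd a Y x)"
    "dd a (dd a (\<lambda>y. expdist \<kappa> (Y y))) x = \<kappa> * exp (- \<kappa> * t) * (\<kappa> * (w \<bullet> dd a Y x)\<^sup>2
       - ((norm (dd a Y x))\<^sup>2 - (w \<bullet> dd a Y x)\<^sup>2) / t - w \<bullet> dd a (dd a Y) x)"
proof -
  have o: "open (- {0::real^3})" by auto
  have nz': "\<And>y. y \<in> W \<Longrightarrow> Y y \<in> - {0}" using nz by auto
  show "Ck_on 2 W (\<lambda>y. expdist \<kappa> (Y y))" by (rule Ck_on_compose[OF W(1) nz' expdist_C2 Y])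
  have nY: "norm (Y x) = t" using Yx by simp
  have e: "expdist \<kappa> (Y x) = exp (- \<kappa> * t)" by (simp add: expdist_def nY)
  show "dd a (\<lambda>y. expdist \<kappa> (Y y)) x = - \<kappa> * exp (- \<kappa> * t) * (w \<bullet> dd a Y x)"
    unfolding dd_compose[OF C2_diff[OF expdist_C2 nz'[OF W(2)]] C2_diff[OF Y W(2)]] expdist_dd(1)[OF nz[OF W(2)]] e nY
    using Yx by simp
  show "dd a (dd a (\<lambda>y. expdist \<kappa> (Y y))) x = \<kappa> * exp (- \<kappa> * t) * (\<kappa> * (w \<bullet> dd a Y x)\<^sup>2
       - ((norm (dd a Y x))\<^sup>2 - (w \<bullet> dd a Y x)\<^sup>2) / t - w \<bullet> dd a (dd a Y) x)"
  proof -
    have s: "dd a (dd a (\<lambda>y. expdist \<kappa> (Y y))) x = dd (dd a Y x) (dd (dd a Y x) (expdist \<kappa>)) (Y x) + dd (dd a (dd a Y) x) (expdist \<kappa>) (Y x)"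
      by (rule dd2_compose[OF W(1) o expdist_C2 Y nz' W(2)])
    show ?thesis
      unfolding s expdist_dd[OF nz[OF W(2)]] e nY
      using Yx(2) by (simp add: Yx(1) field_simps power2_eq_square power3_eq_cube)
  qed
qed

text \<open>A unit vector orthogonal to \<open>a\<close> and \<open>b\<close> is their normalized
  cross product up to sign, so what is left of \<open>u\<close> after removing the components along
  \<open>a\<close> and \<open>b\<close> is its component along \<open>w\<close>.\<close>

lemma orthonormal_expand3:
  fixes a b w u :: "real^3"
  assumes "norm a = 1" "norm b = 1" "norm w = 1" "a \<bullet> b = 0" "w \<bullet> a = 0" "w \<bullet> b = 0"
  shows "u = (u \<bullet> a) *\<^sub>R a + (u \<bullet> b) *\<^sub>R b + (u \<bullet> w) *\<^sub>R w"
proof -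
  have c: "cross3 a b \<noteq> 0" using norm_cross_dot[of a b] assms by auto
  define g where "g = sgn (cross3 a b)"
  have g: "v = (v \<bullet> g) *\<^sub>R g" if "v \<bullet> a = 0" "v \<bullet> b = 0" for v
    unfolding g_def by (rule cross3_normal[OF that c])
  have w: "w = (w \<bullet> g) *\<^sub>R g" by (rule g[OF assms(5,6)])
  have ng: "norm g = 1" using c by (simp add: g_def norm_sgn)
  have "\<bar>w \<bullet> g\<bar> = 1" using arg_cong[OF w, of norm] assms(3) ng by simp
  then have sq: "(w \<bullet> g) * (w \<bullet> g) = 1" by (metis abs_mult_self_eq mult.right_neutral)
  define v where "v = u - (u \<bullet> a) *\<^sub>R a - (u \<bullet> b) *\<^sub>R b"
  have "v \<bullet> a = 0" "v \<bullet> b = 0" using assms by (simp_all add: v_def inner_diff_left inner_diff_right norm_eq_1 inner_commute)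
  then have v: "v = (v \<bullet> g) *\<^sub>R g" by (rule g)
  have "u \<bullet> w = v \<bullet> w" using assms by (simp add: v_def inner_diff_left inner_diff_right inner_commute)
  also have "\<dots> = (w \<bullet> g) * (v \<bullet> g)" by (subst w) simp
  finally have uw: "u \<bullet> w = (w \<bullet> g) * (v \<bullet> g)" .
  have "(u \<bullet> w) *\<^sub>R w = ((w \<bullet> g) * (v \<bullet> g)) *\<^sub>R ((w \<bullet> g) *\<^sub>R g)" unfolding uw by (rule arg_cong[OF w])
  also have "\<dots> = ((w \<bullet> g) * (w \<bullet> g) * (v \<bullet> g)) *\<^sub>R g" by (simp add: mult_ac)
  also have "\<dots> = v" using sq v by simp
  finally show ?thesis by (simp add: v_def)
qed

lemma orthonormal_parseval3:
  fixes a b w u v :: "real^3"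
  assumes "norm a = 1" "norm b = 1" "norm w = 1" "a \<bullet> b = 0" "w \<bullet> a = 0" "w \<bullet> b = 0"
  shows "u \<bullet> v = (u \<bullet> a) * (v \<bullet> a) + (u \<bullet> b) * (v \<bullet> b) + (u \<bullet> w) * (v \<bullet> w)"
  by (subst orthonormal_expand3[OF assms, of u]) (simp add: inner_add_left inner_add_right inner_commute)

lemma unit_normal_cross:
  fixes a b :: "real^3"
  assumes "norm a = 1" "norm b = 1" "a \<bullet> b = 0"
  shows "norm (cross3 a b) = 1" "cross3 a b \<bullet> a = 0" "cross3 a b \<bullet> b = 0"
proof -
  have "(norm (cross3 a b))\<^sup>2 = 1" using norm_cross_dot[of a b] assms by simp
  then show "norm (cross3 a b) = 1" by (simp add: power2_eq_1_iff) (metis norm_ge_zero not_one_le_zero neg_0_le_iff_le)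
  show "cross3 a b \<bullet> a = 0" "cross3 a b \<bullet> b = 0" by (simp_all add: inner_commute dot_cross_self)
qed

lemma second_derivative_test:
  fixes f :: "'a::euclidean_space \<Rightarrow> real"
  assumes U: "open U" "x \<in> U" and f: "Ck_on 2 U f" and min: "\<And>y. y \<in> U \<Longrightarrow> f x \<le> f y"
  shows "dd v f x = 0" "0 \<le> dd v (dd v f) x"
proof -
  have "((\<lambda>h. x + (1 * h) *\<^sub>R v) \<longlongrightarrow> x) (at 0)" by (rule tendsto_line)
  then have near: "\<forall>\<^sub>F h in at 0. x + h *\<^sub>R v \<in> U" using topological_tendstoD[OF _ U] by fastforce
  then obtain d where d: "d > 0" "\<And>h. h \<noteq> 0 \<Longrightarrow> \<bar>h\<bar> < d \<Longrightarrow> x + h *\<^sub>R v \<in> U"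
    unfolding eventually_at by (auto simp: dist_real_def)
  have D: "((\<lambda>h. f (x + h *\<^sub>R v)) has_real_derivative dd v f x) (at 0)"
    using line_DERIV[OF C2_C1[OF f, unfolded One_nat_def], of x 0 v UNIV] U(2) by simp
  have "\<forall>h. \<bar>0 - h\<bar> < d \<longrightarrow> f (x + 0 *\<^sub>R v) \<le> f (x + h *\<^sub>R v)"
  proof (intro allI impI)
    fix h assume "\<bar>0 - h\<bar> < d"
    then show "f (x + 0 *\<^sub>R v) \<le> f (x + h *\<^sub>R v)" using min d(2)[of h] by (cases "h = 0") auto
  qed
  from DERIV_local_min[OF D d(1) this] show 1: "dd v f x = 0" .
  have "0 \<le> dd v (dd v f) x / 2"
  proof (rule tendsto_lowerbound[OF peano_line[OF U f]])
    show "\<forall>\<^sub>F h in at 0. 0 \<le> (f (x + h *\<^sub>R v) - f x - h * dd v f x) / h\<^sup>2"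
      using near by eventually_elim (use min 1 in simp)
  qed simp
  then show "0 \<le> dd v (dd v f) x" by simp
qed

text \<open>If \<open>R v c\<close> were not 0, moving from \<open>v\<close> by a small multiple of
  \<open>c\<close> with the right sign would make the form negative. The summand 1 in the
  denominator of \<open>s\<close> covers the case \<open>R c c = 0\<close>.\<close>

lemma psd_kernel:
  fixes R :: "'a::real_vector \<Rightarrow> 'a \<Rightarrow> real"
  assumes R: "bilinear R" and sym: "\<And>b c. R b c = R c b" and psd: "\<And>b. 0 \<le> R b b" and v: "R v v = 0"
  shows "R v c = 0"
proof (rule ccontr)
  assume ne: "R v c \<noteq> 0"
  define s where "s = - R v c / (R c c + 1)"
  have p: "R c c + 1 > 0" using psd[of c] by simp
  have "R (v + s *\<^sub>R c) (v + s *\<^sub>R c) = 2 * s * R v c + s * s * R c c"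
    using v sym[of c v] by (simp add: bilinear_ladd[OF R] bilinear_radd[OF R] bilinear_lmul[OF R] bilinear_rmul[OF R] algebra_simps)
  then have "0 \<le> 2 * s * R v c + s * s * R c c" using psd[of "v + s *\<^sub>R c"] by simp
  also have "\<dots> \<le> 2 * s * R v c + s * s * (R c c + 1)" by (simp add: algebra_simps)
  also have "s * (R c c + 1) = - R v c" using p by (simp add: s_def)
  then have "2 * s * R v c + s * s * (R c c + 1) = s * R v c" by (simp add: mult.assoc)
  also have "s * R v c = - ((R v c)\<^sup>2 / (R c c + 1))" by (simp add: s_def power2_eq_square)
  finally have "(R v c)\<^sup>2 / (R c c + 1) \<le> 0" by simp
  moreover have "0 < (R v c)\<^sup>2 / (R c c + 1)" using p ne by (intro divide_pos_pos) auto
  ultimately show False by linarith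
qed

section \<open>Normal curvatures are bounded by principal curvatures\<close>

context immersed begin

text \<open>The quotient of the two fundamental forms attains its maximum \<open>k\<close> on the
  unit circle of parameters. There \<open>k\<close> times the first form minus the second is
  nonnegative with a null vector, which by \<open>psd_kernel\<close> solves the eigenvalue equation;
  so \<open>k\<close> is a principal curvature up to the sign \<sigma>. The two signs give the two
  halves of the absolute value.\<close>

lemma second_ff_bound:
  assumes p: "p \<in> pts S" and K: "\<And>k. principal_curvature S p k \<Longrightarrow> \<bar>k\<bar> \<le> K" and P: "param_at S p = (V, \<psi>)"
    and w: "norm w = 1" "\<And>v. w \<bullet> dd v (pos S \<circ> \<psi>) (coord_at S p) = 0"
  shows "\<bar>dd b (dd b (pos S \<circ> \<psi>)) (coord_at S p) \<bullet> w\<bar> \<le> K * (norm (dd b (pos S \<circ> \<psi>) (coord_at S p)))\<^sup>2"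
proof -
  define F where "F = pos S \<circ> \<psi>"
  define y where "y = coord_at S p"
  have c: "(V, \<psi>) \<in> params S" and y: "y \<in> V" using param_at[OF p] P by (auto simp: y_def)
  note I = chart_immersion[OF c, folded F_def]
  note o = immersion_onD(1)[OF I] and F2 = immersion_onD(2)[OF I]
  have dF: "F differentiable (at y)" by (rule C2_diff[OF F2 y])
  have linF: "linear (\<lambda>v. dd v F y)" by (rule dd_linear[OF dF])
  have injF: "dd v F y = 0 \<Longrightarrow> v = 0" for v
    using immersion_onD(3)[OF I y] linear_injective_0[OF linear_frechet_derivative[OF dF]] by blast
  define g where "g = gauss_normal S p"
  have g: "g = sgn (cross3 (dd (axis 1 1) F y) (dd (axis 2 1) F y))"
    by (simp add: g_def gauss_normal_def local_pos_def P y_def F_def pderiv_at_eq)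
  have cn: "cross3 (dd (axis 1 1) F y) (dd (axis 2 1) F y) \<noteq> 0" by (rule cross3_immersion[OF I y])
  have ng: "norm g = 1" using cn by (simp add: g norm_sgn)
  have wg: "w = (w \<bullet> g) *\<^sub>R g" unfolding g by (rule cross3_normal[OF _ _ cn]) (use w(2) in \<open>simp_all add: F_def y_def\<close>)
  have awg: "\<bar>w \<bullet> g\<bar> = 1" using arg_cong[OF wg, of norm] w(1) ng by simp
  have bil: "bilinear (\<lambda>v w. dd v (dd w F) y)" by (rule dd2_bilinear[OF o y F2])
  have one: "\<sigma> * (dd b (dd b F) y \<bullet> g) \<le> K * (norm (dd b F y))\<^sup>2" if \<sigma>: "\<sigma> * \<sigma> = 1" for \<sigma> b
  proof -
    define Q where "Q = (\<lambda>v. \<sigma> * (dd v (dd v F) y \<bullet> g))"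
    define G where "G = (\<lambda>v. (norm (dd v F y))\<^sup>2)"
    have Gp: "G v > 0" if "v \<noteq> 0" for v using injF that by (auto simp: G_def)
    have cQ: "continuous_on A Q" for A
    proof -
      have "Q = (\<lambda>v. \<sigma> * ((\<Sum>i\<in>UNIV. \<Sum>j\<in>UNIV. (v $ i * v $ j) *\<^sub>R dd (axis i 1) (dd (axis j 1) F) y) \<bullet> g))"
        unfolding Q_def by (rule ext) (subst bilinear_axis_expand[OF bil], rule refl)
      then show ?thesis by (simp only:) (intro continuous_intros)
    qed
    have cG: "continuous_on A G" for A
      unfolding G_def by (intro continuous_intros linear_continuous_on linear_conv_bounded_linear[THEN iffD1] linF)
    have "continuous_on (sphere 0 1) (\<lambda>v. Q v / G v)"

    proof (intro continuous_on_divide cQ cG ballI)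
      show "G v \<noteq> 0" if "v \<in> sphere 0 1" for v
      proof -
        have "v \<noteq> 0" using that by auto
        then show ?thesis using Gp[of v] by simp
      qed
    qed
    moreover have "compact (sphere (0::real^2) 1)" "sphere (0::real^2) 1 \<noteq> {}" by auto
    ultimately obtain v0 where v0: "v0 \<in> sphere 0 1" "\<And>v. v \<in> sphere 0 1 \<Longrightarrow> Q v / G v \<le> Q v0 / G v0"
      using continuous_attains_sup[of "sphere 0 1" "\<lambda>v. Q v / G v"] by blast
    define k where "k = Q v0 / G v0"
    have v0n: "v0 \<noteq> 0" using v0(1) by auto
    have Qk: "Q v \<le> k * G v" for v
    proof (cases "v = 0")
      case True
      then show ?thesis using linear_0[OF linF] bilinear_lzero[OF bil] by (simp add: Q_def G_def)
    next
      case False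
      define e where "e = (1 / norm v) *\<^sub>R v"
      have e: "e \<in> sphere 0 1" "v = norm v *\<^sub>R e" using False by (simp_all add: e_def)
      have "e \<noteq> 0" using e(1) by auto
      then have "Q e \<le> k * G e" using v0(2)[OF e(1)] Gp by (simp add: k_def pos_divide_le_eq)
      moreover have "Q v = (norm v)\<^sup>2 * Q e"
        by (subst e(2)) (simp add: Q_def bilinear_lmul[OF bil] bilinear_rmul[OF bil] power2_eq_square)
      moreover have "G v = (norm v)\<^sup>2 * G e"
        by (subst e(2)) (simp add: G_def dd_scaleR[OF dF] power_mult_distrib)
      moreover have "(norm v)\<^sup>2 * Q e \<le> (norm v)\<^sup>2 * (k * G e)" if "Q e \<le> k * G e" using that by (intro mult_left_mono) auto
      ultimately show ?thesis by (simp add: mult.left_commute)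
    qed
    define R where "R = (\<lambda>b c. k * (dd b F y \<bullet> dd c F y) - \<sigma> * (dd b (dd c F) y \<bullet> g))"
    have "bilinear R"
      unfolding bilinear_def R_def
      by (auto intro!: linearI simp: dd_add[OF dF] dd_scaleR[OF dF] bilinear_ladd[OF bil] bilinear_radd[OF bil]
          bilinear_lmul[OF bil] bilinear_rmul[OF bil] inner_add_left inner_add_right algebra_simps)
    moreover have "R b c = R c b" for b c
      unfolding R_def using dd_commute[OF o y F2, of b c] by (simp add: inner_commute)
    moreover have "0 \<le> R b b" for b using Qk[of b] by (simp add: R_def Q_def G_def power2_norm_eq_inner)
    moreover have "R v0 v0 = 0" using Gp[OF v0n] by (simp add: R_def k_def Q_def G_def power2_norm_eq_inner)
    ultimately have R0: "R v0 c = 0" for c by (rule psd_kernel)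
    have II: "second_ff F g y *v v0 = (\<sigma> * k) *s (first_ff F y *v v0)"
    proof (rule vec_eq_iff[THEN iffD2], rule allI)
      fix i :: 2
      have "(second_ff F g y *v v0) $ i = dd (axis i 1) (dd v0 F) y \<bullet> g"
      proof -
        have "dd (axis i 1) (dd (v0 $ 1 *\<^sub>R axis 1 1 + v0 $ 2 *\<^sub>R axis 2 1) F) y
          = v0 $ 1 *\<^sub>R dd (axis i 1) (dd (axis 1 1) F) y + v0 $ 2 *\<^sub>R dd (axis i 1) (dd (axis 2 1) F) y"
          by (simp only: bilinear_radd[OF bil] bilinear_rmul[OF bil])
        then show ?thesis unfolding axis2_expand[symmetric]
          by (simp add: second_ff_def pderiv_at_eq matrix_vector_mult_def sum_2 inner_add_left mult.commute)
      qed
      also have "\<dots> = dd v0 (dd (axis i 1) F) y \<bullet> g" using dd_commute[OF o y F2] by metis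
      also have "\<dots> = \<sigma> * (\<sigma> * (dd v0 (dd (axis i 1) F) y \<bullet> g))" using \<sigma> by (simp add: mult.assoc[symmetric])
      also have "\<dots> = \<sigma> * (k * (dd v0 F y \<bullet> dd (axis i 1) F y))" using R0[of "axis i 1"] by (simp add: R_def)
      also have "dd v0 F y \<bullet> dd (axis i 1) F y = (first_ff F y *v v0) $ i"
        unfolding dd_axis_expand[OF dF, of v0]
        by (simp add: matrix_vector_mult_def sum_2 first_ff_nth inner_add_left inner_add_right inner_commute mult.commute)
      finally show "(second_ff F g y *v v0) $ i = ((\<sigma> * k) *s (first_ff F y *v v0)) $ i" by (simp add: mult.assoc)
    qed
    have ne: "det (first_ff F y) \<noteq> 0" using det_first_ff_pos[OF I y] by simp
    have "shape_matrix S g p *v v0 = matrix_inv (first_ff F y) *v (second_ff F g y *v v0)"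
      by (simp add: shape_matrix_def local_pos_def P F_def y_def matrix_vector_mul_assoc)
    also have "\<dots> = (\<sigma> * k) *s ((matrix_inv (first_ff F y) ** first_ff F y) *v v0)"
      unfolding II by (simp add: matrix_vector_mul_assoc[symmetric] vector_scalar_commute)
    also have "\<dots> = (\<sigma> * k) *s v0" by (simp add: matrix_inv_2(6)[OF ne] matrix_vector_mul_lid)
    finally have "principal_curvature S p (\<sigma> * k)"
      unfolding principal_curvature_def g_def[symmetric] using v0n by blast
    then have "\<bar>\<sigma> * k\<bar> \<le> K" by (rule K)
    moreover have "\<bar>\<sigma>\<bar> = 1" using \<sigma> by (metis abs_1 abs_mult abs_mult_self_eq real_sqrt_abs2 real_sqrt_one)
    ultimately have "k \<le> K" by (simp add: abs_mult)
    then have "k * G b \<le> K * G b" by (intro mult_right_mono) (simp_all add: G_def)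
    then show ?thesis using Qk[of b] by (simp add: Q_def G_def)
  qed
  have "\<bar>dd b (dd b F) y \<bullet> g\<bar> \<le> K * (norm (dd b F y))\<^sup>2" using one[of 1 b] one[of "-1" b] by (simp add: abs_le_iff)
  moreover have "\<bar>dd b (dd b F) y \<bullet> w\<bar> = \<bar>dd b (dd b F) y \<bullet> g\<bar>"
    by (subst wg) (simp add: abs_mult awg)
  ultimately show ?thesis by (simp add: F_def y_def)
qed

end

text \<open>The points \<open>X x'\<close> are compared with the points of \<open>F\<close> whose parameters depend affinely on \<open>x'\<close>, the linear
  part being chosen so that it corresponds to the orthogonal projection between the tangent planes.\<close>

lemma two_point_laplacian:
  assumes X: "immersion_on U X" and x: "x \<in> U" and frX: "lap_frame X x a1 a2 c"
    and F: "immersion_on V F" and y: "y \<in> V" and frF: "lap_frame F y f1 f2 d"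
    and t: "X x - F y = t *\<^sub>R w" "t > 0" "norm w = 1" and wF: "\<And>v. w \<bullet> dd v F y = 0"
    and bound: "\<And>b. \<bar>dd b (dd b F) y \<bullet> w\<bar> \<le> \<kappa> * (norm (dd b F y))\<^sup>2" and \<kappa>: "\<kappa> \<ge> 0"
  shows "\<exists>W z. open W \<and> x \<in> W \<and> W \<subseteq> U \<and> Ck_on 2 W z \<and> z x = exp (- \<kappa> * t) \<and>
    (\<forall>x'\<in>W. \<exists>y'\<in>V. z x' = exp (- \<kappa> * dist (X x') (F y'))) \<and>
    \<kappa> * exp (- \<kappa> * t) * (w \<bullet> (dd f1 (dd f1 F) y + dd f2 (dd f2 F) y + dd d F y)
      - w \<bullet> (dd a1 (dd a1 X) x + dd a2 (dd a2 X) x + dd c X x)) \<le> local_laplacian X z x"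
proof -
  note oU = immersion_onD(1)[OF X] and X2 = immersion_onD(2)[OF X]
  note oV = immersion_onD(1)[OF F] and F2 = immersion_onD(2)[OF F]
  have dX: "X differentiable (at x)" by (rule C2_diff[OF X2 x])
  have dF: "F differentiable (at y)" by (rule C2_diff[OF F2 y])
  define F1 where "F1 = dd f1 F y"
  define F2' where "F2' = dd f2 F y"
  have on: "norm F1 = 1" "norm F2' = 1" "F1 \<bullet> F2' = 0" using frF by (auto simp: lap_frame_def F1_def F2'_def)
  have wo: "w \<bullet> F1 = 0" "w \<bullet> F2' = 0" using wF by (simp_all add: F1_def F2'_def)
  \<comment> \<open>Parameter vector whose image under the differential of \<open>F\<close> is the
    orthogonal projection of \<open>p\<close> to the tangent plane; see \<open>dFT\<close>.\<close>
  define T where "T = (\<lambda>p. (p \<bullet> F1) *\<^sub>R f1 + (p \<bullet> F2') *\<^sub>R f2)"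
  define B where "B = (\<lambda>k. T (dd k X x))"
  have "linear B" unfolding B_def T_def
    by (auto intro!: linearI simp: dd_add[OF dX] dd_scaleR[OF dX] inner_add_left algebra_simps)
  then have Bb: "bounded_linear B" by (simp add: linear_conv_bounded_linear)
  have dFT: "dd (T p) F y = p - (p \<bullet> w) *\<^sub>R w" for p
  proof -
    have "dd (T p) F y = (p \<bullet> F1) *\<^sub>R F1 + (p \<bullet> F2') *\<^sub>R F2'" by (simp add: T_def dd_add[OF dF] dd_scaleR[OF dF] F1_def F2'_def)
    then show ?thesis using orthonormal_expand3[OF on(1,2) t(3) on(3) wo, of p] by (metis add_diff_cancel_right')
  qed
  \<comment> \<open>Being affine, this pairing has no second derivatives and so contributes no first
    derivatives of \<open>F\<close> at second order.\<close>
  define yy where "yy = (\<lambda>x'. y + B (x' - x))"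
  have yyx: "yy x = y" using linear_0[OF \<open>linear B\<close>] by (simp add: yy_def)
  have dyy: "dd k yy z = B k" for k z
  proof (rule dd_eqI)
    show "(yy has_derivative B) (at z)" unfolding yy_def
      by (auto intro!: derivative_eq_intros bounded_linear.has_derivative[OF Bb])
  qed
  have yy2: "Ck_on 2 UNIV yy"
    unfolding yy_def by (intro Ck_on_add Ck_on_const Ck_on_compose_linear[OF _ Bb] Ck_on_diff Ck_on_ident open_UNIV)
  have ddyy: "dd k (dd k yy) z = 0" for k z unfolding dyy by (rule dd_const)
  define W1 where "W1 = U \<inter> yy -` V"
  have W1: "open W1" unfolding W1_def
    by (rule continuous_open_preimage[OF continuous_on_subset[OF Ck_on_cont[OF yy2]] oU oV]) simp
  have W1U: "W1 \<subseteq> U" by (auto simp: W1_def)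
  have yyV: "\<And>z. z \<in> W1 \<Longrightarrow> yy z \<in> V" by (auto simp: W1_def)
  have xW1: "x \<in> W1" using x y yyx by (simp add: W1_def)
  have yyW1: "Ck_on 2 W1 yy" by (rule Ck_on_subset[OF yy2 subset_UNIV])
  have FW: "Ck_on 2 W1 (\<lambda>z. F (yy z))" by (rule Ck_on_compose[OF W1 yyV F2 yyW1])
  define Y where "Y = (\<lambda>z. X z - F (yy z))"
  have Y2: "Ck_on 2 W1 Y" unfolding Y_def by (intro Ck_on_diff W1 FW Ck_on_subset[OF X2 W1U])
  define W where "W = W1 \<inter> Y -` (- {0})"
  have W: "open W" unfolding W_def by (rule continuous_open_preimage[OF Ck_on_cont[OF Y2] W1]) auto
  have Yx: "Y x = t *\<^sub>R w" using t(1) by (simp add: Y_def yyx)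
  have xW: "x \<in> W" using xW1 Yx t by (auto simp: W_def)
  have WU: "W \<subseteq> U" using W1U by (auto simp: W_def)
  have YW: "Ck_on 2 W Y" by (rule Ck_on_subset[OF Y2]) (auto simp: W_def)
  have nz: "\<And>z. z \<in> W \<Longrightarrow> Y z \<noteq> 0" by (auto simp: W_def)
  define z where "z = (\<lambda>x'. expdist \<kappa> (Y x'))"
  have ex: "Ck_on 2 W z" "dd a z x = - \<kappa> * exp (- \<kappa> * t) * (w \<bullet> dd a Y x)"
    "dd a (dd a z) x = \<kappa> * exp (- \<kappa> * t) * (\<kappa> * (w \<bullet> dd a Y x)\<^sup>2
       - ((norm (dd a Y x))\<^sup>2 - (w \<bullet> dd a Y x)\<^sup>2) / t - w \<bullet> dd a (dd a Y) x)" for a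
    unfolding z_def by (rule expdist_compose_dd[OF W xW YW nz Yx t(2,3)]; assumption)+
  have dY1: "dd k Y z = dd k X z - dd (B k) F (yy z)" if z: "z \<in> W1" for k z
  proof -
    have "dd k Y z = dd k X z - dd k (\<lambda>z. F (yy z)) z" unfolding Y_def
      using dd_eqI[OF has_derivative_diff[OF Ck_on_has_derivative[OF X2, of z] Ck_on_has_derivative[OF FW _ z]]] z W1U by auto
    also have "dd k (\<lambda>z. F (yy z)) z = dd (B k) F (yy z)"
      unfolding dd_compose[OF C2_diff[OF F2 yyV[OF z]] C2_diff[OF yyW1 z]] dyy ..
    finally show ?thesis .
  qed
  have dY: "dd k Y x = (dd k X x \<bullet> w) *\<^sub>R w" for k
    unfolding dY1[OF xW1] yyx B_def dFT by simp
  have ddY: "dd k (dd k Y) x = dd k (dd k X) x - dd (B k) (dd (B k) F) y" for k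
  proof -
    have "dd k (dd k Y) x = dd k (\<lambda>z. dd k X z - dd k (\<lambda>z. F (yy z)) z) x"
    proof (rule dd_cong[OF W1 xW1])
      show "dd k Y z = dd k X z - dd k (\<lambda>z. F (yy z)) z" if z: "z \<in> W1" for z unfolding Y_def
        using dd_eqI[OF has_derivative_diff[OF Ck_on_has_derivative[OF X2, of z] Ck_on_has_derivative[OF FW _ z]]] z W1U by auto
    qed
    also have "\<dots> = dd k (dd k X) x - dd k (dd k (\<lambda>z. F (yy z))) x"
      using dd_eqI[OF has_derivative_diff[OF Ck_on_has_derivative[OF C2_dd[OF X2] _ x] Ck_on_has_derivative[OF C2_dd[OF FW] _ xW1]]] by simp
    also have "dd k (dd k (\<lambda>z. F (yy z))) x = dd (B k) (dd (B k) F) y"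
    proof -
      have s: "dd k (dd k (\<lambda>z. F (yy z))) x = dd (dd k yy x) (dd (dd k yy x) F) (yy x) + dd (dd k (dd k yy) x) F (yy x)"
        by (rule dd2_compose[OF W1 oV F2 yyW1 yyV xW1])
      show ?thesis unfolding s unfolding ddyy unfolding dyy yyx using linear_0[OF dd_linear[OF dF]] by simp
    qed
    finally show ?thesis .
  qed
  have onX: "norm (dd a1 X x) = 1" "norm (dd a2 X x) = 1" "dd a1 X x \<bullet> dd a2 X x = 0" using frX by (auto simp: lap_frame_def)
  \<comment> \<open>The frame of \<open>X\<close> and its unit normal \<nu> form an orthonormal
    basis of space, and the sum of \<open>Q (T p)\<close> over it is the full trace of the second
    form of \<open>F\<close>. The comparison sees only the two tangent vectors, so
    \<open>Q (T \<nu>)\<close> is the error caused by the tilt.\<close>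
  define \<nu> where "\<nu> = cross3 (dd a1 X x) (dd a2 X x)"
  note \<nu> = unit_normal_cross[OF onX, folded \<nu>_def]
  note pars = orthonormal_parseval3[OF onX(1,2) \<nu>(1) onX(3) \<nu>(2,3)]
  define Q where "Q = (\<lambda>b. dd b (dd b F) y \<bullet> w)"
  have bil: "bilinear (\<lambda>v w. dd v (dd w F) y)" by (rule dd2_bilinear[OF oV y F2])
  have QT: "Q (T p) = (p \<bullet> F1) * (p \<bullet> F1) * Q f1 + (p \<bullet> F1) * (p \<bullet> F2') * (2 * (dd f1 (dd f2 F) y \<bullet> w)) + (p \<bullet> F2') * (p \<bullet> F2') * Q f2" for p
  proof -
    have "dd (T p) (dd (T p) F) y = (p \<bullet> F1) *\<^sub>R ((p \<bullet> F1) *\<^sub>R dd f1 (dd f1 F) y + (p \<bullet> F2') *\<^sub>R dd f2 (dd f1 F) y)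
      + (p \<bullet> F2') *\<^sub>R ((p \<bullet> F1) *\<^sub>R dd f1 (dd f2 F) y + (p \<bullet> F2') *\<^sub>R dd f2 (dd f2 F) y)"
      unfolding T_def by (simp only: bilinear_ladd[OF bil] bilinear_radd[OF bil] bilinear_lmul[OF bil] bilinear_rmul[OF bil] scaleR_add_right)
    then show ?thesis unfolding dd_commute[OF oV y F2, of f2 f1] Q_def
      by (simp only: inner_add_left inner_scaleR_left) (simp add: algebra_simps)
  qed
  have tr: "Q (T (dd a1 X x)) + Q (T (dd a2 X x)) + Q (T \<nu>) = Q f1 + Q f2"
  proof -
    have "Q (T (dd a1 X x)) + Q (T (dd a2 X x)) + Q (T \<nu>) = (F1 \<bullet> F1) * Q f1 + (F1 \<bullet> F2') * (2 * (dd f1 (dd f2 F) y \<bullet> w)) + (F2' \<bullet> F2') * Q f2"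
      unfolding QT pars[of F1 F1] pars[of F1 F2'] pars[of F2' F2'] by (simp add: inner_commute algebra_simps)
    then show ?thesis using on by (simp add: norm_eq_1)
  qed
  \<comment> \<open>The projections of \<nu> to the tangent plane of \<open>F\<close> and of
    \<open>w\<close> to that of \<open>X\<close> have the same length. Hence the error is at most
    \<kappa> times the squared gradient of the distance, which is what the exponential of rate
    \<kappa> supplies.\<close>
  have Q\<nu>: "Q (T \<nu>) \<le> \<kappa> * ((w \<bullet> dd a1 X x)\<^sup>2 + (w \<bullet> dd a2 X x)\<^sup>2)"
  proof -
    have "(norm (dd (T \<nu>) F y))\<^sup>2 = 1 - (w \<bullet> \<nu>)\<^sup>2"
      unfolding dFT power2_norm_eq_inner using \<nu>(1) t(3)
      by (simp add: inner_diff_left inner_diff_right norm_eq_1 inner_commute power2_eq_square)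
    also have "\<dots> = (w \<bullet> dd a1 X x)\<^sup>2 + (w \<bullet> dd a2 X x)\<^sup>2"
      using pars[of w w] t(3) by (simp add: norm_eq_1 power2_eq_square)
    finally have "(norm (dd (T \<nu>) F y))\<^sup>2 = (w \<bullet> dd a1 X x)\<^sup>2 + (w \<bullet> dd a2 X x)\<^sup>2" .
    then show ?thesis using bound[of "T \<nu>"] by (simp add: Q_def abs_le_iff)
  qed
  have XW: "immersion_on W X" by (rule immersion_on_subset[OF X W WU])
  define E where "E = exp (- \<kappa> * t)"
  have dda: "dd k (dd k z) x = \<kappa> * E * (\<kappa> * (w \<bullet> dd k X x)\<^sup>2 - w \<bullet> dd k (dd k X) x + Q (T (dd k X x)))" for k
  proof -
    have "w \<bullet> dd k Y x = w \<bullet> dd k X x" using t(3) by (simp add: dY norm_eq_1 inner_commute)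
    moreover have "(norm (dd k Y x))\<^sup>2 = (w \<bullet> dd k X x)\<^sup>2" using t(3) by (simp add: dY inner_commute)
    ultimately show ?thesis unfolding ex(3) E_def
      by (simp add: ddY inner_diff_right Q_def B_def inner_commute)
  qed
  have ddc: "dd c z x = \<kappa> * E * (- (w \<bullet> dd c X x))"
    unfolding ex(2) E_def using t(3) by (simp add: dY norm_eq_1 inner_commute)
  have "local_laplacian X z x = dd a1 (dd a1 z) x + dd a2 (dd a2 z) x + dd c z x"
    by (rule local_laplacian_frame[OF XW xW ex(1) frX])
  also have "\<dots> = \<kappa> * E * (\<kappa> * ((w \<bullet> dd a1 X x)\<^sup>2 + (w \<bullet> dd a2 X x)\<^sup>2) - w \<bullet> (dd a1 (dd a1 X) x + dd a2 (dd a2 X) x + dd c X x)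
      + (Q f1 + Q f2 - Q (T \<nu>)))"
    unfolding dda ddc tr[symmetric] by (simp add: inner_add_right algebra_simps)
  finally have lap: "local_laplacian X z x = \<dots>" .
  have "w \<bullet> (dd f1 (dd f1 F) y + dd f2 (dd f2 F) y + dd d F y) = Q f1 + Q f2"
    using wF[of d] by (simp add: inner_add_right Q_def inner_commute)
  then have "\<kappa> * E * (w \<bullet> (dd f1 (dd f1 F) y + dd f2 (dd f2 F) y + dd d F y)
      - w \<bullet> (dd a1 (dd a1 X) x + dd a2 (dd a2 X) x + dd c X x)) \<le> local_laplacian X z x"
    unfolding lap using Q\<nu> \<kappa> by (intro mult_left_mono) (auto simp: E_def)
  moreover have "z x = exp (- \<kappa> * t)" using t(2,3) by (simp add: z_def expdist_def Yx)
  moreover have "\<forall>x'\<in>W. \<exists>y'\<in>V. z x' = exp (- \<kappa> * dist (X x') (F y'))"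
    using yyV by (auto simp: W_def z_def expdist_def Y_def dist_norm)
  ultimately show ?thesis using W xW WU ex(1) unfolding E_def by blast
qed

text \<open>Both parameters move along lines, independently, and the squared distance, which avoids
  the root, is minimal at time 0. The two claims are its first and second derivative tests.\<close>

lemma two_point_hessian:
  assumes X: "immersion_on U X" and x: "x \<in> U" and F: "immersion_on V F" and y: "y \<in> V"
    and t: "X x - F y = t *\<^sub>R w" "t > 0" "norm w = 1"
    and min: "\<And>x' y'. x' \<in> U \<Longrightarrow> y' \<in> V \<Longrightarrow> t \<le> dist (X x') (F y')"
  shows "w \<bullet> (dd e X x - dd b F y) = 0"
    "0 \<le> (norm (dd e X x - dd b F y))\<^sup>2 / t + w \<bullet> (dd e (dd e X) x - dd b (dd b F) y)"
proof -
  note oU = immersion_onD(1)[OF X] and X2 = immersion_onD(2)[OF X]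
  note oV = immersion_onD(1)[OF F] and F2 = immersion_onD(2)[OF F]
  define p where "p = (\<lambda>s::real. x + s *\<^sub>R e)"
  define q where "q = (\<lambda>s::real. y + s *\<^sub>R b)"
  have C2p: "Ck_on 2 UNIV p" "Ck_on 2 UNIV q" unfolding p_def q_def
    by (intro Ck_on_add Ck_on_const Ck_on_scaleR Ck_on_ident open_UNIV)+
  have dp: "dd k p s = k *\<^sub>R e" "dd k q s = k *\<^sub>R b" for k s
    unfolding p_def q_def by (rule dd_eqI, auto intro!: derivative_eq_intros)+
  have ddp: "dd k (dd k p) s = 0" "dd k (dd k q) s = 0" for k s unfolding dp by (rule dd_const)+
  define J where "J = p -` U \<inter> q -` V"
  have J: "open J" unfolding J_def
    by (intro open_Int open_vimage oU oV) (use Ck_on_cont[OF C2p(1)] Ck_on_cont[OF C2p(2)] in auto)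
  have 0: "0 \<in> J" using x y by (simp add: J_def p_def q_def)
  have pq: "\<And>s. s \<in> J \<Longrightarrow> p s \<in> U" "\<And>s. s \<in> J \<Longrightarrow> q s \<in> V" by (auto simp: J_def)
  note pJ = Ck_on_subset[OF C2p(1) subset_UNIV[of J]] and qJ = Ck_on_subset[OF C2p(2) subset_UNIV[of J]]
  have XJ: "Ck_on 2 J (\<lambda>s. X (p s))" by (rule Ck_on_compose[OF J pq(1) X2 pJ])
  have FJ: "Ck_on 2 J (\<lambda>s. F (q s))" by (rule Ck_on_compose[OF J pq(2) F2 qJ])
  define Y where "Y = (\<lambda>s. X (p s) - F (q s))"
  have Y2: "Ck_on 2 J Y" unfolding Y_def by (intro Ck_on_diff J XJ FJ)
  have Y0: "Y 0 = t *\<^sub>R w" using t(1) by (simp add: Y_def p_def q_def)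
  have p0: "p 0 = x" "q 0 = y" by (simp_all add: p_def q_def)
  have dYs: "dd 1 Y s = dd 1 (\<lambda>s. X (p s)) s - dd 1 (\<lambda>s. F (q s)) s" if "s \<in> J" for s unfolding Y_def
    using dd_eqI[OF has_derivative_diff[OF Ck_on_has_derivative[OF XJ _ that] Ck_on_has_derivative[OF FJ _ that]]] by simp
  have dY: "dd 1 Y 0 = dd e X x - dd b F y"
    unfolding dYs[OF 0] dd_compose[OF C2_diff[OF X2 pq(1)[OF 0]] C2_diff[OF pJ 0]]
      dd_compose[OF C2_diff[OF F2 pq(2)[OF 0]] C2_diff[OF qJ 0]] dp p0 by simp
  have ddY: "dd 1 (dd 1 Y) 0 = dd e (dd e X) x - dd b (dd b F) y"
  proof -
    have "dd 1 (dd 1 Y) 0 = dd 1 (\<lambda>s. dd 1 (\<lambda>s. X (p s)) s - dd 1 (\<lambda>s. F (q s)) s) 0" by (rule dd_cong[OF J 0 dYs])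
    also have "\<dots> = dd 1 (dd 1 (\<lambda>s. X (p s))) 0 - dd 1 (dd 1 (\<lambda>s. F (q s))) 0"
      using dd_eqI[OF has_derivative_diff[OF Ck_on_has_derivative[OF C2_dd[OF XJ] _ 0] Ck_on_has_derivative[OF C2_dd[OF FJ] _ 0]]] by simp
    also have "\<dots> = dd e (dd e X) x - dd b (dd b F) y"
    proof -
      have s1: "dd 1 (dd 1 (\<lambda>s. X (p s))) 0 = dd (dd 1 p 0) (dd (dd 1 p 0) X) (p 0) + dd (dd 1 (dd 1 p) 0) X (p 0)"
        by (rule dd2_compose[OF J oU X2 pJ pq(1) 0])
      have s2: "dd 1 (dd 1 (\<lambda>s. F (q s))) 0 = dd (dd 1 q 0) (dd (dd 1 q 0) F) (q 0) + dd (dd 1 (dd 1 q) 0) F (q 0)"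
        by (rule dd2_compose[OF J oV F2 qJ pq(2) 0])
      show ?thesis unfolding s1 s2 unfolding ddp unfolding dp p0
        using linear_0[OF dd_linear[OF C2_diff[OF X2 x]]] linear_0[OF dd_linear[OF C2_diff[OF F2 y]]] by simp
    qed
    finally show ?thesis .
  qed
  define f where "f = (\<lambda>s. Y s \<bullet> Y s)"
  have f2: "Ck_on 2 J f" unfolding f_def by (intro Ck_on_inner J Y2)
  have fmin: "f 0 \<le> f s" if "s \<in> J" for s
  proof -
    have "t \<le> norm (Y s)" using min[OF pq(1)[OF that] pq(2)[OF that]] by (simp add: Y_def dist_norm)
    then have "t\<^sup>2 \<le> (norm (Y s))\<^sup>2" using t(2) by (intro power_mono) auto
    moreover have "f 0 = t\<^sup>2" using t(3) by (simp add: f_def Y0 norm_eq_1 power2_eq_square)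
    ultimately show ?thesis by (simp add: f_def power2_norm_eq_inner)
  qed
  note test = second_derivative_test[OF J 0 f2 fmin, of 1]
  have dfs: "dd 1 f s = 2 * (dd 1 Y s \<bullet> Y s)" if "s \<in> J" for s
    unfolding f_def dd_inner2[OF C2_diff[OF Y2 that] C2_diff[OF Y2 that]] by (simp add: inner_commute)
  have "dd 1 f 0 = 2 * t * ((dd e X x - dd b F y) \<bullet> w)" unfolding dfs[OF 0] dY Y0 by simp
  then show "w \<bullet> (dd e X x - dd b F y) = 0" using test(1) t(2) by (simp add: inner_commute)
  have "dd 1 (dd 1 f) 0 = dd 1 (\<lambda>s. 2 * (dd 1 Y s \<bullet> Y s)) 0" by (rule dd_cong[OF J 0 dfs])
  also have "\<dots> = 2 * (dd 1 (dd 1 Y) 0 \<bullet> Y 0 + dd 1 Y 0 \<bullet> dd 1 Y 0)"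
  proof -
    have i: "(\<lambda>s. dd 1 Y s \<bullet> Y s) differentiable (at 0)"
      by (rule C1_diff[OF _ 0]) (intro Ck_on_inner J C2_dd[OF Y2] C2_C1[OF Y2])
    have "dd 1 (\<lambda>s. 2 * (dd 1 Y s \<bullet> Y s)) 0 = 2 * dd 1 (\<lambda>s. dd 1 Y s \<bullet> Y s) 0"
      using dd_eqI[OF has_derivative_mult_right[OF i[unfolded frechet_derivative_works]]] by simp
    then show ?thesis unfolding dd_inner2[OF C1_diff[OF C2_dd[OF Y2] 0] C2_diff[OF Y2 0]] .
  qed
  finally have "0 \<le> (dd e (dd e X) x - dd b (dd b F) y) \<bullet> (t *\<^sub>R w) + (norm (dd e X x - dd b F y))\<^sup>2"
    using test(2) unfolding ddY dY Y0 by (simp add: power2_norm_eq_inner)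
  then have "0 \<le> (t * (w \<bullet> (dd e (dd e X) x - dd b (dd b F) y)) + (norm (dd e X x - dd b F y))\<^sup>2) / t"
    using t(2) by (simp add: inner_commute)
  then show "0 \<le> (norm (dd e X x - dd b F y))\<^sup>2 / t + w \<bullet> (dd e (dd e X) x - dd b (dd b F) y)"
    using t(2) by (simp add: add_divide_distrib add.commute)
qed

lemma immersion_normal_line:
  assumes X: "immersion_on U X" and x: "x \<in> U" and w: "norm w = 1" "\<And>e. w \<bullet> dd e X x = 0"
    and u: "\<And>e. u \<bullet> dd e X x = 0"
  shows "u = (u \<bullet> w) *\<^sub>R w"
proof -
  obtain a b k where "lap_frame X x a b k" using lap_frame_exists[OF X x] by blast
  then have on: "norm (dd a X x) = 1" "norm (dd b X x) = 1" "dd a X x \<bullet> dd b X x = 0" by (auto simp: lap_frame_def)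
  show ?thesis using orthonormal_expand3[OF on(1,2) w(1) on(3) w(2) w(2), of u] u by simp
qed

lemma unit_normal_unique:
  assumes X: "immersion_on U X" and x: "x \<in> U" and w: "norm w = 1" "\<And>e. w \<bullet> dd e X x = 0"
    and u: "norm u = 1" "\<And>e. u \<bullet> dd e X x = 0"
  shows "u = w \<or> u = - w"
proof -
  have eq: "u = (u \<bullet> w) *\<^sub>R w" by (rule immersion_normal_line[OF X x w u(2)])
  then have "norm u = \<bar>u \<bullet> w\<bar> * norm w" by (metis norm_scaleR)
  then have "\<bar>u \<bullet> w\<bar> = 1" using w(1) u(1) by simp
  then have "u \<bullet> w = 1 \<or> u \<bullet> w = -1" by linarith
  then show ?thesis using eq by auto
qed

section \<open>Nearest points on \<open>N\<close> and the side to which \<xi> points\<close>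

locale comparison = M: immersed M + N: immersed N
  for M :: "'a surface3" and N :: "'b surface3" +
  fixes \<xi> :: "'b \<Rightarrow> real^3" and \<kappa> :: real
  assumes proper: "properly_immersed N" and mcn: "mean_curvature_normal N \<xi>"
    and wo: "well_oriented N \<xi> M" and \<kappa>: "\<kappa> > 0"
    and curv: "\<And>q k. q \<in> pts N \<Longrightarrow> principal_curvature N q k \<Longrightarrow> \<bar>k\<bar> \<le> \<kappa>"
begin

text \<open>The content of \<open>well_oriented\<close> for a single point of space, so that it can
  also be used for points of a plane that need not lie on \<open>M\<close>.\<close>

definition facing :: "real^3 \<Rightarrow> bool" where
  "facing x \<longleftrightarrow> x \<notin> image_of N \<and> (minimal N \<or> (\<exists>W\<in>components (- image_of N). x \<in> W \<and>
     (\<forall>q\<in>pts N. pos N q \<in> frontier W \<longrightarrow> points_into N \<xi> W q)))"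

lemma facing_M: "p \<in> pts M \<Longrightarrow> facing (pos M p)"
  using wo unfolding well_oriented_def facing_def by blast

lemma closed_image: "closed (image_of N)"
proof -
  have "closed_map (topo N) euclidean (pos N)" using proper by (simp add: properly_immersed_def proper_map_def)
  then have "closedin euclidean (pos N ` pts N)" unfolding closed_map_def by blast
  then show ?thesis by simp
qed

lemma image_nonempty: "image_of N \<noteq> {}"
  using N.smooth_surface unfolding smooth_surface_def by blast

lemma disjoint: "image_of N \<inter> image_of M = {}"
  using wo by (auto simp: well_oriented_def)

lemma infdist_pos: "x \<notin> image_of N \<Longrightarrow> infdist x (image_of N) > 0"
  using infdist_pos_not_in_closed[OF closed_image image_nonempty] .

lemma nearest_exists: "\<exists>q\<in>pts N. dist x (pos N q) = infdist x (image_of N)"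
proof -
  obtain z where "z \<in> image_of N" "infdist x (image_of N) = dist x z"
    using infdist_attains_inf[OF closed_image image_nonempty] by blast
  then show ?thesis by force
qed

lemma nearest_orthogonal:
  assumes d: "dist x (pos N (\<psi> y)) = infdist x (image_of N)" and c: "(V, \<psi>) \<in> params N" and y: "y \<in> V"
  shows "(x - pos N (\<psi> y)) \<bullet> dd v (pos N \<circ> \<psi>) y = 0"
proof -
  define F where "F = pos N \<circ> \<psi>"
  note I = immersion_onD[OF N.chart_immersion[OF c], folded F_def]
  have G2: "Ck_on 2 V (\<lambda>z. x - F z)" by (intro Ck_on_diff Ck_on_const I(1,2))
  have f2: "Ck_on 2 V (\<lambda>z. (x - F z) \<bullet> (x - F z))" by (intro Ck_on_inner I(1) G2)
  have "(x - F y) \<bullet> (x - F y) \<le> (x - F z) \<bullet> (x - F z)" if z: "z \<in> V" for z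
  proof -
    have "infdist x (image_of N) \<le> dist x (F z)"
      by (rule infdist_le) (use N.chart_in_pts[OF c z] in \<open>auto simp: F_def\<close>)
    then have "norm (x - F y) \<le> norm (x - F z)" using d by (simp add: F_def dist_norm)
    then show ?thesis by (simp add: norm_le)
  qed
  from second_derivative_test(1)[OF I(1) y f2 this]
  have "dd v (\<lambda>z. (x - F z) \<bullet> (x - F z)) y = 0" .
  moreover have "dd v (\<lambda>z. x - F z) y = - dd v F y"
    using dd_eqI[OF has_derivative_diff[OF has_derivative_const Ck_on_has_derivative[OF I(2) _ y]]] by simp
  ultimately have "2 * ((x - F y) \<bullet> dd v F y) = 0"
    unfolding dd_inner2[OF C2_diff[OF G2 y] C2_diff[OF G2 y]] by (simp add: inner_commute)
  then show ?thesis by (simp add: F_def)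
qed

lemma xi_continuous: "(V, \<psi>) \<in> params N \<Longrightarrow> continuous_on V (\<lambda>z. \<xi> (\<psi> z))"
proof -
  assume c: "(V, \<psi>) \<in> params N"
  have "continuous_map (top_of_set V) euclidean (\<xi> \<circ> \<psi>)"
    by (rule continuous_map_compose[OF N.chart_continuous[OF c]]) (use mcn in \<open>simp add: mean_curvature_normal_def unit_normal_field_def\<close>)
  then show ?thesis by (simp add: comp_def)
qed

lemma xi_cases:
  assumes c: "(V, \<psi>) \<in> params N" and y: "y \<in> V" and w: "norm w = 1" "\<And>v. w \<bullet> dd v (pos N \<circ> \<psi>) y = 0"
  shows "\<xi> (\<psi> y) = w \<or> \<xi> (\<psi> y) = - w"
proof -
  have q: "\<psi> y \<in> pts N" by (rule N.chart_in_pts[OF c y])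
  have \<xi>1: "norm (\<xi> (\<psi> y)) = 1" and \<xi>0: "\<And>v. v \<in> tangent_plane N (\<psi> y) \<Longrightarrow> v \<bullet> \<xi> (\<psi> y) = 0"
    using mcn q by (auto simp: mean_curvature_normal_def unit_normal_field_def)
  have "\<xi> (\<psi> y) \<bullet> dd v (pos N \<circ> \<psi>) y = 0" for v
    using \<xi>0[of "dd v (pos N \<circ> \<psi>) y"] unfolding N.tangent_plane_chart[OF c y] by (simp add: inner_commute)
  then show ?thesis by (rule unit_normal_unique[OF N.chart_immersion[OF c] y w \<xi>1])
qed

text \<open>The segment from the nearest point to \<open>x\<close> lies in \<open>W\<close>, so
  \<open>points_into\<close> applies to points of it that tend to the nearest point: they are
  reached along \<xi> from nearby points \<open>F y'\<close> of the same sheet. If \<xi> pointed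
  away from \<open>x\<close>, the displacement from \<open>F y\<close> to \<open>F y'\<close> would
  be nearly normal, whereas displacements within a sheet are nearly tangent.\<close>

lemma xi_toward:
  assumes x: "facing x" and nm: "\<not> minimal N" and d: "dist x (pos N (\<psi> y)) = infdist x (image_of N)"
    and c: "(V, \<psi>) \<in> params N" and y: "y \<in> V" and t: "x - pos N (\<psi> y) = t *\<^sub>R w" "t > 0" "norm w = 1"
  shows "\<xi> (\<psi> y) = w"
proof (rule ccontr)
  assume ne: "\<xi> (\<psi> y) \<noteq> w"
  define F where "F = pos N \<circ> \<psi>"
  note I = immersion_onD[OF N.chart_immersion[OF c], folded F_def]
  define z where "z = F y"
  have xz: "x - z = t *\<^sub>R w" using t(1) by (simp add: z_def F_def)
  have orth: "w \<bullet> dd v F y = 0" for v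
    using nearest_orthogonal[OF d c y, of v] t by (simp add: F_def)
  then have \<xi>w: "\<xi> (\<psi> y) = - w" using xi_cases[OF c y t(3)] ne by (simp add: F_def)
  have q: "\<psi> y \<in> pts N" by (rule N.chart_in_pts[OF c y])
  obtain W where W: "W \<in> components (- image_of N)" "x \<in> W"
    "\<And>q. q \<in> pts N \<Longrightarrow> pos N q \<in> frontier W \<Longrightarrow> points_into N \<xi> W q"
    using x nm unfolding facing_def by blast
  have dxz: "dist x z = infdist x (image_of N)" using d by (simp add: z_def F_def)
  \<comment> \<open>Points of the segment other than \<open>z\<close> are strictly closer to
    \<open>x\<close> than \<open>N\<close> is. The half-open segment is connected and contains
    \<open>x\<close>, so it stays in the component \<open>W\<close>.\<close>
  have seg: "z + s *\<^sub>R (x - z) \<in> W" if s: "0 < s" "s \<le> 1" for s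
  proof -
    define L where "L = (\<lambda>s. z + s *\<^sub>R (x - z)) ` {0<..1}"
    have "connected L" unfolding L_def
      by (intro connected_continuous_image continuous_intros convex_connected convex_real_interval)
    moreover have "L \<subseteq> - image_of N"
    proof
      fix u assume "u \<in> L"
      then obtain s where s: "0 < s" "s \<le> 1" "u = z + s *\<^sub>R (x - z)" by (auto simp: L_def)
      have "x - u = (1 - s) *\<^sub>R (x - z)" by (simp add: s(3) algebra_simps)
      then have "dist x u = (1 - s) * dist x z" using s by (simp add: dist_norm)
      also have "\<dots> < dist x z" using s t xz by (simp add: dist_norm)
      finally show "u \<in> - image_of N" using infdist_le[of u "image_of N" x] dxz by auto
    qed
    moreover have "x \<in> L" unfolding L_def by (rule image_eqI[of _ _ 1]) auto
    ultimately have "L \<subseteq> W" using components_maximal[OF W(1)] W(2) by blast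
    moreover have "z + s *\<^sub>R (x - z) \<in> L" unfolding L_def by (rule image_eqI[of _ _ s]) (use s in auto)
    ultimately show ?thesis by (rule subsetD)
  qed
  define yn where "yn = (\<lambda>n::nat. z + inverse (real (Suc n)) *\<^sub>R (x - z))"
  have ynW: "yn n \<in> W" for n unfolding yn_def by (rule seg) (auto simp: field_simps)
  have yn0: "yn \<longlonglongrightarrow> z"
  proof -
    have "yn \<longlonglongrightarrow> z + 0 *\<^sub>R (x - z)" unfolding yn_def
      by (intro tendsto_intros LIMSEQ_inverse_real_of_nat)
    then show ?thesis by simp
  qed
  have "z \<in> closure W" using ynW yn0 closure_sequential by blast
  moreover have "z \<notin> interior W"
    using in_components_subset[OF W(1)] interior_subset[of W] q by (auto simp: z_def F_def)
  ultimately have "pos N (\<psi> y) \<in> frontier W" by (simp add: frontier_def z_def F_def)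
  then have pin: "points_into N \<xi> W (\<psi> y)" by (rule W(3)[OF q])
  \<comment> \<open>Lower bound of the differential. With the relative error \<open>c0 / 5\<close>
    below, the normal part of a displacement is at most a quarter of its length; the assumption
    makes the normal part at least \<open>s + t' / 2\<close> and the length at most
    \<open>s + t'\<close>.\<close>
  obtain c0 where c0: "c0 > 0" "\<And>h. c0 * norm h \<le> norm (dd h F y)"
    using linear_inj_bounded_below_pos[OF dd_linear[OF C2_diff[OF I(2) y]]] I(3)[OF y] by blast
  have hd: "(F has_derivative (\<lambda>h. dd h F y)) (at y)" by (rule Ck_on_has_derivative[OF I(2) _ y]) simp
  obtain d1 where d1: "d1 > 0" "\<And>y'. norm (y' - y) < d1 \<Longrightarrow> norm (F y' - F y - dd (y' - y) F y) \<le> c0 / 5 * norm (y' - y)"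
  proof -
    have "c0 / 5 > 0" using c0(1) by simp
    from hd[unfolded has_derivative_at_alt, THEN conjunct2, rule_format, OF this]
    show ?thesis using that by blast
  qed
  have \<xi>c: "continuous_on V (\<lambda>y'. \<xi> (\<psi> y') \<bullet> \<xi> (\<psi> y))"
    by (intro continuous_intros xi_continuous[OF c])
  \<comment> \<open>Here \<xi> stays within 60 degrees of its value at \<open>y\<close>, so its
    contributions cannot cancel.\<close>
  define O1 where "O1 = V \<inter> (\<lambda>y'. \<xi> (\<psi> y') \<bullet> \<xi> (\<psi> y)) -` {1/2<..}"
  have O1: "open O1" unfolding O1_def by (rule continuous_open_preimage[OF \<xi>c I(1)]) simp
  have \<xi>1: "norm (\<xi> (\<psi> y')) = 1" if "y' \<in> V" for y'
    using mcn N.chart_in_pts[OF c that] by (auto simp: mean_curvature_normal_def unit_normal_field_def)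
  have "y \<in> O1" using y \<xi>1[OF y] by (simp add: O1_def norm_eq_1)
  then obtain d2 where d2: "d2 > 0" "ball y d2 \<subseteq> O1" using O1 open_contains_ball by blast
  define D where "D = ball y (min d1 d2)"
  have DV: "D \<subseteq> V" using d2(2) by (auto simp: D_def O1_def subset_eq)
  have "openin (topo N) (\<psi> ` D)" by (rule N.chart_open_image[OF c _ DV]) (simp add: D_def)
  moreover have "\<psi> y \<in> \<psi> ` D" using d1(1) d2(1) by (auto simp: D_def)
  moreover have "yn \<longlonglongrightarrow> pos N (\<psi> y)" using yn0 by (simp add: z_def F_def)
  ultimately have "\<forall>\<^sub>F n in sequentially. \<exists>t z. 0 < t \<and> t < 1 \<and> z \<in> \<psi> ` D \<and> yn n = pos N z + t *\<^sub>R \<xi> z"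
    using pin[unfolded points_into_def, rule_format, of yn 1 "\<psi> ` D"] ynW by simp
  then obtain k where k: "\<forall>n\<ge>k. \<exists>t z. 0 < t \<and> t < 1 \<and> z \<in> \<psi> ` D \<and> yn n = pos N z + t *\<^sub>R \<xi> z"
    unfolding eventually_sequentially by blast
  from k[rule_format, OF order_refl] obtain n t' z' where nt: "0 < t'" "z' \<in> \<psi> ` D" "yn n = pos N z' + t' *\<^sub>R \<xi> z'"
    by blast
  then obtain y' where y': "y' \<in> D" "yn n = F y' + t' *\<^sub>R \<xi> (\<psi> y')" by (auto simp: F_def)
  define s where "s = inverse (real (Suc n)) * t"
  have s: "s > 0" using t(2) by (simp add: s_def)
  define E where "E = F y' - z"
  have E: "E = - (s *\<^sub>R \<xi> (\<psi> y) + t' *\<^sub>R \<xi> (\<psi> y'))"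
    using y'(2) unfolding yn_def xz E_def s_def \<xi>w by (simp add: algebra_simps)
  have "\<xi> (\<psi> y') \<bullet> \<xi> (\<psi> y) > 1/2" using y'(1) d2(2) by (auto simp: D_def O1_def subset_eq)
  then have "t' * (\<xi> (\<psi> y') \<bullet> \<xi> (\<psi> y)) \<ge> t' * (1/2)" using nt(1) by (intro mult_left_mono) auto
  then have lowE: "s + t' / 2 \<le> \<bar>E \<bullet> \<xi> (\<psi> y)\<bar>"
  proof -
    have "E \<bullet> \<xi> (\<psi> y) = - (s + t' * (\<xi> (\<psi> y') \<bullet> \<xi> (\<psi> y)))"
      using \<xi>1[OF y] unfolding E by (simp add: inner_diff_left norm_eq_1)
    moreover have "t' / 2 \<le> t' * (\<xi> (\<psi> y') \<bullet> \<xi> (\<psi> y))" using \<open>t' * (\<xi> (\<psi> y') \<bullet> \<xi> (\<psi> y)) \<ge> t' * (1/2)\<close> by simp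
    ultimately show ?thesis using s nt(1) by linarith
  qed
  have upE: "norm E \<le> s + t'"
    using norm_triangle_ineq[of "s *\<^sub>R \<xi> (\<psi> y)" "t' *\<^sub>R \<xi> (\<psi> y')"] \<xi>1[OF y] \<xi>1[of y'] y'(1) DV s nt(1)
    unfolding E norm_minus_cancel by auto
  define h where "h = y' - y"
  have rem: "norm (E - dd h F y) \<le> c0 / 5 * norm h"
    using d1(2)[of y'] y'(1) by (simp add: E_def z_def h_def D_def dist_norm norm_minus_commute)
  have "\<xi> (\<psi> y) \<bullet> dd h F y = 0" using orth by (simp add: \<xi>w)
  then have "\<bar>E \<bullet> \<xi> (\<psi> y)\<bar> = \<bar>(E - dd h F y) \<bullet> \<xi> (\<psi> y)\<bar>" by (simp add: inner_diff_left inner_diff_right inner_commute)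
  also have "\<dots> \<le> c0 / 5 * norm h" using Cauchy_Schwarz_ineq2[of "E - dd h F y" "\<xi> (\<psi> y)"] \<xi>1[OF y] rem by simp
  finally have a: "\<bar>E \<bullet> \<xi> (\<psi> y)\<bar> \<le> c0 / 5 * norm h" .
  have "c0 * norm h \<le> norm E + norm (E - dd h F y)"
    using c0(2)[of h] norm_triangle_ineq4[of E "E - dd h F y"] by simp
  then have "4 * (c0 / 5 * norm h) \<le> norm E" using rem by simp
  then show False using a lowE upE s nt(1) by linarith
qed

text \<open>For minimal \<open>N\<close> both sides vanish, whatever the sign of \<xi>; otherwise
  \<open>xi_toward\<close> identifies \<xi> with \<open>w\<close>.\<close>

lemma nearest_mean_curvature:
  assumes x: "facing x" and d: "dist x (pos N (\<psi> y)) = infdist x (image_of N)"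
    and c: "(V, \<psi>) \<in> params N" and y: "y \<in> V" and t: "x - pos N (\<psi> y) = t *\<^sub>R w" "t > 0" "norm w = 1"
  shows "w \<bullet> mean_curvature_vector N (\<psi> y) = mean_curvature N (\<xi> (\<psi> y)) (\<psi> y)"
proof -
  have q: "\<psi> y \<in> pts N" by (rule N.chart_in_pts[OF c y])
  have v: "mean_curvature_vector N (\<psi> y) = mean_curvature N (\<xi> (\<psi> y)) (\<psi> y) *\<^sub>R \<xi> (\<psi> y)" and n: "norm (\<xi> (\<psi> y)) = 1"
    using mcn q by (auto simp: mean_curvature_normal_def unit_normal_field_def)
  show ?thesis
  proof (cases "minimal N")
    case True
    then have "mean_curvature_vector N (\<psi> y) = 0" using q by (simp add: minimal_def)
    then show ?thesis using v n by (metis inner_zero_right norm_zero scaleR_eq_0_iff zero_neq_one)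
  next
    case False
    have "\<xi> (\<psi> y) = w" by (rule xi_toward[OF x False d c y t])
    then show ?thesis using v t(3) by (simp add: norm_eq_1)
  qed
qed

lemma direction:
  assumes "infdist x (image_of N) = t" "t > 0" "dist x (pos N q) = t"
  obtains w where "x - pos N q = t *\<^sub>R w" "norm w = 1"
proof (rule that[of "(1/t) *\<^sub>R (x - pos N q)"])
  show "x - pos N q = t *\<^sub>R (1/t) *\<^sub>R (x - pos N q)" using assms(2) by simp
  show "norm ((1/t) *\<^sub>R (x - pos N q)) = 1" using assms by (simp add: dist_norm)
qed

text \<open>At a nearest point \<open>q\<close> the function from \<open>two_point_laplacian\<close>
  touches from below. The mean curvature of \<open>N\<close> enters with its sign, by
  \<open>nearest_mean_curvature\<close>; that of \<open>M\<close> enters through Cauchy-Schwarz,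
  hence as an absolute value.\<close>

lemma udist_lower_support:
  assumes H: "\<And>p q. p \<in> pts M \<Longrightarrow> q \<in> pts N \<Longrightarrow>
      l \<le> \<kappa> * (mean_curvature N (\<xi> q) q - norm (mean_curvature_vector M p))"
    and c: "(U, \<phi>) \<in> params M" and x: "x \<in> U"
  shows "M.lower_support (M.udist \<kappa> (image_of N)) l U \<phi> x"
proof -
  define X where "X = pos M \<circ> \<phi>"
  note I = M.chart_immersion[OF c, folded X_def]
  have p: "\<phi> x \<in> pts M" by (rule M.chart_in_pts[OF c x])
  have f: "facing (X x)" using facing_M[OF p] by (simp add: X_def)
  define t where "t = infdist (X x) (image_of N)"
  have t: "t > 0" using infdist_pos f by (simp add: t_def facing_def)
  obtain q where q: "q \<in> pts N" "dist (X x) (pos N q) = t" using nearest_exists[of "X x"] by (auto simp: t_def)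
  obtain w where w: "X x - pos N q = t *\<^sub>R w" "norm w = 1" using direction[OF t_def[symmetric] t q(2)] .
  \<comment> \<open>The chart selected by \<open>param_at\<close>, because
    \<open>second_ff_bound\<close> is stated in that chart.\<close>
  obtain V \<psi> where P: "param_at N q = (V, \<psi>)" by fastforce
  define y where "y = coord_at N q"
  have d: "(V, \<psi>) \<in> params N" "y \<in> V" "\<psi> y = q" using N.param_at[OF q(1)] P by (auto simp: y_def)
  define F where "F = pos N \<circ> \<psi>"
  note J = N.chart_immersion[OF d(1), folded F_def]
  obtain a1 a2 k where frX: "lap_frame X x a1 a2 k" using lap_frame_exists[OF I x] by blast
  obtain f1 f2 m where frF: "lap_frame F y f1 f2 m" using lap_frame_exists[OF J d(2)] by blast
  have dist: "dist (X x) (pos N (\<psi> y)) = infdist (X x) (image_of N)" using q(2) d(3) by (simp add: t_def)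
  have orth: "w \<bullet> dd v F y = 0" for v
    using nearest_orthogonal[OF dist d(1,2), of v] w(1) t d(3) by (simp add: F_def)
  have XF: "X x - F y = t *\<^sub>R w" using w d(3) by (simp add: F_def)
  have bound: "\<bar>dd b (dd b F) y \<bullet> w\<bar> \<le> \<kappa> * (norm (dd b F y))\<^sup>2" for b
    unfolding F_def y_def by (rule N.second_ff_bound[OF q(1) curv[OF q(1)] P w(2)]) (use orth in \<open>auto simp: F_def y_def\<close>)
  have \<kappa>0: "\<kappa> \<ge> 0" using \<kappa> by simp
  obtain W z where W: "open W" "x \<in> W" "W \<subseteq> U" "Ck_on 2 W z" "z x = exp (- \<kappa> * t)"
    "\<And>x'. x' \<in> W \<Longrightarrow> \<exists>y'\<in>V. z x' = exp (- \<kappa> * dist (X x') (F y'))"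
    "\<kappa> * exp (- \<kappa> * t) * (w \<bullet> (dd f1 (dd f1 F) y + dd f2 (dd f2 F) y + dd m F y)
      - w \<bullet> (dd a1 (dd a1 X) x + dd a2 (dd a2 X) x + dd k X x)) \<le> local_laplacian X z x"
    using two_point_laplacian[OF I x frX J d(2) frF XF t w(2) orth bound \<kappa>0] by blast
  have HN: "w \<bullet> (dd f1 (dd f1 F) y + dd f2 (dd f2 F) y + dd m F y) = mean_curvature N (\<xi> q) q"
    using nearest_mean_curvature[OF f dist d(1,2) _ t w(2)] N.lap_frame_mcv[OF d(1,2) frF[unfolded F_def]] w(1) d(3) by (simp add: F_def)
  have HM: "w \<bullet> (dd a1 (dd a1 X) x + dd a2 (dd a2 X) x + dd k X x) \<le> norm (mean_curvature_vector M (\<phi> x))"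
    using M.lap_frame_mcv[OF c x frX[unfolded X_def]] norm_cauchy_schwarz[of w "mean_curvature_vector M (\<phi> x)"] w(2) by (simp add: X_def)
  have ux: "M.udist \<kappa> (image_of N) (\<phi> x) = exp (- \<kappa> * t)" by (simp add: M.udist_def t_def X_def)
  have "l * exp (- \<kappa> * t) \<le> \<kappa> * (mean_curvature N (\<xi> q) q - norm (mean_curvature_vector M (\<phi> x))) * exp (- \<kappa> * t)"
    using H[OF p q(1)] by (intro mult_right_mono) auto
  also have "\<dots> \<le> \<kappa> * exp (- \<kappa> * t) * (w \<bullet> (dd f1 (dd f1 F) y + dd f2 (dd f2 F) y + dd m F y)
      - w \<bullet> (dd a1 (dd a1 X) x + dd a2 (dd a2 X) x + dd k X x))"
  proof -
    have "\<kappa> * exp (- \<kappa> * t) * (mean_curvature N (\<xi> q) q - norm (mean_curvature_vector M (\<phi> x)))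
      \<le> \<kappa> * exp (- \<kappa> * t) * (w \<bullet> (dd f1 (dd f1 F) y + dd f2 (dd f2 F) y + dd m F y)
      - w \<bullet> (dd a1 (dd a1 X) x + dd a2 (dd a2 X) x + dd k X x))"
      using HN HM \<kappa> by (intro mult_left_mono) auto
    then show ?thesis by (simp add: mult_ac)
  qed
  also note W(7)
  finally have lap: "l * M.udist \<kappa> (image_of N) (\<phi> x) \<le> local_laplacian (pos M \<circ> \<phi>) z x" by (simp add: ux X_def)
  have "z x' \<le> M.udist \<kappa> (image_of N) (\<phi> x')" if x': "x' \<in> W" for x'
  proof -
    obtain y' where y': "y' \<in> V" "z x' = exp (- \<kappa> * dist (X x') (F y'))" using W(6)[OF x'] by blast
    have "infdist (X x') (image_of N) \<le> dist (X x') (F y')"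
      by (rule infdist_le) (use N.chart_in_pts[OF d(1) y'(1)] in \<open>auto simp: F_def\<close>)
    then show ?thesis using y'(2) \<kappa> by (simp add: M.udist_def X_def)
  qed
  then show ?thesis unfolding M.lower_support_def using W(1-5) lap ux by metis
qed

lemma udist_bounded_weak_solution:
  assumes H: "\<And>p q. p \<in> pts M \<Longrightarrow> q \<in> pts N \<Longrightarrow>
      l \<le> \<kappa> * (mean_curvature N (\<xi> q) q - norm (mean_curvature_vector M p))"
  shows "bounded_weak_solution M l (M.udist \<kappa> (image_of N))"
proof (rule M.bounded_weak_solution_from_support[OF M.udist_continuous])
  show "\<bar>M.udist \<kappa> (image_of N) p\<bar> \<le> 1" for p
    using \<kappa> infdist_nonneg[of "pos M p"] by (simp add: M.udist_def)
  show "M.semiconvex_chart (M.udist \<kappa> (image_of N)) U \<phi> x" if "(U, \<phi>) \<in> params M" "x \<in> U" for U \<phi> x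
    by (rule M.udist_semiconvex[OF that closed_image image_nonempty disjoint]) (use \<kappa> in simp)
  show "M.lower_support (M.udist \<kappa> (image_of N)) l U \<phi> x" if "(U, \<phi>) \<in> params M" "x \<in> U" for U \<phi> x
    by (rule udist_lower_support[OF H that])
qed

lemma pts_M_nonempty: obtains p where "p \<in> pts M"
  using M.smooth_surface unfolding smooth_surface_def by blast

text \<open>\<open>udist\<close> is a bounded nonnegative solution for the rate \<open>l\<close>, so
  it would have to vanish, which an exponential never does.\<close>

lemma not_stochastically_complete:
  assumes H: "\<And>p q. p \<in> pts M \<Longrightarrow> q \<in> pts N \<Longrightarrow>
      l \<le> \<kappa> * (mean_curvature N (\<xi> q) q - norm (mean_curvature_vector M p))" and l: "l > 0"
  shows "\<not> stochastically_complete M"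
proof
  assume "stochastically_complete M"
  moreover have "\<forall>p\<in>pts M. 0 \<le> M.udist \<kappa> (image_of N) p" by (simp add: M.udist_def)
  ultimately have ae: "AE p in area_measure M. M.udist \<kappa> (image_of N) p = 0"
    using udist_bounded_weak_solution[OF H] l unfolding stochastically_complete_def by blast
  obtain p where "p \<in> pts M" by (rule pts_M_nonempty)
  then have "M.udist \<kappa> (image_of N) p = 0" using M.AE_area_continuous[OF M.udist_continuous ae] by blast
  then show False by (simp add: M.udist_def)
qed

lemma distance_constant:
  assumes H: "\<And>p q. p \<in> pts M \<Longrightarrow> q \<in> pts N \<Longrightarrow>
      norm (mean_curvature_vector M p) \<le> mean_curvature N (\<xi> q) q" and r: "recurrent M"
  obtains c where "c > 0" "\<And>p. p \<in> pts M \<Longrightarrow> infdist (pos M p) (image_of N) = c"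
proof -
  have "bounded_weak_solution M 0 (M.udist \<kappa> (image_of N))"
    by (rule udist_bounded_weak_solution) (use H \<kappa> in simp)
  then obtain k where ae: "AE p in area_measure M. M.udist \<kappa> (image_of N) p = k" using r unfolding recurrent_def by blast
  have k: "M.udist \<kappa> (image_of N) p = k" if "p \<in> pts M" for p
    using M.AE_area_continuous[OF M.udist_continuous ae that] .
  obtain p0 where p0: "p0 \<in> pts M" by (rule pts_M_nonempty)
  show thesis
  proof (rule that[of "infdist (pos M p0) (image_of N)"])
    show "infdist (pos M p0) (image_of N) > 0"
      using infdist_pos facing_M[OF p0] by (simp add: facing_def)
    show "infdist (pos M p) (image_of N) = infdist (pos M p0) (image_of N)" if "p \<in> pts M" for p
    proof -
      have "exp (- \<kappa> * infdist (pos M p) (image_of N)) = exp (- \<kappa> * infdist (pos M p0) (image_of N))"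
        using k[OF that] k[OF p0] by (simp add: M.udist_def)
      then have "- \<kappa> * infdist (pos M p) (image_of N) = - \<kappa> * infdist (pos M p0) (image_of N)" by (rule exp_inj_iff[THEN iffD1])
      then show ?thesis using \<kappa> by simp
    qed
  qed
qed

end

section \<open>The strong minimum principle\<close>

lemma dd_diff_cmult:
  fixes f g :: "'a::euclidean_space \<Rightarrow> real"
  assumes "f differentiable (at x)" "g differentiable (at x)"
  shows "dd v (\<lambda>z. f z - c * g z) x = dd v f x - c * dd v g x"
  using dd_eqI[OF has_derivative_diff[OF assms(1)[unfolded frechet_derivative_works]
    has_derivative_mult_right[OF assms(2)[unfolded frechet_derivative_works]]]] by simp

lemma dd2_diff_cmult:
  fixes f g :: "'a::euclidean_space \<Rightarrow> real"
  assumes U: "open U" "x \<in> U" and f: "Ck_on 2 U f" and g: "Ck_on 2 U g"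
  shows "dd v (dd w (\<lambda>z. f z - c * g z)) x = dd v (dd w f) x - c * dd v (dd w g) x"
proof -
  have "dd v (dd w (\<lambda>z. f z - c * g z)) x = dd v (\<lambda>z. dd w f z - c * dd w g z) x"
    by (rule dd_cong[OF U]) (rule dd_diff_cmult[OF C2_diff[OF f] C2_diff[OF g]])
  also have "\<dots> = dd v (dd w f) x - c * dd v (dd w g) x"
    by (rule dd_diff_cmult[OF C1_diff[OF C2_dd[OF f] U(2)] C1_diff[OF C2_dd[OF g] U(2)]])
  finally show ?thesis .
qed

lemma gaussian_dd:
  fixes y :: "'a::euclidean_space" and \<alpha> :: real
  defines "E \<equiv> \<lambda>z. exp (- \<alpha> * ((z - y) \<bullet> (z - y)))"
  shows "Ck_on k UNIV E" "dd v E z = - 2 * \<alpha> * ((z - y) \<bullet> v) * E z"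
    "dd v (dd v E) z = E z * (4 * \<alpha>\<^sup>2 * ((z - y) \<bullet> v)\<^sup>2 - 2 * \<alpha> * (v \<bullet> v))"
proof -
  show "Ck_on k UNIV E" unfolding E_def
    by (intro Ck_on_exp_compose Ck_on_mult Ck_on_inner Ck_on_diff Ck_on_ident Ck_on_const open_UNIV)
  have hE: "(E has_derivative (\<lambda>v. - 2 * \<alpha> * ((z - y) \<bullet> v) * E z)) (at z)" for z
    unfolding E_def by (auto intro!: derivative_eq_intros simp: inner_commute algebra_simps)
  show d: "dd v E z = - 2 * \<alpha> * ((z - y) \<bullet> v) * E z" for z by (rule dd_eqI[OF hE])
  have "((\<lambda>z. - 2 * \<alpha> * ((z - y) \<bullet> v) * E z) has_derivative
      (\<lambda>u. - 2 * \<alpha> * ((z - y) \<bullet> v) * (- 2 * \<alpha> * ((z - y) \<bullet> u) * E z) + - 2 * \<alpha> * (u \<bullet> v) * E z)) (at z)"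
    by (rule derivative_eq_intros hE refl)+ simp
  from dd_eqI[OF this] have "dd v (\<lambda>z. - 2 * \<alpha> * ((z - y) \<bullet> v) * E z) z
     = - 2 * \<alpha> * ((z - y) \<bullet> v) * (- 2 * \<alpha> * ((z - y) \<bullet> v) * E z) + - 2 * \<alpha> * (v \<bullet> v) * E z" .
  moreover have "dd v E = (\<lambda>z. - 2 * \<alpha> * ((z - y) \<bullet> v) * E z)" using d by (rule ext)
  ultimately show "dd v (dd v E) z = E z * (4 * \<alpha>\<^sup>2 * ((z - y) \<bullet> v)\<^sup>2 - 2 * \<alpha> * (v \<bullet> v))"
    by (simp add: power2_eq_square algebra_simps)
qed

text \<open>The Gaussian \<open>E\<close> is constant on the sphere about \<open>y\<close> and has
  positive Laplacian near \<open>x\<close>. Subtracting a small multiple of it from \<open>h\<close>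
  leaves a function that, on the part of the ball near \<open>x\<close>, is minimal at
  \<open>x\<close>. But its derivative at \<open>x\<close> towards the centre is negative, because
  the differential of \<open>h\<close> vanishes at the interior minimum \<open>x\<close>.\<close>

lemma hopf_boundary_point:
  fixes h :: "real^2 \<Rightarrow> real"
  assumes F: "immersion_on V F" and h: "Ck_on 2 V h" and ge: "\<And>z. z \<in> V \<Longrightarrow> m \<le> h z"
    and L: "\<And>z. z \<in> V \<Longrightarrow> local_laplacian F h z \<le> 0"
    and B: "cball y R \<subseteq> V" "R > 0" and x: "dist y x = R" "h x = m"
    and inside: "\<And>z. z \<in> cball y R \<Longrightarrow> z \<noteq> x \<Longrightarrow> m < h z"
  shows False
proof -
  note V = immersion_onD(1)[OF F]
  have xV: "x \<in> V" using B x by (auto simp: subset_eq)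
  define g where "g = x - y"
  have gR: "norm g = R" using x by (simp add: g_def dist_norm norm_minus_commute)
  obtain a b k where fr: "lap_frame F x a b k" using lap_frame_exists[OF F xV] by blast
  define S where "S = (g \<bullet> a)\<^sup>2 + (g \<bullet> b)\<^sup>2"
  have S: "S > 0"
  proof (rule ccontr)
    assume "\<not> S > 0"
    then have 0: "g \<bullet> a = 0" "g \<bullet> b = 0" using sum_power2_gt_zero_iff[of "g \<bullet> a" "g \<bullet> b"] by (auto simp: S_def)
    obtain p q where "g = p *\<^sub>R a + q *\<^sub>R b"
      using lap_frame_span[OF C2_diff[OF immersion_onD(2)[OF F] xV] fr, of g] by blast
    then have "g \<bullet> g = p * (g \<bullet> a) + q * (g \<bullet> b)" by (metis inner_add_right inner_scaleR_right)
    then show False using 0 gR B(2) by simp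
  qed
  define T where "T = a \<bullet> a + b \<bullet> b + \<bar>g \<bullet> k\<bar>"
  \<comment> \<open>Chosen so that \<open>4 * \<alpha>\<^sup>2 * S - 2 * \<alpha> * T\<close> equals
    \<open>2 * \<alpha>\<close>: the gradient term of \<open>E\<close>, measured by
    \<open>S\<close>, then dominates all other terms, which \<open>T\<close> bounds.\<close>
  define \<alpha> where "\<alpha> = (T + 1) / (2 * S)"
  have T: "T \<ge> 0" by (simp add: T_def)
  then have \<alpha>: "\<alpha> > 0" using S by (simp add: \<alpha>_def)
  define E where "E = (\<lambda>z. exp (- \<alpha> * ((z - y) \<bullet> (z - y))))"
  have dE: "dd v E z = - 2 * \<alpha> * ((z - y) \<bullet> v) * E z" for v z unfolding E_def by (rule gaussian_dd(2))
  have ddE: "dd v (dd v E) z = E z * (4 * \<alpha>\<^sup>2 * ((z - y) \<bullet> v)\<^sup>2 - 2 * \<alpha> * (v \<bullet> v))" for v z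
    unfolding E_def by (rule gaussian_dd(3))
  have E2: "Ck_on 2 V E" unfolding E_def by (rule Ck_on_subset[OF gaussian_dd(1)]) simp
  have LE: "local_laplacian F E x > 0"
  proof -
    have "local_laplacian F E x = E x * (4 * \<alpha>\<^sup>2 * S - 2 * \<alpha> * (a \<bullet> a + b \<bullet> b + g \<bullet> k))"
      unfolding local_laplacian_frame[OF F xV E2 fr] ddE unfolding dE g_def[symmetric] by (simp add: S_def algebra_simps)
    also have "\<dots> \<ge> E x * (4 * \<alpha>\<^sup>2 * S - 2 * \<alpha> * T)"
      using \<alpha> by (intro mult_left_mono diff_mono) (auto simp: T_def E_def)
    also have "4 * \<alpha>\<^sup>2 * S - 2 * \<alpha> * T = 2 * \<alpha>"
      using S by (simp add: \<alpha>_def power2_eq_square field_simps)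
    finally have "E x * (2 * \<alpha>) \<le> local_laplacian F E x" .
    moreover have "E x * (2 * \<alpha>) > 0" using \<alpha> by (simp add: E_def)
    ultimately show ?thesis by linarith
  qed
  define O1 where "O1 = V \<inter> local_laplacian F E -` {0<..}"
  have "open O1" unfolding O1_def by (rule continuous_open_preimage[OF continuous_on_local_laplacian[OF F E2] V]) simp
  moreover have "x \<in> O1" using LE xV by (simp add: O1_def)
  ultimately obtain d where d: "d > 0" "cball x d \<subseteq> O1" using open_contains_cball by blast
  define e0 where "e0 = exp (- \<alpha> * R\<^sup>2)"
  have Esph: "E z = e0" if "dist y z = R" for z
    using that by (simp add: E_def e0_def dist_norm norm_minus_commute flip: power2_norm_eq_inner)
  have E1: "E z \<le> 1" for z using \<alpha> by (simp add: E_def)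
  \<comment> \<open>The part of the small sphere about \<open>x\<close> that lies in the ball. It
    avoids \<open>x\<close>, so \<open>h\<close> exceeds \<open>m\<close> there by some \<mu>; as
    \<open>E\<close> is at most 1, the same \<mu> can serve as its coefficient.\<close>
  define K where "K = cball y R \<inter> sphere x d"
  have hc: "continuous_on V h" by (rule Ck_on_cont[OF h])
  obtain \<mu> where \<mu>: "\<mu> > 0" "\<And>z. z \<in> K \<Longrightarrow> m + \<mu> \<le> h z"
  proof (cases "K = {}")
    case True
    then show ?thesis using that[of 1] by simp
  next
    case False
    have "compact K" "K \<subseteq> V" using B by (auto simp: K_def)
    then obtain z where z: "z \<in> K" "\<And>u. u \<in> K \<Longrightarrow> h z \<le> h u"
      using continuous_attains_inf[of K h] False continuous_on_subset[OF hc] by blast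
    have "z \<noteq> x" using z(1) d(1) by (auto simp: K_def)
    then have "h z > m" using inside z(1) by (auto simp: K_def)
    then show ?thesis using that[of "h z - m"] z(2) by simp
  qed
  define f where "f = (\<lambda>z. h z - \<mu> * E z)"
  have f2: "Ck_on 2 V f" unfolding f_def by (intro Ck_on_diff Ck_on_mult Ck_on_const V h E2)
  define D where "D = cball y R \<inter> cball x d"
  have fD: "m - \<mu> * e0 \<le> f z" if "z \<in> D" for z
  proof -
    have "compact D" "D \<subseteq> V" "x \<in> D" using B x d by (auto simp: D_def)
    then obtain u where u: "u \<in> D" "\<And>z. z \<in> D \<Longrightarrow> f u \<le> f z"
      using continuous_attains_inf[of D f] continuous_on_subset[OF Ck_on_cont[OF f2]] by blast
    have uV: "u \<in> V" using u(1) \<open>D \<subseteq> V\<close> by blast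
    \<comment> \<open>On the sphere about \<open>y\<close>, \<open>E\<close> equals
      \<open>e0\<close>; on \<open>K\<close> the gap \<mu> suffices; in the open region a minimum
      would have nonnegative Laplacian, against the strict sign.\<close>
    consider "dist y u = R" | "u \<in> K" | "dist y u < R" "dist x u < d"
      using u(1) unfolding D_def K_def by (auto simp: less_le)
    then have "m - \<mu> * e0 \<le> f u"
    proof cases
      case 1
      then show ?thesis using Esph ge[OF uV] by (simp add: f_def)
    next
      case 2
      have "\<mu> * E u \<le> \<mu> * 1" using E1 \<mu>(1) by (intro mult_left_mono) auto
      moreover have "0 \<le> \<mu> * e0" using \<mu>(1) by (simp add: e0_def)
      ultimately show ?thesis using \<mu>(2)[OF 2] by (simp add: f_def)
    next
      case 3
      define G where "G = ball y R \<inter> ball x d"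
      have G: "open G" "u \<in> G" "G \<subseteq> D" using 3 by (auto simp: G_def D_def)
      then have GV: "G \<subseteq> V" using \<open>D \<subseteq> V\<close> by blast
      have minG: "f u \<le> f z" if "z \<in> G" for z using u(2) G(3) that by blast
      note t = second_derivative_test[OF G(1,2) Ck_on_subset[OF f2 GV] minG]
      obtain a b k where fr: "lap_frame F u a b k" using lap_frame_exists[OF F uV] by blast
      have "local_laplacian F f u \<ge> 0"
        unfolding local_laplacian_frame[OF F uV f2 fr] using t(1)[of k] t(2)[of a] t(2)[of b] by simp
      moreover have "local_laplacian F f u = local_laplacian F h u - \<mu> * local_laplacian F E u"
        unfolding local_laplacian_frame[OF F uV f2 fr] local_laplacian_frame[OF F uV h fr] local_laplacian_frame[OF F uV E2 fr]
        unfolding f_def dd2_diff_cmult[OF V uV h E2] dd_diff_cmult[OF C2_diff[OF h uV] C2_diff[OF E2 uV]]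
        by (simp add: algebra_simps)
      moreover have "local_laplacian F E u > 0" using 3(2) d(2) by (auto simp: O1_def subset_eq)
      ultimately show ?thesis using L[OF uV] mult_pos_pos[OF \<mu>(1), of "local_laplacian F E u"] by linarith
    qed
    then show ?thesis using u(2)[OF that] by linarith
  qed
  have fx: "f x = m - \<mu> * e0" using Esph x by (simp add: f_def)
  have "dd (- g) h x = 0" by (rule second_derivative_test(1)[OF V xV h]) (use ge x in auto)
  then have dfx: "dd (- g) f x = - (2 * \<mu> * \<alpha> * E x * R\<^sup>2)"
    unfolding f_def dd_diff_cmult[OF C2_diff[OF h xV] C2_diff[OF E2 xV]] dE g_def[symmetric]
    using gR by (simp flip: power2_norm_eq_inner)
  have "((\<lambda>s. f (x + s *\<^sub>R (- g))) has_real_derivative dd (- g) f (x + 0 *\<^sub>R (- g))) (at 0)"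
    by (rule line_DERIV[of 0]) (use C2_C1[OF f2] xV in auto)
  then have der: "((\<lambda>s. f (x + s *\<^sub>R (- g))) has_real_derivative - (2 * \<mu> * \<alpha> * E x * R\<^sup>2)) (at 0)" by (simp add: dfx)
  have neg: "- (2 * \<mu> * \<alpha> * E x * R\<^sup>2) < 0" using \<mu>(1) \<alpha> B(2) by (simp add: E_def)
  obtain e where e: "e > 0" "\<And>s. 0 < s \<Longrightarrow> s < e \<Longrightarrow> f (x + s *\<^sub>R (- g)) < f x"
    using DERIV_neg_dec_right[OF der neg] by auto
  \<comment> \<open>Small enough for the strict decrease and for staying in \<open>D\<close>:
    \<open>s \<le> 1\<close> keeps the point in the ball about \<open>y\<close>,
    \<open>s * R \<le> d\<close> in the one about \<open>x\<close>.\<close>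
  define s where "s = min (e / 2) (min 1 (d / R))"
  have s: "0 < s" "s < e" "s \<le> 1" using e(1) d(1) B(2) by (auto simp: s_def)
  have "s \<le> d / R" by (simp add: s_def)
  then have sR: "s * R \<le> d" using B(2) by (simp add: pos_le_divide_eq)
  have "y - (x + s *\<^sub>R (- g)) = (s - 1) *\<^sub>R g" by (simp add: g_def algebra_simps)
  then have "dist y (x + s *\<^sub>R (- g)) = (1 - s) * R" using gR s unfolding dist_norm by simp
  moreover have "dist x (x + s *\<^sub>R (- g)) = s * R" using gR s by (simp add: dist_norm)
  ultimately have "x + s *\<^sub>R (- g) \<in> D" using s sR B(2) by (auto simp: D_def mult_left_le_one_le)
  then show False using fD[of "x + s *\<^sub>R (- g)"] e(2)[OF s(1,2)] fx by simp
qed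

text \<open>Otherwise take a point \<open>z\<close> near \<open>y\<close> off the level set of
  \<open>m\<close>, and a point \<open>x\<close> of the level set nearest to \<open>z\<close>. The
  ball with the segment from \<open>z\<close> to \<open>x\<close> as diameter meets the level set
  only in \<open>x\<close>, which \<open>hopf_boundary_point\<close> excludes.\<close>

lemma strong_minimum:
  fixes h :: "real^2 \<Rightarrow> real"
  assumes F: "immersion_on V F" and h: "Ck_on 2 V h" and ge: "\<And>z. z \<in> V \<Longrightarrow> m \<le> h z"
    and L: "\<And>z. z \<in> V \<Longrightarrow> local_laplacian F h z \<le> 0" and y: "y \<in> V" "h y = m"
  obtains r where "r > 0" "ball y r \<subseteq> V" "\<And>z. z \<in> ball y r \<Longrightarrow> h z = m"
proof -
  obtain e where e: "e > 0" "cball y e \<subseteq> V" using immersion_onD(1)[OF F] y(1) open_contains_cball by blast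
  \<comment> \<open>Half the radius leaves room for the nearest point of the level set and for the
    ball built on it.\<close>
  define r where "r = e / 2"
  have r: "r > 0" "cball y (2 * r) \<subseteq> V" using e by (auto simp: r_def)
  have "h z = m" if z: "z \<in> ball y r" for z
  proof (rule ccontr)
    assume ne: "h z \<noteq> m"
    define Z where "Z = cball y (2 * r) \<inter> h -` {m}"
    have "closed Z" unfolding Z_def
      by (rule continuous_closed_preimage[OF continuous_on_subset[OF Ck_on_cont[OF h] r(2)]]) auto
    moreover have yZ: "y \<in> Z" using y r by (simp add: Z_def)
    ultimately obtain x where x: "x \<in> Z" "infdist z Z = dist z x" using infdist_attains_inf[of Z z] by blast
    have near: "dist z x \<le> dist z u" if "u \<in> Z" for u using infdist_le[OF that, of z] x(2) by simp
    define R where "R = dist z x / 2"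
    define c where "c = midpoint z x"
    have "z \<noteq> x" using ne x(1) by (auto simp: Z_def)
    then have R: "R > 0" "2 * R = dist z x" by (auto simp: R_def)
    \<comment> \<open>Parallelogram law about the midpoint \<open>c\<close>: points of the ball
      other than \<open>x\<close> are strictly nearer to \<open>z\<close> than \<open>x\<close>
      is.\<close>
    have cl: "dist z u < dist z x" if u: "u \<in> cball c R" "u \<noteq> x" for u
    proof -
      have p: "(norm (p - q))\<^sup>2 + (norm (p + q))\<^sup>2 = 2 * (norm p)\<^sup>2 + 2 * (norm q)\<^sup>2" for p q :: "real^2"
        unfolding power2_norm_eq_inner by (simp add: inner_add_left inner_add_right inner_diff_left inner_diff_right inner_commute)
      have "c + c = z + x" by (simp add: c_def midpoint_def flip: scaleR_add_left)
      then have e1: "(u - c) + (z - c) = u - x" by (simp add: algebra_simps)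
      have e2: "(u - c) - (z - c) = u - z" by simp
      have "norm (z - c) = R" using dist_midpoint(1)[of z x] by (simp add: c_def R_def dist_norm norm_minus_commute)
      then have "(norm (z - c))\<^sup>2 = R\<^sup>2" by simp
      moreover have "(norm (u - c))\<^sup>2 \<le> R\<^sup>2" using u(1) by (intro power_mono) (simp_all add: dist_norm norm_minus_commute)
      moreover have "0 < (norm (u - x))\<^sup>2" using u(2) by simp
      moreover have "(2 * R)\<^sup>2 = 4 * R\<^sup>2" by simp
      ultimately have "(norm (u - z))\<^sup>2 < (2 * R)\<^sup>2" using p[of "u - c" "z - c"] unfolding e1 e2 by linarith
      then show ?thesis using R by (simp add: power_less_imp_less_base dist_norm norm_minus_commute)
    qed
    have zx: "dist z x < r" using near[OF yZ] z by (simp add: dist_commute)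
    have in2: "u \<in> cball y (2 * r)" if "u \<in> cball c R" for u
    proof (cases "u = x")
      case True then show ?thesis using x(1) by (simp add: Z_def)
    next
      case False
      then show ?thesis using cl[OF that] zx z dist_triangle[of y u z] by simp
    qed
    show False
    proof (rule hopf_boundary_point[OF F h ge L])
      show "cball c R \<subseteq> V" using in2 r(2) by blast
      show "dist c x = R" by (simp add: c_def R_def dist_midpoint)
      show "h x = m" using x(1) by (simp add: Z_def)
      show "m < h u" if "u \<in> cball c R" "u \<noteq> x" for u
      proof -
        have "u \<notin> Z" using near cl[OF that] by force
        then have "h u \<noteq> m" using in2[OF that(1)] by (simp add: Z_def)
        then show ?thesis using ge[of u] in2[OF that(1)] r(2) by fastforce
      qed
    qed (use R in auto)
  qed
  moreover have "ball y r \<subseteq> V" using r by (auto simp: subset_eq)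
  ultimately show thesis using that r(1) by blast
qed

section \<open>Rigidity in the recurrent case\<close>

text \<open>\<open>R\<close> is the second variation of the distance on pairs of parameter vectors,
  nonnegative at a minimal pair. On pairs \<open>(e, T e)\<close>, which move both points in
  parallel, only the second fundamental forms remain, and the sum over a frame is a difference of
  mean curvatures that \<open>H\<close> makes nonpositive. So these pairs are null vectors, and
  pairing them with \<open>(e', 0)\<close> isolates the second form of \<open>X\<close>.\<close>

lemma two_point_flat:
  assumes X: "immersion_on U X" and x: "x \<in> U" and frX: "lap_frame X x a1 a2 k"
    and F: "immersion_on V F" and y: "y \<in> V" and frF: "lap_frame F y f1 f2 l"
    and t: "X x - F y = t *\<^sub>R w" "t > 0" "norm w = 1"
    and min: "\<And>x' y'. x' \<in> U \<Longrightarrow> y' \<in> V \<Longrightarrow> t \<le> dist (X x') (F y')"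
    and H: "w \<bullet> (dd a1 (dd a1 X) x + dd a2 (dd a2 X) x + dd k X x) \<le> w \<bullet> (dd f1 (dd f1 F) y + dd f2 (dd f2 F) y + dd l F y)"
  shows "w \<bullet> dd e X x = 0" "w \<bullet> dd e (dd e' X) x = 0"
proof -
  note I = immersion_onD[OF X] note J = immersion_onD[OF F]
  have dX: "X differentiable (at x)" and dF: "F differentiable (at y)" using C2_diff I(2) J(2) x y by blast+
  note lX = dd_linear[OF dX] and lF = dd_linear[OF dF]
  note tp = two_point_hessian[OF X x F y t min]
  have X0: "w \<bullet> dd e X x = 0" for e
    using tp(1)[of e 0] linear_0[OF lF] by simp
  have F0: "w \<bullet> dd b F y = 0" for b
    using tp(1)[of 0 b] linear_0[OF lX] by simp
  show "w \<bullet> dd e X x = 0" by (rule X0)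
  have onX: "norm (dd a1 X x) = 1" "norm (dd a2 X x) = 1" "dd a1 X x \<bullet> dd a2 X x = 0" using frX by (auto simp: lap_frame_def)
  have onF: "norm (dd f1 F y) = 1" "norm (dd f2 F y) = 1" "dd f1 F y \<bullet> dd f2 F y = 0" using frF by (auto simp: lap_frame_def)
  define R where "R = (\<lambda>(e, b) (e', b'). (dd e X x - dd b F y) \<bullet> (dd e' X x - dd b' F y) / t
     + w \<bullet> (dd e (dd e' X) x - dd b (dd b' F) y))"
  have bX: "bilinear (\<lambda>v v'. dd v (dd v' X) x)" by (rule dd2_bilinear[OF I(1) x I(2)])
  have bF: "bilinear (\<lambda>v v'. dd v (dd v' F) y)" by (rule dd2_bilinear[OF J(1) y J(2)])
  have sym: "R p q = R q p" for p q
    by (cases p; cases q) (simp add: R_def inner_commute dd_commute[OF I(1) x I(2)] dd_commute[OF J(1) y J(2)])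
  have lin: "linear (R p)" for p
  proof (rule linearI)
    fix q q' show "R p (q + q') = R p q + R p q'"
      by (cases p; cases q; cases q') (simp add: R_def linear_add[OF lX] linear_add[OF lF] bilinear_radd[OF bX] bilinear_radd[OF bF]
        inner_add_right inner_diff_right add_divide_distrib diff_divide_distrib)
  next
    fix r q show "R p (r *\<^sub>R q) = r *\<^sub>R R p q"
      by (cases p; cases q) (simp add: R_def linear_cmul[OF lX] linear_cmul[OF lF] bilinear_rmul[OF bX] bilinear_rmul[OF bF]
        inner_diff_right algebra_simps add_divide_distrib diff_divide_distrib)
  qed
  have "(\<lambda>p. R p q) = R q" for q using sym by blast
  then have bil: "bilinear R" using lin by (simp add: bilinear_def)
  have psd: "0 \<le> R p p" for p
    by (cases p) (use tp(2) in \<open>simp add: R_def power2_norm_eq_inner\<close>)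
  define T where "T = (\<lambda>e. (dd e X x \<bullet> dd f1 F y) *\<^sub>R f1 + (dd e X x \<bullet> dd f2 F y) *\<^sub>R f2)"
  have T: "dd (T e) F y = dd e X x" for e
    using orthonormal_expand3[OF onF(1,2) t(3) onF(3) F0 F0, of "dd e X x"] X0[of e]
    by (simp add: T_def linear_add[OF lF] linear_cmul[OF lF] inner_commute)
  have bw: "bilinear (\<lambda>v v'. w \<bullet> dd v (dd v' F) y)"
    unfolding bilinear_def by (intro conjI allI linearI)
      (simp_all add: bilinear_ladd[OF bF] bilinear_radd[OF bF] bilinear_lmul[OF bF] bilinear_rmul[OF bF] inner_add_right)
  have dn: "det (first_ff F y) \<noteq> 0" using det_first_ff_pos[OF F y] by simp
  have tr: "w \<bullet> dd (T a1) (dd (T a1) F) y + w \<bullet> dd (T a2) (dd (T a2) F) y = w \<bullet> dd f1 (dd f1 F) y + w \<bullet> dd f2 (dd f2 F) y"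
    using frame_trace[OF dF dn _ _ _ bw, of "T a1" "T a2"] frame_trace[OF dF dn onF bw] onX unfolding T by metis
  have RT: "R (e, T e) (e, T e) = w \<bullet> dd e (dd e X) x - w \<bullet> dd (T e) (dd (T e) F) y" for e
    by (simp add: R_def T inner_diff_right)
  have "R (a1, T a1) (a1, T a1) + R (a2, T a2) (a2, T a2) \<le> 0"
    using H tr X0[of k] F0[of l] unfolding RT by (simp add: inner_add_right)
  then have "R (a1, T a1) (a1, T a1) = 0" "R (a2, T a2) (a2, T a2) = 0"
    using psd[of "(a1, T a1)"] psd[of "(a2, T a2)"] by linarith+
  then have "R (a1, T a1) (e', 0) = 0" "R (a2, T a2) (e', 0) = 0"
    using psd_kernel[OF bil sym psd] by blast+
  then have "w \<bullet> dd a1 (dd e' X) x = 0" "w \<bullet> dd a2 (dd e' X) x = 0"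
    using bilinear_rzero[OF bF] by (auto simp: R_def T linear_0[OF lF])
  moreover obtain p q where "e = p *\<^sub>R a1 + q *\<^sub>R a2" using lap_frame_span[OF dX frX, of e] by blast
  ultimately show "w \<bullet> dd e (dd e' X) x = 0"
    by (simp add: bilinear_ladd[OF bX] bilinear_lmul[OF bX] inner_add_right)
qed

text \<open>The normals \<open>w\<close> given pointwise need not be continuous, so a unit normal is
  built from the cross product. Its derivative has no normal part, by unit length, and its
  tangential part is the second form up to sign, hence 0. So the normal is locally constant, and
  then so is the height along it.\<close>

lemma flat_immersion_planar:
  assumes X: "immersion_on U X" and x0: "x0 \<in> U"
    and flat: "\<And>x. x \<in> U \<Longrightarrow> \<exists>w. norm w = 1 \<and> (\<forall>e. w \<bullet> dd e X x = 0) \<and> (\<forall>e e'. w \<bullet> dd e (dd e' X) x = 0)"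
  obtains r a where "r > 0" "ball x0 r \<subseteq> U" "norm a = 1" "\<And>x. x \<in> ball x0 r \<Longrightarrow> a \<bullet> X x = a \<bullet> X x0"
proof -
  note I = immersion_onD[OF X]
  define g where "g = (\<lambda>x. cross3 (dd (axis 1 1) X x) (dd (axis 2 1) X x))"
  have g1: "Ck_on 1 U g" unfolding g_def
    by (intro Ck_on_bilinear[OF I(1) bilinear_cross[unfolded bilinear_conv_bounded_bilinear]] C2_dd I(2))
  have g0: "g x \<noteq> 0" if "x \<in> U" for x unfolding g_def by (rule cross3_immersion[OF X that])
  define n where "n = (\<lambda>x. (1 / norm (g x)) *\<^sub>R g x)"
  have n1: "Ck_on 1 U n" unfolding n_def
    by (intro Ck_on_scaleR Ck_on_divide Ck_on_const Ck_on_norm I(1) g1) (use g0 in auto)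
  have nn: "norm (n x) = 1" if "x \<in> U" for x using g0[OF that] by (simp add: n_def)
  have nX: "n x \<bullet> dd e X x = 0" if x: "x \<in> U" for e x
  proof -
    have "g x \<bullet> dd e X x = 0"
      unfolding dd_axis_expand[OF C2_diff[OF I(2) x], of e] g_def
      by (simp add: inner_add_right dot_cross_self)
    then show ?thesis by (simp add: n_def)
  qed
  have dn: "dd v n x = 0" if x: "x \<in> U" for v x
  proof -
    have nd: "n differentiable (at x)" by (rule C1_diff[OF n1 x])
    have "dd v (\<lambda>z. n z \<bullet> n z) x = dd v (\<lambda>z. 1) x"
      by (rule dd_cong[OF I(1) x]) (use nn in \<open>simp add: norm_eq_1\<close>)
    then have 1: "dd v n x \<bullet> n x = 0"
      unfolding dd_inner2[OF nd nd] dd_const by (simp add: inner_commute)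
    have 2: "dd v n x \<bullet> dd e X x = 0" for e
    proof -
      obtain w where w: "norm w = 1" "\<And>e. w \<bullet> dd e X x = 0" "\<And>e e'. w \<bullet> dd e (dd e' X) x = 0"
        using flat[OF x] by blast
      have "dd v (\<lambda>z. n z \<bullet> dd e X z) x = dd v (\<lambda>z. 0) x"
        by (rule dd_cong[OF I(1) x]) (rule nX)
      then have "dd v n x \<bullet> dd e X x + n x \<bullet> dd v (dd e X) x = 0"
        unfolding dd_inner2[OF nd C1_diff[OF C2_dd[OF I(2)] x]] dd_const .
      moreover have "n x = w \<or> n x = - w" by (rule unit_normal_unique[OF X x w(1,2) nn[OF x] nX[OF x]])
      then have "n x \<bullet> dd v (dd e X) x = 0" using w(3) by auto
      ultimately show ?thesis by simp
    qed
    show ?thesis using immersion_normal_line[OF X x nn[OF x] nX[OF x] 2] 1 by simp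
  qed
  obtain r where r: "r > 0" "ball x0 r \<subseteq> U" using I(1) x0 open_contains_ball by blast
  have const: "f x = f x0" if f: "Ck_on 1 (ball x0 r) f" and d: "\<And>v x. x \<in> ball x0 r \<Longrightarrow> dd v f x = 0" and x: "x \<in> ball x0 r"
    for f :: "real^2 \<Rightarrow> 'c::euclidean_space" and x
  proof (rule has_derivative_zero_unique_connected[OF open_ball connected_ball _ x])
    fix z assume z: "z \<in> ball x0 r"
    have "(f has_derivative (\<lambda>v. dd v f z)) (at z)"
      using C1_diff[OF f z] by (simp add: frechet_derivative_works)
    then show "(f has_derivative (\<lambda>h. 0)) (at z)" using d[OF z] by simp
  qed (use r in auto)
  have nc: "n x = n x0" if "x \<in> ball x0 r" for x
    by (rule const[OF Ck_on_subset[OF n1 r(2)] dn that]) (use r in auto)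
  show thesis
  proof (rule that[OF r nn[OF x0]])
    fix x assume x: "x \<in> ball x0 r"
    have X1: "Ck_on 1 U (\<lambda>x. X x \<bullet> n x0)" by (intro Ck_on_inner I(1) C2_C1 I(2) Ck_on_const)
    have "X x \<bullet> n x0 = X x0 \<bullet> n x0"
    proof (rule const[OF Ck_on_subset[OF X1 r(2)] _ x])
      fix v z assume z: "z \<in> ball x0 r"
      then have zU: "z \<in> U" using r by blast
      show "dd v (\<lambda>x. X x \<bullet> n x0) z = 0"
        unfolding dd_inner[OF C2_diff[OF I(2) zU]] using nX[OF zU, of v] nc[OF z] by (simp add: inner_commute)
    qed
    then show "n x0 \<bullet> X x = n x0 \<bullet> X x0" by (simp add: inner_commute)
  qed
qed

section \<open>Planar surfaces and recurrence\<close>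

context immersed begin

lemma planar_normal:
  assumes c: "(U, \<phi>) \<in> params S" and x: "x \<in> U" and G: "openin (topo S) G" "\<phi> x \<in> G" "\<And>p. p \<in> G \<Longrightarrow> a \<bullet> pos S p = m"
  shows "a \<bullet> dd e (pos S \<circ> \<phi>) x = 0"
proof -
  have "dd e (\<lambda>z. (pos S \<circ> \<phi>) z \<bullet> a) x = dd e (\<lambda>z. m) x"
    by (rule dd_cong[OF chart_open_preimage[OF c G(1)]]) (use x G in \<open>auto simp: inner_commute\<close>)
  then show ?thesis
    unfolding dd_inner[OF C2_diff[OF immersion_onD(2)[OF chart_immersion[OF c]] x]] dd_const by (simp add: inner_commute)
qed

text \<open>Overlapping planar pieces have the same unit normal up to sign and hence lie in the same
  plane. The points near which the plane of \<open>p0\<close> is valid therefore form an open and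
  closed set.\<close>

lemma flat_planar:
  assumes flat: "\<And>U \<phi> x. (U, \<phi>) \<in> params S \<Longrightarrow> x \<in> U \<Longrightarrow> \<exists>w. norm w = 1 \<and> (\<forall>e. w \<bullet> dd e (pos S \<circ> \<phi>) x = 0)
      \<and> (\<forall>e e'. w \<bullet> dd e (dd e' (pos S \<circ> \<phi>)) x = 0)"
  obtains a m where "norm a = 1" "\<And>p. p \<in> pts S \<Longrightarrow> a \<bullet> pos S p = m"
proof -
  have loc: "\<exists>G a m. openin (topo S) G \<and> p \<in> G \<and> norm a = 1 \<and> (\<forall>q\<in>G. a \<bullet> pos S q = m)" if p: "p \<in> pts S" for p
  proof -
    obtain U \<phi> x where c: "(U, \<phi>) \<in> params S" "x \<in> U" "p = \<phi> x" using chart_cover[OF p] by blast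
    obtain r a where r: "r > 0" "ball x r \<subseteq> U" "norm a = 1" "\<And>z. z \<in> ball x r \<Longrightarrow> a \<bullet> (pos S \<circ> \<phi>) z = a \<bullet> (pos S \<circ> \<phi>) x"
      using flat_immersion_planar[OF chart_immersion[OF c(1)] c(2) flat[OF c(1)]] by blast
    have "openin (topo S) (\<phi> ` ball x r)" by (rule chart_open_image[OF c(1) open_ball r(2)])
    moreover have "p \<in> \<phi> ` ball x r" using c(3) r(1) by simp
    moreover have "\<forall>q\<in>\<phi> ` ball x r. a \<bullet> pos S q = a \<bullet> pos S p" using r(4) c(3) by simp
    ultimately show ?thesis using r(3) by blast
  qed
  obtain p0 where p0: "p0 \<in> pts S" using smooth_surface unfolding smooth_surface_def by blast
  obtain G0 a m where G0: "openin (topo S) G0" "p0 \<in> G0" "norm a = 1" "\<forall>q\<in>G0. a \<bullet> pos S q = m" using loc[OF p0] by blast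
  define T where "T = \<Union> {G. openin (topo S) G \<and> (\<forall>q\<in>G. a \<bullet> pos S q = m)}"
  have T: "openin (topo S) T" unfolding T_def by (rule openin_Union) blast
  have Tm: "a \<bullet> pos S q = m" if "q \<in> T" for q using that unfolding T_def by blast
  have sub: "\<exists>G. openin (topo S) G \<and> p \<in> G \<and> G \<subseteq> pts S - T" if p: "p \<in> pts S - T" for p
  proof -
    obtain G b l where G: "openin (topo S) G" "p \<in> G" "norm b = 1" "\<forall>q\<in>G. b \<bullet> pos S q = l" using loc p by blast
    have "q \<notin> T" if q: "q \<in> G" for q
    proof
      assume qT: "q \<in> T"
      have qp: "q \<in> pts S" using q openin_subset[OF G(1)] by blast
      obtain U \<phi> x where c: "(U, \<phi>) \<in> params S" "x \<in> U" "q = \<phi> x" using chart_cover[OF qp] by blast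
      have "a \<bullet> dd e (pos S \<circ> \<phi>) x = 0" for e
        by (rule planar_normal[OF c(1,2) T _ Tm]) (use qT c(3) in auto)
      moreover have "b \<bullet> dd e (pos S \<circ> \<phi>) x = 0" for e
        by (rule planar_normal[OF c(1,2) G(1)]) (use q c(3) G(4) in auto)
      ultimately have ab: "a = b \<or> a = - b"
        by (intro unit_normal_unique[OF chart_immersion[OF c(1)] c(2)] G0(3) G(3))
      have "a \<bullet> pos S z = m" if z: "z \<in> G" for z
      proof -
        have "b \<bullet> pos S z = b \<bullet> pos S q" using G(4) z q by simp
        then have "a \<bullet> pos S z = a \<bullet> pos S q" using ab by auto
        then show ?thesis using Tm[OF qT] by simp
      qed
      then have "G \<subseteq> T" using G(1) unfolding T_def by blast
      then show False using p G(2) by blast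
    qed
    then show ?thesis using G openin_subset[OF G(1)] by blast
  qed
  have "closedin (topo S) T"
    unfolding closedin_def using openin_subset[OF T] sub openin_subopen by blast
  moreover have "p0 \<in> T" using G0 unfolding T_def by blast
  ultimately have "T = pts S"
    using T smooth_surface connected_space_clopen_in[of "topo S"] unfolding smooth_surface_def by blast
  then show thesis using that[OF G0(3)] Tm by blast
qed

text \<open>In a plane, the function \<open>exp (- k * t)\<close> of the distance \<open>t\<close>
  to \<open>z\<close> has Laplacian \<open>k * exp (- k * t) * (k - 1 / t)\<close>, nonnegative
  where \<open>t \<ge> 1 / k\<close>. If the surface avoids the ball of radius \<open>e\<close>
  about \<open>z\<close>, then \<open>k = 1 / e\<close> gives a bounded subsolution, constant by
  recurrence; but the distance to \<open>z\<close> cannot be constant on an open piece of the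
  plane.\<close>

lemma recurrent_dense_in_plane:
  assumes r: "recurrent S" and a: "norm a = 1" and pl: "\<And>p. p \<in> pts S \<Longrightarrow> a \<bullet> pos S p = m"
  shows "{x. a \<bullet> x = m} \<subseteq> closure (image_of S)"
proof
  fix z assume z: "z \<in> {x. a \<bullet> x = m}"
  have nX: "a \<bullet> dd e (pos S \<circ> \<phi>) x = 0" if "(U, \<phi>) \<in> params S" "x \<in> U" for U \<phi> x e
    by (rule planar_normal[OF that openin_topspace chart_in_pts[OF that] pl])
  show "z \<in> closure (image_of S)"
  proof (rule ccontr)
    assume nz: "z \<notin> closure (image_of S)"
    have "open (- closure (image_of S))" by (rule open_Compl[OF closed_closure])
    then obtain e where e: "e > 0" "ball z e \<subseteq> - closure (image_of S)" using nz open_contains_ball by blast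
    have far: "e \<le> dist (pos S p) z" if "p \<in> pts S" for p
    proof (rule ccontr)
      assume "\<not> e \<le> dist (pos S p) z"
      then have "pos S p \<in> ball z e" by (simp add: dist_commute)
      then show False using e(2) closure_subset[of "image_of S"] that by blast
    qed
    define k where "k = 1 / e"
    have k: "k > 0" using e(1) by (simp add: k_def)
    define u where "u = udist k {z}"
    have ux: "u p = exp (- k * dist (pos S p) z)" for p by (simp add: u_def udist_def)
    have uc: "continuous_map (topo S) euclidean u" unfolding u_def by (rule udist_continuous)
    have "bounded_weak_solution S 0 u"
    proof (rule bounded_weak_solution_from_support[OF uc])
      show "\<bar>u p\<bar> \<le> 1" for p using k by (simp add: ux)
      fix U \<phi> x assume c: "(U, \<phi>) \<in> params S" and x: "x \<in> U"
      show "semiconvex_chart u U \<phi> x" unfolding u_def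
        by (rule udist_semiconvex[OF c x]) (use k nz closure_subset[of "image_of S"] in auto)
      define X where "X = pos S \<circ> \<phi>"
      note X = chart_immersion[OF c, folded X_def] and I = immersion_onD[OF chart_immersion[OF c, folded X_def]]
      define Y where "Y = (\<lambda>x. X x - z)"
      have Y2: "Ck_on 2 U Y" unfolding Y_def by (intro Ck_on_diff Ck_on_const I(1,2))
      have Yn: "e \<le> norm (Y y)" if "y \<in> U" for y
        using far[OF chart_in_pts[OF c that]] by (simp add: Y_def X_def dist_norm)
      define t where "t = norm (Y x)"
      define w where "w = (1 / t) *\<^sub>R Y x"
      have t: "e \<le> t" "t > 0" using Yn[OF x] e(1) by (auto simp: t_def)
      have tw: "Y x = t *\<^sub>R w" "norm w = 1" using t(2) by (auto simp: w_def t_def)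
      have Y0: "Y y \<noteq> 0" if "y \<in> U" for y using Yn[OF that] e(1) by auto
      have dY: "dd v Y y = dd v X y" if y: "y \<in> U" for v y
        using dd_eqI[OF has_derivative_diff[OF Ck_on_has_derivative[OF I(2) _ y] has_derivative_const]] by (simp add: Y_def)
      have ddY: "dd v (dd v Y) x = dd v (dd v X) x" for v
        by (rule dd_cong[OF I(1) x]) (rule dY)
      obtain p q l where fr: "lap_frame X x p q l" using lap_frame_exists[OF X x] by blast
      have on: "norm (dd p X x) = 1" "norm (dd q X x) = 1" "dd p X x \<bullet> dd q X x = 0" using fr by (auto simp: lap_frame_def)
      have aX: "a \<bullet> dd v X x = 0" for v using nX[OF c x] by (simp add: X_def)
      have aw: "a \<bullet> w = 0" using pl[OF chart_in_pts[OF c x]] z by (simp add: w_def Y_def X_def inner_diff_right)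
      \<comment> \<open>The vector from \<open>z\<close> and the tangent plane are both orthogonal
        to \<open>a\<close>, so \<open>w\<close> is a tangent unit vector.\<close>
      have w1: "(w \<bullet> dd p X x)\<^sup>2 + (w \<bullet> dd q X x)\<^sup>2 = 1"
        using orthonormal_parseval3[OF on(1,2) a on(3) aX aX, of w w] aw tw(2)
        by (simp add: norm_eq_1 power2_eq_square inner_commute)
      define H where "H = dd p (dd p X) x + dd q (dd q X) x + dd l X x"
      have "H = (H \<bullet> a) *\<^sub>R a"
        by (rule immersion_normal_line[OF X x a aX]) (use fr in \<open>simp add: lap_frame_def H_def\<close>)
      then have Hw: "w \<bullet> H = 0" using aw by (metis inner_commute inner_scaleR_right mult_zero_right)
      define E where "E = exp (- k * t)"
      note ex = expdist_compose_dd[OF I(1) x Y2 Y0 tw(1) t(2) tw(2), of k, folded E_def]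
      have Ff: "expdist k (Y y) = u (\<phi> y)" for y by (simp add: ux expdist_def Y_def X_def dist_norm)
      have u2: "Ck_on 2 U (\<lambda>y. u (\<phi> y))" using ex(1) by (simp add: Ff)
      have "local_laplacian X (\<lambda>y. u (\<phi> y)) x
          = k * E * (k * (w \<bullet> dd p X x)\<^sup>2 - (1 - (w \<bullet> dd p X x)\<^sup>2) / t - w \<bullet> dd p (dd p X) x)
          + k * E * (k * (w \<bullet> dd q X x)\<^sup>2 - (1 - (w \<bullet> dd q X x)\<^sup>2) / t - w \<bullet> dd q (dd q X) x)
          + - k * E * (w \<bullet> dd l X x)"
        using local_laplacian_frame[OF X x u2 fr] ex(2)[of l] ex(3)[of p] ex(3)[of q] dY[OF x] ddY on
        by (simp add: Ff)
      also have "\<dots> = k * E * (k * ((w \<bullet> dd p X x)\<^sup>2 + (w \<bullet> dd q X x)\<^sup>2)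
          - (2 - ((w \<bullet> dd p X x)\<^sup>2 + (w \<bullet> dd q X x)\<^sup>2)) / t - w \<bullet> H)"
        by (simp add: H_def inner_add_right diff_divide_distrib add_divide_distrib ring_distribs)
      also have "\<dots> = k * E * (k - 1 / t)" unfolding w1 Hw by simp
      finally have L: "local_laplacian X (\<lambda>y. u (\<phi> y)) x = k * E * (k - 1 / t)" .
      have "1 / t \<le> k" using t e(1) by (simp add: k_def frac_le)
      then have "0 \<le> local_laplacian X (\<lambda>y. u (\<phi> y)) x" unfolding L using k by (simp add: E_def)
      then show "lower_support u 0 U \<phi> x" unfolding lower_support_def using I(1) x u2
        by (intro exI[of _ "\<lambda>y. u (\<phi> y)"] exI[of _ U]) (simp add: X_def)
    qed
    then obtain b where ae: "AE p in area_measure S. u p = b" using r unfolding recurrent_def by blast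
    have ub: "u p = b" if "p \<in> pts S" for p by (rule AE_area_continuous[OF uc ae that])
    obtain p0 where p0: "p0 \<in> pts S" using smooth_surface unfolding smooth_surface_def by blast
    obtain U \<phi> x where c: "(U, \<phi>) \<in> params S" "x \<in> U" "p0 = \<phi> x" using chart_cover[OF p0] by blast
    define X where "X = pos S \<circ> \<phi>"
    note X = chart_immersion[OF c(1), folded X_def] and I = immersion_onD[OF chart_immersion[OF c(1), folded X_def]]
    define Y where "Y = (\<lambda>x. X x - z)"
    have Y2: "Ck_on 2 U Y" unfolding Y_def by (intro Ck_on_diff Ck_on_const I(1,2))
    have ny: "norm (Y y) = norm (Y x)" if y: "y \<in> U" for y
    proof -
      have "exp (- k * norm (Y y)) = exp (- k * norm (Y x))"
        using ub[OF chart_in_pts[OF c(1) y]] ub[OF chart_in_pts[OF c(1,2)]] by (simp add: ux Y_def X_def dist_norm)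
      then have "- k * norm (Y y) = - k * norm (Y x)" by (rule exp_inj_iff[THEN iffD1])
      then show ?thesis using k by simp
    qed
    have "Y x \<bullet> dd v X x = 0" for v
    proof -
      have dY: "dd v Y x = dd v X x"
        using dd_eqI[OF has_derivative_diff[OF Ck_on_has_derivative[OF I(2) _ c(2)] has_derivative_const]] by (simp add: Y_def)
      have "dd v (\<lambda>y. Y y \<bullet> Y y) x = dd v (\<lambda>y. (norm (Y x))\<^sup>2) x"
        by (rule dd_cong[OF I(1) c(2)]) (use ny in \<open>simp flip: power2_norm_eq_inner\<close>)
      then show ?thesis
        unfolding dd_inner2[OF C2_diff[OF Y2 c(2)] C2_diff[OF Y2 c(2)]] dd_const dY by (simp add: inner_commute)
    qed
    then have "Y x = (Y x \<bullet> a) *\<^sub>R a"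
      by (intro immersion_normal_line[OF X c(2) a]) (use nX[OF c(1,2)] in \<open>simp_all add: X_def\<close>)
    moreover have "Y x \<bullet> a = 0" using pl[OF p0] z c(3) by (simp add: Y_def X_def inner_diff_left inner_diff_right inner_commute)
    ultimately have "pos S p0 = z" using c(3) by (simp add: Y_def X_def)
    then show False using far[OF p0] e(1) by simp
  qed
qed

end

section \<open>Rigidity: both surfaces in parallel planes\<close>

context comparison begin

lemma recurrent_flat:
  assumes H: "\<And>p q. p \<in> pts M \<Longrightarrow> q \<in> pts N \<Longrightarrow>
      norm (mean_curvature_vector M p) \<le> mean_curvature N (\<xi> q) q"
    and dist: "\<And>p. p \<in> pts M \<Longrightarrow> infdist (pos M p) (image_of N) = t" and t: "t > 0"
    and c: "(U, \<phi>) \<in> params M" and x: "x \<in> U"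
  shows "\<exists>w. norm w = 1 \<and> (\<forall>e. w \<bullet> dd e (pos M \<circ> \<phi>) x = 0) \<and> (\<forall>e e'. w \<bullet> dd e (dd e' (pos M \<circ> \<phi>)) x = 0)"
proof -
  define X where "X = pos M \<circ> \<phi>"
  note I = M.chart_immersion[OF c, folded X_def]
  have p: "\<phi> x \<in> pts M" by (rule M.chart_in_pts[OF c x])
  have f: "facing (X x)" using facing_M[OF p] by (simp add: X_def)
  have tx: "infdist (X x) (image_of N) = t" using dist[OF p] by (simp add: X_def)
  obtain q where q: "q \<in> pts N" "dist (X x) (pos N q) = t" using nearest_exists[of "X x"] tx by auto
  obtain w where w: "X x - pos N q = t *\<^sub>R w" "norm w = 1" using direction[OF tx t q(2)] .
  obtain V \<psi> y where d: "(V, \<psi>) \<in> params N" "y \<in> V" "q = \<psi> y" using N.chart_cover[OF q(1)] by blast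
  define F where "F = pos N \<circ> \<psi>"
  note J = N.chart_immersion[OF d(1), folded F_def]
  obtain a1 a2 k where frX: "lap_frame X x a1 a2 k" using lap_frame_exists[OF I x] by blast
  obtain f1 f2 m where frF: "lap_frame F y f1 f2 m" using lap_frame_exists[OF J d(2)] by blast
  have near: "dist (X x) (pos N (\<psi> y)) = infdist (X x) (image_of N)" using q(2) d(3) tx by simp
  have XF: "X x - F y = t *\<^sub>R w" "X x - pos N (\<psi> y) = t *\<^sub>R w" using w d(3) by (auto simp: F_def)
  have min: "t \<le> dist (X x') (F y')" if "x' \<in> U" "y' \<in> V" for x' y'
  proof -
    have "infdist (X x') (image_of N) \<le> dist (X x') (F y')"
      by (rule infdist_le) (use N.chart_in_pts[OF d(1) that(2)] in \<open>auto simp: F_def\<close>)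
    then show ?thesis using dist[OF M.chart_in_pts[OF c that(1)]] by (simp add: X_def)
  qed
  have HN: "w \<bullet> (dd f1 (dd f1 F) y + dd f2 (dd f2 F) y + dd m F y) = mean_curvature N (\<xi> q) q"
    using nearest_mean_curvature[OF f near d(1,2) XF(2) t w(2)] N.lap_frame_mcv[OF d(1,2) frF[unfolded F_def]] d(3) by (simp add: F_def)
  have HM: "w \<bullet> (dd a1 (dd a1 X) x + dd a2 (dd a2 X) x + dd k X x) \<le> norm (mean_curvature_vector M (\<phi> x))"
    using M.lap_frame_mcv[OF c x frX[unfolded X_def]] norm_cauchy_schwarz[of w "mean_curvature_vector M (\<phi> x)"] w(2) by (simp add: X_def)
  have le: "w \<bullet> (dd a1 (dd a1 X) x + dd a2 (dd a2 X) x + dd k X x) \<le> w \<bullet> (dd f1 (dd f1 F) y + dd f2 (dd f2 F) y + dd m F y)"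
    using HN HM H[OF p q(1)] by linarith
  note tf = two_point_flat[OF I x frX J d(2) frF XF(1) t w(2) min le]
  show ?thesis using tf w(2) unfolding X_def by blast
qed

text \<open>A convex set disjoint from \<open>N\<close> lies in a single component of the
  complement, here the one containing a point of \<open>M\<close>.\<close>

lemma facing_plane:
  assumes P: "convex P" "P \<subseteq> - image_of N" "image_of M \<inter> P \<noteq> {}" and x: "x \<in> P"
  shows "facing x"
proof -
  obtain p where p: "p \<in> pts M" "pos M p \<in> P" using P(3) by blast
  have xN: "x \<notin> image_of N" using P x by blast
  have fp: "facing (pos M p)" by (rule facing_M[OF p(1)])
  show ?thesis
  proof (cases "minimal N")
    case True
    then show ?thesis using xN by (simp add: facing_def)
  next
    case False
    then obtain W where W: "W \<in> components (- image_of N)" "pos M p \<in> W"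
      "\<forall>q\<in>pts N. pos N q \<in> frontier W \<longrightarrow> points_into N \<xi> W q" using fp unfolding facing_def by blast
    have "P \<subseteq> W" using components_maximal[OF W(1) convex_connected[OF P(1)] P(2)] p(2) W(2) by blast
    then show ?thesis using W x xN unfolding facing_def by blast
  qed
qed

text \<open>Near \<open>q\<close> the height in direction \<open>b\<close> is at least its value at
  \<open>q\<close>. If \<open>N\<close> is not minimal, \<xi> at \<open>q\<close> points to the
  plane and so equals \<open>- b\<close>, and the mean curvature vector, a nonnegative multiple of
  \<xi>, makes the height superharmonic nearby; for minimal \<open>N\<close> it is harmonic. The
  strong minimum principle makes it constant.\<close>

lemma touching_plane_open:
  assumes b: "norm b = 1" and c: "c > 0" and gap: "\<And>q. q \<in> pts N \<Longrightarrow> c \<le> \<bar>b \<bullet> pos N q - m\<bar>"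
    and fc: "facing (pos N q - c *\<^sub>R b)" and ds: "infdist (pos N q - c *\<^sub>R b) (image_of N) = c"
    and q: "q \<in> pts N" "b \<bullet> pos N q = m + c"
  shows "\<exists>G. openin (topo N) G \<and> q \<in> G \<and> (\<forall>p\<in>G. b \<bullet> pos N p = m + c)"
proof -
  obtain V \<psi> y where d: "(V, \<psi>) \<in> params N" "y \<in> V" "q = \<psi> y" using N.chart_cover[OF q(1)] by blast
  define F where "F = pos N \<circ> \<psi>"
  note J = N.chart_immersion[OF d(1), folded F_def]
  note I = immersion_onD[OF J]
  define x where "x = pos N q - c *\<^sub>R b"
  have near: "dist x (pos N (\<psi> y)) = infdist x (image_of N)" using ds b c d(3) by (simp add: x_def dist_norm)
  have xw: "x - pos N (\<psi> y) = c *\<^sub>R (- b)" "norm (- b) = 1" using d(3) b by (auto simp: x_def)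
  have \<xi>: "minimal N \<or> \<xi> q = - b"
    using xi_toward[OF fc[folded x_def] _ near d(1,2) xw(1) c xw(2)] d(3) by blast
  have "\<exists>O1. open O1 \<and> y \<in> O1 \<and> O1 \<subseteq> V \<and> (\<forall>z\<in>O1. mean_curvature_vector N (\<psi> z) \<bullet> b \<le> 0)"
  proof (cases "minimal N")
    case True
    then show ?thesis using I(1) d(2) N.chart_in_pts[OF d(1)] by (intro exI[of _ V]) (auto simp: minimal_def)
  next
    case False
    define O1 where "O1 = V \<inter> (\<lambda>z. \<xi> (\<psi> z) \<bullet> b) -` {..<0}"
    have "continuous_on V (\<lambda>z. \<xi> (\<psi> z) \<bullet> b)" by (intro continuous_intros xi_continuous[OF d(1)])
    then have "open O1" unfolding O1_def by (rule continuous_open_preimage) (use I(1) in auto)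
    moreover have "y \<in> O1" using False \<xi> d b by (simp add: O1_def norm_eq_1)
    moreover have "mean_curvature_vector N (\<psi> z) \<bullet> b \<le> 0" if "z \<in> O1" for z
    proof -
      have z: "z \<in> V" "\<xi> (\<psi> z) \<bullet> b < 0" using that by (auto simp: O1_def)
      have "mean_curvature_vector N (\<psi> z) = mean_curvature N (\<xi> (\<psi> z)) (\<psi> z) *\<^sub>R \<xi> (\<psi> z)"
        "0 \<le> mean_curvature N (\<xi> (\<psi> z)) (\<psi> z)"
        using mcn N.chart_in_pts[OF d(1) z(1)] by (auto simp: mean_curvature_normal_def)
      then show ?thesis using z(2) by (simp add: mult_nonneg_nonpos)
    qed
    ultimately show ?thesis unfolding O1_def by blast
  qed
  then obtain O1 where O1: "open O1" "y \<in> O1" "O1 \<subseteq> V" "\<And>z. z \<in> O1 \<Longrightarrow> mean_curvature_vector N (\<psi> z) \<bullet> b \<le> 0" by blast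
  define h where "h = (\<lambda>z. F z \<bullet> b)"
  have h2: "Ck_on 2 V h" unfolding h_def by (intro Ck_on_inner I(1,2) Ck_on_const)
  \<comment> \<open>Restriction to one side of the plane, where \<open>gap\<close> bounds the height
    itself and not only its distance from \<open>m\<close>.\<close>
  define O2 where "O2 = O1 \<inter> h -` {m<..}"
  have O2: "open O2" unfolding O2_def
    by (rule continuous_open_preimage[OF continuous_on_subset[OF Ck_on_cont[OF h2] O1(3)] O1(1)]) simp
  have hy: "h y = m + c" using q(2) d(3) by (simp add: h_def F_def inner_commute)
  have yO: "y \<in> O2" using O1(2) c hy by (simp add: O2_def)
  have O2V: "O2 \<subseteq> V" using O1(3) by (auto simp: O2_def)
  have FO: "immersion_on O2 F" by (rule immersion_on_subset[OF J O2 O2V])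
  have ge: "m + c \<le> h z" if z: "z \<in> O2" for z
    using gap[OF N.chart_in_pts[OF d(1)], of z] z O2V by (auto simp: O2_def h_def F_def inner_commute)
  have L: "local_laplacian F h z \<le> 0" if z: "z \<in> O2" for z
  proof -
    have zV: "z \<in> V" using z O2V by blast
    obtain a1 a2 k where fr: "lap_frame F z a1 a2 k" using lap_frame_exists[OF J zV] by blast
    have 1: "dd v h z = dd v F z \<bullet> b" for v unfolding h_def by (rule dd_inner[OF C2_diff[OF I(2) zV]])
    have 2: "dd v (dd v h) z = dd v (dd v F) z \<bullet> b" for v unfolding h_def by (rule dd_inner_const[OF I(1,2) zV])
    have "local_laplacian F h z = mean_curvature_vector N (\<psi> z) \<bullet> b"
      unfolding local_laplacian_frame[OF J zV h2 fr] 2 unfolding 1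
      using N.lap_frame_mcv[OF d(1) zV fr[unfolded F_def]] by (simp add: F_def flip: inner_add_left)
    then show ?thesis using O1(4)[of z] z by (simp add: O2_def)
  qed
  obtain r where r: "r > 0" "ball y r \<subseteq> O2" "\<And>z. z \<in> ball y r \<Longrightarrow> h z = m + c"
    by (rule strong_minimum[OF FO Ck_on_subset[OF h2 O2V] ge L yO hy]) blast+
  have "openin (topo N) (\<psi> ` ball y r)" by (rule N.chart_open_image[OF d(1)]) (use r O2V in auto)
  moreover have "q \<in> \<psi> ` ball y r" using d(3) r(1) by simp
  moreover have "\<forall>p\<in>\<psi> ` ball y r. b \<bullet> pos N p = m + c" using r(3) by (simp add: h_def F_def inner_commute)
  ultimately show ?thesis by blast
qed

lemma recurrent_parallel_flat:
  assumes H: "\<And>p q. p \<in> pts M \<Longrightarrow> q \<in> pts N \<Longrightarrow>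
      norm (mean_curvature_vector M p) \<le> mean_curvature N (\<xi> q) q" and r: "recurrent M"
  shows "parallel_flat M N"
proof -
  obtain c where c: "c > 0" "\<And>p. p \<in> pts M \<Longrightarrow> infdist (pos M p) (image_of N) = c"
    using distance_constant[OF H r] by blast
  obtain a m where a: "norm a = 1" "\<And>p. p \<in> pts M \<Longrightarrow> a \<bullet> pos M p = m"
    by (rule M.flat_planar, rule recurrent_flat[OF H c(2,1)]) blast+
  define P where "P = {x. a \<bullet> x = m}"
  have dP: "infdist x (image_of N) = c" if "x \<in> P" for x
  proof -
    have "closed {x. infdist x (image_of N) = c}" by (intro closed_Collect_eq continuous_intros)
    moreover have "image_of M \<subseteq> {x. infdist x (image_of N) = c}" using c(2) by blast
    ultimately have "closure (image_of M) \<subseteq> {x. infdist x (image_of N) = c}" by (rule closure_minimal[rotated])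
    then show ?thesis using M.recurrent_dense_in_plane[OF r a] that by (auto simp: P_def)
  qed
  have PN: "P \<subseteq> - image_of N"
  proof
    fix x assume "x \<in> P"
    then show "x \<in> - image_of N" using dP c(1) by fastforce
  qed
  obtain p0 where p0: "p0 \<in> pts M" by (rule pts_M_nonempty)
  have MP: "image_of M \<subseteq> P" using a(2) by (auto simp: P_def)
  have fP: "facing x" if "x \<in> P" for x
    by (rule facing_plane[OF _ PN _ that]) (use MP p0 in \<open>auto simp: P_def convex_hyperplane\<close>)
  have aa: "a \<bullet> a = 1" using a(1) by (simp add: norm_eq_1)
  \<comment> \<open>Comparison with the orthogonal projection of \<open>z\<close> to
    \<open>P\<close>.\<close>
  have gap: "c \<le> \<bar>a \<bullet> z - m\<bar>" if z: "z \<in> image_of N" for z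
  proof -
    define x where "x = z - (a \<bullet> z - m) *\<^sub>R a"
    have "x \<in> P" by (simp add: P_def x_def inner_diff_right aa)
    then have "c \<le> dist x z" using dP infdist_le[OF z, of x] by simp
    then show ?thesis using a(1) by (simp add: x_def dist_norm)
  qed
  \<comment> \<open>The equality case of \<open>gap\<close>: a vector of length \<open>c\<close>
    whose component along \<open>a\<close> has at least that size is a multiple of
    \<open>a\<close>.\<close>
  have foot: "pos N q = x + c *\<^sub>R a \<or> pos N q = x - c *\<^sub>R a" if x: "x \<in> P" and q: "q \<in> pts N" "dist x (pos N q) = c" for x q
  proof -
    define v where "v = pos N q - x"
    have nv: "norm v = c" using q(2) by (simp add: v_def dist_norm norm_minus_commute)
    define s where "s = a \<bullet> v"
    have s: "c \<le> \<bar>s\<bar>" using gap[of "pos N q"] q(1) x by (simp add: s_def v_def P_def inner_diff_right)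
    have "(norm (v - s *\<^sub>R a))\<^sup>2 = (norm v)\<^sup>2 - s\<^sup>2"
      unfolding power2_norm_eq_inner by (simp add: inner_diff_left inner_diff_right s_def inner_commute aa power2_eq_square)
    moreover have "c\<^sup>2 \<le> s\<^sup>2" using s c(1) by (simp add: abs_le_square_iff[symmetric])
    ultimately have "(norm (v - s *\<^sub>R a))\<^sup>2 \<le> 0" using nv by simp
    then have vs: "v = s *\<^sub>R a" by simp
    then have "\<bar>s\<bar> = c" using nv a(1) by simp
    then have "s = c \<or> s = - c" by linarith
    then show ?thesis using vs unfolding v_def by (auto simp: algebra_simps)
  qed
  obtain q0 where q0: "q0 \<in> pts N" "dist (pos M p0) (pos N q0) = c" using nearest_exists[of "pos M p0"] c(2)[OF p0] by auto
  have p0P: "pos M p0 \<in> P" using MP p0 by blast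
  \<comment> \<open>The sign of the normal is chosen towards the side on which a nearest point of
    \<open>N\<close> was found.\<close>
  obtain b where b: "b = a \<or> b = - a" "pos N q0 = pos M p0 + c *\<^sub>R b"
    using foot[OF p0P q0] by (metis add_uminus_conv_diff scaleR_minus_right)
  define l where "l = b \<bullet> pos M p0"
  have Pb: "P = {x. b \<bullet> x = l}" using b(1) a(2)[OF p0] by (auto simp: P_def l_def)
  have nb: "norm b = 1" "b \<bullet> b = 1" using b(1) a(1) aa by auto
  have gapb: "c \<le> \<bar>b \<bullet> z - l\<bar>" if "z \<in> image_of N" for z
    using gap[OF that] b(1) a(2)[OF p0] by (auto simp: l_def)
  \<comment> \<open>Closed by continuity, open by \<open>touching_plane_open\<close>, nonempty by
    \<open>q0\<close>; connectedness then puts all of \<open>N\<close> into one plane.\<close>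
  define T where "T = {q \<in> pts N. b \<bullet> pos N q \<in> {l + c}}"
  have "continuous_map (topo N) euclidean (\<lambda>q. b \<bullet> pos N q)"
    using continuous_map_compose[OF N.pos_continuous, of euclidean "\<lambda>x. b \<bullet> x"] by (simp add: comp_def continuous_intros)
  from closedin_continuous_map_preimage[OF this, of "{l + c}"] have clT: "closedin (topo N) T" by (simp add: T_def)
  have "\<exists>G. openin (topo N) G \<and> q \<in> G \<and> G \<subseteq> T" if q: "q \<in> T" for q
  proof -
    have q': "q \<in> pts N" "b \<bullet> pos N q = l + c" using q by (auto simp: T_def)
    have "pos N q - c *\<^sub>R b \<in> P" using q'(2) nb(2) by (simp add: Pb inner_diff_right)
    then obtain G where "openin (topo N) G" "q \<in> G" "\<forall>p\<in>G. b \<bullet> pos N p = l + c"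
      using touching_plane_open[OF nb(1) c(1) gapb fP dP q'] by auto
    then show ?thesis using openin_subset[of "topo N" G] unfolding T_def by blast
  qed
  then have "openin (topo N) T" by (subst openin_subopen) blast
  moreover have "q0 \<in> T" using q0(1) b(2) nb(2) by (simp add: T_def l_def inner_add_right)
  ultimately have "T = pts N"
    using clT N.smooth_surface connected_space_clopen_in[of "topo N"] unfolding smooth_surface_def by blast
  then have NP: "b \<bullet> pos N q = l + c" if "q \<in> pts N" for q using that unfolding T_def by blast
  \<comment> \<open>A point of \<open>N\<close> nearest to the projection of \<open>z\<close> to
    \<open>P\<close> is \<open>z\<close> or its mirror image, and \<open>NP\<close> rules out the
    mirror image.\<close>
  have "z \<in> image_of N" if z: "b \<bullet> z = l + c" for z
  proof -
    define x where "x = z - c *\<^sub>R b"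
    have xP: "x \<in> P" using z nb(2) by (simp add: Pb x_def inner_diff_right)
    obtain q where q: "q \<in> pts N" "dist x (pos N q) = c" using nearest_exists[of x] dP[OF xP] by auto
    have "pos N q = x + c *\<^sub>R b \<or> pos N q = x - c *\<^sub>R b" using foot[OF xP q] b(1) by auto
    moreover have "b \<bullet> x = l" using xP by (simp add: Pb)
    ultimately have "pos N q = x + c *\<^sub>R b" using NP[OF q(1)] c(1) nb(2) by (auto simp: inner_diff_right)
    then show ?thesis using q(1) by (force simp: x_def)
  qed
  then have "image_of N = {x. b \<bullet> x = l + c}" using NP by blast
  moreover have "image_of M \<subseteq> {x. b \<bullet> x = l}" using MP Pb by blast
  moreover have "b \<noteq> 0" using nb(1) by auto
  ultimately show ?thesis unfolding parallel_flat_def by blast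
qed

end

text \<open>\<open>M\<close> carries no orientation, so the absolute value of its mean curvature is
  the norm of the mean curvature vector. Supremum and infimum are taken in the extended reals and
  exist without any boundedness.\<close>

theorem theorem1p7:
  fixes M :: "'a surface3" and N :: "'b surface3" and \<xi> :: "'b \<Rightarrow> real^3"
  assumes "immersed_surface M"
    and "properly_immersed N" and "geodesically_complete N" and "bounded_curvature N"
    and "mean_curvature_normal N \<xi>"
    and "\<not> parallel_flat M N"
    and "(recurrent M \<and>
           (SUP p\<in>pts M. ereal (norm (mean_curvature_vector M p)))
             \<le> (INF q\<in>pts N. ereal (mean_curvature N (\<xi> q) q))) \<or>
         (stochastically_complete M \<and>
           (SUP p\<in>pts M. ereal (norm (mean_curvature_vector M p)))
             < (INF q\<in>pts N. ereal (mean_curvature N (\<xi> q) q)))"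
  shows "\<not> well_oriented N \<xi> M"
proof
  assume wo: "well_oriented N \<xi> M"
  obtain K where K: "\<And>p k. p \<in> pts N \<Longrightarrow> principal_curvature N p k \<Longrightarrow> \<bar>k\<bar> \<le> K"
    using assms(4) unfolding bounded_curvature_def by blast
  \<comment> \<open>The given bound need not be positive, while the comparison requires a strictly
    decreasing exponential.\<close>
  define \<kappa> where "\<kappa> = max K 1"
  have \<kappa>: "\<kappa> > 0" by (simp add: \<kappa>_def)
  interpret comparison M N \<xi> \<kappa>
  proof unfold_locales
    show "immersed_surface M" "immersed_surface N" using assms(1,2) by (simp_all add: properly_immersed_def)
    show "\<bar>k\<bar> \<le> \<kappa>" if "q \<in> pts N" "principal_curvature N q k" for q k
      using K[OF that] by (simp add: \<kappa>_def)
  qed (use assms(2,5) wo \<kappa> in auto)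
  define A where "A = (SUP p\<in>pts M. ereal (norm (mean_curvature_vector M p)))"
  define B where "B = (INF q\<in>pts N. ereal (mean_curvature N (\<xi> q) q))"
  have A: "ereal (norm (mean_curvature_vector M p)) \<le> A" if "p \<in> pts M" for p
    unfolding A_def by (rule SUP_upper[OF that])
  have B: "B \<le> ereal (mean_curvature N (\<xi> q) q)" if "q \<in> pts N" for q
    unfolding B_def by (rule INF_lower[OF that])
  from assms(7)[folded A_def B_def] show False
  proof
    assume h: "recurrent M \<and> A \<le> B"
    have "norm (mean_curvature_vector M p) \<le> mean_curvature N (\<xi> q) q" if "p \<in> pts M" "q \<in> pts N" for p q
      using order_trans[OF A[OF that(1)] order_trans[OF conjunct2[OF h] B[OF that(2)]]] by simp
    then show False using recurrent_parallel_flat h assms(6) by blast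
  next
    assume h: "stochastically_complete M \<and> A < B"
    \<comment> \<open>Two reals strictly between the extended bounds give a positive gap
      \<open>s - r\<close> that is uniform over all pairs of points.\<close>
    then obtain r where r: "A < ereal r" "ereal r < B" using ereal_dense2 by blast
    then obtain s where s: "r < s" "ereal s < B" using ereal_dense2[OF r(2)] by auto
    have "\<kappa> * (s - r) \<le> \<kappa> * (mean_curvature N (\<xi> q) q - norm (mean_curvature_vector M p))"
      if "p \<in> pts M" "q \<in> pts N" for p q
    proof -
      have "norm (mean_curvature_vector M p) < r" using order_le_less_trans[OF A[OF that(1)] r(1)] by simp
      moreover have "s < mean_curvature N (\<xi> q) q" using order_less_le_trans[OF s(2) B[OF that(2)]] by simp
      ultimately show ?thesis using \<kappa> by (intro mult_left_mono) auto
    qed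
    then show False using not_stochastically_complete[of "\<kappa> * (s - r)"] h s(1) \<kappa> by simp
  qed
qed

end
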